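(* Let $(\mathsf{L},\models)$ be a self-complementary logic on graphs for which there exists a class $\mathcal{F}$ of simple graphs such that any two simple graphs $G$ and $H$ are homomorphism indistinguishable over $\mathcal{F}$ if and only if they are $\mathsf{L}$-equivalent. Suppose that for every $k\in\mathbb{N}$ there exist graphs $G$ and $H$ which are $\mathsf{C}^k$-equivalent but not $\mathsf{L}$-equivalent. Then any two $\mathsf{L}$-equivalent graphs are quantum isomorphic.
   Context: All graphs are finite, undirected, without multiple edges; simple means without loops. $G\equiv_{\mathcal{F}}H$ (homomorphism indistinguishability over $\mathcal{F}$) means $\hom(F,G)=\hom(F,H)$ for all $F\in\mathcal{F}$, where $\hom$ counts homomorphisms. A logic on graphs is a pair $(\mathsf{L},\models)$ of a class of sentences and an isomorphism-invariant relation between graphs and sentences; $G,H$ are $\mathsf{L}$-equivalent if $G\models\phi\iff H\models\phi$ for all $\phi\in\mathsf{L}$. It is self-complementary if for every $\phi\in\mathsf{L}$ there is $\overline\phi\in\mathsf{L}$ with $G\models\phi \iff \overline G\models\overline\phi$ for all simple graphs $G$, $\overline G$ being the complement graph. $\mathsf{C}^k$ is the $k$-variable fragment of first-order logic over the signature $\{E\}$ extended by counting quantifiers $\exists^{\geq n}x$; $\mathsf{C}^k$-equivalence means satisfying the same $\mathsf{C}^k$ sentences. Graphs $G,H$ are quantum isomorphic if there is a unital C*-algebra $\mathcal{A}$ and projections $u_{gh}\in\mathcal{A}$ ($g\in V(G)$, $h\in V(H)$) with $\sum_{h}u_{gh}=1$ for every $g$, $\sum_g u_{gh}=1$ for every $h$,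 and $u_{gh}u_{g'h'}=0$ whenever $\mathrm{rel}(g,g')\neq\mathrm{rel}(h,h')$, where $\mathrm{rel}$ records whether two vertices are equal, adjacent, or distinct and non-adjacent.
   Formalization: The graphs in the C^k hypothesis and in the conclusion are taken to be simple; with loops allowed the claim fails, since self-complementarity and the link to homomorphism counts say nothing about how L behaves on looped graphs. *)

theory Defs
  imports Complex_Main "HOL-Library.FuncSet"
begin

text \<open>Graphs have vertices from nat (every finite graph is isomorphic to one of these).
  All notions below are isomorphism invariant.\<close>

record graph =
  verts :: "nat set"
  adj :: "nat \<Rightarrow> nat \<Rightarrow> bool"

definition wf_graph :: "graph \<Rightarrow> bool" where
  "wf_graph G \<longleftrightarrow> finite (verts G) \<and>
     (\<forall>u v. adj G u v \<longrightarrow> u \<in> verts G \<and> v \<in> verts G) \<and>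
     (\<forall>u v. adj G u v \<longrightarrow> adj G v u)"

definition simple_graph :: "graph \<Rightarrow> bool" where
  "simple_graph G \<longleftrightarrow> wf_graph G \<and> (\<forall>v. \<not> adj G v v)"

definition compl_graph :: "graph \<Rightarrow> graph" where
  "compl_graph G = \<lparr> verts = verts G,
     adj = (\<lambda>u v. u \<in> verts G \<and> v \<in> verts G \<and> u \<noteq> v \<and> \<not> adj G u v) \<rparr>"

definition graph_iso :: "graph \<Rightarrow> graph \<Rightarrow> bool" where
  "graph_iso G H \<longleftrightarrow> (\<exists>f. bij_betw f (verts G) (verts H) \<and>
     (\<forall>u\<in>verts G. \<forall>v\<in>verts G. adj G u v \<longleftrightarrow> adj H (f u) (f v)))"

definition hom :: "graph \<Rightarrow> graph \<Rightarrow> nat" where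
  "hom F G = card {f. f \<in> verts F \<rightarrow>\<^sub>E verts G \<and>
     (\<forall>u v. adj F u v \<longrightarrow> adj G (f u) (f v))}"

definition hom_indist :: "graph set \<Rightarrow> graph \<Rightarrow> graph \<Rightarrow> bool" where
  "hom_indist \<F> G H \<longleftrightarrow> (\<forall>F\<in>\<F>. hom F G = hom F H)"

definition logic_on_graphs :: "(graph \<Rightarrow> 's \<Rightarrow> bool) \<Rightarrow> bool" where
  "logic_on_graphs models \<longleftrightarrow> (\<forall>G H \<phi>. wf_graph G \<longrightarrow> wf_graph H \<longrightarrow> graph_iso G H \<longrightarrow>
      (models G \<phi> \<longleftrightarrow> models H \<phi>))"

definition L_equiv :: "(graph \<Rightarrow> 's \<Rightarrow> bool) \<Rightarrow> graph \<Rightarrow> graph \<Rightarrow> bool" where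
  "L_equiv models G H \<longleftrightarrow> (\<forall>\<phi>. models G \<phi> \<longleftrightarrow> models H \<phi>)"

definition self_complementary :: "(graph \<Rightarrow> 's \<Rightarrow> bool) \<Rightarrow> bool" where
  "self_complementary models \<longleftrightarrow> (\<forall>\<phi>. \<exists>\<psi>. \<forall>G. simple_graph G \<longrightarrow>
      (models G \<phi> \<longleftrightarrow> models (compl_graph G) \<psi>))"

text \<open>Variables are x_i, i :: nat. CEx n i \<phi> is the counting quantifier \<exists>^{\<ge>n} x_i. \<phi>.\<close>
datatype cform =
    CAdj nat nat
  | CEq nat nat
  | CNeg cform
  | CConj cform cform
  | CEx nat nat cform

fun cvars :: "cform \<Rightarrow> nat set" where
  "cvars (CAdj i j) = {i, j}"
| "cvars (CEq i j) = {i, j}"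
| "cvars (CNeg \<phi>) = cvars \<phi>"
| "cvars (CConj \<phi> \<psi>) = cvars \<phi> \<union> cvars \<psi>"
| "cvars (CEx n i \<phi>) = insert i (cvars \<phi>)"

fun cfree :: "cform \<Rightarrow> nat set" where
  "cfree (CAdj i j) = {i, j}"
| "cfree (CEq i j) = {i, j}"
| "cfree (CNeg \<phi>) = cfree \<phi>"
| "cfree (CConj \<phi> \<psi>) = cfree \<phi> \<union> cfree \<psi>"
| "cfree (CEx n i \<phi>) = cfree \<phi> - {i}"

fun csat :: "graph \<Rightarrow> (nat \<Rightarrow> nat) \<Rightarrow> cform \<Rightarrow> bool" where
  "csat G \<alpha> (CAdj i j) = adj G (\<alpha> i) (\<alpha> j)"
| "csat G \<alpha> (CEq i j) = (\<alpha> i = \<alpha> j)"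
| "csat G \<alpha> (CNeg \<phi>) = (\<not> csat G \<alpha> \<phi>)"
| "csat G \<alpha> (CConj \<phi> \<psi>) = (csat G \<alpha> \<phi> \<and> csat G \<alpha> \<psi>)"
| "csat G \<alpha> (CEx n i \<phi>) = (n \<le> card {v \<in> verts G. csat G (\<alpha>(i := v)) \<phi>})"

definition C_sentence :: "nat \<Rightarrow> cform \<Rightarrow> bool" where
  "C_sentence k \<phi> \<longleftrightarrow> cvars \<phi> \<subseteq> {..<k} \<and> cfree \<phi> = {}"

text \<open>Sentences do not depend on the assignment; we evaluate with an arbitrary one.\<close>
definition C_equiv :: "nat \<Rightarrow> graph \<Rightarrow> graph \<Rightarrow> bool" where
  "C_equiv k G H \<longleftrightarrow> (\<forall>\<phi>. C_sentence k \<phi> \<longrightarrow>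
      (csat G (\<lambda>_. undefined) \<phi> \<longleftrightarrow> csat H (\<lambda>_. undefined) \<phi>))"

record 'a cstar =
  ca_carrier :: "'a set"
  ca_zero :: 'a
  ca_one :: 'a
  ca_add :: "'a \<Rightarrow> 'a \<Rightarrow> 'a"
  ca_smult :: "complex \<Rightarrow> 'a \<Rightarrow> 'a"
  ca_mult :: "'a \<Rightarrow> 'a \<Rightarrow> 'a"
  ca_star :: "'a \<Rightarrow> 'a"
  ca_norm :: "'a \<Rightarrow> real"

definition ca_diff :: "'a cstar \<Rightarrow> 'a \<Rightarrow> 'a \<Rightarrow> 'a" where
  "ca_diff A a b = ca_add A a (ca_smult A (-1) b)"

definition unital_cstar :: "'a cstar \<Rightarrow> bool" where
  "unital_cstar A \<longleftrightarrow> (let C = ca_carrier A; z = ca_zero A; e = ca_one A;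
       add = ca_add A; sm = ca_smult A; mul = ca_mult A; st = ca_star A; nm = ca_norm A in
     \<comment> \<open>closure\<close>
     z \<in> C \<and> e \<in> C \<and>
     (\<forall>a\<in>C. \<forall>b\<in>C. add a b \<in> C \<and> mul a b \<in> C) \<and>
     (\<forall>c a. a \<in> C \<longrightarrow> sm c a \<in> C) \<and> (\<forall>a\<in>C. st a \<in> C) \<and>
     \<comment> \<open>complex vector space\<close>
     (\<forall>a\<in>C. \<forall>b\<in>C. \<forall>c\<in>C. add (add a b) c = add a (add b c)) \<and>
     (\<forall>a\<in>C. \<forall>b\<in>C. add a b = add b a) \<and>
     (\<forall>a\<in>C. add z a = a) \<and>
     (\<forall>a\<in>C. \<exists>b\<in>C. add a b = z) \<and>
     (\<forall>c. \<forall>a\<in>C. \<forall>b\<in>C. sm c (add a b) = add (sm c a) (sm c b)) \<and>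
     (\<forall>c d. \<forall>a\<in>C. sm (c + d) a = add (sm c a) (sm d a)) \<and>
     (\<forall>c d. \<forall>a\<in>C. sm c (sm d a) = sm (c * d) a) \<and>
     (\<forall>a\<in>C. sm 1 a = a) \<and>
     \<comment> \<open>associative unital algebra\<close>
     (\<forall>a\<in>C. \<forall>b\<in>C. \<forall>c\<in>C. mul (mul a b) c = mul a (mul b c)) \<and>
     (\<forall>a\<in>C. mul e a = a \<and> mul a e = a) \<and>
     (\<forall>a\<in>C. \<forall>b\<in>C. \<forall>c\<in>C. mul a (add b c) = add (mul a b) (mul a c)
                          \<and> mul (add a b) c = add (mul a c) (mul b c)) \<and>
     (\<forall>c. \<forall>a\<in>C. \<forall>b\<in>C. mul (sm c a) b = sm c (mul a b) \<and> mul a (sm c b) = sm c (mul a b)) \<and>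
     \<comment> \<open>involution\<close>
     (\<forall>a\<in>C. st (st a) = a) \<and>
     (\<forall>a\<in>C. \<forall>b\<in>C. st (add a b) = add (st a) (st b)) \<and>
     (\<forall>c. \<forall>a\<in>C. st (sm c a) = sm (cnj c) (st a)) \<and>
     (\<forall>a\<in>C. \<forall>b\<in>C. st (mul a b) = mul (st b) (st a)) \<and>
     \<comment> \<open>submultiplicative norm\<close>
     (\<forall>a\<in>C. nm a = 0 \<longleftrightarrow> a = z) \<and>
     (\<forall>a\<in>C. \<forall>b\<in>C. nm (add a b) \<le> nm a + nm b) \<and>
     (\<forall>c. \<forall>a\<in>C. nm (sm c a) = cmod c * nm a) \<and>
     (\<forall>a\<in>C. \<forall>b\<in>C. nm (mul a b) \<le> nm a * nm b) \<and>
     \<comment> \<open>completeness\<close>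
     (\<forall>s :: nat \<Rightarrow> 'a. (\<forall>n. s n \<in> C) \<longrightarrow>
          (\<forall>\<epsilon>>0. \<exists>N. \<forall>m\<ge>N. \<forall>n\<ge>N. nm (ca_diff A (s m) (s n)) < \<epsilon>) \<longrightarrow>
          (\<exists>l\<in>C. \<forall>\<epsilon>>0. \<exists>N. \<forall>n\<ge>N. nm (ca_diff A (s n) l) < \<epsilon>)) \<and>
     \<comment> \<open>C* identity\<close>
     (\<forall>a\<in>C. nm (mul (st a) a) = (nm a)\<^sup>2) \<and>
     \<comment> \<open>non-trivial\<close>
     e \<noteq> z)"

definition ca_proj :: "'a cstar \<Rightarrow> 'a \<Rightarrow> bool" where
  "ca_proj A p \<longleftrightarrow> p \<in> ca_carrier A \<and> ca_mult A p p = p \<and> ca_star A p = p"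

definition ca_sum :: "'a cstar \<Rightarrow> (nat \<Rightarrow> 'a) \<Rightarrow> nat set \<Rightarrow> 'a" where
  "ca_sum A f S = foldr (\<lambda>x acc. ca_add A (f x) acc) (sorted_list_of_set S) (ca_zero A)"

datatype vrel = REq | RAdj | RNonadj

definition rel :: "graph \<Rightarrow> nat \<Rightarrow> nat \<Rightarrow> vrel" where
  "rel G u v = (if u = v then REq else if adj G u v then RAdj else RNonadj)"

definition qiso_in :: "'a cstar \<Rightarrow> graph \<Rightarrow> graph \<Rightarrow> bool" where
  "qiso_in A G H \<longleftrightarrow> unital_cstar A \<and> (\<exists>u :: nat \<Rightarrow> nat \<Rightarrow> 'a.
     (\<forall>g\<in>verts G. \<forall>h\<in>verts H. ca_proj A (u g h)) \<and>
     (\<forall>g\<in>verts G. ca_sum A (\<lambda>h. u g h) (verts H) = ca_one A) \<and>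
     (\<forall>h\<in>verts H. ca_sum A (\<lambda>g. u g h) (verts G) = ca_one A) \<and>
     (\<forall>g\<in>verts G. \<forall>g'\<in>verts G. \<forall>h\<in>verts H. \<forall>h'\<in>verts H.
        rel G g g' \<noteq> rel H h h' \<longrightarrow> ca_mult A (u g h) (u g' h') = ca_zero A))"

text \<open>Quantum isomorphism: existence of a unital C*-algebra with such projections.
  It suffices to consider C*-algebras whose carrier is a subset of a fixed type of
  cardinality continuum, since the C*-subalgebra generated by the finitely many u_gh is
  separable and hence has cardinality (at most) continuum.\<close>
definition quantum_isomorphic :: "graph \<Rightarrow> graph \<Rightarrow> bool" where
  "quantum_isomorphic G H \<longleftrightarrow> (\<exists>A :: (nat \<Rightarrow> complex) cstar. qiso_in A G H)"

end

theory Submission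
  imports Defs "HOL-Library.Nat_Bijection"
begin

text \<open>
  Let R be homomorphism indistinguishability over the given class and let cl be the class of all simple F
  whose homomorphism counts agree on R-related graphs. Since R is closed under complements and under
  products with arbitrary graphs (loops allowed), an interpolation argument in the counts from F into
  complements of G x K x J_n isolates the counts of homomorphisms from F with some edges deleted and
  others contracted, so cl is closed under minors. If the members of cl had bounded tree-width k, then
  C^k-equivalence would imply R; hence tree-width is unbounded and, by the excluded grid theorem, cl contains all grids.

  Grid counts are exactly the scalars obtained from words in the local operators "sum over a site",
  "neighbouring sites are equal" and "neighbouring sites are adjacent". Their agreement for G and H yields
  a linear bijection, compatible with contraction, tensor product and reversal, between the tensors on G and those on H
  generated by these operators. With simultaneous orthonormal bases (b_i, b'_i) of the n-site tensors the
  kernel P_n(x, y) = sum_i b_i(x) b'_i(y) defines a state phi(u_{x_1 y_1} ... u_{x_n y_n}) = P_n(x, y) on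
  words in the generators of a quantum isomorphism. Its positivity follows from C^2 = (S x 1) C for
  C = sum_i b_i x b'_i and the positive definite S = sum_i b_i b_i^T, and a GNS construction turns the state
  into projections in a C*-algebra of bounded matrices.
\<close>

section \<open>Menger's theorem\<close>

text \<open>Planarity shapes the second half. Grid counts never let two sites cross; if crossings
  were allowed, all graphs would be counted and the conclusion would be an isomorphism. So operators
  act on neighbouring sites, contractions are nested (a tuple against its reversal), and reversal
  takes the place of arbitrary permutations. Positivity of the state is then not inherited from
  anything classical. It rests on the square relation together with the fact that the identity
  kernel is itself a generated tensor, which is what makes S definite.

  In the interpolation, \<open>J_n\<close> weighs a term by a power of \<open>n\<close> that depends
  only on the contracted edges. The two leading powers single out "nothing contracted" and "one edge
  contracted", so deletion and contraction of a single edge are obtained, and minors follow by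
  iteration. The free factor K then isolates one target graph by Moebius inversion over its
  subgraphs.

  For the grid theorem, a failed search for a tree decomposition yields connected sets that are
  pairwise linked by many paths. Either these paths can be chosen disjoint for all pairs at once,
  which gives a clique, or two linkages cross so often that they form a weave.\<close>

fun path_edges :: "'a list => ('a \<times> 'a) set" where
 "path_edges [] = {}"
| "path_edges [x] = {}"
| "path_edges (x # y # zs) = insert (x, y) (path_edges (y # zs))"

lemma path_edges_append:
 "p ~= [] ==> q ~= [] ==> path_edges (p @ q) = insert (last p, hd q) (path_edges p Un path_edges q)"
proof (induction p rule: path_edges.induct)
 case (2 x) then show ?case by (cases q) auto
qed auto

lemma path_edges_Cons: "path_edges (x # p) = (if p = [] then {} else insert (x, hd p) (path_edges p))"
 by (cases p) auto

lemma path_edges_append_tl: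
 assumes "p ~= []" "q ~= []" "last p = hd q"
 shows "path_edges (p @ tl q) = path_edges p Un path_edges q"
 using assms by (cases q; cases "tl q = []") (auto simp: path_edges_append path_edges_Cons)

lemma path_edges_subset: "path_edges p \<subseteq> set p \<times> set p"
 by (induction p rule: path_edges.induct) auto

lemma path_edges_rev: "path_edges (rev p) = (path_edges p)\<inverse>"
proof (induction p)
 case (Cons a p)
 then show ?case by (cases "p = []") (auto simp: path_edges_append path_edges_Cons last_rev)
qed simp

lemma path_edges_sub_append: "path_edges p \<subseteq> path_edges (p @ q)" "path_edges q \<subseteq> path_edges (p @ q)"
 by (cases "p = []"; cases "q = []"; auto simp: path_edges_append)+

text \<open>Only a walk: repetitions are allowed, so that two paths can be spliced at a common
  vertex without shortcuts. \<open>linkage\<close> adds distinctness.\<close>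

definition is_path :: "('a \<times> 'a) set => 'a set => 'a set => 'a list => bool" where
 "is_path E A B p \<longleftrightarrow> p ~= [] & path_edges p \<subseteq> E & hd p \<in> A & last p \<in> B"

definition linkage :: "('a \<times> 'a) set => 'a set => 'a set => 'a list set => bool" where
 "linkage E A B P \<longleftrightarrow> finite P & (\<forall>p\<in>P. is_path E A B p & distinct p) &
  (\<forall>p\<in>P. \<forall>q\<in>P. p ~= q --> set p Int set q = {})"

definition separates :: "('a \<times> 'a) set => 'a set => 'a set => 'a set => bool" where
 "separates E A B S \<longleftrightarrow> (\<forall>p. is_path E A B p --> set p Int S ~= {})"

lemma linkage_mono: "linkage E A B P ==> E \<subseteq> E' ==> P' \<subseteq> P ==> linkage E' A B P'"
 unfolding linkage_def is_path_def by (meson finite_subset subset_iff)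

lemma separatesD: "separates E A B S ==> is_path E A B p ==> \<exists>v. v \<in> set p & v \<in> S"
 by (auto simp: separates_def)

lemma walk_split_first:
 assumes "set p Int T ~= {}"
 obtains q t r where "p = q @ t # r" "t \<in> T" "set q Int T = {}"
 using assms split_list_first_prop[of p "%x. x \<in> T"] by (metis disjoint_iff)

lemma walk_split_last:
 assumes "set p Int T ~= {}"
 obtains q t r where "p = q @ t # r" "t \<in> T" "set r Int T = {}"
 using assms split_list_last_prop[of p "%x. x \<in> T"] by (metis disjoint_iff)

lemma card_disjoint_sets_le:
 assumes "finite S" "\<forall>p\<in>P. set p Int S ~= {}" "\<forall>p\<in>P. \<forall>q\<in>P. p ~= q --> set p Int set q = {}" "finite P"
 shows "card P <= card S"
proof -
 obtain f where f: "\<forall>p\<in>P. f p \<in> set p Int S" using assms(2) unfolding ex_in_conv[symmetric] by metis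
 have "inj_on f P" unfolding inj_on_def using f assms(3) by (metis IntD1 disjoint_iff)
 moreover have "f ` P \<subseteq> S" using f by auto
 ultimately show ?thesis using assms(1) by (metis card_image card_mono)
qed

text \<open>Goering's induction over the edges of a digraph. If every separator still has at least
  \<open>k\<close> elements after deleting \<open>e = (x, y)\<close>, the smaller edge set suffices.
  Otherwise a smaller \<open>S\<close> separates without \<open>e\<close>, while
  \<open>insert x S\<close> and \<open>insert y S\<close> separate in the full digraph and hence
  have exactly \<open>k\<close> elements. Linkages from \<open>A\<close> to
  \<open>insert x S\<close> and from \<open>insert y S\<close> to \<open>B\<close> exist without
  \<open>e\<close> and are glued along \<open>S\<close> and across \<open>e\<close>.\<close>

lemma menger_aux:
 assumes "finite E" "!!S. finite S ==> separates E A B S ==> k <= card S" "finite A"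
 shows "\<exists>P. linkage E A B P & card P = k"
 using assms
proof (induction E arbitrary: A B rule: finite_induct)
 case empty
 have "separates {} A B (A Int B)" unfolding separates_def is_path_def
 proof (intro allI impI)
  fix p assume "p ~= [] & path_edges p \<subseteq> {} & hd p \<in> A & last p \<in> B"
  then show "set p Int (A Int B) ~= {}" by (cases p rule: path_edges.cases) auto
 qed
 with empty have "k <= card (A Int B)" by simp
 then obtain T where T: "T \<subseteq> A Int B" "card T = k" "finite T" using obtain_subset_with_card_n by metis
 have "linkage {} A B ((%v. [v]) ` T)" using T by (auto simp: linkage_def is_path_def)
 moreover have "card ((%v. [v]) ` T) = k" using T by (simp add: card_image inj_on_def)
 ultimately show ?case by blast
next
 case (insert e E)
 obtain x y where e: "e = (x, y)" by force
 have "x ~: {} " by simp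
 show ?case
 proof (cases "\<forall>S. finite S --> separates E A B S --> k <= card S")
  case True
  then obtain P where "linkage E A B P" "card P = k" using insert.IH insert.prems by metis
  then show ?thesis using linkage_mono[of E A B P "insert e E" P] by blast
 next
  case False
  then obtain S where S: "finite S" "separates E A B S" "card S < k" by force
  have avoid: "e \<in> path_edges p" if "is_path (insert e E) A B p" "set p Int S = {}" for p
   using that S(2) by (auto simp: separates_def is_path_def)
  have ends: "u \<in> set p & v \<in> set p" if "(u,v) \<in> path_edges p" for u v and p :: "'a list"
   using path_edges_subset[of p] that by auto
  have sx: "separates (insert e E) A B (insert x S)" "separates (insert e E) A B (insert y S)"
   unfolding separates_def using avoid ends e by blast+
  have k: "k = Suc (card S)" "x ~: S" "y ~: S"
   using insert.prems(1)[OF _ sx(1)] insert.prems(1)[OF _ sx(2)] S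
   by (auto simp: card_insert_if split: if_splits)
  \<comment> \<open>A walk from \<open>A\<close> to \<open>B\<close> is cut at its first vertex in
    \<open>insert x S\<close>. The initial piece cannot use \<open>e\<close>, which leaves from
    \<open>x\<close>, so any set separating \<open>A\<close> from \<open>insert x S\<close> without
    \<open>e\<close> separates \<open>A\<close> from \<open>B\<close> in the full digraph.\<close>
  have b1: "k <= card T" if T: "finite T" "separates E A (insert x S) T" for T
  proof (rule insert.prems(1)[OF T(1)], unfold separates_def, intro allI impI)
   fix p assume p: "is_path (insert e E) A B p"
   then have "set p Int insert x S ~= {}" using sx(1) by (auto simp: separates_def)
   then obtain q t r where s: "p = q @ t # r" "t \<in> insert x S" "set q Int insert x S = {}"
    by (rule walk_split_first)
   have "path_edges (q @ [t]) \<subseteq> path_edges p" using path_edges_sub_append(1)[of "q @ [t]" r] s(1) by simp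
   moreover have "e ~: path_edges (q @ [t])"
   proof
    assume *: "e \<in> path_edges (q @ [t])"
    then have "x \<in> set q"
    proof (induction q)
     case (Cons a q) then show ?case by (cases "q = []") (auto simp: path_edges_Cons e)
    qed simp
    then show False using s by auto
   qed
   ultimately have "is_path E A (insert x S) (q @ [t])"
    using p s unfolding is_path_def by (cases q) auto
   then show "set p Int T ~= {}" using T(2) s(1) by (fastforce simp: separates_def)
  qed
  have b2: "k <= card T" if T: "finite T" "separates E (insert y S) B T" for T
  proof (rule insert.prems(1)[OF T(1)], unfold separates_def, intro allI impI)
   fix p assume p: "is_path (insert e E) A B p"
   then have "set p Int insert y S ~= {}" using sx(2) by (auto simp: separates_def)
   then obtain q t r where s: "p = q @ t # r" "t \<in> insert y S" "set r Int insert y S = {}"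
    by (rule walk_split_last)
   have "path_edges (t # r) \<subseteq> path_edges p" using path_edges_sub_append(2)[of "t # r" q] s(1) by simp
   moreover have "e ~: path_edges (t # r)"
   proof
    assume *: "e \<in> path_edges (t # r)"
    then have "y \<in> set r"
     using ends[of x y r] by (auto simp: path_edges_Cons e split: if_splits)
    then show False using s by auto
   qed
   ultimately have "is_path E (insert y S) B (t # r)"
    using p s unfolding is_path_def by auto
   then show "set p Int T ~= {}" using T(2) s(1) by (fastforce simp: separates_def)
  qed
  obtain P1 where P1: "linkage E A (insert x S) P1" "card P1 = k" using insert.IH[of A "insert x S"] b1 insert.prems by blast
  obtain P2 where P2: "linkage E (insert y S) B P2" "card P2 = k" using insert.IH[of "insert y S" B] b2 S by blast
  have inj1: "inj_on last P1" using P1(1) unfolding linkage_def is_path_def inj_on_def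
   by (metis disjoint_iff last_in_set)
  have inj2: "inj_on hd P2" using P2(1) unfolding linkage_def is_path_def inj_on_def
   by (metis disjoint_iff list.set_sel(1))
  have im1: "last ` P1 = insert x S"
   by (rule card_subset_eq) (use P1 S k inj1 in \<open>auto simp: card_image linkage_def is_path_def\<close>)
  have im2: "hd ` P2 = insert y S"
   by (rule card_subset_eq) (use P2 S k inj2 in \<open>auto simp: card_image linkage_def is_path_def\<close>)
  have "\<exists>p. \<forall>s\<in>insert x S. p s \<in> P1 & last (p s) = s" unfolding im1[symmetric] by (intro bchoice) auto
  then obtain p where p: "!!s. s \<in> insert x S ==> p s \<in> P1 & last (p s) = s" by blast
  have "\<exists>q. \<forall>s\<in>insert y S. q s \<in> P2 & hd (q s) = s" unfolding im2[symmetric] by (intro bchoice) auto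
  then obtain q where q: "!!s. s \<in> insert y S ==> q s \<in> P2 & hd (q s) = s" by blast
  have p': "p s ~= []" "path_edges (p s) \<subseteq> E" "distinct (p s)" "hd (p s) \<in> A" if "s \<in> insert x S" for s
   using p[OF that] P1(1) by (auto simp: linkage_def is_path_def)
  have q': "q s ~= []" "path_edges (q s) \<subseteq> E" "distinct (q s)" "last (q s) \<in> B" if "s \<in> insert y S" for s
   using q[OF that] P2(1) by (auto simp: linkage_def is_path_def)
  have pd: "set (p s) Int set (p t) = {}" if "s \<in> insert x S" "t \<in> insert x S" "s ~= t" for s t
   using p[OF that(1)] p[OF that(2)] P1(1) that(3) unfolding linkage_def by metis
  have qd: "set (q s) Int set (q t) = {}" if "s \<in> insert y S" "t \<in> insert y S" "s ~= t" for s t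
   using q[OF that(1)] q[OF that(2)] P2(1) that(3) unfolding linkage_def by metis
  have pS: "w = s" if "s \<in> insert x S" "w \<in> set (p s)" "w \<in> insert x S" for s w
   using pd[of s w] p[of w] p'(1)[of w] that last_in_set by fastforce
  have qS: "w = s" if "s \<in> insert y S" "w \<in> set (q s)" "w \<in> insert y S" for s w
   using qd[of s w] q[of w] q'(1)[of w] that hd_in_set by fastforce
  \<comment> \<open>At a common vertex \<open>w\<close> the two paths splice into a walk from
    \<open>A\<close> to \<open>B\<close> without \<open>e\<close>. It meets \<open>S\<close>, but
    each half can meet the separator only at its own end, so the meeting point is
    \<open>w\<close>.\<close>
  have pq: "w \<in> S & w = s & w = t" if s: "s \<in> insert x S" and t: "t \<in> insert y S"
   and w: "w \<in> set (p s)" "w \<in> set (q t)" for s t w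
  proof -
   obtain a b where ab: "p s = a @ w # b" using w(1) by (meson split_list)
   obtain c d where cd: "q t = c @ w # d" using w(2) by (meson split_list)
   have "path_edges (a @ [w]) \<subseteq> E" "path_edges (w # d) \<subseteq> E"
    using p'(2)[OF s] q'(2)[OF t] path_edges_sub_append(1)[of "a @ [w]" b] path_edges_sub_append(2)[of "w # d" c]
    by (auto simp: ab cd)
   then have "path_edges (a @ w # d) \<subseteq> E" using path_edges_append_tl[of "a @ [w]" "w # d"] by simp
   moreover have "hd (a @ w # d) \<in> A" using p'(4)[OF s] by (cases a) (auto simp: ab)
   moreover have "last (a @ w # d) \<in> B" using q'(4)[OF t] by (auto simp: cd)
   ultimately have "is_path E A B (a @ w # d)" by (simp add: is_path_def)
   then obtain v where v: "v \<in> S" "v \<in> set a \<or> v = w \<or> v \<in> set d" using S(2) by (fastforce simp: separates_def)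
   have la: "s = last (w # b)" using p[OF s] ab by simp
   have ht: "t = hd (c @ [w])" using q[OF t] cd by (cases c) auto
   have "v ~: set a"
   proof
    assume "v \<in> set a"
    then have "v = s" using pS[OF s, of v] v by (auto simp: ab)
    moreover have "s \<in> set (w # b)" using la last_in_set by blast
    ultimately show False using \<open>v \<in> set a\<close> p'(3)[OF s] ab by auto
   qed
   moreover have "v ~: set d"
   proof
    assume "v \<in> set d"
    then have "v = t" using qS[OF t, of v] v by (auto simp: cd)
    moreover have "t \<in> set (c @ [w])" using ht hd_in_set by blast
    ultimately show False using \<open>v \<in> set d\<close> q'(3)[OF t] cd by auto
   qed
   ultimately have "v = w" using v by auto
   then show ?thesis using pS[OF s w(1)] qS[OF t w(2)] v by auto
  qed
  \<comment> \<open>Only the path ending in \<open>x\<close> crosses the new edge; every other one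
    is glued at its vertex of \<open>S\<close>, whose second copy \<open>tl\<close> removes.\<close>
  define r where "r s = (if s = x then p x @ q y else p s @ tl (q s))" for s
  define g where "g s = (if s = x then y else s)" for s
  have g: "g s \<in> insert y S" if "s \<in> insert x S" for s using that by (auto simp: g_def)
  have gi: "g s ~= g t" if "s \<in> insert x S" "t \<in> insert x S" "s ~= t" for s t using that k by (auto simp: g_def)
  have rset: "set (r s) \<subseteq> set (p s) Un set (q (g s))" for s
   by (cases "q s") (auto simp: r_def g_def)
  have rd: "set (r s) Int set (r t) = {}" if st: "s \<in> insert x S" "t \<in> insert x S" "s ~= t" for s t
  proof -
   have "set (p s) Int set (q (g t)) = {}"
    using pq[OF st(1) g[OF st(2)]] st k by (fastforce simp: g_def split: if_splits)
   moreover have "set (p t) Int set (q (g s)) = {}"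
    using pq[OF st(2) g[OF st(1)]] st k by (fastforce simp: g_def split: if_splits)
   ultimately show ?thesis using rset[of s] rset[of t] pd[OF st] qd[OF g[OF st(1)] g[OF st(2)] gi[OF st]] by blast
  qed
  have rp: "is_path (insert e E) A B (r s) & distinct (r s)" if s: "s \<in> insert x S" for s
  proof (cases "s = x")
   case True
   have "set (p x) Int set (q y) = {}" using pq[of x y] k by auto
   then show ?thesis using True p'[of x] q'[of y] p[of x] q[of y]
    by (auto simp: r_def is_path_def path_edges_append e)
  next
   case False
   then have sS: "s \<in> S" using s by auto
   have "last (p s) = hd (q s)" using p q sS by auto
   moreover have "set (p s) Int set (tl (q s)) = {}"
   proof (rule ccontr)
    assume "set (p s) Int set (tl (q s)) ~= {}"
    then obtain w where w: "w \<in> set (p s)" "w \<in> set (tl (q s))" by auto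
    have "w \<in> set (q s)" using w(2) by (cases "q s") auto
    then have "w = s" using w(1) pq[of s s w] sS by auto
    then show False using w(2) q[of s] q'(1,3)[of s] sS by (cases "q s") auto
   qed
   moreover have "last (p s @ tl (q s)) = last (q s)"
    using q'(1)[of s] sS calculation(1) by (cases "q s") auto
   ultimately show ?thesis using False sS p'[of s] q'[of s]
    by (auto simp: r_def is_path_def path_edges_append_tl distinct_tl)
  qed
  have ri: "inj_on r (insert x S)"
   unfolding inj_on_def by (metis rd rp is_path_def inf.idem set_empty)
  have "linkage (insert e E) A B (r ` insert x S)"
   unfolding linkage_def using S(1) rp rd by auto
  moreover have "card (r ` insert x S) = k" using ri k S(1) by (simp add: card_image)
  ultimately show ?thesis by blast
 qed
qed

text \<open>The last clause is the tight case: as many disjoint paths as separator vertices force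
  each path to carry exactly one of them. The halves of these paths later serve as connections to
  the separator.\<close>

theorem menger:
 assumes "finite E" "finite A"
 obtains S P where "finite S" "separates E A B S" "linkage E A B P" "card P = card S"
  "!!s. s \<in> S ==> \<exists>p\<in>P. set p Int S = {s}"
proof -
 have "separates E A B A" unfolding separates_def is_path_def using hd_in_set by blast
 then obtain S where S: "finite S" "separates E A B S" "!!T. finite T ==> separates E A B T ==> card S <= card T"
  using ex_has_least_nat[of "%S. finite S & separates E A B S" A card] assms by auto
 obtain P where P: "linkage E A B P" "card P = card S"
  using menger_aux[OF assms(1) S(3) assms(2)] by auto
 have "\<forall>p\<in>P. \<exists>s. s \<in> set p Int S" using P(1) separatesD[OF S(2)] by (simp add: linkage_def)
 then obtain f where f: "\<forall>p\<in>P. f p \<in> set p Int S" by metis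
 have disj: "!!p q. p \<in> P ==> q \<in> P ==> p ~= q ==> set p Int set q = {}" using P(1) by (auto simp: linkage_def)
 have "inj_on f P" unfolding inj_on_def using f disj by (metis IntD1 disjoint_iff)
 moreover have "f ` P \<subseteq> S" using f by auto
 ultimately have im: "f ` P = S" using S P by (intro card_subset_eq) (auto simp: card_image)
 show ?thesis
 proof (rule that[OF S(1,2) P(1)])
  show "card P = card S" using P S by simp
  fix s assume "s \<in> S"
  then obtain p where p: "p \<in> P" "f p = s" using im by auto
  have "set p Int S = {s}"
  proof (intro equalityI subsetI)
   fix t assume t: "t \<in> set p Int S"
   then obtain p' where "p' \<in> P" "f p' = t" using im by auto
   then show "t \<in> {s}" using f p t disj[of p p'] by blast
  qed (use f p in auto)
  then show "\<exists>p\<in>P. set p Int S = {s}" using p by blast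
 qed
qed

section \<open>Meshes in graphs of large tree-width\<close>

definition conn :: "('a \<times> 'a) set => 'a set => bool" where
 "conn E W \<longleftrightarrow> (\<forall>x\<in>W. \<forall>y\<in>W. (x, y) \<in> (E Int W \<times> W)\<^sup>*)"

definition component :: "('a \<times> 'a) set => 'a set => 'a => 'a set" where
 "component E C x = (E Int C \<times> C)\<^sup>* `` {x}"

lemma rtrancl_restrict_mono: "(a, b) \<in> (E Int U \<times> U)\<^sup>* ==> U \<subseteq> W ==> E \<subseteq> E' ==> (a, b) \<in> (E' Int W \<times> W)\<^sup>*"
 by (meson Int_mono Sigma_mono rtrancl_mono subsetD)

lemma sym_restrict_rtrancl: "sym E ==> (a, b) \<in> (E Int W \<times> W)\<^sup>* ==> (b, a) \<in> (E Int W \<times> W)\<^sup>*"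
 by (rule symD[OF sym_rtrancl]) (auto simp: sym_def)

lemma conn_hub:
 assumes "sym E" "!!w. w \<in> W ==> (w, h) \<in> (E Int W \<times> W)\<^sup>*"
 shows "conn E W"
 unfolding conn_def
proof (intro ballI)
 fix x y assume "x \<in> W" "y \<in> W"
 then show "(x, y) \<in> (E Int W \<times> W)\<^sup>*"
  using assms(2)[of x] sym_restrict_rtrancl[OF assms(1) assms(2)[of y]] by (meson rtrancl_trans)
qed

lemma conn_mono: "conn E W ==> E \<subseteq> E' ==> conn E' W"
 unfolding conn_def by (intro ballI) (rule rtrancl_restrict_mono[OF _ order_refl], auto)

lemma conn_empty [simp]: "conn E {}" by (simp add: conn_def)

lemma conn_singleton [simp]: "conn E {x}" by (simp add: conn_def)

lemma conn_Un:
 assumes "sym E" "conn E U" "conn E W" "a \<in> U" "b \<in> W" "a = b \<or> (a, b) \<in> E"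
 shows "conn E (U Un W)"
proof (rule conn_hub[OF assms(1)])
 fix w assume w: "w \<in> U Un W"
 have ab: "(a, b) \<in> (E Int (U Un W) \<times> (U Un W))\<^sup>*" using assms(4-6) by auto
 show "(w, b) \<in> (E Int (U Un W) \<times> (U Un W))\<^sup>*"
 proof (cases "w \<in> W")
  case True
  then have "(w, b) \<in> (E Int W \<times> W)\<^sup>*" using assms by (auto simp: conn_def)
  then show ?thesis by (rule rtrancl_restrict_mono) auto
 next
  case False
  then have "(w, a) \<in> (E Int U \<times> U)\<^sup>*" using assms w by (auto simp: conn_def)
  then have "(w, a) \<in> (E Int (U Un W) \<times> (U Un W))\<^sup>*" by (rule rtrancl_restrict_mono) auto
  then show ?thesis using ab by (rule rtrancl_trans)
 qed
qed

lemma conn_UN: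
 assumes "sym E" "conn E W" "!!i. i \<in> I ==> conn E (B i)" "!!i. i \<in> I ==> B i Int W ~= {}"
 shows "conn E (W Un (\<Union>i\<in>I. B i))"
proof (cases "W = {}")
 case True then have "I = {}" using assms(4) by auto
 then show ?thesis using True by simp
next
 case False
 then obtain h where h: "h \<in> W" by auto
 let ?U = "W Un (\<Union>i\<in>I. B i)"
 have W: "(w, h) \<in> (E Int ?U \<times> ?U)\<^sup>*" if "w \<in> W" for w
 proof -
  have "(w, h) \<in> (E Int W \<times> W)\<^sup>*" using assms(2) h that by (auto simp: conn_def)
  then show ?thesis by (rule rtrancl_restrict_mono) auto
 qed
 show ?thesis
 proof (rule conn_hub[OF assms(1)])
  fix w assume w: "w \<in> ?U"
  show "(w, h) \<in> (E Int ?U \<times> ?U)\<^sup>*"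
  proof (cases "w \<in> W")
   case False
   then obtain i where i: "i \<in> I" "w \<in> B i" using w by auto
   then obtain c where c: "c \<in> B i" "c \<in> W" using assms(4) by blast
   have "(w, c) \<in> (E Int B i \<times> B i)\<^sup>*" using assms(3)[OF i(1)] i(2) c(1) by (auto simp: conn_def)
   then have "(w, c) \<in> (E Int ?U \<times> ?U)\<^sup>*" by (rule rtrancl_restrict_mono) (use i in auto)
   then show ?thesis using W[OF c(2)] by (rule rtrancl_trans)
  qed (use W in auto)
 qed
qed

lemma comp_sub: "x \<in> C ==> component E C x \<subseteq> C"
proof
 fix y assume "x \<in> C" "y \<in> component E C x"
 then have "(x, y) \<in> (E Int C \<times> C)\<^sup>*" by (simp add: component_def)
 then show "y \<in> C" using \<open>x \<in> C\<close> by (induction rule: rtrancl_induct) auto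
qed

lemma comp_self: "x \<in> component E C x" by (simp add: component_def)

lemma comp_closed: "E `` component E C x Int C \<subseteq> component E C x" if "x \<in> C"
proof
 fix b assume b: "b \<in> E `` component E C x Int C"
 then obtain a where a: "a \<in> component E C x" "(a, b) \<in> E" by auto
 then have "a \<in> C" using comp_sub[OF that] by auto
 then show "b \<in> component E C x" using a b unfolding component_def by (auto intro: rtrancl_into_rtrancl)
qed

lemma conn_comp: assumes "sym E" "x \<in> C" shows "conn E (component E C x)"
proof (rule conn_hub[OF assms(1)])
 fix w assume "w \<in> component E C x"
 then have "(x, w) \<in> (E Int C \<times> C)\<^sup>*" by (simp add: component_def)
 then have "(x, w) \<in> (E Int component E C x \<times> component E C x)\<^sup>*"
 proof (induction rule: rtrancl_induct)
  case (step y z)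
  then have "y \<in> component E C x" "z \<in> component E C x" unfolding component_def by (auto intro: rtrancl_into_rtrancl)
  then show ?case using step by (auto intro: rtrancl_into_rtrancl)
 qed simp
 then show "(w, x) \<in> (E Int component E C x \<times> component E C x)\<^sup>*" by (rule sym_restrict_rtrancl[OF assms(1)])
qed

lemma conn_edge_out:
 assumes "conn E C" "a \<in> C" "a \<in> K" "b \<in> C" "b ~: K"
 shows "\<exists>x y. (x, y) \<in> E & x \<in> K & y ~: K & x \<in> C & y \<in> C"
proof -
 have "(a, b) \<in> (E Int C \<times> C)\<^sup>*" using assms by (auto simp: conn_def)
 then show ?thesis using assms(3,5)
  by (induction rule: converse_rtrancl_induct) auto
qed

lemma conn_path:
 assumes "conn E K" "a \<in> K" "b \<in> K"
 obtains q where "q ~= []" "hd q = a" "last q = b" "set q \<subseteq> K" "path_edges q \<subseteq> E Int K \<times> K"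
proof -
 have "(a, b) \<in> (E Int K \<times> K)\<^sup>*" using assms by (auto simp: conn_def)
 then have "\<exists>q. q ~= [] & hd q = a & last q = b & set q \<subseteq> K & path_edges q \<subseteq> E Int K \<times> K"
 proof (induction rule: converse_rtrancl_induct)
  case base then show ?case by (intro exI[of _ "[b]"]) (use assms in auto)
 next
  case (step y z)
  then obtain q where "q ~= []" "hd q = z" "last q = b" "set q \<subseteq> K" "path_edges q \<subseteq> E Int K \<times> K" by auto
  then show ?case using step by (intro exI[of _ "y # q"]) (auto simp: path_edges_Cons)
 qed
 then show ?thesis using that by blast
qed

lemma conn_path_set: "sym E ==> path_edges q \<subseteq> E ==> conn E (set q)"
proof (induction q rule: path_edges.induct)
 case (3 x y zs)
 then have "conn E ({x} Un set (y # zs))" by (intro conn_Un[of E _ _ x y]) auto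
 then show ?case by (simp add: insert_commute)
qed auto

text \<open>A derivation is a tree decomposition read from the root, or a winning strategy for
  \<open>k\<close> searchers: \<open>S\<close> is the current bag and \<open>C\<close> the part
  still to be covered. Starting from an empty bag, all bags have at most \<open>k\<close> vertices,
  so tree-width is below \<open>k\<close>. In this form \<open>ok_add\<close> corresponds to one
  quantifier of \<open>C^k\<close>, with the bag stored in the variables.\<close>

inductive ok :: "('a \<times> 'a) set => nat => 'a set => 'a set => bool" for E k where
 ok_empty: "ok E k S {}"
| ok_split: "ok E k S C1 ==> ok E k S C2 ==> C1 Int C2 = {} ==> E Int C1 \<times> C2 = {} ==> ok E k S (C1 Un C2)"
| ok_add: "ok E k (insert v S) (C - {v}) ==> v \<in> C ==> v ~: S ==> finite S ==> card S < k ==> ok E k S C"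
| ok_forget: "ok E k S' C ==> S' \<subseteq> S ==> S Int C = {} ==> E `` C \<subseteq> S' Un C ==> ok E k S C"

section \<open>Searching a graph: a bounded search succeeds or a mesh appears\<close>

definition is_comp :: "('a \<times> 'a) set => 'a set => 'a set => bool" where
 "is_comp E C K \<longleftrightarrow> K ~= {} & K \<subseteq> C & conn E K & E `` K Int C \<subseteq> K"

lemma ok_components:
 assumes "finite C" "sym E" "!!K. is_comp E C K ==> ok E k S K"
 shows "ok E k S C"
 using assms(1,3)
proof (induction "card C" arbitrary: C rule: less_induct)
 case less
 show ?case
 proof (cases "C = {}")
  case True then show ?thesis by (simp add: ok_empty)
 next
  case False
  then obtain x where x: "x \<in> C" by auto
  let ?K = "component E C x"
  have K: "is_comp E C ?K" unfolding is_comp_def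
   using comp_sub[OF x] comp_self conn_comp[OF assms(2) x] comp_closed[OF x] by fast
  have no: "E Int ?K \<times> (C - ?K) = {}" using comp_closed[OF x] by auto
  have "ok E k S (C - ?K)"
  proof (rule less(1))
   show "card (C - ?K) < card C" using less.prems(1) x comp_self[of x E C] by (intro psubset_card_mono) auto
   fix K assume k: "is_comp E (C - ?K) K"
   have "E `` K Int ?K = {}" using no k assms(2) by (fastforce simp: is_comp_def sym_def)
   then have "is_comp E C K" using k by (auto simp: is_comp_def)
   then show "ok E k S K" by (rule less.prems(2))
  qed (use less.prems in auto)
  then have "ok E k S (?K Un (C - ?K))" using less.prems(2)[OF K] no by (intro ok_split) auto
  then show ?thesis using comp_sub[OF x, of E] by (simp add: Un_absorb1)
 qed
qed

lemma ok_add_set: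
 assumes "finite T" "T \<subseteq> C" "S Int C = {}" "finite S" "card S + card T <= k" "ok E k (S Un T) (C - T)"
 shows "ok E k S C"
 using assms
proof (induction T arbitrary: S C rule: finite_induct)
 case (insert v T)
 have "ok E k (insert v S) (C - {v})"
 proof (rule insert.IH)
  show "ok E k (insert v S Un T) (C - {v} - T)" using insert.prems(5)
   by (simp add: Diff_insert2[symmetric] insert_commute)
  show "card (insert v S) + card T <= k" using insert by (auto simp: card_insert_if)
 qed (use insert in auto)
 then show ?case using insert by (rule_tac ok_add[of E k v]) auto
qed simp

text \<open>Take \<open>W1\<close> smallest among the connected sets with connected complement in
  \<open>W\<close> and at least \<open>k\<close> elements of \<open>X\<close>, and \<open>v\<close>
  in it touching the complement, if that is nonempty. Every component of \<open>W1 - {v}\<close>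
  could replace \<open>W1\<close>, since the rest hangs together at \<open>v\<close>; so it holds
  fewer than \<open>k\<close> elements of \<open>X\<close>. Degree at most 3 leaves at most three
  components, hence at most \<open>1 + 3 * (k - 1)\<close> elements.\<close>

lemma split_conn_step:
 assumes "finite W" "sym D" "conn D W" "!!x. card (D `` {x}) <= 3" "finite D" "k >= 1" "k <= card (X Int W)"
 shows "\<exists>W1 \<subseteq> W. conn D W1 & conn D (W - W1) & k <= card (X Int W1) & card (X Int W1) <= 3 * k"
proof -
 let ?P = "%W1. W1 \<subseteq> W & conn D W1 & conn D (W - W1) & k <= card (X Int W1)"
 have "?P W" using assms by simp
 then obtain W1 where P: "?P W1" and min: "!!U. ?P U ==> card W1 <= card U"
  using ex_has_least_nat[of ?P W card] by blast
 have fin: "finite W1" using P assms(1) finite_subset by blast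
 have "W1 ~= {}" using P assms(6) by auto
 have "\<exists>v\<in>W1. W - W1 = {} \<or> (\<exists>b\<in>W - W1. (v, b) \<in> D)"
 proof (cases "W - W1 = {}")
  case False
  then obtain b a where "b \<in> W - W1" "a \<in> W1" using \<open>W1 ~= {}\<close> by auto
  then show ?thesis using conn_edge_out[of D W a W1 b] assms(3) P by blast
 qed (use \<open>W1 ~= {}\<close> in auto)
 then obtain v where v: "v \<in> W1" "W - W1 = {} \<or> (\<exists>b\<in>W - W1. (v, b) \<in> D)" by blast
 let ?c = "component D (W1 - {v})"
 have touch: "\<exists>y\<in>?c w. (y, v) \<in> D" if w: "w \<in> W1 - {v}" for w
 proof -
  obtain x y where xy: "(x, y) \<in> D" "x \<in> ?c w" "y ~: ?c w" "y \<in> W1"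
   using conn_edge_out[of D W1 w "?c w" v] P w v(1) comp_self[of w D "W1 - {v}"] comp_sub[OF w, of D] by auto
  then have "y = v" using comp_closed[OF w, of D] by blast
  then show ?thesis using xy by blast
 qed
 have small: "card (X Int ?c u) <= k - 1" if u: "u \<in> W1 - {v}" for u
 proof (rule ccontr)
  assume "~ ?thesis"
  then have big: "k <= card (X Int ?c u)" by simp
  have sub: "?c u \<subseteq> W1 - {v}" using comp_sub[OF u] .
  have "conn D (W - ?c u)"
  proof -
   have base: "conn D ({v} Un (W - W1))"
   proof (cases "W - W1 = {}")
    case False
    then obtain b where "b \<in> W - W1" "(v, b) \<in> D" using v(2) by auto
    then show ?thesis using P assms(2) by (intro conn_Un[of D _ _ v b]) auto
   next
    case True then show ?thesis by (simp only: True Un_empty_right conn_singleton)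
   qed
   let ?I = "W1 - {v} - ?c u"
   have "conn D (({v} Un (W - W1)) Un (\<Union>w\<in>?I. insert v (?c w)))"
   proof (rule conn_UN[OF assms(2) base])
    fix w assume w: "w \<in> ?I"
    then obtain y where y: "y \<in> ?c w" "(y, v) \<in> D" using touch by blast
    have "conn D ({v} Un ?c w)"
     using conn_comp[OF assms(2), of w "W1 - {v}"] w y assms(2) by (intro conn_Un[of D _ _ v y]) (auto simp: sym_def)
    then show "conn D (insert v (?c w))" by simp
   qed auto
   moreover have "?c w Int ?c u = {}" if "w \<in> ?I" for w
   proof (rule ccontr)
    assume "?c w Int ?c u ~= {}"
    then obtain z where z: "z \<in> ?c w" "z \<in> ?c u" by auto
    then have "(z, w) \<in> (D Int (W1 - {v}) \<times> (W1 - {v}))\<^sup>*" using sym_restrict_rtrancl[OF assms(2)] by (auto simp: component_def)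
    then have "w \<in> ?c u" using z(2) unfolding component_def by (auto intro: rtrancl_trans)
    then show False using that by auto
   qed
   then have "({v} Un (W - W1)) Un (\<Union>w\<in>?I. insert v (?c w)) = W - ?c u"
   proof (intro equalityI subsetI)
    fix z assume "z \<in> ({v} Un (W - W1)) Un (\<Union>w\<in>?I. insert v (?c w))"
    then consider "z = v" | "z \<in> W - W1" | w where "w \<in> ?I" "z \<in> ?c w" by blast
    then show "z \<in> W - ?c u"
    proof cases
     case 3
     then have "z \<in> W1" "z ~: ?c u" using comp_sub[of w "W1 - {v}" D] \<open>!!w. w \<in> ?I ==> ?c w Int ?c u = {}\<close>[of w] by auto
     then show ?thesis using P by auto
    qed (use v(1) P sub in auto)
   next
    fix z assume z: "z \<in> W - ?c u"
    show "z \<in> ({v} Un (W - W1)) Un (\<Union>w\<in>?I. insert v (?c w))"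
    proof (cases "z \<in> ?I")
     case True then show ?thesis using comp_self[of z D "W1 - {v}"] by blast
    qed (use z in auto)
   qed
   ultimately show ?thesis by simp
  qed
  moreover have "conn D (?c u)" using conn_comp[OF assms(2) u] .
  ultimately have "card W1 <= card (?c u)" using sub P big by (intro min) auto
  moreover have "card (?c u) < card W1" using sub v(1) fin by (intro psubset_card_mono) auto
  ultimately show False by simp
 qed
 let ?N = "D `` {v} Int (W1 - {v})"
 have "X Int W1 \<subseteq> insert v (\<Union>u\<in>?N. X Int ?c u)"
 proof
  fix w assume w: "w \<in> X Int W1"
  show "w \<in> insert v (\<Union>u\<in>?N. X Int ?c u)"
  proof (cases "w = v")
   case False
   then have w': "w \<in> W1 - {v}" using w by auto
   then obtain y where y: "y \<in> ?c w" "(y, v) \<in> D" using touch by blast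
   then have "y \<in> ?N" using comp_sub[OF w', of D] assms(2) by (auto simp: sym_def)
   moreover have "w \<in> ?c y" using y(1) sym_restrict_rtrancl[OF assms(2)] by (auto simp: component_def)
   ultimately show ?thesis using w by auto
  qed simp
 qed
 then have "card (X Int W1) <= card (insert v (\<Union>u\<in>?N. X Int ?c u))"
  using fin comp_sub[of _ "W1 - {v}" D] by (intro card_mono) (auto intro!: finite_subset[OF _ fin])
 also have "... <= Suc (card (\<Union>u\<in>?N. X Int ?c u))" by (simp add: card_insert_le_m1)
 also have "card (\<Union>u\<in>?N. X Int ?c u) <= (\<Sum>u\<in>?N. card (X Int ?c u))" using fin by (intro card_UN_le) auto
 also have "... <= (\<Sum>u\<in>?N. k - 1)" using small by (intro sum_mono) auto
 also have "... <= 3 * (k - 1)"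
 proof -
  have "card ?N <= card (D `` {v})" using assms(5) by (intro card_mono) (auto intro: finite_subset[OF _ finite_Range[OF assms(5)]])
  then show ?thesis using assms(4)[of v] by simp
 qed
 finally have "card (X Int W1) <= 3 * k" using assms(6) by simp
 then show ?thesis using P by blast
qed

text \<open>One piece is cut off at a time. It costs at most \<open>3 * k\<close> elements of
  \<open>X\<close> and leaves a connected rest; this is the origin of the 3 in the boundary size
  \<open>3 * k * m\<close>.\<close>

lemma split_conn:
 assumes "finite W" "sym D" "conn D W" "!!x. card (D `` {x}) <= 3" "finite D" "k >= 1" "3 * k * m <= card (X Int W)"
 shows "\<exists>A. (\<forall>i<m. A i \<subseteq> W & conn D (A i) & k <= card (X Int A i)) & (\<forall>i<m. \<forall>j<m. i ~= j --> A i Int A j = {})"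
 using assms(1,3,7)
proof (induction m arbitrary: W)
 case (Suc m)
 have "k <= card (X Int W)" using Suc.prems(3) by simp
 then obtain W1 where W1: "W1 \<subseteq> W" "conn D W1" "conn D (W - W1)" "k <= card (X Int W1)" "card (X Int W1) <= 3 * k"
  using split_conn_step[OF Suc.prems(1) assms(2) Suc.prems(2) assms(4,5,6), of X] by auto
 have "card (X Int W) = card (X Int W1) + card (X Int (W - W1))"
  using Suc.prems(1) W1(1) by (subst card_Un_disjoint[symmetric]) (auto intro: finite_subset arg_cong[of _ _ card])
 then have "3 * k * m <= card (X Int (W - W1))" using Suc.prems(3) W1(5) by simp
 then obtain A where A: "\<forall>i<m. A i \<subseteq> W - W1 & conn D (A i) & k <= card (X Int A i)"
  "\<forall>i<m. \<forall>j<m. i ~= j --> A i Int A j = {}" using Suc.IH[of "W - W1"] Suc.prems W1 by auto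
 show ?case
  by (intro exI[of _ "%i. if i = m then W1 else A i"])
   (use A W1 in \<open>auto simp: less_Suc_eq\<close>)
qed simp

lemma path_degree:
 assumes "distinct p"
 shows "card ((path_edges p Un (path_edges p)\<inverse>) `` {w}) <= 2"
  "w = hd p \<or> w = last p ==> card ((path_edges p Un (path_edges p)\<inverse>) `` {w}) <= 1"
proof -
 let ?N = "%p. (path_edges p Un (path_edges p)\<inverse>) `` {w}"
 have fin: "finite (?N p)" for p by (rule finite_subset[of _ "set p"]) (use path_edges_subset[of p] in auto)
 have out: "w ~: set p ==> ?N p = {}" for p using path_edges_subset[of p] by auto
 have "card (?N p) <= 2 & (w = hd p \<or> w = last p --> card (?N p) <= 1)"
  using assms
 proof (induction p rule: path_edges.induct)
  case (3 x y zs)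
  show ?case
  proof (cases "w = x")
   case True
   then have "?N (x # y # zs) = insert y (?N (y # zs))" using 3 by auto
   also have "?N (y # zs) = {}" using 3(2) True by (intro out) auto
   finally show ?thesis by simp
  next
   case wx: False
   show ?thesis
   proof (cases "w = y")
    case True
    then have e: "?N (x # y # zs) = insert x (?N (y # zs))" using wx by auto
    have "card (?N (y # zs)) <= 1" using 3 True by auto
    then have "card (?N (x # y # zs)) <= 2" unfolding e using card_insert_le_m1[of 2 "?N (y # zs)" x] by simp
    moreover have "card (?N (x # y # zs)) <= 1" if "w = last (x # y # zs)"
    proof -
     have "zs = []" using that True 3(2) by (cases zs) (auto split: if_splits dest: last_in_set)
     then show ?thesis using e True wx by simp
    qed
    ultimately show ?thesis using wx by auto
   next
    case False
    then have "?N (x # y # zs) = ?N (y # zs)" using wx by auto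
    then show ?thesis using 3 wx False by auto
   qed
  qed
 qed auto
 then show "card (?N p) <= 2" "w = hd p \<or> w = last p ==> card (?N p) <= 1" by auto
qed

text \<open>The intermediate object between large tree-width and a grid: the linkages of different
  pairs run through the same set \<open>C\<close> and may cross each other.\<close>

definition mesh :: "('a \<times> 'a) set => 'a set => nat => nat => bool" where
 "mesh E V m k \<longleftrightarrow> (\<exists>A C. C \<subseteq> V & (\<forall>i<m. A i \<subseteq> V & conn E (A i) & A i Int C = {}) &
  (\<forall>i<m. \<forall>j<m. i ~= j --> A i Int A j = {}) &
  (\<forall>i<m. \<forall>j<m. i ~= j --> (\<exists>P. linkage (E Int C \<times> C) (C Int E `` A i) (C Int E `` A j) P & k <= card P)))"

text \<open>The auxiliary edges let a walk leave \<open>Y\<close> only at its start and reach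
  \<open>Z\<close> only at its end, so its interior lies in \<open>C\<close>.\<close>

lemma strip_path:
 assumes "is_path (E Int Y \<times> C Un E Int C \<times> C Un E Int C \<times> Z) Y Z p" "Y Int Z = {}" "Y Int C = {}" "Z Int C = {}"
 obtains y q z where "p = y # q @ [z]" "q ~= []" "set q \<subseteq> C" "path_edges q \<subseteq> E Int C \<times> C" "y \<in> Y" "z \<in> Z"
  "(y, hd q) \<in> E" "(last q, z) \<in> E"
proof -
 let ?B = "E Int Y \<times> C Un E Int C \<times> C Un E Int C \<times> Z"
 have p: "p ~= []" "path_edges p \<subseteq> ?B" "hd p \<in> Y" "last p \<in> Z" using assms(1) by (auto simp: is_path_def)
 obtain y r where r: "p = y # r" using p(1) by (cases p) auto
 have "r ~= []" using p r assms(2) by auto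
 then obtain q z where q: "r = q @ [z]" by (metis rev_exhaust)
 have y: "y \<in> Y" "z \<in> Z" using p r q by auto
 have "path_edges (q @ [z]) \<subseteq> ?B" using p(2) r q by (auto simp: path_edges_Cons)
 then have "path_edges q \<subseteq> ?B" using path_edges_sub_append(1) by blast
 have ne: "q ~= []" using p(2) r q y assms by (auto simp: path_edges_Cons)
 have e: "(y, hd q) \<in> ?B" "(last q, z) \<in> ?B" "path_edges q \<subseteq> ?B"
  using p(2) r q ne by (auto simp: path_edges_append path_edges_Cons)
 have "set q \<subseteq> C" if "hd q \<in> C Un Z" "last q \<in> Y Un C" "path_edges q \<subseteq> ?B" "q ~= []" for q
  using that
 proof (induction q rule: path_edges.induct)
  case (2 x) then show ?case using assms by auto
 next
  case (3 x y zs) then show ?case using assms by auto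
 qed simp
 then have C: "set q \<subseteq> C" using e ne by auto
 then have "path_edges q \<subseteq> E Int C \<times> C" using e(3) path_edges_subset[of q] assms by auto
 then show ?thesis using that[of y q z] r q ne C y e by auto
qed

text \<open>The new paths are disjoint and attach at different vertices of \<open>Z\<close>, where
  the degree was at most 2, so the bound 3 persists. Their far ends \<open>s\<close> get degree at
  most 1 and can be extended again.\<close>

lemma extend_tree:
 assumes "sym E" "finite V" "W \<subseteq> V" "W Int C = {}" "D \<subseteq> E Int W \<times> W" "sym D" "conn D W" "C \<subseteq> V" "E \<subseteq> V \<times> V"
  "!!x. card (D `` {x}) <= 3" "Z \<subseteq> W" "!!x. x \<in> Z ==> card (D `` {x}) <= 2" "T \<subseteq> C"
  "!!s. s \<in> T ==> r s ~= [] & hd (r s) = s & distinct (r s) & last (r s) \<in> Z & set (butlast (r s)) \<subseteq> C & path_edges (r s) \<subseteq> E"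
  "!!s t. s \<in> T ==> t \<in> T ==> s ~= t ==> set (r s) Int set (r t) = {}"
 obtains D' W' where "W' \<subseteq> V" "W Un T \<subseteq> W'" "W' \<subseteq> W Un (\<Union>s\<in>T. set (r s))" "D' \<subseteq> E Int W' \<times> W'" "sym D'" "conn D' W'"
  "!!x. card (D' `` {x}) <= 3" "!!x. x \<in> W - (last \<circ> r) ` T ==> D' `` {x} = D `` {x}" "!!s. s \<in> T ==> card (D' `` {s}) <= 1"
proof -
 define R where "R s = path_edges (r s) Un (path_edges (r s))\<inverse>" for s
 define D' where "D' = D Un (\<Union>s\<in>T. R s)"
 define W' where "W' = W Un (\<Union>s\<in>T. set (r s))"
 have fE: "finite E" using assms(2,9) finite_subset by blast
 have RE: "R s \<subseteq> set (r s) \<times> set (r s)" for s unfolding R_def using path_edges_subset[of "r s"] by auto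
 have set_r: "set (r s) \<subseteq> C Un {last (r s)}" if "s \<in> T" for s
 proof
  fix w assume "w \<in> set (r s)"
  moreover have "r s = butlast (r s) @ [last (r s)]" using assms(14)[OF that] by simp
  ultimately have "w \<in> set (butlast (r s)) \<or> w = last (r s)"
   by (metis Un_iff empty_iff empty_set insert_iff list.simps(15) set_append)
  then show "w \<in> C Un {last (r s)}" using assms(14)[OF that] by auto
 qed
 have symD': "sym D'" using assms(6) unfolding D'_def R_def sym_def by blast
 have conn': "conn D' W'" unfolding W'_def
 proof (rule conn_UN[OF symD'])
  show "conn D' W" using conn_mono[OF assms(7)] by (simp add: D'_def)
  fix s assume s: "s \<in> T"
  show "conn D' (set (r s))" using s by (intro conn_path_set[OF symD']) (auto simp: D'_def R_def)
  show "set (r s) Int W ~= {}" using assms(14)[OF s] assms(11) last_in_set[of "r s"] by blast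
 qed
 have nbr: "D' `` {w} = D `` {w} Un R s `` {w}" if "s \<in> T" "w \<in> set (r s)" for s w
 proof -
  have "R t `` {w} = {}" if "t \<in> T" "t ~= s" for t
   using RE[of t] assms(15)[of t s] that \<open>s \<in> T\<close> \<open>w \<in> set (r s)\<close> by blast
  then show ?thesis unfolding D'_def using that(1) by blast
 qed
 have nbr0: "D' `` {w} = D `` {w}" if "!!s. s \<in> T ==> w ~: set (r s)" for w
  unfolding D'_def using that RE by blast
 have DW: "D `` {w} = {}" if "w ~: W" for w using assms(5) that by auto
 have Rd: "card (R s `` {w}) <= 2" "w = hd (r s) \<or> w = last (r s) ==> card (R s `` {w}) <= 1" if "s \<in> T" for s w
  unfolding R_def using path_degree[of "r s" w] assms(14)[OF that] by auto
 have Wl: "w = last (r s)" if "s \<in> T" "w \<in> set (r s)" "w \<in> W" for s w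
  using set_r[OF that(1)] that assms(4) by auto
 show ?thesis
 proof (rule that[of W' D'])
  show "W' \<subseteq> V" unfolding W'_def using assms(3,8,11) set_r assms(14) by blast
  have "s \<in> set (r s)" if "s \<in> T" for s using assms(14)[OF that] hd_in_set by metis
  then show "W Un T \<subseteq> W'" unfolding W'_def by blast
  show "W' \<subseteq> W Un (\<Union>s\<in>T. set (r s))" by (simp add: W'_def)
  have "R s \<subseteq> E" if "s \<in> T" for s unfolding R_def using assms(14)[OF that] assms(1) by (auto simp: sym_def)
  then show "D' \<subseteq> E Int W' \<times> W'" unfolding D'_def W'_def using assms(5) RE by blast
  show "D' `` {x} = D `` {x}" if "x \<in> W - (last \<circ> r) ` T" for x
   by (rule nbr0) (use that Wl in force)
  show "card (D' `` {s}) <= 1" if s: "s \<in> T" for s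
  proof -
   have "s ~: W" using s assms(4,13) by auto
   moreover have "s \<in> set (r s)" "hd (r s) = s" using assms(14)[OF s] hd_in_set by metis+
   ultimately show ?thesis using nbr[OF s, of s] DW[of s] Rd(2)[OF s, of s] by simp
  qed
  show "card (D' `` {x}) <= 3" for x
  proof (cases "\<exists>s\<in>T. x \<in> set (r s)")
   case True
   then obtain s where s: "s \<in> T" "x \<in> set (r s)" by auto
   have c: "card (D' `` {x}) <= card (D `` {x}) + card (R s `` {x})" unfolding nbr[OF s] by (rule card_Un_le)
   show ?thesis
   proof (cases "x \<in> W")
    case True
    then have "x = last (r s)" using Wl s by auto
    then show ?thesis using c Rd(2)[OF s(1), of x] assms(12)[of x] assms(14)[OF s(1)] by simp
   qed (use c Rd(1)[OF s(1), of x] DW[of x] in simp)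
  qed (use nbr0[of x] assms(10)[of x] in auto)
 qed (use symD' conn' in auto)
qed

lemma path_edges_leave:
 assumes "q ~= []" "hd q \<in> K" "last q ~: K"
 shows "\<exists>u v. (u, v) \<in> path_edges q & u \<in> K & v ~: K"
 using assms
proof (induction q rule: path_edges.induct)
 case (3 x y zs) then show ?case by (cases "y \<in> K") auto
qed auto

lemma strip_linkage:
 assumes "linkage (E Int Y \<times> C Un E Int C \<times> C Un E Int C \<times> Z) Y Z P" "Y Int Z = {}" "Y Int C = {}" "Z Int C = {}"
  "sym E" "Y \<subseteq> A" "Z \<subseteq> A'"
 shows "\<exists>P'. linkage (E Int C \<times> C) (C Int E `` A) (C Int E `` A') P' & card P' = card P"
proof -
 let ?B = "E Int Y \<times> C Un E Int C \<times> C Un E Int C \<times> Z"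
 define f where "f p = butlast (tl p)" for p :: "'a list"
 have f: "is_path (E Int C \<times> C) (C Int E `` A) (C Int E `` A') (f p)" "distinct (f p)" "set (f p) \<subseteq> set p" "f p ~= []"
  if "p \<in> P" for p
 proof -
  have p: "is_path ?B Y Z p" "distinct p" using assms(1) that by (auto simp: linkage_def)
  from strip_path[OF p(1) assms(2-4)] obtain y q z where q: "p = y # q @ [z]" "q ~= []" "set q \<subseteq> C"
   "path_edges q \<subseteq> E Int C \<times> C" "y \<in> Y" "z \<in> Z" "(y, hd q) \<in> E" "(last q, z) \<in> E" by metis
  have fp: "f p = q" using q by (simp add: f_def)
  have "(z, last q) \<in> E" using q assms(5) by (auto simp: sym_def)
  moreover have "hd q \<in> C" "last q \<in> C" using q by auto
  ultimately show "is_path (E Int C \<times> C) (C Int E `` A) (C Int E `` A') (f p)"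
   unfolding is_path_def fp using q assms(6,7) by blast
  show "distinct (f p)" "set (f p) \<subseteq> set p" "f p ~= []" using p(2) q fp by auto
 qed
 have disj: "set (f p) Int set (f q) = {}" if "p \<in> P" "q \<in> P" "p ~= q" for p q
  using assms(1) f(3)[OF that(1)] f(3)[OF that(2)] that unfolding linkage_def by blast
 have inj: "inj_on f P" unfolding inj_on_def using disj f(4) by (metis inf.idem set_empty)
 have "linkage (E Int C \<times> C) (C Int E `` A) (C Int E `` A') (f ` P)"
  unfolding linkage_def using f(1,2) disj assms(1) unfolding linkage_def by (metis (no_types, lifting) finite_imageI imageE)
 then show ?thesis using card_image[OF inj] by blast
qed

text \<open>The search invariant: \<open>C\<close> is unexplored, its boundary \<open>X\<close> has
  at most \<open>h\<close> vertices, and the explored \<open>W\<close> carries a connected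
  \<open>D\<close> of degree at most 3 with a spare slot at each vertex of \<open>X\<close> and two
  at one of them. A boundary below \<open>h\<close> absorbs one more vertex. A full one is split
  into \<open>m\<close> connected sets rich in \<open>X\<close>. If two of them are badly linked
  through \<open>C\<close>, Menger gives fewer than \<open>k\<close> vertices whose addition to the
  bag cuts every remaining component off from \<open>k\<close> boundary vertices. Hence bags of size
  \<open>h + k\<close>.\<close>

lemma mesh_or_ok:
 assumes "sym E" "E \<subseteq> V \<times> V" "finite V" "k >= 1" "h = 3 * k * m"
  and "conn E C" "C ~= {}" "C \<subseteq> V" "X = E `` C - C" "card X <= h" "W \<subseteq> V" "W Int C = {}" "X \<subseteq> W"
  "D \<subseteq> E Int W \<times> W" "sym D" "conn D W" "!!x. card (D `` {x}) <= 3" "!!x. x \<in> X ==> card (D `` {x}) <= 2"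
  "\<exists>x\<in>X. card (D `` {x}) <= 1"
 shows "mesh E V m k \<or> ok E (h + k) X C"
 using assms(6-)
proof (induction "card C" arbitrary: C X W D rule: less_induct)
 case less
 note p = less.prems
 have fV: "finite C" "finite X" "finite E" using p(3,4) assms(2,3) by (auto intro: finite_subset)
 have XV: "X \<subseteq> V" "X Int C = {}" using p(4,6,8) by auto
 have nbrs: "E `` K - K \<subseteq> X Un T" "(X Un T) Int K = {}" "E `` K \<subseteq> (E `` K - K) Un K" if "is_comp E (C - T) K" for K T
  using that p(4) unfolding is_comp_def by auto
 have reach: "\<exists>t\<in>T. t \<in> E `` K - K" if K: "is_comp E (C - T) K" "T \<subseteq> C" "T ~= {}" for K T
 proof -
  have K': "K ~= {}" "K \<subseteq> C - T" "E `` K Int (C - T) \<subseteq> K" using K(1) unfolding is_comp_def by blast+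
  obtain a b where ab: "a \<in> K" "b \<in> T" using K'(1) K(3) by blast
  have "a \<in> C" "b \<in> C" "b ~: K" using ab K' K(2) by auto
  then obtain x y where "(x, y) \<in> E" "x \<in> K" "y ~: K" "y \<in> C"
   using conn_edge_out[OF p(1), of a K b] ab by blast
  then show ?thesis using K' by blast
 qed
 have smaller: "card K < card C" if "is_comp E (C - T) K" "T \<subseteq> C" "T ~= {}" for K T
  using that fV unfolding is_comp_def by (intro psubset_card_mono) auto
 have Kprops: "conn E K" "K ~= {}" "K \<subseteq> V" "K \<subseteq> C - T" if "is_comp E (C - T) K" for K T
  using that p(3) by (auto simp: is_comp_def)
 show ?case
 proof (cases "card X < h")
  case True
  \<comment> \<open>The vertex with two free slots: after attaching \<open>v\<close> it has degree
    at most 2, and \<open>v\<close>, with degree 1, is the next vertex of this kind.\<close>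
  obtain x where x: "x \<in> X" "card (D `` {x}) <= 1" using p(14) by auto
  then obtain v where v: "v \<in> C" "(v, x) \<in> E" using p(4) by auto
  have vW: "v ~: W" "v ~: X" using v p(7) XV by auto
  have comps: "mesh E V m k \<or> ok E (h + k) (insert v X) K" if K: "is_comp E (C - {v}) K" for K
  proof -
   let ?X = "E `` K - K"
   let ?D = "D Un {(x, v), (v, x)}" and ?W = "insert v W"
   have xW: "x \<in> W" using x p(8) by auto
   have Dv: "D `` {v} = {}" using p(9) vW by auto
   have fD: "finite (D `` {y})" for y using p(9) fV by (meson Image_singleton finite_Image finite_subset le_infE)
   have deg: "?D `` {y} = (if y = x then insert v (D `` {x}) else if y = v then {x} else D `` {y})" for y
    using Dv vW xW by auto
   have degx: "card (insert v (D `` {x})) <= 2" using x(2) card_insert_le_m1[of 2 "D `` {x}" v] by simp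
   have sub: "?X \<subseteq> insert v X" using nbrs[OF K] by auto
   have "mesh E V m k \<or> ok E (h + k) ?X K"
   proof (rule less.hyps[of K ?X ?W ?D])
    show "card K < card C" using smaller[OF K] v by auto
    show "conn E K" "K ~= {}" "K \<subseteq> V" using Kprops[OF K] by auto
    show "card ?X <= h" using card_mono[OF _ sub] fV True vW by simp
    show "?W \<subseteq> V" using p(6) v p(3) by auto
    show "?W Int K = {}" using p(7) Kprops[OF K] by auto
    show "?X \<subseteq> ?W" using sub p(8) by auto
    show "?D \<subseteq> E Int ?W \<times> ?W" using p(9) v(2) assms(1) xW by (auto simp: sym_def)
    show sD: "sym ?D" using p(10) by (auto simp: sym_def)
    have "conn ?D ({v} Un W)" using sD conn_mono[OF p(11), of ?D] xW by (intro conn_Un[of _ _ _ v x]) auto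
    then show "conn ?D ?W" by simp
    show "card (?D `` {y}) <= 3" for y unfolding deg using degx p(12)[of y] by auto
    show "card (?D `` {y}) <= 2" if "y \<in> ?X" for y unfolding deg using degx p(13)[of y] that sub by auto
    have "v \<in> ?X" using reach[OF K] v by auto
    then show "\<exists>y\<in>?X. card (?D `` {y}) <= 1" unfolding deg using v xW vW by (intro bexI[of _ v]) auto
   qed simp
   moreover have "insert v X Int K = {}" using nbrs(2)[OF K] by auto
   ultimately show ?thesis using ok_forget[OF _ sub _ nbrs(3)[OF K], of "h + k"] by blast
  qed
  have "ok E (h + k) X C" if no: "~ mesh E V m k"
  proof (rule ok_add[of _ _ v])
   show "ok E (h + k) (insert v X) (C - {v})"
    using no comps fV by (rule_tac ok_components[OF _ assms(1)]) auto
  qed (use v vW fV True in auto)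
  then show ?thesis by blast
 next
  case False
  then have cX: "card X = h" using p(5) by simp
  have fD: "finite D" "finite W" using p(6,9) fV assms(3) by (auto intro: finite_subset)
  have "X Int W = X" using p(8) by auto
  then obtain A where A: "\<forall>i<m. A i \<subseteq> W & conn D (A i) & k <= card (X Int A i)" "\<forall>i<m. \<forall>j<m. i ~= j --> A i Int A j = {}"
   using split_conn[OF fD(2) p(10,11,12) fD(1) assms(4), of m X] cX assms(5) by auto
  show ?thesis
  proof (cases "\<forall>i<m. \<forall>j<m. i ~= j --> (\<exists>P. linkage (E Int C \<times> C) (C Int E `` A i) (C Int E `` A j) P & k <= card P)")
   case True
   have "conn E (A i)" if "i < m" for i using A(1) that p(9) conn_mono[of D "A i" E] by auto
   then have "mesh E V m k" unfolding mesh_def using A True p(3,6,7) by (intro exI[of _ A] exI[of _ C]) blast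
   then show ?thesis ..
  next
   case nolink: False
   then obtain i j where ij: "i < m" "j < m" "i ~= j"
    "\<nexists>P. linkage (E Int C \<times> C) (C Int E `` A i) (C Int E `` A j) P & k <= card P" by blast
   obtain Y where Y: "Y \<subseteq> X Int A i" "card Y = k" "finite Y" using obtain_subset_with_card_n A(1) ij(1) by metis
   obtain Z where Z: "Z \<subseteq> X Int A j" "card Z = k" "finite Z" using obtain_subset_with_card_n A(1) ij(2) by metis
   have YZ: "Y Int Z = {}" "Y Int C = {}" "Z Int C = {}" using Y Z A(2) ij XV by blast+
   let ?B = "E Int Y \<times> C Un E Int C \<times> C Un E Int C \<times> Z"
   have fB: "finite ?B" using fV by auto
   obtain S P where S: "finite S" "separates ?B Y Z S" "linkage ?B Y Z P" "card P = card S"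
    "!!s. s \<in> S ==> \<exists>p\<in>P. set p Int S = {s}" using menger[OF fB Y(3)] by metis
   obtain P' where "linkage (E Int C \<times> C) (C Int E `` A i) (C Int E `` A j) P'" "card P' = card P"
    using strip_linkage[OF S(3) YZ assms(1), of "A i" "A j"] Y Z by auto
   then have Sk: "card S < k" using ij(4) S(4) by (metis not_le)
   \<comment> \<open>A connected set outside \<open>S\<close> that touches both \<open>Y - S\<close>
     and \<open>Z - S\<close> would provide a path around the separator.\<close>
   have thru: False if yz: "y \<in> Y - S" "z \<in> Z - S" "y \<in> E `` K" "z \<in> E `` K" "K \<subseteq> C" "K Int S = {}" "conn E K" for y z K
   proof -
    obtain c c' where c: "c \<in> K" "c' \<in> K" "(y, c) \<in> E" "(c', z) \<in> E" using yz(3,4) assms(1) by (auto simp: sym_def)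
    from conn_path[OF yz(7) c(1,2)] obtain q where q: "q ~= []" "hd q = c" "last q = c'" "set q \<subseteq> K" "path_edges q \<subseteq> E Int K \<times> K" by metis
    have "is_path ?B Y Z (y # q @ [z])"
     unfolding is_path_def using q c yz by (auto simp: path_edges_Cons path_edges_append)
    then obtain s where "s \<in> set (y # q @ [z])" "s \<in> S" using separatesD[OF S(2)] by blast
    then show False using q(4) yz by auto
   qed
   let ?T = "S Int C"
   have ne: "Y - S ~= {}" "Z - S ~= {}" using Y Z Sk S(1) by (metis Diff_eq_empty_iff card_mono not_le)+
   have T: "?T ~= {}"
   proof
    assume T: "?T = {}"
    obtain y z where "y \<in> Y - S" "z \<in> Z - S" using ne by auto
    moreover have "y \<in> E `` C" "z \<in> E `` C" using calculation Y Z p(4) by auto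
    ultimately show False using thru[of y z C] T p(1) by auto
   qed
   have comps: "mesh E V m k \<or> ok E (h + k) (X Un ?T) K" if K: "is_comp E (C - ?T) K" for K
   proof -
    let ?X = "E `` K - K"
    have KC: "K \<subseteq> C" "K Int S = {}" using Kprops[OF K] by auto
    let ?R = "%Z' r s. r s ~= [] & hd (r s) = s & distinct (r s) &
      last (r s) \<in> Z' - S & set (butlast (r s)) \<subseteq> C & path_edges (r s) \<subseteq> E & set (r s) Int S \<subseteq> {s}"
    \<comment> \<open>\<open>Z'\<close> is whichever of \<open>Y\<close> and \<open>Z\<close> the
      component does not touch outside \<open>S\<close>, and \<open>r s\<close> is the half of the
      Menger path through \<open>s\<close> that leads to that side.\<close>
    have "\<exists>Z' r. Z' \<subseteq> X & card Z' = k & ?X Int (Z' - S) = {} & (\<forall>s\<in>?T. ?R Z' r s) &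
      (\<forall>s\<in>?T. \<forall>t\<in>?T. s ~= t --> set (r s) Int set (r t) = {})"
    proof -
     have "\<forall>s\<in>?T. \<exists>p. p \<in> P & set p Int S = {s}" using S(5) by blast
     then obtain pp where pp: "\<forall>s\<in>?T. pp s \<in> P & set (pp s) Int S = {s}" by (rule bchoice[THEN exE])
     have pinj: "set (pp s) Int set (pp t) = {}" if "s \<in> ?T" "t \<in> ?T" "s ~= t" for s t
     proof -
      have "set (pp s) Int S = {s}" "set (pp t) Int S = {t}" using pp that by auto
      then have "pp s ~= pp t" using that(3) by auto
      then show ?thesis using S(3) pp that unfolding linkage_def by blast
     qed
     have "\<forall>s\<in>?T. \<exists>w. fst w @ s # snd w = pp s" using pp by (metis IntD1 fst_conv insertI1 snd_conv split_list)
     then obtain w where w: "\<forall>s\<in>?T. fst (w s) @ s # snd (w s) = pp s" by (rule bchoice[THEN exE])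
     have dec: "pp s = fst (w s) @ s # snd (w s)" "distinct (pp s)" "set (tl (butlast (pp s))) \<subseteq> C" "hd (pp s) \<in> Y" "last (pp s) \<in> Z"
      "path_edges (pp s) \<subseteq> E" "fst (w s) ~= []" "snd (w s) ~= []" if s: "s \<in> ?T" for s
     proof -
      show d: "pp s = fst (w s) @ s # snd (w s)" using w s by simp
      have P: "is_path ?B Y Z (pp s)" "distinct (pp s)" using pp s S(3) by (auto simp: linkage_def)
      then show "distinct (pp s)" "hd (pp s) \<in> Y" "last (pp s) \<in> Z" "path_edges (pp s) \<subseteq> E" by (auto simp: is_path_def)
      from strip_path[OF P(1) YZ] obtain y q z where q: "pp s = y # q @ [z]" "set q \<subseteq> C" by metis
      then show "set (tl (butlast (pp s))) \<subseteq> C" by (simp add: butlast_append)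
      show "fst (w s) ~= []" "snd (w s) ~= []" using d \<open>hd (pp s) \<in> Y\<close> \<open>last (pp s) \<in> Z\<close> YZ s by (auto)
     qed
     have pack: ?thesis if "Z' \<subseteq> X" "card Z' = k" "?X Int (Z' - S) = {}" "!!s. s \<in> ?T ==> ?R Z' r s"
      "!!s. s \<in> ?T ==> set (r s) \<subseteq> set (pp s)" for Z' r
     proof (rule exI[of _ Z'], rule exI[of _ r], intro conjI that(1-3))
      show "\<forall>s\<in>?T. ?R Z' r s" by (rule ballI) (rule that(4))
      show "\<forall>s\<in>?T. \<forall>t\<in>?T. s ~= t --> set (r s) Int set (r t) = {}"
      proof (intro ballI impI)
       fix s t assume st: "s \<in> ?T" "t \<in> ?T" "s ~= t"
       show "set (r s) Int set (r t) = {}" using pinj[OF st] that(5)[OF st(1)] that(5)[OF st(2)] by blast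
      qed
     qed
     show ?thesis
     proof (cases "?X Int (Z - S) = {}")
      case True
      define r where "r s = s # snd (w s)" for s
      have "?R Z r s & set (r s) \<subseteq> set (pp s)"
       if s: "s \<in> ?T" for s
      proof -
       have l: "last (r s) = last (pp s)" using dec[OF s] by (simp add: r_def)
       have "last (r s) \<in> set (snd (w s))" using dec(8)[OF s] by (simp add: r_def)
       moreover have di: "distinct (fst (w s) @ s # snd (w s))" and se: "set (pp s) = set (fst (w s)) Un insert s (set (snd (w s)))"
        using dec(1,2)[OF s] by auto
       ultimately have "last (r s) ~= s" "last (r s) \<in> set (pp s)" by auto
       then have lS: "last (r s) ~: S" using pp s by blast
       have "tl (butlast (pp s)) = tl (fst (w s)) @ butlast (r s)" using dec(1,7,8)[OF s]
        by (subst dec(1)[OF s]) (simp add: butlast_append r_def)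
       then have "set (butlast (r s)) \<subseteq> C" using dec(3)[OF s] by simp
       moreover have "path_edges (r s) \<subseteq> E" using dec(1,6)[OF s] path_edges_sub_append(2)[of "r s" "fst (w s)"] by (simp add: r_def)
       moreover have "distinct (r s)" "set (r s) \<subseteq> set (pp s)" using di se by (auto simp: r_def)
       moreover have "set (r s) Int S \<subseteq> {s}" using calculation(4) pp s by blast
       ultimately show ?thesis using lS l dec(5)[OF s] by (simp add: r_def)
      qed
      then have R: "s \<in> ?T ==> ?R Z r s" "s \<in> ?T ==> set (r s) \<subseteq> set (pp s)" for s by blast+
      show ?thesis by (rule pack[of Z r, OF _ _ True R]) (use Z in auto)
     next
      case F: False
      then have XY: "?X Int (Y - S) = {}" using thru[OF _ _ _ _ KC] Kprops(1)[OF K] by blast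
      define r where "r s = s # rev (fst (w s))" for s
      have "?R Y r s & set (r s) \<subseteq> set (pp s)"
       if s: "s \<in> ?T" for s
      proof -
       have rr: "r s = rev (fst (w s) @ [s])" by (simp add: r_def)
       have l: "last (r s) = hd (pp s)" using dec(1,7)[OF s] unfolding rr by (simp add: last_rev)
       have di0: "distinct (fst (w s) @ s # snd (w s))" and se: "set (pp s) = set (fst (w s)) Un insert s (set (snd (w s)))"
        using dec(1,2)[OF s] by auto
       then have sub: "set (r s) \<subseteq> set (pp s)" and di: "distinct (r s)" by (auto simp: r_def)
       have "last (r s) \<in> set (fst (w s))" using l dec(7)[OF s] by (simp add: dec(1)[OF s])
       then have "last (r s) ~= s" using di0 by auto
       moreover have "last (r s) \<in> set (r s)" by (rule last_in_set) (simp add: r_def)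
       ultimately have lS: "last (r s) ~: S" using pp s sub by blast
       have "butlast (r s) = rev (tl (fst (w s) @ [s]))" unfolding rr by (metis butlast_rev)
       moreover have "tl (butlast (pp s)) = tl (fst (w s) @ [s]) @ butlast (snd (w s))" using dec(7,8)[OF s]
        by (subst dec(1)[OF s]) (simp add: butlast_append)
       ultimately have "set (butlast (r s)) \<subseteq> C" using dec(3)[OF s] by simp
       moreover have "path_edges (r s) \<subseteq> E"
       proof -
        have "path_edges (fst (w s) @ [s]) \<subseteq> E" using dec(1,6)[OF s] path_edges_sub_append(1)[of "fst (w s) @ [s]" "snd (w s)"] by simp
        then show ?thesis unfolding rr path_edges_rev using assms(1) by (auto simp: sym_def)
       qed
       moreover have "set (r s) Int S \<subseteq> {s}" using sub pp s by blast
       ultimately show ?thesis using lS l dec(4)[OF s] sub di by (simp add: r_def)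
      qed
      then have R: "s \<in> ?T ==> ?R Y r s" "s \<in> ?T ==> set (r s) \<subseteq> set (pp s)" for s by blast+
      show ?thesis by (rule pack[of Y r, OF _ _ XY R]) (use Y in auto)
     qed
    qed
    then obtain Z' r where zr: "Z' \<subseteq> X & card Z' = k & ?X Int (Z' - S) = {} & (\<forall>s\<in>?T. ?R Z' r s) &
      (\<forall>s\<in>?T. \<forall>t\<in>?T. s ~= t --> set (r s) Int set (r t) = {})" by (elim exE)
    have Z': "Z' \<subseteq> X" "card Z' = k" "?X Int (Z' - S) = {}" and r1: "\<forall>s\<in>?T. ?R Z' r s"
     and r2: "\<forall>s\<in>?T. \<forall>t\<in>?T. s ~= t --> set (r s) Int set (r t) = {}"
     by (rule conjunct1[OF zr] conjunct2[OF zr, THEN conjunct1] conjunct2[OF zr, THEN conjunct2, THEN conjunct1]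
      conjunct2[OF zr, THEN conjunct2, THEN conjunct2, THEN conjunct1] conjunct2[OF zr, THEN conjunct2, THEN conjunct2, THEN conjunct2])+
    have r: "!!s. s \<in> ?T ==> ?R Z' r s" "!!s t. s \<in> ?T ==> t \<in> ?T ==> s ~= t ==> set (r s) Int set (r t) = {}"
     using bspec[OF r1] bspec[OF bspec[OF r2]] by simp_all
    \<comment> \<open>The path ends outside \<open>K\<close>, so after meeting \<open>K\<close> it
      would leave it. The exit is not in \<open>S\<close>, not elsewhere in \<open>C\<close> because
      \<open>K\<close> is a component, and not the end in \<open>Z' - S\<close>, which
      \<open>K\<close> does not touch.\<close>
    have rK: "set (r s) Int K = {}" if s: "s \<in> ?T" for s
    proof (rule ccontr)
     assume "set (r s) Int K ~= {}"
     then obtain x where x: "x \<in> set (r s)" "x \<in> K" by auto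
     then obtain a b where ab: "r s = a @ x # b" by (meson split_list)
     have "last (r s) \<in> Z'" using r(1)[OF s] by (elim conjE) simp
     then have "last (r s) ~: K" using Z'(1) XV(2) KC(1) by blast
     then have "last (x # b) ~: K" by (simp add: ab)
     then obtain u v where uv: "(u, v) \<in> path_edges (x # b)" "u \<in> K" "v ~: K"
      using path_edges_leave[of "x # b" K] x(2) by auto
     have vb: "v \<in> set b" using path_edges_subset[of "x # b"] uv x by auto
     have rs: "path_edges (a @ x # b) \<subseteq> E" "hd (a @ x # b) = s" "distinct (a @ x # b)" "set (r s) Int S \<subseteq> {s}"
      "set (butlast (r s)) \<subseteq> C" "last (r s) \<in> Z' - S" "r s ~= []" using r(1)[OF s] by (simp_all add: ab)
     have E: "(u, v) \<in> E" using uv(1) rs(1) path_edges_sub_append(2)[of "x # b" a] by blast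
     have "v ~= s" using vb rs(2,3) by (cases a) auto
     moreover have vr: "v \<in> set (r s)" using vb ab by simp
     ultimately have vS: "v ~: S" using rs(4) by blast
     have "set (r s) = insert (last (r s)) (set (butlast (r s)))"
      using append_butlast_last_id[OF rs(7)] by (metis Un_insert_right list.simps(15) set_append sup_bot.right_neutral empty_set)
     then have "v \<in> C \<or> v = last (r s)" using vr rs(5) by blast
     then show False
     proof
      assume "v \<in> C"
      then show False using K E uv vS unfolding is_comp_def by blast
     next
      assume "v = last (r s)"
      then show False using Z'(3) rs(6) E uv by blast
     qed
    qed
    have ZW: "Z' - S \<subseteq> W" "!!x. x \<in> Z' - S ==> card (D `` {x}) <= 2" using Z' p(8,13) by auto
    obtain D' W' where D': "W' \<subseteq> V" "W Un ?T \<subseteq> W'" "W' \<subseteq> W Un (\<Union>s\<in>?T. set (r s))" "D' \<subseteq> E Int W' \<times> W'" "sym D'" "conn D' W'"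
     "!!x. card (D' `` {x}) <= 3" "!!x. x \<in> W - (last \<circ> r) ` ?T ==> D' `` {x} = D `` {x}" "!!s. s \<in> ?T ==> card (D' `` {s}) <= 1"
     by (rule extend_tree[OF assms(1,3) p(6,7,9,10,11,3) assms(2) p(12) ZW, of ?T r]) (use r in auto)
    have sub: "?X \<subseteq> X Un ?T" using nbrs[OF K] by auto
    have "mesh E V m k \<or> ok E (h + k) ?X K"
    proof (rule less.hyps[of K ?X W' D'])
     show "card K < card C" using smaller[OF K] T by auto
     show "conn E K" "K ~= {}" "K \<subseteq> V" using Kprops[OF K] by auto
     \<comment> \<open>The \<open>k\<close> boundary vertices in \<open>Z'\<close> are traded for
       fewer than \<open>k\<close> vertices of \<open>S\<close>, so the bound \<open>h\<close> is
       kept.\<close>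
     have "?X \<subseteq> (X - Z') Un S" using sub Z'(3) by auto
     then have "card ?X <= card ((X - Z') Un S)" using fV S by (intro card_mono) auto
     also have "... <= card (X - Z') + card S" by (rule card_Un_le)
     also have "... <= h" using Z'(1,2) cX Sk fV card_mono[OF fV(2) Z'(1)] by (simp add: card_Diff_subset finite_subset)
     finally show "card ?X <= h" .
     show "W' Int K = {}" using p(7) KC D'(3) rK by blast
     show "?X \<subseteq> W'" using sub p(8) D'(2) by auto
     show "card (D' `` {x}) <= 3" for x by (rule D'(7))
     show "card (D' `` {x}) <= 2" if "x \<in> ?X" for x
     proof (cases "x \<in> ?T")
      case False
      then have "x \<in> X" using that sub by auto
      moreover have "x ~: (last \<circ> r) ` ?T" using that Z'(3) r(1) by auto
      ultimately show ?thesis using D'(8)[of x] p(8,13) by auto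
     qed (use D'(9)[of x] in simp)
     obtain t where "t \<in> ?T" "t \<in> ?X" using reach[OF K] T by auto
     then show "\<exists>x\<in>?X. card (D' `` {x}) <= 1" using D'(9) by blast
    qed (use D' in auto)
    then show ?thesis using ok_forget[OF _ sub nbrs(2)[OF K] nbrs(3)[OF K], of "h + k"] by blast
   qed
   have "ok E (h + k) X C" if no: "~ mesh E V m k"
   proof (rule ok_add_set[of ?T])
    show "ok E (h + k) (X Un ?T) (C - ?T)"
     using no comps fV by (rule_tac ok_components[OF _ assms(1)]) auto
    have "card ?T <= card S" using S(1) by (intro card_mono) auto
    then show "card X + card ?T <= h + k" using cX Sk by simp
   qed (use XV fV S(1) in auto)
   then show ?thesis by blast
  qed
 qed
qed

text \<open>In each component the search starts from one explored vertex with empty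
  \<open>D\<close>; its degree 0 provides the slots that the invariant asks for.\<close>

theorem mesh_exists:
 assumes "sym E" "E \<subseteq> V \<times> V" "finite V" "k >= 1" "m >= 1" "~ ok E (3 * k * m + k) {} V"
 shows "mesh E V m k"
proof (rule ccontr)
 assume no: "~ mesh E V m k"
 let ?h = "3 * k * m"
 have h: "1 <= ?h" using assms(4,5) by simp
 have "ok E (?h + k) {} V"
 proof (rule ok_components[OF assms(3,1)])
  fix K assume K: "is_comp E V K"
  then obtain v where v: "v \<in> K" by (auto simp: is_comp_def)
  have EK: "E `` K \<subseteq> K" "K \<subseteq> V" "conn E K" using K assms(2) by (auto simp: is_comp_def)
  have fK: "finite K" using EK(2) assms(3) finite_subset by blast
  have "ok E (?h + k) {v} (K - {v})"
  proof (rule ok_components[OF _ assms(1)])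
   show "finite (K - {v})" using fK by simp
   fix K' assume K': "is_comp E (K - {v}) K'"
   then have k': "K' ~= {}" "K' \<subseteq> K - {v}" "conn E K'" "E `` K' Int (K - {v}) \<subseteq> K'" by (auto simp: is_comp_def)
   obtain a where a: "a \<in> K'" using k' by auto
   have "\<exists>x y. (x, y) \<in> E & x \<in> K' & y ~: K' & x \<in> K & y \<in> K"
    by (rule conn_edge_out[OF EK(3), of a K' v]) (use a k' v in auto)
   then obtain x y where xy: "(x, y) \<in> E" "x \<in> K'" "y ~: K'" "y \<in> K" by blast
   then have "y = v" using k'(4) by blast
   moreover have "E `` K' - K' \<subseteq> {v}" using k'(2,4) EK(1) by blast
   ultimately have X: "E `` K' - K' = {v}" using xy by blast
   have "mesh E V m k \<or> ok E (?h + k) {v} K'"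
    by (rule mesh_or_ok[OF assms(1-4) refl k'(3,1), where W = "{v}" and D = "{}"]) (use k' EK v X h in auto)
   then show "ok E (?h + k) {v} K'" using no by blast
  qed
  then show "ok E (?h + k) {} K" using v h by (rule_tac ok_add[of _ _ v]) auto
 qed
 then show False using assms(6) by contradiction
qed

section \<open>Disjoint paths or weaves\<close>

lemma path_edges_nth: "path_edges p = {(p ! i, p ! Suc i) |i. Suc i < length p}"
proof (induction p rule: path_edges.induct)
 case (3 x y zs)
 have "{((x # y # zs) ! i, (x # y # zs) ! Suc i) |i. Suc i < length (x # y # zs)} =
   insert (x, y) {((y # zs) ! i, (y # zs) ! Suc i) |i. Suc i < length (y # zs)}" (is "?L = ?R")
 proof
  show "?L \<subseteq> ?R"
  proof
   fix e assume "e \<in> ?L"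
   then obtain i where "e = ((x # y # zs) ! i, (x # y # zs) ! Suc i)" "Suc i < length (x # y # zs)" by blast
   then show "e \<in> ?R" by (cases i) auto
  qed
  show "?R \<subseteq> ?L" by (auto intro: exI[of _ 0] exI[of _ "Suc _"])
 qed
 then show ?case using 3 by simp
qed auto

lemma path_in_set: "path_edges p \<subseteq> U \<times> U ==> hd p \<in> U ==> set p \<subseteq> U"
 by (induction p rule: path_edges.induct) auto

lemma pigeonhole_fiber:
 assumes "finite A" "finite B" "f ` A \<subseteq> B" "card B * m < card A"
 shows "\<exists>b\<in>B. m < card {a \<in> A. f a = b}"
proof (rule ccontr)
 assume "~ ?thesis"
 then have le: "card {a \<in> A. f a = b} <= m" if "b \<in> B" for b using that by force
 have "A = (\<Union>b\<in>B. {a \<in> A. f a = b})" using assms(3) by auto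
 then have "card A <= (\<Sum>b\<in>B. card {a \<in> A. f a = b})" using card_UN_le[OF assms(2), of "%b. {a \<in> A. f a = b}"] by simp
 also have "... <= card B * m" using sum_bounded_above[of B "%b. card {a \<in> A. f a = b}" m] le by simp
 finally show False using assms(4) by simp
qed

definition disjoint_paths :: "('a \<times> 'a) set => nat => (nat => 'a list) => bool" where
 "disjoint_paths E n p \<longleftrightarrow> (\<forall>a<n. p a ~= [] & distinct (p a) & path_edges (p a) \<subseteq> E) &
  (\<forall>a<n. \<forall>b<n. a ~= b --> set (p a) Int set (p b) = {})"

text \<open>Order is imposed along the \<open>Q a\<close> only. In which order a \<open>v i\<close>
  visits the \<open>Q a\<close> is arbitrary and is made uniform later by a pigeonhole over parent
  functions.\<close>

definition weaves :: "('a \<times> 'a) set => nat => nat => (nat => 'a list) => (nat => 'a list) => bool" where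
 "weaves E N d Q v \<longleftrightarrow> disjoint_paths E N Q & disjoint_paths E d v &
  (\<forall>a<N. \<forall>i<d. set (Q a) Int set (v i) ~= {}) &
  (\<forall>a<N. \<forall>i j s t. i < j & j < d & s < length (Q a) & t < length (Q a) & Q a ! s \<in> set (v i) & Q a ! t \<in> set (v j) --> s < t)"

definition weave :: "('a \<times> 'a) set => nat => nat => bool" where
 "weave E N d \<longleftrightarrow> (\<exists>Q v. weaves E N d Q v)"

lemma weave_mono: "weave E N d ==> E \<subseteq> E' ==> weave E' N d"
proof -
 assume A: "weave E N d" "E \<subseteq> E'"
 then obtain Q v where "weaves E N d Q v" by (auto simp: weave_def)
 moreover have "disjoint_paths E n p ==> disjoint_paths E' n p" for n p
  using A(2) unfolding disjoint_paths_def by blast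
 ultimately have "weaves E' N d Q v" unfolding weaves_def by (elim conjE) (intro conjI; assumption?)
 then show ?thesis unfolding weave_def by (intro exI)
qed

text \<open>The fixed linkage is usable in both directions, so that reachability cannot separate two
  vertices of one of its paths. The paths to be cut are usable forwards only
  (\<open>dir_edges\<close>), so that reachability marks initial segments of them.\<close>

definition sym_edges :: "'a list set => ('a \<times> 'a) set" where
 "sym_edges L = (\<Union>p\<in>L. path_edges p Un (path_edges p)\<inverse>)"

definition dir_edges :: "'a list set => ('a \<times> 'a) set" where
 "dir_edges L = (\<Union>p\<in>L. path_edges p)"

text \<open>Delete the edge of \<open>Q0\<close> before position \<open>n\<close>, which is foreign
  to \<open>L0\<close>. By minimality the remaining edges of \<open>Q\<close> and \<open>L0\<close>
  carry no linkage of size \<open>card Q\<close>, so Menger gives a smaller separator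
  \<open>S\<close>. It meets every other path of \<open>Q\<close> exactly once and misses
  \<open>Q0\<close>. The side \<open>L\<close> consists of what is reachable from \<open>Y\<close>
  around \<open>S\<close>.\<close>

lemma cut_lemma:
 assumes E: "sym E" "finite E" and L0: "linkage E Y0 Z0 L0" and Q: "linkage E Y Z Q" "finite Y"
  and min: "!!Q'. linkage E Y Z Q' ==> card Q' = card Q ==> card (dir_edges Q - sym_edges L0) <= card (dir_edges Q' - sym_edges L0)"
  and Q0: "Q0 \<in> Q" "0 < n" "n < length Q0" "(Q0 ! (n - 1), Q0 ! n) ~: sym_edges L0"
 obtains S L where "finite S" "card S < card Q"
  "!!s. s < length Q0 ==> Q0 ! s \<in> L \<longleftrightarrow> s < n"
  "!!P. P \<in> L0 ==> set P Int S = {} ==> set P \<subseteq> L \<or> set P Int L = {}"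
  "!!q. q \<in> Q ==> \<exists>c. \<forall>s<length q. q ! s ~: S --> (q ! s \<in> L \<longleftrightarrow> s < c)"
proof -
 let ?E0 = "sym_edges L0" and ?e = "(Q0 ! (n - 1), Q0 ! n)"
 let ?E' = "(?E0 Un dir_edges Q) - {?e}"
 have fQ: "finite Q" "finite L0" using Q(1) L0 by (auto simp: linkage_def)
 have pe: "p \<in> L0 ==> path_edges p \<subseteq> E" for p using L0 by (simp add: linkage_def is_path_def)
 have E0E: "?E0 \<subseteq> E"
 proof
  fix x assume "x \<in> ?E0"
  then obtain p where p: "p \<in> L0" "x \<in> path_edges p Un (path_edges p)\<inverse>" by (auto simp: sym_edges_def)
  then show "x \<in> E" using pe[OF p(1)] E(1) by (cases x) (auto dest: symD)
 qed
 have QE: "dir_edges Q \<subseteq> E" using Q(1) by (auto simp: dir_edges_def linkage_def is_path_def)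
 have fE': "finite ?E'" using E(2) E0E QE finite_subset by (metis Un_least finite_Diff)
 have qp: "q ~= []" "path_edges q \<subseteq> dir_edges Q" "hd q \<in> Y" "last q \<in> Z" "distinct q" if "q \<in> Q" for q
  using Q(1) that by (auto simp: linkage_def is_path_def dir_edges_def)
 have qd: "set q Int set q' = {}" if "q \<in> Q" "q' \<in> Q" "q ~= q'" for q q' using Q(1) that by (simp add: linkage_def)
 have eQ: "?e \<in> path_edges Q0" using Q0(2,3) unfolding path_edges_nth by (auto intro!: exI[of _ "n - 1"])
 then have eD: "?e \<in> dir_edges Q - ?E0" using Q0 by (auto simp: dir_edges_def)
 obtain S P where S: "finite S" "separates ?E' Y Z S" "linkage ?E' Y Z P" "card P = card S"
  using menger[OF fE' Q(2)] by metis
 have Sq: "card S < card Q"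
 proof (rule ccontr)
  assume "~ ?thesis"
  then obtain P' where P': "P' \<subseteq> P" "card P' = card Q" using S(4) obtain_subset_with_card_n by (metis not_le)
  have l': "linkage ?E' Y Z P'" using linkage_mono[OF S(3) order_refl P'(1)] .
  then have l: "linkage E Y Z P'" using linkage_mono[of ?E' Y Z P' E P'] E0E QE by blast
  have "dir_edges P' \<subseteq> ?E'" using l' unfolding dir_edges_def linkage_def is_path_def by blast
  then have "dir_edges P' - ?E0 \<subset> dir_edges Q - ?E0" using eD by blast
  moreover have "finite (dir_edges Q - ?E0)" using QE E(2) finite_subset by blast
  ultimately have "card (dir_edges P' - ?E0) < card (dir_edges Q - ?E0)" by (rule psubset_card_mono[rotated])
  then show False using min[OF l P'(2)] by simp
 qed
 have ne: "?e ~: path_edges q" if "q \<in> Q" "q ~= Q0" for q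
  using path_edges_subset[of q] path_edges_subset[of Q0] eQ qd[OF that(1) Q0(1) that(2)] by blast
 have hit: "\<exists>v. v \<in> set q & v \<in> S" if "q \<in> Q - {Q0}" for q
 proof -
  have "is_path ?E' Y Z q" using qp[of q] ne[of q] that unfolding is_path_def by auto
  then show ?thesis by (rule separatesD[OF S(2)])
 qed
 then obtain f where f: "!!q. q \<in> Q - {Q0} ==> f q \<in> set q & f q \<in> S" by metis
 have finj: "inj_on f (Q - {Q0})" unfolding inj_on_def using f qd by (metis Diff_iff disjoint_iff)
 have "f ` (Q - {Q0}) = S"
 proof (rule card_seteq[OF S(1)])
  show "f ` (Q - {Q0}) \<subseteq> S" using f by auto
  show "card S <= card (f ` (Q - {Q0}))" using Sq Q0(1) fQ by (simp add: card_image[OF finj])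
 qed
 then have Sf: "\<exists>q\<in>Q - {Q0}. s = f q" if "s \<in> S" for s using that by auto
 have S0: "set Q0 Int S = {}"
 proof (rule ccontr)
  assume "set Q0 Int S ~= {}"
  then obtain s where s: "s \<in> set Q0" "s \<in> S" by auto
  then obtain q where "q \<in> Q - {Q0}" "s = f q" using Sf by blast
  then show False using f[of q] qd[of q Q0] s Q0(1) by auto
 qed
 have Sq1: "set q Int S = {f q}" if q: "q \<in> Q - {Q0}" for q
 proof (intro equalityI subsetI)
  fix s assume s: "s \<in> set q Int S"
  then obtain q' where q': "q' \<in> Q - {Q0}" "s = f q'" using Sf by blast
  then have "q' = q" using f[OF q'(1)] qd[of q q'] s q by blast
  then show "s \<in> {f q}" using q' by simp
 qed (use f[OF q] in auto)
 define L where "L = {x. \<exists>p. is_path ?E' Y {x} p & set p Int S = {}}"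
 have Lstep: "y \<in> L" if xy: "x \<in> L" "(x, y) \<in> ?E'" "y ~: S" for x y
 proof -
  obtain p where p: "is_path ?E' Y {x} p & set p Int S = {}" using xy(1) unfolding L_def by blast
  then have "is_path ?E' Y {y} (p @ [y])" using xy(2) by (auto simp: is_path_def path_edges_append)
  moreover have "set (p @ [y]) Int S = {}" using p xy(3) by auto
  ultimately show ?thesis unfolding L_def by blast
 qed
 have LZ: "z ~: L" if "z \<in> Z" for z
 proof
  assume "z \<in> L"
  then obtain p where p: "is_path ?E' Y {z} p & set p Int S = {}" unfolding L_def by blast
  then have "is_path ?E' Y Z p" using that by (auto simp: is_path_def)
  then show False using separatesD[OF S(2)] p by blast
 qed
 have LY: "y \<in> L" if "y \<in> Y" "y ~: S" for y using that by (auto simp: L_def is_path_def intro!: exI[of _ "[y]"])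
 \<comment> \<open>Before \<open>c\<close> the path is reachable step by step from \<open>Y\<close>;
   reachability at or after \<open>c\<close> would carry on to the end in \<open>Z\<close>. Here
   \<open>c\<close> is the position after the deleted edge on \<open>Q0\<close>, and the position of
   the separator vertex on any other path.\<close>
 have side: "q ! s \<in> L \<longleftrightarrow> s < c"
  if q: "q \<in> Q" and c: "!!t. Suc t < length q ==> Suc t ~= c ==> (q ! t, q ! Suc t) \<in> ?E'" "!!t. t < length q ==> t ~= c ==> q ! t ~: S"
   and c0: "q ! 0 ~: S & c ~= 0 \<or> q ! c \<in> S" and cl: "c < length q" and s: "s < length q" "q ! s ~: S" for q c s
 proof -
  have up: "t < c ==> q ! t \<in> L" for t
  proof (induction t)
   case 0 then show ?case using c(2)[of 0] LY qp[OF q] cl by (metis gr_implies_not0 hd_conv_nth length_greater_0_conv less_irrefl)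
  next
   case (Suc t) then show ?case using Lstep[of "q ! t" "q ! Suc t"] c(1)[of t] c(2)[of "Suc t"] cl by auto
  qed
  have down: "q ! s ~: L" if sc: "s >= c"
  proof
   assume sL: "q ! s \<in> L"
   have "s <= t ==> t < length q ==> q ! t \<in> L" for t
   proof (induction t)
    case 0 then show ?case using sL by simp
   next
    case (Suc t)
    show ?case
    proof (cases "s = Suc t")
     case False
     then have st: "s <= t" using Suc by simp
     then have "Suc t ~= c" using sc by simp
     then show ?thesis using Suc st c by (rule_tac Lstep[of "q ! t"]) auto
    qed (use sL in simp)
   qed
   from this[of "length q - 1"] have "last q \<in> L" using s qp(1)[OF q] by (simp add: last_conv_nth)
   then show False using LZ qp(4)[OF q] by blast
  qed
  show ?thesis using up[of s] down by (meson not_le)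
 qed
 have E0E': "?E0 \<subseteq> ?E'" using Q0(4) by blast
 show ?thesis
 proof (rule that[OF S(1) Sq, of L])
  show "Q0 ! s \<in> L \<longleftrightarrow> s < n" if "s < length Q0" for s
  proof (rule side[OF Q0(1)])
   fix t assume t: "Suc t < length Q0" "Suc t ~= n"
   have "(Q0 ! t, Q0 ! Suc t) \<in> dir_edges Q" using t(1) qp(2)[OF Q0(1)] unfolding path_edges_nth by blast
   moreover have "Q0 ! Suc t ~= Q0 ! n" using t Q0(3) qp(5)[OF Q0(1)] by (simp add: nth_eq_iff_index_eq)
   ultimately show "(Q0 ! t, Q0 ! Suc t) \<in> ?E'" by auto
  next
   show "Q0 ! t ~: S" if "t < length Q0" for t using S0 nth_mem[OF that] by auto
   have "Q0 ! 0 \<in> set Q0" using Q0(3) by (intro nth_mem) linarith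
   then show "Q0 ! 0 ~: S & n ~= 0 \<or> Q0 ! n \<in> S" using S0 Q0 by auto
   show "Q0 ! s ~: S" using S0 nth_mem[OF that] by auto
  qed (use Q0 that in auto)
  show "\<exists>c. \<forall>s<length q. q ! s ~: S --> (q ! s \<in> L \<longleftrightarrow> s < c)" if q: "q \<in> Q" for q
  proof (cases "q = Q0")
   case True then show ?thesis using \<open>!!s. s < length Q0 ==> (Q0 ! s \<in> L) = (s < n)\<close> by blast
  next
   case False
   then have q': "q \<in> Q - {Q0}" using q by simp
   obtain c where c: "c < length q" "q ! c = f q" using f[OF q'] by (auto simp: in_set_conv_nth)
   have "q ! s \<in> L \<longleftrightarrow> s < c" if s: "s < length q" "q ! s ~: S" for s
   proof (rule side[OF q _ _ _ c(1) s])
    show "(q ! t, q ! Suc t) \<in> ?E'" if "Suc t < length q" for t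
    proof -
     have "(q ! t, q ! Suc t) \<in> path_edges q" unfolding path_edges_nth using that by blast
     then show ?thesis using ne[OF q False] qp(2)[OF q] by auto
    qed
    show "q ! t ~: S" if "t < length q" "t ~= c" for t
     using that c Sq1[OF q'] qp(5)[OF q] nth_mem[OF that(1)] by (metis IntI nth_eq_iff_index_eq singletonD)
    show "q ! 0 ~: S & c ~= 0 \<or> q ! c \<in> S" using c f[OF q'] by simp
   qed
   then show ?thesis by blast
  qed
  show "set P \<subseteq> L \<or> set P Int L = {}" if P: "P \<in> L0" "set P Int S = {}" for P
  proof -
   have sy: "sym ?E0" by (auto simp: sym_def sym_edges_def)
   have "conn ?E0 (set P)" using P by (intro conn_path_set[OF sy]) (auto simp: sym_edges_def)
   moreover have "(x, y) \<in> (?E0 Int set P \<times> set P)\<^sup>* ==> x \<in> L ==> y \<in> L" for x y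
    by (induction rule: rtrancl_induct) (use Lstep E0E' P(2) in blast)+
   ultimately show ?thesis unfolding conn_def by blast
  qed
 qed
qed

text \<open>The paths of \<open>V\<close> are sorted by their first vertex on one path
  \<open>Q0\<close> and grouped into \<open>d\<close> blocks. In front of each later block
  \<open>cut_lemma\<close> applies. All separators together have at most \<open>d * card Q\<close>
  vertices, so a block of \<open>d * card Q + 1\<close> disjoint paths contains one that avoids them
  all. It lies entirely on the right side of the cuts, which orders the visits along all members of
  \<open>H\<close> at once.\<close>

lemma weave_of_linkages:
 assumes E: "sym E" "finite E" and L0: "linkage E Y0 Z0 L0" and Q: "linkage E Y Z Q" "finite Y"
  and min: "!!Q'. linkage E Y Z Q' ==> card Q' = card Q ==> card (dir_edges Q - sym_edges L0) <= card (dir_edges Q' - sym_edges L0)"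
  and V: "V \<subseteq> L0" "d * (d * card Q + 1) <= card V" and H: "H \<subseteq> Q" "H ~= {}"
  and meet: "!!p q. p \<in> V ==> q \<in> H ==> set p Int set q ~= {}"
 shows "weave E (card H) d"
proof -
 have fV: "finite V" "finite H" "finite Q" using V(1) H(1) L0 Q(1) finite_subset by (auto simp: linkage_def)
 have Ld: "set p Int set p' = {}" if "p \<in> L0" "p' \<in> L0" "p ~= p'" for p p' using L0 that by (simp add: linkage_def)
 obtain Q0 where Q0: "Q0 \<in> H" using H(2) by auto
 define fi where "fi p = (LEAST s. s < length Q0 & Q0 ! s \<in> set p)" for p
 have fi: "fi p < length Q0" "Q0 ! fi p \<in> set p" "!!s. s < length Q0 ==> Q0 ! s \<in> set p ==> fi p <= s" if "p \<in> V" for p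
 proof -
  have "set p Int set Q0 ~= {}" by (rule meet[OF that Q0])
  then obtain x where x: "x \<in> set p" "x \<in> set Q0" by blast
  then have "\<exists>s. s < length Q0 & Q0 ! s \<in> set p" by (metis in_set_conv_nth)
  from LeastI_ex[OF this] show "fi p < length Q0" "Q0 ! fi p \<in> set p" by (auto simp: fi_def)
  show "!!s. s < length Q0 ==> Q0 ! s \<in> set p ==> fi p <= s" by (auto simp: fi_def intro: Least_le)
 qed
 have fiinj: "inj_on fi V" unfolding inj_on_def using fi(2) Ld V(1) by (metis disjoint_iff subsetD)
 define fs where "fs = sorted_list_of_set (fi ` V)"
 have fs: "sorted_wrt (<) fs" "set fs = fi ` V" "length fs = card V"
  using fV(1) card_image[OF fiinj] by (auto simp: fs_def)
 define b where "b = d * card Q + 1"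
 have b0: "0 < b" and Vb: "d * b <= card V" using V(2) by (simp_all add: b_def)
 have "\<exists>p. \<forall>t<length fs. p t \<in> V & fi (p t) = fs ! t"
 proof -
  have "\<forall>t. \<exists>p. t < length fs --> p \<in> V & fi p = fs ! t" using fs(2) nth_mem by fastforce
  then show ?thesis by metis
 qed
 then obtain p where p: "!!t. t < length fs ==> p t \<in> V & fi (p t) = fs ! t" by blast
 have pmono: "fi (p s) < fi (p t)" if "s < t" "t < length fs" for s t
  using that p[of s] p[of t] sorted_wrt_nth_less[OF fs(1), of s t] by simp
 have pinj: "p s ~= p t" if "s < t" "t < length fs" for s t using pmono[OF that] by auto
 have blk: "j * b + s < length fs" if "j < d" "s < b" for j s
 proof -
  have "j * b + s < Suc j * b" using that by simp
  also have "... <= d * b" using that by (intro mult_le_mono1) simp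
  also have "... <= length fs" using Vb fs(3) by simp
  finally show ?thesis .
 qed
 define Phi where "Phi j S L \<longleftrightarrow> finite S & card S < card Q & (\<forall>s<length Q0. Q0 ! s \<in> L \<longleftrightarrow> s < fi (p (j * b))) &
   (\<forall>P\<in>L0. set P Int S = {} --> set P \<subseteq> L \<or> set P Int L = {}) &
   (\<forall>q\<in>Q. \<exists>c. \<forall>s<length q. q ! s ~: S --> (q ! s \<in> L \<longleftrightarrow> s < c))" for j S L
 have ex: "\<exists>S L. Phi j S L" if j: "0 < j" "j < d" for j
 proof -
  let ?n = "fi (p (j * b))"
  have lt: "j * b < length fs" using blk[OF j(2), of 0] b0 by simp
  have jb: "0 < j * b" using j b0 by simp
  have n: "0 < ?n" "?n < length Q0" "p (j * b) \<in> V" using pmono[OF jb lt] p[OF lt] fi(1)[of "p (j * b)"] by auto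
  \<comment> \<open>Both ends of an edge of \<open>L0\<close> lie on one path of \<open>L0\<close>,
    so this edge would show an earlier visit to \<open>p (j * b)\<close>.\<close>
  have "(Q0 ! (?n - 1), Q0 ! ?n) ~: sym_edges L0"
  proof
   assume "(Q0 ! (?n - 1), Q0 ! ?n) \<in> sym_edges L0"
   then obtain P where P: "P \<in> L0" "Q0 ! (?n - 1) \<in> set P" "Q0 ! ?n \<in> set P"
    unfolding sym_edges_def using path_edges_subset by fastforce
   then have "P = p (j * b)" using fi(2)[OF n(3)] Ld[of P "p (j * b)"] V(1) n(3) by blast
   then have "?n <= ?n - 1" using fi(3)[OF n(3), of "?n - 1"] P n(1,2) by auto
   then show False using n(1) by simp
  qed
  note cut = cut_lemma[OF E L0 Q min subsetD[OF H(1) Q0] n(1,2) this]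
  show ?thesis
  proof (rule cut)
   fix S L assume "finite S" "card S < card Q" "!!s. s < length Q0 ==> (Q0 ! s \<in> L) = (s < ?n)"
    "!!P. P \<in> L0 ==> set P Int S = {} ==> set P \<subseteq> L \<or> set P Int L = {}"
    "!!q. q \<in> Q ==> \<exists>c. \<forall>s<length q. q ! s ~: S --> (q ! s \<in> L) = (s < c)"
   then show ?thesis unfolding Phi_def by (intro exI[of _ S] exI[of _ L] conjI allI ballI impI)
  qed
 qed
 then have "\<forall>j. \<exists>S L. 0 < j & j < d --> Phi j S L" by blast
 then obtain S L where SL0: "!!j. 0 < j ==> j < d ==> Phi j (S j) (L j)" by metis
 have SL: "finite (S j)" "card (S j) < card Q" "\<forall>s<length Q0. Q0 ! s \<in> L j \<longleftrightarrow> s < fi (p (j * b))"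
   "\<forall>P\<in>L0. set P Int S j = {} --> set P \<subseteq> L j \<or> set P Int L j = {}"
   "\<forall>q\<in>Q. \<exists>c. \<forall>s<length q. q ! s ~: S j --> (q ! s \<in> L j \<longleftrightarrow> s < c)" if "0 < j" "j < d" for j
  using SL0[OF that] by (simp_all add: Phi_def)
 let ?S = "\<Union>j\<in>{1..<d}. S j"
 have SS: "S j \<subseteq> ?S" if "0 < j" "j < d" for j using that by (intro UN_upper) simp
 have "\<exists>t<b. set (p (i * b + t)) Int ?S = {}" if i: "i < d" for i
 proof (rule ccontr)
  assume "~ ?thesis"
  then have "\<forall>q\<in>(%t. p (i * b + t)) ` {..<b}. set q Int ?S ~= {}" by auto
  moreover have "inj_on (%t. p (i * b + t)) {..<b}"
   by (rule linorder_inj_onI') (use pinj blk[OF i] in auto)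
  moreover have "finite ?S" using SL(1) by auto
  moreover have "\<forall>q\<in>(%t. p (i * b + t)) ` {..<b}. \<forall>q'\<in>(%t. p (i * b + t)) ` {..<b}. q ~= q' --> set q Int set q' = {}"
   using Ld V(1) p blk[OF i] by blast
  ultimately have "card {..<b} <= card ?S"
   using card_disjoint_sets_le[of ?S "(%t. p (i * b + t)) ` {..<b}"] by (simp add: card_image)
  also have "... <= (\<Sum>j\<in>{1..<d}. card (S j))" by (rule card_UN_le) simp
  also have "... <= (\<Sum>j\<in>{1..<d}. card Q)" using SL(2) by (intro sum_mono) (auto intro: less_imp_le)
  also have "... <= d * card Q" by simp
  finally show False by (simp add: b_def)
 qed
 then obtain t where t: "!!i. i < d ==> t i < b & set (p (i * b + t i)) Int ?S = {}" by metis
 define v where "v i = p (i * b + t i)" for i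
 have vV: "v i \<in> V" "i * b + t i < length fs" if "i < d" for i using p blk[OF that, of "t i"] t[OF that] by (auto simp: v_def)
 have vd: "v i ~= v j" if "i < j" "j < d" for i j
 proof -
  have "i * b + t i < i * b + b" using t[of i] that by simp
  also have "i * b + b = Suc i * b" by simp
  also have "... <= j * b" using that by (intro mult_le_mono1) simp
  finally show ?thesis unfolding v_def using vV(2)[OF that(2)] by (intro pinj) auto
 qed
 have in1: "set (v i) \<subseteq> L j" if ij: "i < j" "j < d" for i j
 proof -
  have id: "i < d" "0 < j" using ij by auto
  have "i * b + t i < i * b + b" using t[OF id(1)] by simp
  also have "i * b + b = Suc i * b" by simp
  also have "... <= j * b" using ij by (intro mult_le_mono1) simp
  finally have "fi (v i) < fi (p (j * b))" unfolding v_def using blk[OF ij(2), of 0] b0 by (intro pmono) auto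
  then have "Q0 ! fi (v i) \<in> L j" using SL(3)[OF id(2) ij(2)] fi(1)[OF vV(1)[OF id(1)]] by blast
  moreover have "set (v i) Int S j = {}" using t[OF id(1)] SS[OF id(2) ij(2)] unfolding v_def by blast
  ultimately show ?thesis using SL(4)[OF id(2) ij(2)] fi(2)[OF vV(1)[OF id(1)]] vV(1)[OF id(1)] V(1) by blast
 qed
 have in2: "set (v j) Int L j = {}" if j: "0 < j" "j < d" for j
 proof -
  have "fi (p (j * b)) <= fi (v j)"
  proof (cases "t j = 0")
   case False
   then have "fi (p (j * b)) < fi (v j)" unfolding v_def using vV(2)[OF j(2)] by (intro pmono) auto
   then show ?thesis by simp
  qed (simp add: v_def)
  then have "Q0 ! fi (v j) ~: L j" using SL(3)[OF j] fi(1)[OF vV(1)[OF j(2)]] by (meson not_le)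
  moreover have "set (v j) Int S j = {}" using t[OF j(2)] SS[OF j] unfolding v_def by blast
  ultimately show ?thesis using SL(4)[OF j] fi(2)[OF vV(1)[OF j(2)]] vV(1)[OF j(2)] V(1) by blast
 qed
 obtain h where h: "bij_betw h {..<card H} H" using ex_bij_betw_nat_finite[OF fV(2)] by (auto simp: atLeast0LessThan)
 have hH: "h a \<in> H" if "a < card H" for a using h that by (auto simp: bij_betw_def)
 have hd: "h a ~= h b" if "a < card H" "b < card H" "a ~= b" for a b using h that by (auto simp: bij_betw_def inj_on_def)
 have "weaves E (card H) d h v" unfolding weaves_def
 proof (intro conjI allI impI)
  show "disjoint_paths E (card H) h" unfolding disjoint_paths_def
   using hH hd H(1) Q(1) unfolding linkage_def is_path_def by (metis subsetD)
  have "v i ~= v j" if "i < d" "j < d" "i ~= j" for i j using vd[of i j] vd[of j i] that by (metis nat_neq_iff)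
  then show "disjoint_paths E d v" unfolding disjoint_paths_def
   using vV(1) V(1) L0 unfolding linkage_def is_path_def by (metis subsetD)
  show "set (h a) Int set (v i) ~= {}" if "a < card H" "i < d" for a i using meet[OF vV(1)[OF that(2)] hH[OF that(1)]] by blast
  fix a i j s u assume a: "a < card H" and A: "i < j & j < d & s < length (h a) & u < length (h a) & h a ! s \<in> set (v i) & h a ! u \<in> set (v j)"
  have jj: "0 < j" "j < d" "i < d" using A by auto
  obtain c where c: "\<forall>s<length (h a). h a ! s ~: S j --> (h a ! s \<in> L j \<longleftrightarrow> s < c)"
   using SL(5)[OF jj(1,2)] hH[OF a] H(1) by blast
  have "set (v i) Int S j \<subseteq> set (v i) Int ?S" "set (v j) Int S j \<subseteq> set (v j) Int ?S" using SS[OF jj(1,2)] by (rule Int_mono[OF order_refl])+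
  moreover have "set (v i) Int ?S = {}" "set (v j) Int ?S = {}" using t[OF jj(3)] t[OF jj(2)] by (simp_all only: v_def)
  ultimately have "set (v i) Int S j = {}" "set (v j) Int S j = {}" by (simp_all only: subset_empty)
  then have "h a ! s ~: S j" "h a ! u ~: S j" using A by blast+
  moreover have "h a ! s \<in> L j" "h a ! u ~: L j" using in1[of i j] in2[OF jj(1,2)] A by auto
  ultimately have "s < c" "~ u < c" using c A by auto
  then show "s < u" by simp
 qed
 then show ?thesis unfolding weave_def by blast
qed

text \<open>Induction on the number of pairs. If some path of the last linkage spares
  \<open>k'\<close> paths of each other linkage, it is kept and the rest is found off it. Otherwise
  each path of the last linkage meets \<open>N\<close> paths of some \<open>Q a\<close>, and by
  pigeonhole more than \<open>M\<close> of them meet the same \<open>N\<close> paths, as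
  \<open>weave_of_linkages\<close> requires.\<close>

theorem select_disjoint_paths:
 fixes n N d :: nat
 assumes "N >= 1"
 shows "\<exists>k\<ge>1. \<forall>E Y Z. finite E & sym (E :: ('a \<times> 'a) set) &
  (\<forall>a<n. finite (Y a) & (\<exists>P. linkage E (Y a) (Z a) P & k <= card P)) -->
  weave E N d \<or> (\<exists>p. (\<forall>a<n. is_path E (Y a) (Z a) (p a)) & (\<forall>a<n. \<forall>b<n. a ~= b --> set (p a) Int set (p b) = {}))"
proof (induction n)
 case 0 then show ?case by auto
next
 case (Suc n)
 then obtain k' where k'0: "\<forall>E Y Z. finite E & sym (E :: ('a \<times> 'a) set) &
  (\<forall>a<n. finite (Y a) & (\<exists>P. linkage E (Y a) (Z a) P & k' <= card P)) -->
  weave E N d \<or> (\<exists>p. (\<forall>a<n. is_path E (Y a) (Z a) (p a)) & (\<forall>a<n. \<forall>b<n. a ~= b --> set (p a) Int set (p b) = {}))" by (elim exE conjE)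
 note k' = mp[OF spec[OF spec[OF spec[OF k'0]]]]
 define q where "q = k' + N"
 define M where "M = d * (d * q + 1)"
 \<comment> \<open>There are at most \<open>n * 2 ^ q\<close> pairs of an index and a subset of its
   \<open>Q a\<close>, so more than \<open>n * 2 ^ q * M\<close> paths make one pair occur more than
   \<open>M\<close> times. The summand \<open>q\<close> lets each linkage supply \<open>q\<close>
   paths.\<close>
 define K where "K = n * 2 ^ q * M + 1 + q"
 show ?case
 proof (intro exI[of _ K] conjI allI impI)
  show "1 <= K" by (simp add: K_def)
  fix E Y Z assume A: "finite E & sym (E :: ('a \<times> 'a) set) & (\<forall>a<Suc n. finite (Y a) & (\<exists>P. linkage E (Y a) (Z a) P & K <= card P))"
  then have E: "finite E" "sym E" by auto
  obtain L0 where L0: "linkage E (Y n) (Z n) L0" "K <= card L0" using A by blast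
  have fL0: "finite L0" using L0 by (simp add: linkage_def)
  have "\<exists>Q. (linkage E (Y a) (Z a) Q & card Q = q) & (\<forall>Q'. linkage E (Y a) (Z a) Q' & card Q' = q -->
    card (dir_edges Q - sym_edges L0) <= card (dir_edges Q' - sym_edges L0))" if a: "a < n" for a
  proof -
   obtain P where P: "linkage E (Y a) (Z a) P" "K <= card P" using A a by (meson less_SucI)
   then obtain P' where "P' \<subseteq> P" "card P' = q" using obtain_subset_with_card_n[of q P] by (auto simp: K_def)
   then have "linkage E (Y a) (Z a) P' & card P' = q" using linkage_mono[OF P(1) order_refl] by blast
   then show ?thesis using ex_has_least_nat[of "%Q. linkage E (Y a) (Z a) Q & card Q = q" P' "%Q. card (dir_edges Q - sym_edges L0)"] by blast
  qed
  then obtain Q where Q: "!!a. a < n ==> linkage E (Y a) (Z a) (Q a) & card (Q a) = q"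
   "!!a Q'. a < n ==> linkage E (Y a) (Z a) Q' ==> card Q' = q ==> card (dir_edges (Q a) - sym_edges L0) <= card (dir_edges Q' - sym_edges L0)"
   by metis
  have fQ: "finite (Q a)" if "a < n" for a using Q(1)[OF that] by (simp add: linkage_def)
  show "weave E N d \<or> (\<exists>p. (\<forall>a<Suc n. is_path E (Y a) (Z a) (p a)) & (\<forall>a<Suc n. \<forall>b<Suc n. a ~= b --> set (p a) Int set (p b) = {}))"
  proof (cases "\<exists>P\<in>L0. \<forall>a<n. k' <= card {x \<in> Q a. set x Int set P = {}}")
   case True
   then obtain P where P: "P \<in> L0" "!!a. a < n ==> k' <= card {x \<in> Q a. set x Int set P = {}}" by blast
   have PP: "is_path E (Y n) (Z n) P" using L0(1) P(1) by (simp add: linkage_def)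
   let ?U = "- set P"
   let ?E = "E Int ?U \<times> ?U"
   have "weave ?E N d \<or> (\<exists>p. (\<forall>a<n. is_path ?E (Y a Int ?U) (Z a) (p a)) & (\<forall>a<n. \<forall>b<n. a ~= b --> set (p a) Int set (p b) = {}))"
   proof (rule k', intro conjI allI impI)
    show "finite ?E" using E by simp
    show "sym ?E" using E(2) by (auto simp: sym_def)
    fix a assume a: "a < n"
    show "finite (Y a Int ?U)" using A a by simp
    have "linkage ?E (Y a Int ?U) (Z a) {x \<in> Q a. set x Int set P = {}}"
    proof -
     have "path_edges x \<subseteq> ?E" "hd x \<in> ?U" if "x \<in> Q a" "set x Int set P = {}" for x
     proof -
      have x: "x ~= []" "path_edges x \<subseteq> E" using Q(1)[OF a] that by (auto simp: linkage_def is_path_def)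
      then have "hd x \<in> set x" by simp
      then show "hd x \<in> ?U" using that(2) by blast
      have "set x \<subseteq> ?U" using that(2) by auto
      then show "path_edges x \<subseteq> ?E" using x(2) path_edges_subset[of x] by auto
     qed
     then show ?thesis using Q(1)[OF a] by (simp add: linkage_def is_path_def)
    qed
    then show "\<exists>P. linkage ?E (Y a Int ?U) (Z a) P & k' <= card P" using P(2)[OF a] by blast
   qed
   then show ?thesis
   proof
    assume "weave ?E N d" then show ?thesis using weave_mono[of ?E N d E] by blast
   next
    assume "\<exists>p. (\<forall>a<n. is_path ?E (Y a Int ?U) (Z a) (p a)) & (\<forall>a<n. \<forall>b<n. a ~= b --> set (p a) Int set (p b) = {})"
    then obtain p where p: "!!a. a < n ==> is_path ?E (Y a Int ?U) (Z a) (p a)" "!!a b. a < n ==> b < n ==> a ~= b ==> set (p a) Int set (p b) = {}" by blast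
    have pU: "set (p a) \<subseteq> ?U" if "a < n" for a using p(1)[OF that] path_in_set[of "p a" ?U] by (auto simp: is_path_def)
    have pE: "is_path E (Y a) (Z a) (p a)" if "a < n" for a using p(1)[OF that] by (auto simp: is_path_def)
    have "is_path E (Y a) (Z a) ((p(n := P)) a)" if "a < Suc n" for a
     using pE[of a] PP that by (cases "a = n") simp_all
    moreover have "set ((p(n := P)) a) Int set ((p(n := P)) b) = {}" if "a < Suc n" "b < Suc n" "a ~= b" for a b
    proof (cases "a = n \<or> b = n")
     case True then show ?thesis using pU[of a] pU[of b] that by auto
    qed (use p(2)[of a b] that in simp)
    ultimately show ?thesis by (intro disjI2 exI[of _ "p(n := P)"] conjI allI impI)
   qed
  next
   case False
   have "\<exists>aH. fst aH < n & snd aH \<subseteq> Q (fst aH) & card (snd aH) = N & (\<forall>x\<in>snd aH. set x Int set P ~= {})" if P: "P \<in> L0" for P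
   proof -
    have "~ (\<forall>a<n. k' <= card {x \<in> Q a. set x Int set P = {}})" using False P by blast
    then obtain a where a: "a < n" "card {x \<in> Q a. set x Int set P = {}} < k'" by (auto simp: not_le)
    have "card (Q a) = card {x \<in> Q a. set x Int set P = {}} + card {x \<in> Q a. set x Int set P ~= {}}"
     using fQ[OF a(1)] by (subst card_Un_disjoint[symmetric]) (auto intro: arg_cong[of _ _ card])
    then have "N <= card {x \<in> Q a. set x Int set P ~= {}}" using a Q(1)[OF a(1)] by (simp add: q_def)
    then obtain H where "H \<subseteq> {x \<in> Q a. set x Int set P ~= {}}" "card H = N" by (rule obtain_subset_with_card_n)
    then show ?thesis using a by (intro exI[of _ "(a, H)"]) auto
   qed
   then obtain g where g: "!!P. P \<in> L0 ==> fst (g P) < n & snd (g P) \<subseteq> Q (fst (g P)) & card (snd (g P)) = N & (\<forall>x\<in>snd (g P). set x Int set P ~= {})"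
    by metis
   let ?B = "SIGMA a:{..<n}. Pow (Q a)"
   have fB: "finite ?B" using fQ by auto
   have cB: "card ?B = n * 2 ^ q" using fQ Q(1) by (simp add: card_Pow)
   have "\<exists>b\<in>?B. M < card {P \<in> L0. g P = b}"
   proof (rule pigeonhole_fiber[OF fL0 fB])
    show "g ` L0 \<subseteq> ?B" using g by (auto simp: mem_Sigma_iff split: prod.splits) (metis fst_conv, metis fst_conv snd_conv subsetD)
    show "card ?B * M < card L0" using L0(2) cB by (simp add: K_def)
   qed
   then obtain a H where aH: "M < card {P \<in> L0. g P = (a, H)}" "a < n" by auto
   have "{P \<in> L0. g P = (a, H)} ~= {}" using aH by (metis card.empty not_less0)
   then obtain P0 where P0: "P0 \<in> L0" "g P0 = (a, H)" by auto
   have H: "H \<subseteq> Q a" "card H = N" using g[OF P0(1)] P0(2) by auto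
   have "weave E (card H) d"
   proof (rule weave_of_linkages[OF E(2,1) L0(1), of "Y a" "Z a" "Q a" "{P \<in> L0. g P = (a, H)}"])
    show "linkage E (Y a) (Z a) (Q a)" "finite (Y a)" using Q(1) A aH(2) by auto
    show "d * (d * card (Q a) + 1) <= card {P \<in> L0. g P = (a, H)}" using aH Q(1)[OF aH(2)] by (simp add: M_def)
    show "H ~= {}" using H(2) assms by auto
    show "set p Int set x ~= {}" if "p \<in> {P \<in> L0. g P = (a, H)}" "x \<in> H" for p x using g[of p] that by auto
   qed (use Q aH H in auto)
   then show ?thesis using H by simp
  qed
 qed
qed

section \<open>Grid minors\<close>

definition minor :: "('a \<times> 'a) set => 'a set => ('b \<times> 'b) set => 'b set => bool" where
 "minor E V E' V' \<longleftrightarrow> (\<exists>B. (\<forall>x\<in>V'. B x ~= {} & B x \<subseteq> V & conn E (B x)) &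
  (\<forall>x\<in>V'. \<forall>y\<in>V'. x ~= y --> B x Int B y = {}) & (\<forall>(x, y)\<in>E'. \<exists>u\<in>B x. \<exists>v\<in>B y. (u, v) \<in> E))"

lemma minor_mono: "minor E V E' V' ==> E \<subseteq> F ==> V \<subseteq> W ==> minor F W E' V'"
 unfolding minor_def
proof (elim exE conjE)
 fix B assume A: "E \<subseteq> F" "V \<subseteq> W" "\<forall>x\<in>V'. B x ~= {} & B x \<subseteq> V & conn E (B x)"
  "\<forall>x\<in>V'. \<forall>y\<in>V'. x ~= y --> B x Int B y = {}" "\<forall>(x, y)\<in>E'. \<exists>u\<in>B x. \<exists>v\<in>B y. (u, v) \<in> E"
 show "\<exists>B. (\<forall>x\<in>V'. B x ~= {} & B x \<subseteq> W & conn F (B x)) &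
  (\<forall>x\<in>V'. \<forall>y\<in>V'. x ~= y --> B x Int B y = {}) & (\<forall>(x, y)\<in>E'. \<exists>u\<in>B x. \<exists>v\<in>B y. (u, v) \<in> F)"
 proof (intro exI[of _ B] conjI)
  show "\<forall>x\<in>V'. B x ~= {} & B x \<subseteq> W & conn F (B x)" using A(1,2,3) conn_mono by blast
  show "\<forall>(x, y)\<in>E'. \<exists>u\<in>B x. \<exists>v\<in>B y. (u, v) \<in> F" using A(1,5) by blast
 qed (rule A(4))
qed

definition clique_edges :: "nat => (nat \<times> nat) set" where
 "clique_edges m = {(i, j). i < m & j < m & i ~= j}"

definition grid_edges :: "nat => ((nat \<times> nat) \<times> (nat \<times> nat)) set" where
 "grid_edges r = {((a, i), (b, j)). a < r & i < r & b < r & j < r &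
  (a = b & (j = Suc i \<or> i = Suc j) \<or> i = j & (b = Suc a \<or> a = Suc b))}"

lemma clique_minor_grid_minor:
 assumes "minor E V (clique_edges m) {..<m}" "r * r <= m"
 shows "minor E V (grid_edges r) ({..<r} \<times> {..<r})"
proof -
 obtain B where B: "\<forall>x\<in>{..<m}. B x ~= {} & B x \<subseteq> V & conn E (B x)"
  "\<forall>x\<in>{..<m}. \<forall>y\<in>{..<m}. x ~= y --> B x Int B y = {}" "\<forall>(x, y)\<in>clique_edges m. \<exists>u\<in>B x. \<exists>v\<in>B y. (u, v) \<in> E"
  using assms(1) unfolding minor_def by (elim exE conjE)
 define f where "f = (%(a, i). a * r + i)"
 have f: "f x < m" if x: "x \<in> {..<r} \<times> {..<r}" for x
 proof -
  obtain a i where ai: "x = (a, i)" "a < r" "i < r" using x by auto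
  have "a * r + i < Suc a * r" using ai by simp
  also have "... <= r * r" using ai by (intro mult_le_mono1) simp
  finally show ?thesis using assms(2) ai by (simp add: f_def)
 qed
 have inj: "x = y" if xy: "x \<in> {..<r} \<times> {..<r}" "y \<in> {..<r} \<times> {..<r}" "f x = f y" for x y
 proof -
  obtain a i b j where e: "x = (a, i)" "y = (b, j)" "i < r" "j < r" using xy(1,2) by auto
  then have "a * r + i = b * r + j" using xy(3) by (simp add: f_def)
  moreover have "(a * r + i) div r = a" "(b * r + j) div r = b" "(a * r + i) mod r = i" "(b * r + j) mod r = j" using e by auto
  ultimately show ?thesis using e by metis
 qed
 show ?thesis unfolding minor_def
 proof (intro exI[of _ "%x. B (f x)"] conjI ballI impI)
  fix x y assume "x \<in> {..<r} \<times> {..<r}" "y \<in> {..<r} \<times> {..<r}" "x ~= y"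
  then show "B (f x) Int B (f y) = {}" using B(2) f inj by (metis lessThan_iff)
 next
  fix e assume e: "e \<in> grid_edges r"
  then obtain x y where xy: "e = (x, y)" "x \<in> {..<r} \<times> {..<r}" "y \<in> {..<r} \<times> {..<r}" "x ~= y" by (auto simp: grid_edges_def)
  then have "(f x, f y) \<in> clique_edges m" using f inj by (auto simp: clique_edges_def)
  then show "case e of (x, y) => \<exists>u\<in>B (f x). \<exists>v\<in>B (f y). (u, v) \<in> E" using B(3) xy(1) by auto
 qed (use B(1) f in auto)
qed

section \<open>Reading a grid or a clique off a weave\<close>

lemma conn_interval:
 assumes "sym E" "path_edges p \<subseteq> E" "lo <= hi" "hi < length p"
 shows "conn E {p ! t |t. lo <= t & t <= hi}"
 using assms(3,4)
proof (induction hi rule: dec_induct)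
 case base
 have "{p ! t |t. lo <= t & t <= lo} = {p ! lo}" by auto
 then show ?case by simp
next
 case (step n)
 have "{p ! t |t. lo <= t & t <= Suc n} = {p ! t |t. lo <= t & t <= n} Un {p ! Suc n}"
  using step by (auto simp: le_Suc_eq)
 moreover have "(p ! n, p ! Suc n) \<in> E" using assms(2) step unfolding path_edges_nth by blast
 ultimately show ?case using step assms(1)
  by (simp only:) (rule conn_Un[of E _ _ "p ! n" "p ! Suc n"], auto)
qed

text \<open>The column is cut at the first visit to each row. \<open>St a\<close> ends at the first
  visit to \<open>Q a\<close> and begins just after the last earlier vertex on any row;
  \<open>par a\<close> is that row, or \<open>N\<close> if there is none. First visits get strictly
  earlier along \<open>par\<close>, so contracting the stretches turns the rows into a rooted
  tree.\<close>

lemma column: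
 fixes N :: nat
 assumes "sym E" "distinct v" "path_edges v \<subseteq> E" and disj: "!!a b. a < N ==> b < N ==> a ~= b ==> Q a Int Q b = {}"
  and meet: "!!a. a < N ==> Q a Int set v ~= {}"
 obtains par St rank where
  "!!a. a < N ==> par a <= N" "!!a. a < N ==> par a < N ==> rank (par a) < (rank a :: nat)"
  "!!a b. a < N ==> b < N ==> par a = N ==> par b = N ==> a = b"
  "!!a. a < N ==> St a \<subseteq> set v & conn E (St a) & St a Int Q a ~= {}"
  "!!a b. a < N ==> b < N ==> a ~= b ==> St a Int Q b = {}"
  "!!a b. a < N ==> b < N ==> a ~= b ==> St a Int St b = {}"
  "!!a. a < N ==> par a < N ==> \<exists>x \<in> set v Int Q (par a). \<exists>y\<in>St a. (x, y) \<in> E"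
proof -
 define f where "f a = (LEAST t. t < length v & v ! t \<in> Q a)" for a
 have f: "f a < length v" "v ! f a \<in> Q a" "!!t. t < length v ==> v ! t \<in> Q a ==> f a <= t" if "a < N" for a
 proof -
  obtain x where "x \<in> Q a" "x \<in> set v" using meet[OF \<open>a < N\<close>] by blast
  then have "\<exists>t. t < length v & v ! t \<in> Q a" by (metis in_set_conv_nth)
  from LeastI_ex[OF this] show "f a < length v" "v ! f a \<in> Q a" by (auto simp: f_def)
  show "!!t. t < length v ==> v ! t \<in> Q a ==> f a <= t" by (auto simp: f_def intro: Least_le)
 qed
 have finj: "f a ~= f b" if "a < N" "b < N" "a ~= b" for a b using f(2)[OF that(1)] f(2)[OF that(2)] disj[OF that] by auto
 define G where "G a = {t. t < f a & (\<exists>b<N. v ! t \<in> Q b)}" for a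
 have fG: "finite (G a)" for a by (simp add: G_def)
 define par where "par a = (if G a = {} then N else (SOME b. b < N & v ! Max (G a) \<in> Q b))" for a
 define lo where "lo a = (if G a = {} then f a else Suc (Max (G a)))" for a
 define St where "St a = {v ! t |t. lo a <= t & t <= f a}" for a
 have M: "Max (G a) < f a" "par a < N" "v ! Max (G a) \<in> Q (par a)" if "G a ~= {}" for a
 proof -
  have "Max (G a) \<in> G a" using Max_in[OF fG that] .
  then have *: "Max (G a) < f a" "\<exists>b. b < N & v ! Max (G a) \<in> Q b" by (auto simp: G_def)
  show "Max (G a) < f a" by (rule *(1))
  show "par a < N" "v ! Max (G a) \<in> Q (par a)" using someI_ex[OF *(2)] that by (auto simp: par_def)
 qed
 have G0: "G a = {} \<longleftrightarrow> par a = N" for a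
 proof
  show "G a = {}" if "par a = N" using M(2)[of a] that by (cases "G a = {}") auto
 qed (simp add: par_def)
 have lof: "lo a <= f a" for a using M(1)[of a] by (cases "G a = {}") (simp_all add: lo_def)
 have loG: "t < lo a" if "t \<in> G a" for t a using that Max_ge[OF fG, of t a] by (auto simp: lo_def)
 have onlyf: "t = f a" if "a < N" "b < N" "lo a <= t" "t <= f a" "v ! t \<in> Q b" for a b t
  using loG[of t a] that by (force simp: G_def)
 show ?thesis
 proof (rule that[of par f St])
  show "par a <= N" if "a < N" for a using M(2)[of a] by (cases "G a = {}") (auto simp: par_def)
  show "f (par a) < f a" if "a < N" "par a < N" for a
  proof -
   have g: "G a ~= {}" using G0[of a] that by auto
   then have "f (par a) <= Max (G a)" using M[OF g] f(3)[OF that(2)] f(1)[OF that(1)] by auto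
   then show ?thesis using M(1)[OF g] by simp
  qed
  have inG: "f a \<in> G b" if "a < N" "f a < f b" for a b using that f(2) by (auto simp: G_def)
  show "a = b" if "a < N" "b < N" "par a = N" "par b = N" for a b
  proof (rule ccontr)
   assume "a ~= b"
   then have "f a < f b \<or> f b < f a" using finj[OF that(1,2)] by linarith
   then show False using inG[of a b] inG[of b a] that G0[of a] G0[of b] by auto
  qed
  show "St a \<subseteq> set v & conn E (St a) & St a Int Q a ~= {}" if "a < N" for a
  proof (intro conjI)
   show "St a \<subseteq> set v" using f(1)[OF that] by (auto simp: St_def)
   show "conn E (St a)" unfolding St_def using conn_interval[OF assms(1,3) lof f(1)[OF that]] .
   show "St a Int Q a ~= {}" using f(2)[OF that] lof[of a] by (auto simp: St_def)
  qed
  show "St a Int Q b = {}" if ab: "a < N" "b < N" "a ~= b" for a b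
  proof (rule ccontr)
   assume "St a Int Q b ~= {}"
   then obtain t where t: "lo a <= t" "t <= f a" "v ! t \<in> Q b" by (auto simp: St_def)
   then have "t = f a" using onlyf[OF ab(1,2)] by blast
   then show False using t f(2)[OF ab(1)] disj[OF ab] by auto
  qed
  have half: False if "a < N" "b < N" "f a < f b" "t <= f a" "lo b <= t" for a b t using loG[OF inG[OF that(1,3)]] that by simp
  show "St a Int St b = {}" if ab: "a < N" "b < N" "a ~= b" for a b
  proof (rule ccontr)
   assume "St a Int St b ~= {}"
   then obtain t u where t: "lo a <= t" "t <= f a" "lo b <= u" "u <= f b" "v ! t = v ! u" by (auto simp: St_def)
   have "t = u" using t f(1)[OF ab(1)] f(1)[OF ab(2)] assms(2) nth_eq_iff_index_eq by (metis le_less_trans)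
   then show False using half[of a b t] half[of b a t] t ab finj[OF ab] by (metis nat_neq_iff)
  qed
  show "\<exists>x\<in>set v Int Q (par a). \<exists>y\<in>St a. (x, y) \<in> E" if a: "a < N" "par a < N" for a
  proof -
   have g: "G a ~= {}" using G0[of a] a by auto
   let ?g = "Max (G a)"
   have l: "Suc ?g < length v" using M(1)[OF g] f(1)[OF a(1)] by simp
   then have "(v ! ?g, v ! Suc ?g) \<in> E" using assms(3) unfolding path_edges_nth by blast
   moreover have "v ! Suc ?g \<in> St a" using M(1)[OF g] g by (auto simp: St_def lo_def)
   moreover have "v ! ?g \<in> set v Int Q (par a)" using M(3)[OF g] l by simp
   ultimately show ?thesis by blast
  qed
 qed
qed

text \<open>The row is cut at the first visit to each \<open>V i\<close>; by the order hypothesis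
  the stretch up to the next cut contains all visits to \<open>V i\<close>.\<close>

lemma segments:
 assumes "sym E" "distinct q" "path_edges q \<subseteq> E" and meet: "!!i. i < D ==> set q Int V i ~= {}"
  and ord: "!!i j s t. i < j ==> j < D ==> s < length q ==> t < length q ==> q ! s \<in> V i ==> q ! t \<in> V j ==> s < t"
 obtains seg where "!!i. i < D ==> seg i \<subseteq> set q & seg i ~= {} & conn E (seg i) & set q Int V i \<subseteq> seg i"
  "!!i j. i < D ==> j < D ==> i ~= j ==> seg i Int seg j = {}"
  "!!i. Suc i < D ==> \<exists>x\<in>seg i. \<exists>y\<in>seg (Suc i). (x, y) \<in> E"
proof -
 define lo where "lo i = (LEAST t. t < length q & q ! t \<in> V i)" for i
 have lo: "lo i < length q" "q ! lo i \<in> V i" "!!t. t < length q ==> q ! t \<in> V i ==> lo i <= t" if "i < D" for i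
 proof -
  obtain x where "x \<in> V i" "x \<in> set q" using meet[OF \<open>i < D\<close>] by blast
  then have "\<exists>t. t < length q & q ! t \<in> V i" by (metis in_set_conv_nth)
  from LeastI_ex[OF this] show "lo i < length q" "q ! lo i \<in> V i" by (auto simp: lo_def)
  show "!!t. t < length q ==> q ! t \<in> V i ==> lo i <= t" by (auto simp: lo_def intro: Least_le)
 qed
 have mono: "lo i < lo j" if "i < j" "j < D" for i j
  using ord[OF that] lo[of i] lo[of j] that by auto
 define hi where "hi i = (if Suc i < D then lo (Suc i) - 1 else length q - 1)" for i
 define seg where "seg i = {q ! t |t. lo i <= t & t <= hi i}" for i
 have hi: "lo i <= hi i" "hi i < length q" if "i < D" for i
  using mono[of i "Suc i"] lo(1)[of "Suc i"] lo(1)[OF that] by (auto simp: hi_def)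
 have hl: "hi i < lo j" if "i < j" "j < D" for i j
 proof -
  have "lo (Suc i) <= lo j" using mono[of "Suc i" j] that by (cases "Suc i = j") auto
  moreover have "0 < lo (Suc i)" using mono[of i "Suc i"] that by auto
  ultimately show ?thesis using that by (auto simp: hi_def)
 qed
 show ?thesis
 proof (rule that[of seg])
  show "seg i \<subseteq> set q & seg i ~= {} & conn E (seg i) & set q Int V i \<subseteq> seg i" if i: "i < D" for i
  proof (intro conjI)
   show "seg i \<subseteq> set q" "seg i ~= {}" using hi[OF i] by (auto simp: seg_def)
   show "conn E (seg i)" unfolding seg_def using conn_interval[OF assms(1,3) hi[OF i]] .
   show "set q Int V i \<subseteq> seg i"
   proof
    fix x assume "x \<in> set q Int V i"
    then obtain t where t: "t < length q" "q ! t \<in> V i" "x = q ! t" by (auto simp: in_set_conv_nth)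
    have "t <= hi i"
    proof (cases "Suc i < D")
     case True
     then have "t < lo (Suc i)" using ord[of i "Suc i" t "lo (Suc i)"] lo[OF True] t by auto
     then show ?thesis using True by (simp add: hi_def)
    qed (use t in \<open>simp add: hi_def\<close>)
    then show "x \<in> seg i" using lo(3)[OF i t(1,2)] t(3) by (auto simp: seg_def)
   qed
  qed
  have half: "seg i Int seg j = {}" if "i < j" "j < D" for i j
  proof (rule ccontr)
   assume "seg i Int seg j ~= {}"
   then obtain t u where tu: "lo i <= t" "t <= hi i" "lo j <= u" "u <= hi j" "q ! t = q ! u" by (auto simp: seg_def)
   have "t = u" using tu hi(2)[of i] hi(2)[of j] that assms(2) nth_eq_iff_index_eq by (metis le_less_trans less_trans)
   then show False using tu hl[OF that] by simp
  qed
  show "seg i Int seg j = {}" if "i < D" "j < D" "i ~= j" for i j using half[of i j] half[of j i] that by (metis Int_commute nat_neq_iff)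
  show "\<exists>x\<in>seg i. \<exists>y\<in>seg (Suc i). (x, y) \<in> E" if i: "Suc i < D" for i
  proof -
   have h: "Suc (hi i) = lo (Suc i)" using i mono[of i "Suc i"] by (simp add: hi_def)
   then have "(q ! hi i, q ! lo (Suc i)) \<in> E" using assms(3) lo(1)[OF i] unfolding path_edges_nth by (metis (mono_tags, lifting) mem_Collect_eq subsetD)
   moreover have "q ! hi i \<in> seg i" "q ! lo (Suc i) \<in> seg (Suc i)" using hi[of i] hi[OF i] i by (auto simp: seg_def)
   ultimately show ?thesis by blast
  qed
 qed
qed

text \<open>Bounded branching and bounded height bound the number of nodes, level \<open>j\<close>
  having at most \<open>m ^ j\<close> of them; decreasing ranks make every node reach the
  root.\<close>

lemma tree_depth_or_degree:
 fixes par rank :: "nat => nat"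
 assumes "!!a. a < N ==> par a <= N" "!!a. a < N ==> par a < N ==> rank (par a) < rank a"
  "!!a b. a < N ==> b < N ==> par a = N ==> par b = N ==> a = b" "r * m ^ r < N" "m >= 1"
 shows "(\<exists>c. (\<forall>j<r. c j < N) & (\<forall>j. Suc j < r --> par (c j) = c (Suc j))) \<or>
  (\<exists>b<N. \<exists>ch \<subseteq> {..<N}. card ch = m & (\<forall>x\<in>ch. par x = b))"
proof (rule ccontr)
 assume no: "~ ?thesis"
 have deg: "card {x. x < N & par x = b} <= m" if "b < N" for b
 proof (rule ccontr)
  assume "~ ?thesis"
  then have "m <= card {x. x < N & par x = b}" by simp
  then obtain ch where "ch \<subseteq> {x. x < N & par x = b}" "card ch = m" by (rule obtain_subset_with_card_n)
  then show False using no that by blast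
 qed
 define L where "L = rec_nat {a. a < N & par a = N} (%_ S. {a. a < N & par a \<in> S})"
 have L0: "L 0 = {a. a < N & par a = N}" and LS: "L (Suc j) = {a. a < N & par a \<in> L j}" for j by (simp_all add: L_def)
 have LN: "L j \<subseteq> {..<N}" for j by (cases j) (auto simp: L0 LS)
 have cL: "card (L j) <= m ^ j" for j
 proof (induction j)
  case 0
  have "card (L 0) <= Suc 0" unfolding L0 by (subst card_le_Suc0_iff_eq) (use assms(3) in auto)
  then show ?case by simp
 next
  case (Suc j)
  have fin: "finite (L j)" using LN finite_subset by blast
  have "L (Suc j) = (\<Union>b\<in>L j. {x. x < N & par x = b})" by (auto simp: LS)
  then have "card (L (Suc j)) <= (\<Sum>b\<in>L j. card {x. x < N & par x = b})" using card_UN_le[OF fin] by metis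
  also have "... <= (\<Sum>b\<in>L j. m)" using deg LN by (intro sum_mono) auto
  also have "... <= m ^ Suc j" using Suc by simp
  finally show ?case .
 qed
 have cov: "\<exists>j. a \<in> L j" if "a < N" for a using that
 proof (induction "rank a" arbitrary: a rule: less_induct)
  case less
  show ?case
  proof (cases "par a < N")
   case True
   then obtain j where "par a \<in> L j" using less assms(2) by blast
   then show ?thesis using less.prems by (intro exI[of _ "Suc j"]) (simp add: LS)
  next
   case False
   then show ?thesis using less.prems assms(1)[of a] by (intro exI[of _ 0]) (simp add: L0)
  qed
 qed
 have short: "j < r" if a: "a \<in> L j" for a j
 proof (rule ccontr)
  assume "~ j < r"
  then have rj: "r <= j" by simp
  have ch: "(par ^^ i) a \<in> L (j - i)" if "i <= j" for i using that
  proof (induction i)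
   case (Suc i)
   then have "(par ^^ i) a \<in> L (Suc (j - Suc i))" by (simp add: Suc_diff_Suc)
   then show ?case by (simp add: LS)
  qed (use a in simp)
  have "\<forall>i<r. (par ^^ i) a < N" using ch LN rj by (meson le_trans lessThan_iff less_imp_le subsetD)
  moreover have "\<forall>i. Suc i < r --> par ((par ^^ i) a) = (par ^^ Suc i) a" by simp
  ultimately have "\<exists>c. (\<forall>j<r. c j < N) & (\<forall>j. Suc j < r --> par (c j) = c (Suc j))" by (intro exI[of _ "%i. (par ^^ i) a"] conjI)
  then show False using no by (elim notE) (rule disjI1)
 qed
 have "{..<N} \<subseteq> (\<Union>j<r. L j)" using cov short by blast
 then have "N <= card (\<Union>j<r. L j)" using LN by (metis card_lessThan card_mono finite_UN_I finite_lessThan finite_subset)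
 also have "... <= (\<Sum>j<r. card (L j))" by (rule card_UN_le) simp
 also have "... <= (\<Sum>j<r. m ^ r)" using cL assms(5) by (intro sum_mono) (meson lessThan_iff less_imp_le order_trans power_increasing)
 also have "... = r * m ^ r" by simp
 finally show False using assms(4) by simp
qed

lemma long_path_Field:
 assumes "path_edges p \<subseteq> E" "x \<in> set p" "y \<in> set p" "x ~= y"
 shows "set p \<subseteq> Field E"
proof -
 have F: "set p \<subseteq> Field E" if "path_edges p \<subseteq> E" "2 <= length p" for p :: "'a list"
  using that
 proof (induction p rule: path_edges.induct)
  case (3 a b zs) then show ?case by (cases zs) (auto simp: Field_def)
 qed auto
 have "2 <= length p" using assms(2-4) by (cases p rule: path_edges.cases) auto
 then show ?thesis using F assms(1) by blast
qed

lemma weavesD: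
 assumes "weaves E N d Q v"
 shows "disjoint_paths E N Q" "disjoint_paths E d v" "a < N ==> i < d ==> set (Q a) Int set (v i) ~= {}"
  "a < N ==> i < j ==> j < d ==> s < length (Q a) ==> t < length (Q a) ==> Q a ! s \<in> set (v i) ==> Q a ! t \<in> set (v j) ==> s < t"
proof -
 note w = assms[unfolded weaves_def]
 note w2 = conjunct2[OF w] note w3 = conjunct2[OF w2] note w4 = conjunct2[OF w3]
 show "disjoint_paths E N Q" "disjoint_paths E d v" by (rule conjunct1[OF w], rule conjunct1[OF w2])
 show "set (Q a) Int set (v i) ~= {}" if "a < N" "i < d" using conjunct1[OF w3] that by blast
 show "s < t" if "a < N" "i < j" "j < d" "s < length (Q a)" "t < length (Q a)" "Q a ! s \<in> set (v i)" "Q a ! t \<in> set (v j)"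
  using w4 that by blast
qed

lemma weaves_sub:
 assumes "weaves E N d Q v" "!!i. i < D ==> g i < d" "!!i j. i < j ==> j < D ==> g i < (g j :: nat)"
 shows "weaves E N D Q (v \<circ> g)"
proof -
 have g: "g i ~= g j" if "i < D" "j < D" "i ~= j" for i j using assms(3)[of i j] assms(3)[of j i] that by (metis nat_neq_iff less_irrefl)
 note w = weavesD[OF assms(1)]
 have d: "disjoint_paths E D (v \<circ> g)" using w(2) g assms(2) by (simp add: disjoint_paths_def)
 show ?thesis unfolding weaves_def
 proof (intro conjI allI impI w(1) d)
  fix a i assume "a < N" "i < D" then show "set (Q a) Int set ((v \<circ> g) i) ~= {}" using w(3) assms(2) by simp
 next
  fix a i j s t assume a: "a < N" "i < j & j < D & s < length (Q a) & t < length (Q a) & Q a ! s \<in> set ((v \<circ> g) i) & Q a ! t \<in> set ((v \<circ> g) j)"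
  then have "g i < g j" "g j < d" using assms(2,3) by auto
  then show "s < t" using w(4)[OF a(1), of "g i" "g j" s t] a(2) by simp
 qed
qed

text \<open>There are at most \<open>(N + 1) ^ N\<close> parent functions, so \<open>m + r\<close>
  columns induce the same tree on the rows. A chain of \<open>r\<close> rows together with
  \<open>r\<close> columns is a grid. A row \<open>b\<close> with \<open>m\<close> children gives a
  clique: child \<open>j\<close>, contracted with its stretches of all columns, touches every
  segment of \<open>b\<close>, and joining it to segment \<open>j\<close> yields the branch set of
  \<open>j\<close>.\<close>

lemma weave_minor:
 assumes "weave E N d" "sym E" "r * m ^ r < N" "2 <= N" "m >= 2" "(m + r) * (N + 1) ^ N < d" "finite E"
 shows "minor E (Field E) (grid_edges r) ({..<r} \<times> {..<r}) \<or> minor E (Field E) (clique_edges m) {..<m}"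
proof -
 obtain Q v0 where w0: "weaves E N d Q v0" using assms(1) by (auto simp: weave_def)
 note dq = weavesD(1)[OF w0] and dv0 = weavesD(2)[OF w0] and meet0 = weavesD(3)[OF w0]
 have Qd: "set (Q a) Int set (Q b) = {}" if "a < N" "b < N" "a ~= b" for a b using dq that by (simp add: disjoint_paths_def)
 define Phi where "Phi i par St rank \<longleftrightarrow> (\<forall>a<N. par a <= N) & (\<forall>a<N. par a < N --> rank (par a) < (rank a :: nat)) &
  (\<forall>a<N. \<forall>b<N. par a = N --> par b = N --> a = b) &
  (\<forall>a<N. St a \<subseteq> set (v0 i) & conn E (St a) & St a Int set (Q a) ~= {}) &
  (\<forall>a<N. \<forall>b<N. a ~= b --> St a Int set (Q b) = {}) & (\<forall>a<N. \<forall>b<N. a ~= b --> St a Int St b = {}) &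
  (\<forall>a<N. par a < N --> (\<exists>x\<in>set (v0 i) Int set (Q (par a)). \<exists>y\<in>St a. (x, y) \<in> E))" for i par St rank
 have ex: "\<exists>par St rank. Phi i par St rank" if i: "i < d" for i
 proof (rule column[OF assms(2), of "v0 i" N "%a. set (Q a)"])
  show "distinct (v0 i)" "path_edges (v0 i) \<subseteq> E" using dv0 i by (simp_all add: disjoint_paths_def)
  show "set (Q a) Int set (v0 i) ~= {}" if "a < N" for a using meet0 i that by simp
  fix par St rank
  assume "!!a. a < N ==> par a <= N" "!!a. a < N ==> par a < N ==> rank (par a) < (rank a :: nat)"
   "!!a b. a < N ==> b < N ==> par a = N ==> par b = N ==> a = b"
   "!!a. a < N ==> St a \<subseteq> set (v0 i) & conn E (St a) & St a Int set (Q a) ~= {}"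
   "!!a b. a < N ==> b < N ==> a ~= b ==> St a Int set (Q b) = {}"
   "!!a b. a < N ==> b < N ==> a ~= b ==> St a Int St b = {}"
   "!!a. a < N ==> par a < N ==> \<exists>x\<in>set (v0 i) Int set (Q (par a)). \<exists>y\<in>St a. (x, y) \<in> E"
  then have "Phi i par St rank" by (simp add: Phi_def)
  then show ?thesis by blast
 qed (use Qd in auto)
 then obtain par0 St0 rank0 where P0: "!!i. i < d ==> Phi i (par0 i) (St0 i) (rank0 i)" by metis
 let ?p = "%i. restrict (par0 i) {..<N}"
 have "\<exists>b\<in>{..<N} \<rightarrow>\<^sub>E {..N}. m + r < card {i \<in> {..<d}. ?p i = b}"
 proof (rule pigeonhole_fiber)
  have "par0 i a <= N" if "i < d" "a < N" for i a using P0[OF that(1)] that(2) by (simp add: Phi_def)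
  then show "?p ` {..<d} \<subseteq> {..<N} \<rightarrow>\<^sub>E {..N}" by (auto simp: PiE_iff extensional_def restrict_def split: if_splits)
  show "card ({..<N} \<rightarrow>\<^sub>E {..N}) * (m + r) < card {..<d}" using assms(6) by (simp add: card_PiE mult.commute)
 qed (auto intro: finite_PiE)
 then obtain par where par: "m + r < card {i \<in> {..<d}. ?p i = par}" by blast
 define D where "D = m + r"
 define I where "I = {i \<in> {..<d}. ?p i = par}"
 define g where "g i = sorted_list_of_set I ! i" for i
 have fI: "finite I" "D < card I" using par by (auto simp: I_def D_def)
 have gI: "g i \<in> I" if "i < D" for i using that fI nth_mem[of i "sorted_list_of_set I"] by (simp add: g_def)
 have gm: "g i < g j" if "i < j" "j < D" for i j
  using that fI sorted_wrt_nth_less[OF strict_sorted_list_of_set, of i j I] by (simp add: g_def)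
 define v where "v = v0 \<circ> g"
 have w: "weaves E N D Q v" unfolding v_def by (rule weaves_sub[OF w0]) (use gI gm in \<open>auto simp: I_def\<close>)
 define St where "St i = St0 (g i)" for i
 have Dp: "m <= D" "r <= D" "0 < D" "1 < D" using assms(5) by (auto simp: D_def)
 have par0: "par0 (g i) a = par a" if "i < D" "a < N" for i a
  using gI[OF that(1)] that(2) by (auto simp: I_def restrict_def fun_eq_iff split: if_splits)
 have P: "Phi (g i) (par0 (g i)) (St i) (rank0 (g i))" if "i < D" for i using P0[of "g i"] gI[OF that] by (simp add: I_def St_def)
 have S1: "St i a \<subseteq> set (v i)" "conn E (St i a)" "St i a Int set (Q a) ~= {}" if "i < D" "a < N" for i a
  using P[OF that(1)] that(2) by (simp_all add: Phi_def v_def)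
 have S2: "St i a Int set (Q b) = {}" "St i a Int St i b = {}" if "i < D" "a < N" "b < N" "a ~= b" for i a b
  using P[OF that(1)] that(2-) by (simp_all add: Phi_def)
 have S3: "\<exists>x\<in>set (v i) Int set (Q (par a)). \<exists>y\<in>St i a. (x, y) \<in> E" if "i < D" "a < N" "par a < N" for i a
 proof -
  have "par0 (g i) a < N --> (\<exists>x\<in>set (v0 (g i)) Int set (Q (par0 (g i) a)). \<exists>y\<in>St i a. (x, y) \<in> E)"
   using P[OF that(1)] that(2) unfolding Phi_def by blast
  then show ?thesis using par0[OF that(1,2)] that(3) by (simp add: v_def)
 qed
 note dv = weavesD(2)[OF w] and meet = weavesD(3)[OF w] and ord = weavesD(4)[OF w]
 have vd: "set (v i) Int set (v j) = {}" if "i < D" "j < D" "i ~= j" for i j using dv that by (simp add: disjoint_paths_def)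
 have Qp: "distinct (Q a)" "path_edges (Q a) \<subseteq> E" "Q a ~= []" if "a < N" for a using dq that by (simp_all add: disjoint_paths_def)
 define Psi where "Psi a seg \<longleftrightarrow> (\<forall>i<D. seg i \<subseteq> set (Q a) & seg i ~= {} & conn E (seg i) & set (Q a) Int set (v i) \<subseteq> seg i) &
  (\<forall>i<D. \<forall>j<D. i ~= j --> seg i Int seg j = {}) & (\<forall>i. Suc i < D --> (\<exists>x\<in>seg i. \<exists>y\<in>seg (Suc i). (x, y) \<in> E))" for a seg
 have "\<exists>seg. Psi a seg" if a: "a < N" for a
 proof (rule segments[OF assms(2) Qp(1,2)[OF a], of D "%i. set (v i)"])
  show "set (Q a) Int set (v i) ~= {}" if "i < D" for i using meet[OF a that] .
  show "s < t" if "i < j" "j < D" "s < length (Q a)" "t < length (Q a)" "Q a ! s \<in> set (v i)" "Q a ! t \<in> set (v j)" for i j s t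
   using ord[OF a that] .
  fix seg
  assume "!!i. i < D ==> seg i \<subseteq> set (Q a) & seg i ~= {} & conn E (seg i) & set (Q a) Int set (v i) \<subseteq> seg i"
   "!!i j. i < D ==> j < D ==> i ~= j ==> seg i Int seg j = {}" "!!i. Suc i < D ==> \<exists>x\<in>seg i. \<exists>y\<in>seg (Suc i). (x, y) \<in> E"
  then have "Psi a seg" by (simp add: Psi_def)
  then show ?thesis by blast
 qed
 then obtain seg where seg0: "!!a. a < N ==> Psi a (seg a)" by metis
 have g1: "seg a i \<subseteq> set (Q a)" "seg a i ~= {}" "conn E (seg a i)" "set (Q a) Int set (v i) \<subseteq> seg a i" if "a < N" "i < D" for a i
  using seg0[OF that(1)] that(2) by (simp_all add: Psi_def)
 have g2: "seg a i Int seg a j = {}" if "a < N" "i < D" "j < D" "i ~= j" for a i j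
  using seg0[OF that(1)] that(2-) by (simp add: Psi_def)
 have g3: "\<exists>x\<in>seg a i. \<exists>y\<in>seg a (Suc i). (x, y) \<in> E" if "a < N" "Suc i < D" for a i
  using seg0[OF that(1)] that(2-) by (simp add: Psi_def)
 have QF: "set (Q a) \<subseteq> Field E" if a: "a < N" for a
 proof -
  obtain x y where "x \<in> set (Q a) Int set (v 0)" "y \<in> set (Q a) Int set (v 1)" using meet[OF a, of 0] meet[OF a, of 1] Dp by blast
  moreover then have "x ~= y" using vd[of 0 1] Dp by auto
  ultimately show ?thesis using long_path_Field[OF Qp(2)[OF a]] by blast
 qed
 have vF: "set (v i) \<subseteq> Field E" if i: "i < D" for i
 proof -
  obtain x y where "x \<in> set (Q 0) Int set (v i)" "y \<in> set (Q 1) Int set (v i)" using meet[of 0 i] meet[of 1 i] i assms(4) by fastforce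
  moreover then have "x ~= y" using Qd[of 0 1] assms(4) by auto
  moreover have "path_edges (v i) \<subseteq> E" using dv i by (simp add: disjoint_paths_def)
  ultimately show ?thesis using long_path_Field[of "v i"] by blast
 qed
 have gS: "seg a i Int St j b = {}" if "a < N" "b < N" "i < D" "j < D" "(a, i) ~= (b, j)" for a b i j
 proof (cases "a = b")
  case True
  then have "i ~= j" using that by auto
  have "seg a i Int St j b \<subseteq> seg a i Int seg a j" using S1(1)[OF that(4,2)] g1(1)[OF that(1,3)] g1(4)[OF that(1,4)] True by blast
  then show ?thesis using g2[OF that(1,3,4) \<open>i ~= j\<close>] by blast
 qed (use S2(1)[OF that(4,2,1)] g1(1)[OF that(1,3)] in auto)
 have SS: "St i a Int St j b = {}" if "a < N" "b < N" "i < D" "j < D" "(a, i) ~= (b, j)" for a b i j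
 proof (cases "i = j")
  case True then show ?thesis using S2(2)[OF that(3,1,2)] that by auto
 qed (use vd[OF that(3,4)] S1(1)[OF that(3,1)] S1(1)[OF that(4,2)] in auto)
 have gg: "seg a i Int seg b j = {}" if "a < N" "b < N" "i < D" "j < D" "(a, i) ~= (b, j)" for a b i j
 proof (cases "a = b")
  case True then show ?thesis using g2[OF that(1,3,4)] that by auto
 qed (use Qd[OF that(1,2)] g1(1)[OF that(1,3)] g1(1)[OF that(2,4)] in auto)
 have vert: "\<exists>x\<in>seg (par a) i. \<exists>y\<in>St i a. (x, y) \<in> E" if "a < N" "par a < N" "i < D" for a i
  using S3[OF that(3,1,2)] g1(4)[OF that(2,3)] by blast
 have bS: "St i a Int seg a i ~= {}" if "a < N" "i < D" for a i
  using S1[OF that(2,1)] g1(4)[OF that] by blast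
 have symE: "(y, x) \<in> E" if "(x, y) \<in> E" for x y using assms(2) that by (rule symD)
 have p0: "par0 (g 0) a = par a" if "a < N" for a using par0[OF Dp(3) that] .
 have Ph0: "Phi (g 0) (par0 (g 0)) (St 0) (rank0 (g 0))" using P[OF Dp(3)] .
 have "(\<exists>c. (\<forall>j<r. c j < N) & (\<forall>j. Suc j < r --> par (c j) = c (Suc j))) \<or>
  (\<exists>b<N. \<exists>ch \<subseteq> {..<N}. card ch = m & (\<forall>x\<in>ch. par x = b))"
 proof (rule tree_depth_or_degree)
  show "par a <= N" if "a < N" for a using Ph0 p0 that by (simp add: Phi_def)
  show "rank0 (g 0) (par a) < rank0 (g 0) a" if "a < N" "par a < N" for a using Ph0 p0 that by (simp add: Phi_def)
  show "a = b" if "a < N" "b < N" "par a = N" "par b = N" for a b using Ph0 p0 that by (simp add: Phi_def)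
  show "r * m ^ r < N" "m >= 1" using assms by auto
 qed
 then show ?thesis
 proof
  assume "\<exists>c. (\<forall>j<r. c j < N) & (\<forall>j. Suc j < r --> par (c j) = c (Suc j))"
  then obtain c where c: "!!j. j < r ==> c j < N" "!!j. Suc j < r ==> par (c j) = c (Suc j)" by blast
  have crank: "rank0 (g 0) (c j) < rank0 (g 0) (c i)" if "i < j" "j < r" for i j using that
  proof (induction j)
   case (Suc j)
   have "rank0 (g 0) (c (Suc j)) < rank0 (g 0) (c j)"
    using Ph0 p0[of "c j"] c(1)[of j] c(1)[of "Suc j"] c(2)[of j] Suc.prems by (simp add: Phi_def) (metis Suc_lessD)
   then show ?case using Suc by (cases "i = j") auto
  qed simp
  have cinj: "c i ~= c j" if "i < r" "j < r" "i ~= j" for i j using crank[of i j] crank[of j i] that by (metis nat_neq_iff less_irrefl)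
  define B where "B = (%(j, i). seg (c j) i Un St i (c j))"
  have "minor E (Field E) (grid_edges r) ({..<r} \<times> {..<r})" unfolding minor_def
  proof (intro exI[of _ B] conjI ballI impI)
   fix x assume "x \<in> {..<r} \<times> {..<r}"
   then obtain j i where x: "x = (j, i)" "j < r" "i < r" by auto
   have cj: "c j < N" "i < D" using c x Dp by auto
   show "B x ~= {}" using g1(2)[OF cj] x by (simp add: B_def)
   show "B x \<subseteq> Field E" using g1(1)[OF cj] QF[OF cj(1)] S1(1)[OF cj(2,1)] vF[OF cj(2)] x by (auto simp: B_def)
   obtain z where "z \<in> St i (c j)" "z \<in> seg (c j) i" using bS[OF cj] by blast
   then have "conn E (seg (c j) i Un St i (c j))" using g1(3)[OF cj] S1(2)[OF cj(2,1)] by (intro conn_Un[OF assms(2), of _ _ z z]) auto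
   then show "conn E (B x)" using x by (simp add: B_def)
  next
   fix x y assume "x \<in> {..<r} \<times> {..<r}" "y \<in> {..<r} \<times> {..<r}" "x ~= y"
   then obtain j i j' i' where x: "x = (j, i)" "j < r" "i < r" "y = (j', i')" "j' < r" "i' < r" "(j, i) ~= (j', i')" by auto
   have cj: "c j < N" "i < D" "c j' < N" "i' < D" using c x Dp by auto
   have ne: "(c j, i) ~= (c j', i')" using x cinj[of j j'] by auto
   then have ne': "(c j', i') ~= (c j, i)" by auto
   show "B x Int B y = {}" unfolding x B_def
    using gg[OF cj(1,3,2,4) ne] SS[OF cj(1,3,2,4) ne] gS[OF cj(1,3,2,4) ne] gS[OF cj(3,1,4,2) ne'] by auto
  next
   fix e assume "e \<in> grid_edges r"
   then obtain a i b j where e: "e = ((a, i), (b, j))" "a < r" "i < r" "b < r" "j < r"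
    "a = b & (j = Suc i \<or> i = Suc j) \<or> i = j & (b = Suc a \<or> a = Suc b)" by (auto simp: grid_edges_def)
   have cj: "c a < N" "c b < N" "i < D" "j < D" using c e Dp by auto
   have "\<exists>u\<in>B (a, i). \<exists>v\<in>B (b, j). (u, v) \<in> E" using e(6)
   proof (elim disjE conjE)
    assume "a = b" "j = Suc i" then show ?thesis using g3[of "c a" i] cj by (auto simp: B_def)
   next
    assume "a = b" "i = Suc j" then show ?thesis using g3[of "c a" j] cj symE by (fastforce simp: B_def)
   next
    assume "i = j" "b = Suc a" then show ?thesis using vert[of "c a" i] c(2)[of a] cj e symE by (fastforce simp: B_def)
   next
    assume "i = j" "a = Suc b" then show ?thesis using vert[of "c b" i] c(2)[of b] cj e by (fastforce simp: B_def)
   qed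
   then show "case e of (x, y) => \<exists>u\<in>B x. \<exists>v\<in>B y. (u, v) \<in> E" using e(1) by simp
  qed
  then show ?thesis ..
 next
  assume "\<exists>b<N. \<exists>ch\<subseteq>{..<N}. card ch = m & (\<forall>x\<in>ch. par x = b)"
  then obtain b ch where b: "b < N" "ch \<subseteq> {..<N}" "card ch = m" "\<forall>x\<in>ch. par x = b" by blast
  have "finite ch" using b(2) finite_subset by blast
  then obtain h where h: "bij_betw h {..<m} ch" using ex_bij_betw_nat_finite[of ch] b(3) by (auto simp: atLeast0LessThan)
  have hc: "h j < N" "par (h j) = b" if "j < m" for j using h that b unfolding bij_betw_def by auto
  have hi: "h i ~= h j" if "i < m" "j < m" "i ~= j" for i j using h that unfolding bij_betw_def inj_on_def by auto
  have hb: "h j ~= b" if "j < m" for j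
  proof
   assume "h j = b"
   then have "par b = b" using hc[OF that] by simp
   then show False using Ph0 p0[OF b(1)] b(1) unfolding Phi_def by (metis less_irrefl)
  qed
  define T where "T j = set (Q (h j)) Un (\<Union>i\<in>{..<D}. St i (h j))" for j
  define B where "B j = seg b j Un T j" for j
  have cT: "conn E (T j)" if "j < m" for j unfolding T_def
  proof (rule conn_UN[OF assms(2)])
   show "conn E (set (Q (h j)))" by (rule conn_path_set[OF assms(2) Qp(2)[OF hc(1)[OF that]]])
   show "conn E (St i (h j))" if "i \<in> {..<D}" for i using S1(2) that hc(1)[OF \<open>j < m\<close>] by auto
   show "St i (h j) Int set (Q (h j)) ~= {}" if "i \<in> {..<D}" for i using S1(3) that hc(1)[OF \<open>j < m\<close>] by auto
  qed
  have adj: "\<exists>x\<in>seg b i. \<exists>y\<in>T j. (x, y) \<in> E" if "i < m" "j < m" for i j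
  proof -
   have "i < D" using that Dp by simp
   then have "\<exists>x\<in>seg b i. \<exists>y\<in>St i (h j). (x, y) \<in> E" using vert[of "h j" i] hc[OF that(2)] b(1) by auto
   then show ?thesis using \<open>i < D\<close> unfolding T_def by blast
  qed
  have TT: "T i Int T j = {}" if "i < m" "j < m" "i ~= j" for i j
  proof -
   note hh = hc(1)[OF that(1)] hc(1)[OF that(2)] hi[OF that]
   have "set (Q (h i)) Int set (Q (h j)) = {}" using Qd[OF hh] .
   moreover have "St k (h i) Int set (Q (h j)) = {}" "St k (h j) Int set (Q (h i)) = {}" if "k < D" for k
    using S2(1)[OF that hh] S2(1)[OF that hh(2,1)] hh(3) by auto
   moreover have "St k (h i) Int St l (h j) = {}" if "k < D" "l < D" for k l using SS[OF hh(1,2) that] hh(3) by auto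
   ultimately show ?thesis unfolding T_def by (auto; blast)
  qed
  have gT: "seg b i Int T j = {}" if "i < m" "j < m" for i j
  proof -
   have iD: "i < D" using that Dp by simp
   have "seg b i Int set (Q (h j)) = {}" using g1(1)[OF b(1) iD] Qd[OF b(1) hc(1)[OF that(2)]] hb[OF that(2)] by auto
   moreover have "seg b i Int St k (h j) = {}" if "k < D" for k using gS[OF b(1) hc(1)[OF \<open>j < m\<close>] iD that] hb[OF \<open>j < m\<close>] by auto
   ultimately show ?thesis unfolding T_def by auto
  qed
  have "minor E (Field E) (clique_edges m) {..<m}" unfolding minor_def
  proof (intro exI[of _ B] conjI ballI impI)
   fix j assume "j \<in> {..<m}"
   then have j: "j < m" "j < D" using Dp by auto
   show "B j ~= {}" using g1(2)[OF b(1) j(2)] by (simp add: B_def)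
   have "T j \<subseteq> Field E" unfolding T_def using QF[OF hc(1)[OF j(1)]] S1(1)[OF _ hc(1)[OF j(1)]] vF by blast
   then show "B j \<subseteq> Field E" using g1(1)[OF b(1) j(2)] QF[OF b(1)] by (auto simp: B_def)
   obtain x y where "x \<in> seg b j" "y \<in> T j" "(x, y) \<in> E" using adj[OF j(1) j(1)] by blast
   then show "conn E (B j)" unfolding B_def using g1(3)[OF b(1) j(2)] cT[OF j(1)] by (intro conn_Un[OF assms(2), of _ _ x y]) auto
  next
   fix i j assume "i \<in> {..<m}" "j \<in> {..<m}" "i ~= j"
   then have ij: "i < m" "j < m" "i ~= j" "i < D" "j < D" using Dp by auto
   show "B i Int B j = {}" unfolding B_def
    using g2[OF b(1) ij(4,5,3)] gT[OF ij(1,2)] gT[OF ij(2,1)] TT[OF ij(1-3)] by blast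
  next
   fix e assume "e \<in> clique_edges m"
   then obtain i j where "e = (i, j)" "i < m" "j < m" by (auto simp: clique_edges_def)
   then show "case e of (x, y) => \<exists>u\<in>B x. \<exists>v\<in>B y. (u, v) \<in> E" using adj[of i j] by (auto simp: B_def)
  qed
  then show ?thesis ..
 qed
qed

text \<open>The path serving a pair \<open>i < j\<close> is absorbed into the branch set of
  \<open>i\<close> and ends next to \<open>A j\<close>.\<close>

lemma disjoint_paths_clique:
 assumes "sym E" "C \<subseteq> V" "!!i. i < m ==> A i \<subseteq> V & conn E (A i) & A i Int C = {}"
  "!!i j. i < m ==> j < m ==> i ~= j ==> A i Int A j = {}" "!!i. i < m ==> A i ~= {}"
  "set ps = {(i, j). i < j & j < m}"
  "!!a. a < length ps ==> is_path (E Int C \<times> C) (C Int E `` A (fst (ps ! a))) (C Int E `` A (snd (ps ! a))) (p a)"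
  "!!a b. a < length ps ==> b < length ps ==> a ~= b ==> set (p a) Int set (p b) = {}"
 shows "minor E V (clique_edges m) {..<m}"
proof -
 let ?I = "%i. {a. a < length ps & fst (ps ! a) = i}"
 define B where "B i = A i Un (\<Union>a\<in>?I i. set (p a))" for i
 have p: "p a ~= []" "path_edges (p a) \<subseteq> E" "set (p a) \<subseteq> C" "hd (p a) \<in> E `` A (fst (ps ! a))" "last (p a) \<in> E `` A (snd (ps ! a))"
  if "a < length ps" for a
  using assms(7)[OF that] path_in_set[of "p a" C] unfolding is_path_def by auto
 have ps: "fst (ps ! a) < snd (ps ! a)" "snd (ps ! a) < m" if "a < length ps" for a
 proof -
  have "ps ! a \<in> {(i, j). i < j & j < m}" using nth_mem[OF that] assms(6) by simp
  then show "fst (ps ! a) < snd (ps ! a)" "snd (ps ! a) < m" by auto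
 qed
 have cB: "conn E (B i)" if i: "i < m" for i
 proof -
  have "conn E (A i Un (\<Union>a\<in>?I i. A i Un set (p a)))"
  proof (rule conn_UN[OF assms(1)])
   show "conn E (A i)" using assms(3)[OF i] by simp
   fix a assume a: "a \<in> ?I i"
   then obtain x where x: "x \<in> A i" "(x, hd (p a)) \<in> E" using p(4)[of a] by auto
   show "conn E (A i Un set (p a))"
    using x assms(3)[OF i] conn_path_set[OF assms(1), of "p a"] p(1,2)[of a] a by (intro conn_Un[OF assms(1), of _ _ x "hd (p a)"]) auto
   show "(A i Un set (p a)) Int A i ~= {}" using assms(5)[OF i] by auto
  qed
  moreover have "A i Un (\<Union>a\<in>?I i. A i Un set (p a)) = B i" by (auto simp: B_def)
  ultimately show ?thesis by simp
 qed
 have edge: "\<exists>u\<in>B i. \<exists>v\<in>B j. (u, v) \<in> E" if ij: "i < j" "j < m" for i j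
 proof -
  have "(i, j) \<in> set ps" using assms(6) ij by simp
  then obtain a where a: "a < length ps" "ps ! a = (i, j)" by (metis in_set_conv_nth)
  obtain y where "y \<in> A j" "(y, last (p a)) \<in> E" using p(5)[OF a(1)] a(2) by auto
  moreover have "last (p a) \<in> B i" using a p(1)[OF a(1)] by (auto simp: B_def)
  ultimately show ?thesis using symD[OF assms(1)] by (auto simp: B_def)
 qed
 show ?thesis unfolding minor_def
 proof (intro exI[of _ B] conjI ballI impI)
  fix i assume "i \<in> {..<m}"
  then have i: "i < m" by simp
  show "B i ~= {}" using assms(5)[OF i] by (simp add: B_def)
  show "B i \<subseteq> V" using assms(2) assms(3)[OF i] p(3) by (auto simp: B_def)
  show "conn E (B i)" by (rule cB[OF i])
 next
  fix i j assume "i \<in> {..<m}" "j \<in> {..<m}" "i ~= j"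
  then have ij: "i < m" "j < m" "i ~= j" by auto
  have "A k Int set (p a) = {}" if "k < m" "a < length ps" for k a using assms(3)[OF that(1)] p(3)[OF that(2)] by auto
  moreover have "set (p a) Int set (p b) = {}" if "a \<in> ?I i" "b \<in> ?I j" for a b using assms(8)[of a b] that ij(3) by auto
  moreover have "A i Int A j = {}" using assms(4)[OF ij] .
  ultimately show "B i Int B j = {}" using ij(1,2) unfolding B_def by (auto; blast)
 next
  fix e assume "e \<in> clique_edges m"
  then obtain i j where e: "e = (i, j)" "i < m" "j < m" "i ~= j" by (auto simp: clique_edges_def)
  then have "\<exists>u\<in>B i. \<exists>v\<in>B j. (u, v) \<in> E" using edge[of i j] edge[of j i] symD[OF assms(1)] by (metis nat_neq_iff)
  then show "case e of (x, y) => \<exists>u\<in>B x. \<exists>v\<in>B y. (u, v) \<in> E" using e by simp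
 qed
qed

text \<open>A clique on at least \<open>r * r\<close> vertices contains the grid, so both outcomes
  of \<open>select_disjoint_paths\<close> lead to the goal. The summands 2 in \<open>m\<close> and
  \<open>N\<close> make these sizes admissible in \<open>weave_minor\<close>.\<close>

theorem excluded_grid:
 "\<exists>k. \<forall>(E :: ('a \<times> 'a) set) V. sym E & E \<subseteq> V \<times> V & finite V & ~ ok E k {} V -->
  minor E V (grid_edges r) ({..<r} \<times> {..<r})"
proof -
 define m where "m = r * r + 2"
 define N where "N = r * m ^ r + 2"
 define d where "d = (m + r) * (N + 1) ^ N + 1"
 have "finite {(i :: nat, j). i < j & j < m}" by (rule finite_subset[of _ "{..<m} \<times> {..<m}"]) auto
 then obtain ps where ps: "set ps = {(i :: nat, j). i < j & j < m}" using finite_list by blast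
 have "N >= 1" by (simp add: N_def)
 from select_disjoint_paths[OF this, of "length ps" d, where ?'a = 'a]
 obtain k where k1: "k >= 1" and k: "\<forall>E Y Z. finite E & sym (E :: ('a \<times> 'a) set) &
  (\<forall>a<length ps. finite (Y a) & (\<exists>P. linkage E (Y a) (Z a) P & k <= card P)) -->
  weave E N d \<or> (\<exists>p. (\<forall>a<length ps. is_path E (Y a) (Z a) (p a)) & (\<forall>a<length ps. \<forall>b<length ps. a ~= b --> set (p a) Int set (p b) = {}))"
  by (elim exE conjE)
 show ?thesis
 proof (intro exI[of _ "3 * k * m + k"] allI impI)
  fix E :: "('a \<times> 'a) set" and V assume a: "sym E & E \<subseteq> V \<times> V & finite V & ~ ok E (3 * k * m + k) {} V"
  then have E: "sym E" "E \<subseteq> V \<times> V" "finite V" by auto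
  have "mesh E V m k" by (rule mesh_exists) (use a k1 in \<open>auto simp: m_def\<close>)
  then obtain A C where C: "C \<subseteq> V" and A: "\<forall>i<m. A i \<subseteq> V & conn E (A i) & A i Int C = {}"
   "\<forall>i<m. \<forall>j<m. i ~= j --> A i Int A j = {}"
   "\<forall>i<m. \<forall>j<m. i ~= j --> (\<exists>P. linkage (E Int C \<times> C) (C Int E `` A i) (C Int E `` A j) P & k <= card P)"
   unfolding mesh_def by (elim exE conjE)
  have ne: "A i ~= {}" if i: "i < m" for i
  proof -
   define j where "j = (if i = 0 then 1 else 0 :: nat)"
   have "j < m" "i ~= j" by (auto simp: j_def m_def)
   then obtain P where P: "linkage (E Int C \<times> C) (C Int E `` A i) (C Int E `` A j) P" "k <= card P" using A(3) i by blast
   then have "P ~= {}" using k1 by auto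
   then obtain p where "p \<in> P" by auto
   then have "hd p \<in> E `` A i" using P(1) by (auto simp: linkage_def is_path_def)
   then show ?thesis by auto
  qed
  let ?E = "E Int C \<times> C"
  have fC: "finite C" "finite E" using C E finite_subset by (blast, metis finite_SigmaI finite_subset)
  have F: "finite ?E" "sym ?E" using fC E(1) by (auto simp: sym_def)
  let ?Y = "%a. C Int E `` A (fst (ps ! a))" and ?Z = "%a. C Int E `` A (snd (ps ! a))"
  have psa: "fst (ps ! a) < m & snd (ps ! a) < m & fst (ps ! a) ~= snd (ps ! a)" if "a < length ps" for a
  proof -
   have "ps ! a \<in> {(i, j). i < j & j < m}" using nth_mem[OF that] ps by simp
   then show ?thesis by auto
  qed
  have lk: "finite (?Y a) & (\<exists>P. linkage ?E (?Y a) (?Z a) P & k <= card P)" if "a < length ps" for a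
   using A(3) psa[OF that] fC by blast
  then have "weave ?E N d \<or> (\<exists>p. (\<forall>a<length ps. is_path ?E (?Y a) (?Z a) (p a)) & (\<forall>a<length ps. \<forall>b<length ps. a ~= b --> set (p a) Int set (p b) = {}))"
   using F by (intro mp[OF spec[OF spec[OF spec[OF k]]]]) blast
  then show "minor E V (grid_edges r) ({..<r} \<times> {..<r})"
  proof
   assume w: "weave ?E N d"
   have FV: "Field ?E \<subseteq> V" using E(2) by (auto simp: Field_def)
   have "minor ?E (Field ?E) (grid_edges r) ({..<r} \<times> {..<r}) \<or> minor ?E (Field ?E) (clique_edges m) {..<m}"
    by (rule weave_minor[OF w F(2)]) (auto simp: N_def m_def d_def fC)
   then show ?thesis
   proof
    assume "minor ?E (Field ?E) (grid_edges r) ({..<r} \<times> {..<r})"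
    then show ?thesis by (rule minor_mono) (use FV in auto)
   next
    assume "minor ?E (Field ?E) (clique_edges m) {..<m}"
    then have "minor E V (clique_edges m) {..<m}" by (rule minor_mono) (use FV in auto)
    then show ?thesis by (rule clique_minor_grid_minor) (simp add: m_def)
   qed
  next
   assume "\<exists>p. (\<forall>a<length ps. is_path ?E (?Y a) (?Z a) (p a)) & (\<forall>a<length ps. \<forall>b<length ps. a ~= b --> set (p a) Int set (p b) = {})"
   then obtain p where p: "\<forall>a<length ps. is_path ?E (?Y a) (?Z a) (p a)" "\<forall>a<length ps. \<forall>b<length ps. a ~= b --> set (p a) Int set (p b) = {}"
    by (elim exE conjE)
   have "minor E V (clique_edges m) {..<m}"
    by (rule disjoint_paths_clique[OF E(1) C _ _ ne ps, where p = p]) (use A(1,2) p in auto)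
   then show ?thesis by (rule clique_minor_grid_minor) (simp add: m_def)
  qed
 qed
qed

section \<open>Counting logic and tree-width\<close>

definition cform_in :: "nat => nat set => cform set" where
 "cform_in k X = {\<phi>. cvars \<phi> \<subseteq> {..<k} & cfree \<phi> \<subseteq> X}"

definition same_type :: "nat => nat set => graph => (nat => nat) => graph => (nat => nat) => bool" where
 "same_type k X G \<alpha> H \<beta> \<longleftrightarrow> (\<forall>\<phi>\<in>cform_in k X. csat G \<alpha> \<phi> = csat H \<beta> \<phi>)"

text \<open>The shape of every step that places one more vertex: equally many choices of each type,
  and a summand depending on the type only.\<close>

lemma sum_by_type:
 fixes p :: "'a => nat" and q :: "'b => nat"
 assumes "finite A" "finite B" "!!t. card {x \<in> A. f x = t} = card {y \<in> B. g y = t}"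
  "!!x y. x \<in> A ==> y \<in> B ==> f x = g y ==> p x = q y"
 shows "sum p A = sum q B"
proof -
 have im: "f ` A = g ` B"
 proof -
  have f: "t \<in> f ` A \<longleftrightarrow> card {x \<in> A. f x = t} ~= 0" for t using assms(1) by auto
  have g: "t \<in> g ` B \<longleftrightarrow> card {y \<in> B. g y = t} ~= 0" for t using assms(2) by auto
  show ?thesis by (rule set_eqI) (simp only: f g assms(3))
 qed
 have eq: "sum p {x \<in> A. f x = t} = sum q {y \<in> B. g y = t}" if t: "t \<in> f ` A" for t
 proof -
  have t': "t \<in> g ` B" using t im by simp
  obtain x0 where x0: "x0 \<in> A" "f x0 = t" using t by auto
  obtain y0 where y0: "y0 \<in> B" "g y0 = t" using t' by auto
  have "p x = q y0" if "x \<in> {x \<in> A. f x = t}" for x using that assms(4)[of x y0] y0 by auto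
  then have "sum p {x \<in> A. f x = t} = card {x \<in> A. f x = t} * q y0" using sum.cong[of _ _ p "%_. q y0"] by simp
  moreover have "q y = q y0" if "y \<in> {y \<in> B. g y = t}" for y
   using that assms(4)[of x0 y] assms(4)[of x0 y0] x0 y0 by auto
  then have "sum q {y \<in> B. g y = t} = card {y \<in> B. g y = t} * q y0" using sum.cong[of _ _ q "%_. q y0"] by simp
  ultimately show ?thesis by (simp only: assms(3))
 qed
 have "sum p A = (\<Sum>t\<in>f ` A. sum p {x \<in> A. f x = t})" using assms(1) by (rule sum.image_gen)
 also have "... = (\<Sum>t\<in>g ` B. sum q {y \<in> B. g y = t})" using eq im by simp
 also have "... = sum q B" using sum.image_gen[OF assms(2), of q g] by simp
 finally show ?thesis .
qed

definition ctype :: "nat => nat set => graph => (nat => nat) => cform set" where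
 "ctype k X G \<alpha> = {\<phi> \<in> cform_in k X. csat G \<alpha> \<phi>}"

lemma same_type_ctype: "same_type k X G \<alpha> H \<beta> \<longleftrightarrow> ctype k X G \<alpha> = ctype k X H \<beta>"
proof
 assume "ctype k X G \<alpha> = ctype k X H \<beta>"
 then have "\<phi> \<in> ctype k X G \<alpha> \<longleftrightarrow> \<phi> \<in> ctype k X H \<beta>" for \<phi> by simp
 then show "same_type k X G \<alpha> H \<beta>" unfolding same_type_def ctype_def by (metis (mono_tags, lifting) mem_Collect_eq)
next
 assume "same_type k X G \<alpha> H \<beta>"
 then show "ctype k X G \<alpha> = ctype k X H \<beta>" unfolding same_type_def ctype_def by (intro Collect_cong conj_cong refl) (erule bspec)
qed

text \<open>A type is an infinite set of formulas, but against finitely many other types a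
  conjunction of finitely many distinguishing formulas isolates it. The index \<open>i\<close>
  supplies the true formula \<open>CEq i i\<close> where there is nothing to distinguish.\<close>

lemma isolating_formula:
 assumes "finite T" "i < k" "i \<in> X"
 shows "\<exists>\<chi>\<in>cform_in k X. csat G0 \<alpha>0 \<chi> &
  (\<forall>G \<alpha>. ctype k X G \<alpha> \<in> T --> ctype k X G \<alpha> ~= ctype k X G0 \<alpha>0 --> ~ csat G \<alpha> \<chi>)"
 using assms(1)
proof (induction T rule: finite_induct)
 case empty
 have "CEq i i \<in> cform_in k X" using assms(2,3) by (simp add: cform_in_def)
 then show ?case by (intro bexI[of _ "CEq i i"]) auto
next
 case (insert t T)
 let ?t0 = "ctype k X G0 \<alpha>0"
 obtain \<chi> where \<chi>: "\<chi> \<in> cform_in k X" "csat G0 \<alpha>0 \<chi>" "!!G \<alpha>. ctype k X G \<alpha> \<in> T ==> ctype k X G \<alpha> ~= ?t0 ==> ~ csat G \<alpha> \<chi>"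
  using insert.IH by blast
 have "\<exists>\<psi>\<in>cform_in k X. csat G0 \<alpha>0 \<psi> & (\<forall>G \<alpha>. ctype k X G \<alpha> = t --> t ~= ?t0 --> ~ csat G \<alpha> \<psi>)"
 proof (cases "t ~= ?t0 & (\<exists>G \<alpha>. ctype k X G \<alpha> = t)")
  case True
  then obtain G1 \<alpha>1 where t: "t = ctype k X G1 \<alpha>1" by blast
  from True obtain \<phi> where "\<phi> \<in> ?t0 & \<phi> ~: t \<or> \<phi> \<in> t & \<phi> ~: ?t0" by blast
  then show ?thesis
  proof
   assume a: "\<phi> \<in> t & \<phi> ~: ?t0"
   then have "\<phi> \<in> cform_in k X" by (auto simp: t ctype_def)
   moreover from this have "CNeg \<phi> \<in> cform_in k X" by (simp add: cform_in_def)
   ultimately show ?thesis using a by (intro bexI[of _ "CNeg \<phi>"]) (auto simp: ctype_def)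
  next
   assume a: "\<phi> \<in> ?t0 & \<phi> ~: t"
   then show ?thesis by (intro bexI[of _ \<phi>]) (auto simp: ctype_def)
  qed
 next
  case False
  have "CEq i i \<in> cform_in k X" using assms(2,3) by (simp add: cform_in_def)
  then show ?thesis using False by (intro bexI[of _ "CEq i i"]) auto
 qed
 then obtain \<psi> where \<psi>: "\<psi> \<in> cform_in k X" "csat G0 \<alpha>0 \<psi>" "!!G \<alpha>. ctype k X G \<alpha> = t ==> t ~= ?t0 ==> ~ csat G \<alpha> \<psi>" by blast
 have "CConj \<chi> \<psi> \<in> cform_in k X" using \<chi>(1) \<psi>(1) by (simp add: cform_in_def)
 then show ?case using \<chi>(2,3) \<psi>(2,3) by (intro bexI[of _ "CConj \<chi> \<psi>"]) auto
qed

text \<open>Quantifying an isolating formula by \<open>CEx n i\<close> for all \<open>n\<close>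
  determines how many vertices realise a type.\<close>

lemma same_type_counts:
 assumes "same_type k X G \<alpha> H \<beta>" "i < k" "finite (verts G)" "finite (verts H)"
 shows "card {x \<in> verts G. ctype k (insert i X) G (\<alpha>(i := x)) = t} = card {y \<in> verts H. ctype k (insert i X) H (\<beta>(i := y)) = t}"
proof (cases "\<exists>G0 \<alpha>0. t = ctype k (insert i X) G0 \<alpha>0")
 case True
 then obtain G0 \<alpha>0 where t: "t = ctype k (insert i X) G0 \<alpha>0" by blast
 let ?c = "ctype k (insert i X)"
 let ?T = "(%x. ?c G (\<alpha>(i := x))) ` verts G Un (%y. ?c H (\<beta>(i := y))) ` verts H"
 have "finite ?T" using assms by simp
 from isolating_formula[OF this assms(2), of "insert i X" G0 \<alpha>0] obtain \<chi> where \<chi>: "\<chi> \<in> cform_in k (insert i X)" "csat G0 \<alpha>0 \<chi>"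
  "!!G' \<alpha>'. ?c G' \<alpha>' \<in> ?T ==> ?c G' \<alpha>' ~= t ==> ~ csat G' \<alpha>' \<chi>" unfolding t by blast
 have iff: "csat G' \<alpha>' \<chi> \<longleftrightarrow> ?c G' \<alpha>' = t" if "?c G' \<alpha>' \<in> ?T" for G' \<alpha>'
 proof
  assume "?c G' \<alpha>' = t"
  moreover have "\<chi> \<in> t" using \<chi> by (simp add: t ctype_def)
  ultimately show "csat G' \<alpha>' \<chi>" by (auto simp: ctype_def)
 qed (use \<chi>(3)[OF that] in blast)
 have "csat G \<alpha> (CEx n i \<chi>) = csat H \<beta> (CEx n i \<chi>)" for n
 proof -
  have "CEx n i \<chi> \<in> cform_in k X" using \<chi>(1) assms(2) by (auto simp: cform_in_def)
  then show ?thesis using assms(1) by (simp only: same_type_def)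
 qed
 then have "n <= card {x \<in> verts G. csat G (\<alpha>(i := x)) \<chi>} \<longleftrightarrow> n <= card {y \<in> verts H. csat H (\<beta>(i := y)) \<chi>}" for n by simp
 then have "card {x \<in> verts G. csat G (\<alpha>(i := x)) \<chi>} = card {y \<in> verts H. csat H (\<beta>(i := y)) \<chi>}" by (meson le_antisym order_refl)
 moreover have "{x \<in> verts G. csat G (\<alpha>(i := x)) \<chi>} = {x \<in> verts G. ?c G (\<alpha>(i := x)) = t}" using iff by blast
 moreover have "{y \<in> verts H. csat H (\<beta>(i := y)) \<chi>} = {y \<in> verts H. ?c H (\<beta>(i := y)) = t}" using iff by blast
 ultimately show ?thesis by simp
next
 case False
 then have e: "{x \<in> verts G. ctype k (insert i X) G (\<alpha>(i := x)) = t} = {}" "{y \<in> verts H. ctype k (insert i X) H (\<beta>(i := y)) = t} = {}"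
  by blast+
 show ?thesis unfolding e by simp
qed

text \<open>The homomorphisms of the part \<open>C\<close> relative to a fixed placement
  \<open>g\<close> of the bag \<open>S\<close>. Edges inside \<open>S\<close> are not tested here;
  \<open>ext_set_add\<close> tests them when their later end enters the bag.\<close>

definition ext_set :: "graph => nat set => nat set => graph => (nat => nat) => (nat => nat) set" where
 "ext_set F S C G g = {f \<in> C \<rightarrow>\<^sub>E verts G. \<forall>u v. adj F u v & u \<in> C & v \<in> S Un C --> adj G (f u) (if v \<in> C then f v else g v)}"

abbreviation gedges :: "graph => (nat \<times> nat) set" where
 "gedges F \<equiv> {(u, v). adj F u v}"

lemma ext_set_cong: "(!!s. s \<in> S ==> g s = g' s) ==> ext_set F S C G g = ext_set F S C G g'"
 unfolding ext_set_def by (intro Collect_cong conj_cong refl all_cong1 imp_cong) (elim conjE UnE; simp)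

lemma finite_ext_set: "finite C ==> finite (verts G) ==> finite (ext_set F S C G g)"
 by (rule finite_subset[OF _ finite_PiE[of C "%_. verts G"]]) (simp_all add: ext_set_def Collect_mono_iff Collect_conj_eq)

lemma ext_set_split:
 assumes "C1 Int C2 = {}" "gedges F Int C1 \<times> C2 = {}" "wf_graph F"
 shows "card (ext_set F S (C1 Un C2) G g) = card (ext_set F S C1 G g) * card (ext_set F S C2 G g)"
proof -
 have sym: "adj F u v ==> adj F v u" for u v using assms(3) by (auto simp: wf_graph_def)
 have no: "~ adj F u v" "~ adj F v u" if "u \<in> C1" "v \<in> C2" for u v using assms(2) that sym by auto
 let ?m = "%(f1, f2). (%x. if x \<in> C1 then f1 x else f2 x :: nat)"
 have "bij_betw ?m (ext_set F S C1 G g \<times> ext_set F S C2 G g) (ext_set F S (C1 Un C2) G g)"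
 proof (rule bij_betwI[where g = "%f. (restrict f C1, restrict f C2)"])
  show "?m \<in> ext_set F S C1 G g \<times> ext_set F S C2 G g \<rightarrow> ext_set F S (C1 Un C2) G g"
  proof
   fix p assume "p \<in> ext_set F S C1 G g \<times> ext_set F S C2 G g"
   then obtain f1 f2 where p: "p = (f1, f2)" "f1 \<in> ext_set F S C1 G g" "f2 \<in> ext_set F S C2 G g" by auto
   have f1: "adj G (f1 u) (if v \<in> C1 then f1 v else g v)" if "adj F u v" "u \<in> C1" "v \<in> S Un C1" for u v
    using p(2) that by (simp add: ext_set_def)
   have f2: "adj G (f2 u) (if v \<in> C2 then f2 v else g v)" if "adj F u v" "u \<in> C2" "v \<in> S Un C2" for u v
    using p(3) that by (simp add: ext_set_def)
   have "?m p \<in> C1 Un C2 \<rightarrow>\<^sub>E verts G" using p assms(1) by (auto simp: ext_set_def PiE_iff extensional_def)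
   moreover have "adj G (?m p u) (if v \<in> C1 Un C2 then ?m p v else g v)" if uv: "adj F u v" "u \<in> C1 Un C2" "v \<in> S Un (C1 Un C2)" for u v
   proof (cases "u \<in> C1")
    case True
    then have "v ~: C2" using no uv by blast
    then show ?thesis using f1[of u v] p(1) True uv by (auto split: if_splits)
   next
    case False
    then have "u \<in> C2" "v ~: C1" using no uv by blast+
    then show ?thesis using f2[of u v] p(1) False uv by (auto split: if_splits)
   qed
   ultimately show "?m p \<in> ext_set F S (C1 Un C2) G g" unfolding ext_set_def by blast
  qed
  show "(%f. (restrict f C1, restrict f C2)) \<in> ext_set F S (C1 Un C2) G g \<rightarrow> ext_set F S C1 G g \<times> ext_set F S C2 G g"
  proof
   fix f assume f: "f \<in> ext_set F S (C1 Un C2) G g"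
   have fd: "f \<in> C1 Un C2 \<rightarrow>\<^sub>E verts G" and fe: "!!u v. adj F u v ==> u \<in> C1 Un C2 ==> v \<in> S Un (C1 Un C2) ==> adj G (f u) (if v \<in> C1 Un C2 then f v else g v)"
    using f by (simp_all add: ext_set_def)
   have "restrict f C1 \<in> ext_set F S C1 G g" unfolding ext_set_def
   proof (intro CollectI conjI allI impI)
    show "restrict f C1 \<in> C1 \<rightarrow>\<^sub>E verts G" using fd by (auto simp: PiE_iff)
    fix u v assume uv: "adj F u v & u \<in> C1 & v \<in> S Un C1"
    then have "v ~: C2" using no by blast
    then show "adj G (restrict f C1 u) (if v \<in> C1 then restrict f C1 v else g v)" using fe[of u v] uv by (auto split: if_splits)
   qed
   moreover have "restrict f C2 \<in> ext_set F S C2 G g" unfolding ext_set_def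
   proof (intro CollectI conjI allI impI)
    show "restrict f C2 \<in> C2 \<rightarrow>\<^sub>E verts G" using fd by (auto simp: PiE_iff)
    fix u v assume uv: "adj F u v & u \<in> C2 & v \<in> S Un C2"
    then have "v ~: C1" using no by blast
    then show "adj G (restrict f C2 u) (if v \<in> C2 then restrict f C2 v else g v)" using fe[of u v] uv by (auto split: if_splits)
   qed
   ultimately show "(restrict f C1, restrict f C2) \<in> ext_set F S C1 G g \<times> ext_set F S C2 G g" by simp
  qed
  show "(%f. (restrict f C1, restrict f C2)) (?m p) = p" if "p \<in> ext_set F S C1 G g \<times> ext_set F S C2 G g" for p
  proof -
   obtain f1 f2 where p: "p = (f1, f2)" "f1 \<in> ext_set F S C1 G g" "f2 \<in> ext_set F S C2 G g" using \<open>p \<in> _\<close> by auto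
   have "f1 \<in> extensional C1" "f2 \<in> extensional C2" using p by (auto simp: ext_set_def PiE_iff)
   then show ?thesis using assms(1) by (auto simp: p fun_eq_iff restrict_def extensional_def)
  qed
  show "?m ((%f. (restrict f C1, restrict f C2)) f) = f" if "f \<in> ext_set F S (C1 Un C2) G g" for f
   using that by (auto simp: ext_set_def PiE_iff extensional_def fun_eq_iff)
 qed
 from bij_betw_same_card[OF this] show ?thesis by (simp add: card_cartesian_product)
qed

lemma ext_set_add:
 assumes "v \<in> C" "v ~: S" "S Int C = {}" "simple_graph F" "finite C" "finite (verts G)" "wf_graph G"
 shows "card (ext_set F S C G g) =
  (\<Sum>x\<in>verts G. if \<forall>s\<in>S. adj F v s --> adj G x (g s) then card (ext_set F (insert v S) (C - {v}) G (g(v := x))) else 0)"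
proof -
 have symF: "adj F a b ==> adj F b a" "~ adj F a a" for a b using assms(4) by (auto simp: simple_graph_def wf_graph_def)
 have symG: "adj G a b ==> adj G b a" for a b using assms(7) by (auto simp: wf_graph_def)
 let ?Y = "{x \<in> verts G. \<forall>s\<in>S. adj F v s --> adj G x (g s)}"
 let ?S = "SIGMA x:?Y. ext_set F (insert v S) (C - {v}) G (g(v := x))"
 have "bij_betw (%(x, f). f(v := x)) ?S (ext_set F S C G g)"
 proof (rule bij_betwI[where g = "%f. (f v, f(v := undefined))"])
  show "(%(x, f). f(v := x)) \<in> ?S \<rightarrow> ext_set F S C G g"
  proof
   fix p assume "p \<in> ?S"
   then obtain x f where p: "p = (x, f)" "x \<in> verts G" "\<forall>s\<in>S. adj F v s --> adj G x (g s)"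
    "f \<in> ext_set F (insert v S) (C - {v}) G (g(v := x))" by auto
   have fd: "f \<in> C - {v} \<rightarrow>\<^sub>E verts G" and fe: "!!a b. adj F a b ==> a \<in> C - {v} ==> b \<in> insert v S Un (C - {v}) ==>
    adj G (f a) (if b \<in> C - {v} then f b else (g(v := x)) b)" using p(4) by (simp_all add: ext_set_def)
   have "f(v := x) \<in> C \<rightarrow>\<^sub>E verts G" using fd p(2) assms(1) by (auto simp: PiE_iff extensional_def)
   moreover have "adj G ((f(v := x)) a) (if b \<in> C then (f(v := x)) b else g b)" if ab: "adj F a b" "a \<in> C" "b \<in> S Un C" for a b
   proof (cases "a = v")
    case True
    show ?thesis
    proof (cases "b \<in> C")
     case bC: True
     have "b ~= v" using symF ab True by auto
     then have "adj G (f b) x" using fe[of b v] symF(1)[OF ab(1)] bC True by auto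
     then show ?thesis using True bC \<open>b ~= v\<close> symG by simp
    next
     case False
     then show ?thesis using True ab p(3) by auto
    qed
   next
    case False
    then show ?thesis using fe[of a b] ab assms(2) by (auto split: if_splits)
   qed
   ultimately show "(%(x, f). f(v := x)) p \<in> ext_set F S C G g" unfolding ext_set_def p by auto
  qed
  show "(%f. (f v, f(v := undefined))) \<in> ext_set F S C G g \<rightarrow> ?S"
  proof
   fix f assume "f \<in> ext_set F S C G g"
   then have fd: "f \<in> C \<rightarrow>\<^sub>E verts G" and fe: "!!a b. adj F a b ==> a \<in> C ==> b \<in> S Un C ==> adj G (f a) (if b \<in> C then f b else g b)"
    by (simp_all add: ext_set_def)
   have "adj G (f v) (g s)" if "s \<in> S" "adj F v s" for s
   proof -
    have "s ~: C" using that assms(3) by auto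
    then show ?thesis using fe[OF that(2) assms(1)] that by auto
   qed
   then have "f v \<in> ?Y" using fd assms(1) by auto
   moreover have "f(v := undefined) \<in> ext_set F (insert v S) (C - {v}) G (g(v := f v))" unfolding ext_set_def
   proof (intro CollectI conjI allI impI)
    show "f(v := undefined) \<in> C - {v} \<rightarrow>\<^sub>E verts G" using fd by (auto simp: PiE_iff extensional_def)
    fix a b assume "adj F a b & a \<in> C - {v} & b \<in> insert v S Un (C - {v})"
    then show "adj G ((f(v := undefined)) a) (if b \<in> C - {v} then (f(v := undefined)) b else (g(v := f v)) b)"
     using fe[of a b] assms(1) by (auto split: if_splits)
   qed
   ultimately show "(f v, f(v := undefined)) \<in> ?S" by simp
  qed
 qed (auto simp: ext_set_def PiE_iff extensional_def fun_eq_iff)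
 from bij_betw_same_card[OF this] have "card (ext_set F S C G g) = card ?S" by (rule sym)
 also have "... = (\<Sum>x\<in>?Y. card (ext_set F (insert v S) (C - {v}) G (g(v := x))))"
  using assms(5,6) by (intro card_SigmaI) (auto intro: finite_ext_set)
 also have "... = (\<Sum>x\<in>verts G. if \<forall>s\<in>S. adj F v s --> adj G x (g s) then card (ext_set F (insert v S) (C - {v}) G (g(v := x))) else 0)"
  using assms(6) by (simp add: sum.inter_filter)
 finally show ?thesis .
qed

text \<open>\<open>\<rho>\<close> stores the bag in variables below \<open>k\<close>. A bag with
  room leaves a variable for the new vertex; its possible images are matched type by type through
  \<open>same_type_counts\<close>, and adjacency to the bag is read off the type.\<close>

lemma ok_ext_set:
 assumes "ok (gedges F) k S C" "simple_graph F" "wf_graph G" "wf_graph H"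
  "inj_on \<rho> S" "\<rho> ` S \<subseteq> {..<k}" "S Int C = {}" "finite C" "finite S" "same_type k (\<rho> ` S) G \<alpha> H \<beta>"
 shows "card (ext_set F S C G (\<alpha> \<circ> \<rho>)) = card (ext_set F S C H (\<beta> \<circ> \<rho>))"
 using assms(1,5-)
proof (induction arbitrary: \<rho> \<alpha> \<beta> rule: ok.induct)
 case (ok_empty S)
 show ?case by (simp add: ext_set_def)
next
 case (ok_split S C1 C2)
 have "card (ext_set F S C1 G (\<alpha> \<circ> \<rho>)) = card (ext_set F S C1 H (\<beta> \<circ> \<rho>))" by (rule ok_split.IH(1)) (use ok_split.prems in auto)
 moreover have "card (ext_set F S C2 G (\<alpha> \<circ> \<rho>)) = card (ext_set F S C2 H (\<beta> \<circ> \<rho>))" by (rule ok_split.IH(2)) (use ok_split.prems in auto)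
 moreover have "wf_graph F" using assms(2) by (simp add: simple_graph_def)
 ultimately show ?case by (simp only: ext_set_split[OF ok_split.hyps(3,4)])
next
 case (ok_add v S C)
 have fin: "finite (verts G)" "finite (verts H)" using assms(3,4) by (auto simp: wf_graph_def)
 have "card (\<rho> ` S) < k" using ok_add card_image_le[of S \<rho>] by simp
 then have "~ {..<k} \<subseteq> \<rho> ` S" using ok_add.hyps(4) by (metis card_lessThan card_mono finite_imageI not_le)
 then obtain i where i: "i < k" "i ~: \<rho> ` S" by auto
 let ?\<rho> = "\<rho>(v := i)"
 have im: "?\<rho> ` insert v S = insert i (\<rho> ` S)" using ok_add.hyps(3) by (auto simp: image_iff)
 have upd: "(\<alpha>(i := x) \<circ> ?\<rho>) s = ((\<alpha> \<circ> \<rho>)(v := x)) s" if "s \<in> insert v S" for \<alpha> x s using that i by auto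
 show ?case
  unfolding ext_set_add[OF ok_add.hyps(2,3) ok_add.prems(3) assms(2) ok_add.prems(4) fin(1) assms(3)]
   ext_set_add[OF ok_add.hyps(2,3) ok_add.prems(3) assms(2) ok_add.prems(4) fin(2) assms(4)]
 proof (rule sum_by_type[OF fin, of "%x. ctype k (insert i (\<rho> ` S)) G (\<alpha>(i := x))" "%y. ctype k (insert i (\<rho> ` S)) H (\<beta>(i := y))"])
  show "card {x \<in> verts G. ctype k (insert i (\<rho> ` S)) G (\<alpha>(i := x)) = t} = card {y \<in> verts H. ctype k (insert i (\<rho> ` S)) H (\<beta>(i := y)) = t}" for t
   by (rule same_type_counts[OF ok_add.prems(6) i(1) fin])
  fix x y assume "ctype k (insert i (\<rho> ` S)) G (\<alpha>(i := x)) = ctype k (insert i (\<rho> ` S)) H (\<beta>(i := y))"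
  then have st: "same_type k (insert i (\<rho> ` S)) G (\<alpha>(i := x)) H (\<beta>(i := y))" by (simp add: same_type_ctype)
  have a: "adj G x ((\<alpha> \<circ> \<rho>) s) \<longleftrightarrow> adj H y ((\<beta> \<circ> \<rho>) s)" if s: "s \<in> S" for s
  proof -
   have "\<rho> s ~= i" "\<rho> s < k" using i s ok_add.prems(2) by auto
   then have "CAdj i (\<rho> s) \<in> cform_in k (insert i (\<rho> ` S))" using i s by (simp add: cform_in_def)
   then have "csat G (\<alpha>(i := x)) (CAdj i (\<rho> s)) = csat H (\<beta>(i := y)) (CAdj i (\<rho> s))" using st by (simp only: same_type_def)
   then show ?thesis using \<open>\<rho> s ~= i\<close> by simp
  qed
  have "card (ext_set F (insert v S) (C - {v}) G (\<alpha>(i := x) \<circ> ?\<rho>)) = card (ext_set F (insert v S) (C - {v}) H (\<beta>(i := y) \<circ> ?\<rho>))"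
  proof (rule ok_add.IH)
   show "inj_on ?\<rho> (insert v S)" using ok_add.prems(1) ok_add.hyps(3) i by (auto simp: inj_on_def)
   show "?\<rho> ` insert v S \<subseteq> {..<k}" unfolding im using i ok_add.prems(2) by auto
   show "same_type k (?\<rho> ` insert v S) G (\<alpha>(i := x)) H (\<beta>(i := y))" unfolding im by (rule st)
  qed (use ok_add in auto)
  then have "card (ext_set F (insert v S) (C - {v}) G ((\<alpha> \<circ> \<rho>)(v := x))) = card (ext_set F (insert v S) (C - {v}) H ((\<beta> \<circ> \<rho>)(v := y)))"
   by (simp only: ext_set_cong[OF upd])
  then show "(if \<forall>s\<in>S. adj F v s --> adj G x ((\<alpha> \<circ> \<rho>) s) then card (ext_set F (insert v S) (C - {v}) G ((\<alpha> \<circ> \<rho>)(v := x))) else 0) =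
   (if \<forall>s\<in>S. adj F v s --> adj H y ((\<beta> \<circ> \<rho>) s) then card (ext_set F (insert v S) (C - {v}) H ((\<beta> \<circ> \<rho>)(v := y))) else 0)"
  proof -
   have "(\<forall>s\<in>S. adj F v s --> adj G x ((\<alpha> \<circ> \<rho>) s)) \<longleftrightarrow> (\<forall>s\<in>S. adj F v s --> adj H y ((\<beta> \<circ> \<rho>) s))" using a by blast
   then show ?thesis using \<open>card (ext_set F (insert v S) (C - {v}) G ((\<alpha> \<circ> \<rho>)(v := x))) = _\<close> by (simp only:)
  qed
 qed
next
 case (ok_forget S' C S)
 have e: "ext_set F S C G g = ext_set F S' C G g" for G g unfolding ext_set_def
  using ok_forget.hyps(2,4) by (intro Collect_cong) blast
 have "card (ext_set F S' C G (\<alpha> \<circ> \<rho>)) = card (ext_set F S' C H (\<beta> \<circ> \<rho>))"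
 proof (rule ok_forget.IH)
  show "inj_on \<rho> S'" using ok_forget by (meson inj_on_subset)
  show "same_type k (\<rho> ` S') G \<alpha> H \<beta>" using ok_forget.prems(6) ok_forget.hyps(2) unfolding same_type_def cform_in_def by blast
  show "finite S'" using ok_forget.prems(5) ok_forget.hyps(2) finite_subset by blast
  show "\<rho> ` S' \<subseteq> {..<k}" using ok_forget.prems(2) ok_forget.hyps(2) by blast
 qed (use ok_forget in auto)
 then show ?case by (simp only: e)
qed

theorem ok_hom_eq:
 assumes "ok (gedges F) k {} (verts F)" "simple_graph F" "wf_graph G" "wf_graph H" "C_equiv k G H"
 shows "hom F G = hom F H"
proof -
 have wf: "wf_graph F" "finite (verts F)" using assms(2) by (auto simp: simple_graph_def wf_graph_def)
 have h: "hom F G = card (ext_set F {} (verts F) G g)" for G g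
 proof -
  have "{f. f \<in> verts F \<rightarrow>\<^sub>E verts G & (\<forall>u v. adj F u v --> adj G (f u) (f v))} = ext_set F {} (verts F) G g"
   unfolding ext_set_def using wf(1) by (intro Collect_cong) (auto simp: wf_graph_def)
  then show ?thesis by (simp add: hom_def)
 qed
 have "same_type k ((%_. 0 :: nat) ` {}) G (%_. undefined) H (%_. undefined)"
  using assms(5) by (simp add: same_type_def C_equiv_def C_sentence_def cform_in_def)
 then have "card (ext_set F {} (verts F) G ((%_. undefined) \<circ> (%_. 0 :: nat))) = card (ext_set F {} (verts F) H ((%_. undefined) \<circ> (%_. 0 :: nat)))"
  using wf by (rule_tac ok_ext_set[OF assms(1-4)]) auto
 then show ?thesis using h by metis
qed

section \<open>Constrained homomorphism counts\<close>

text \<open>For edge sets \<open>K\<close> and \<open>C\<close> of a graph these are the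
  homomorphisms from the graph that keeps the edges in \<open>K\<close> and contracts those in
  \<open>C\<close>, without forming the quotient.\<close>

definition homc_set :: "nat set => (nat \<times> nat) set => (nat \<times> nat) set => graph => (nat => nat) set" where
 "homc_set V K C G = {f \<in> V \<rightarrow>\<^sub>E verts G. (\<forall>(u, v)\<in>K. adj G (f u) (f v)) & (\<forall>(u, v)\<in>C. f u = f v)}"

definition homc :: "nat set => (nat \<times> nat) set => (nat \<times> nat) set => graph => nat" where
 "homc V K C G = card (homc_set V K C G)"

text \<open>The categorical product, on pairs coded as numbers because vertices have type
  \<open>nat\<close>.\<close>

definition prodg :: "graph => graph => graph" where
 "prodg G H = \<lparr> verts = prod_encode ` (verts G \<times> verts H),
  adj = (%x y. adj G (fst (prod_decode x)) (fst (prod_decode y)) & adj H (snd (prod_decode x)) (snd (prod_decode y))) \<rparr>"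

text \<open>Adjacency constraints are void in this graph, so as a factor it weighs a term according
  to \<open>C\<close> alone.\<close>

definition looped :: "nat => graph" where
 "looped n = \<lparr> verts = {..<n}, adj = (%x y. x < n & y < n) \<rparr>"

lemma wf_looped: "wf_graph (looped n)" by (auto simp: wf_graph_def looped_def)

lemma wf_prodg: assumes "wf_graph G" "wf_graph H" shows "wf_graph (prodg G H)"
proof -
 have "x \<in> prod_encode ` (verts G \<times> verts H)" if "fst (prod_decode x) \<in> verts G" "snd (prod_decode x) \<in> verts H" for x
  by (rule image_eqI[of _ _ "prod_decode x"]) (use that in \<open>auto simp: mem_Times_iff\<close>)
 then show ?thesis using assms unfolding wf_graph_def prodg_def by auto
qed

lemma simple_prodg: "simple_graph G ==> wf_graph H ==> simple_graph (prodg G H)"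
 using wf_prodg[of G H] by (auto simp: simple_graph_def prodg_def)

lemma simple_compl: "simple_graph G ==> simple_graph (compl_graph G)"
 by (auto simp: simple_graph_def wf_graph_def compl_graph_def)

lemma finite_homc_set: "finite V ==> finite (verts G) ==> finite (homc_set V K C G)"
 by (rule finite_subset[OF _ finite_PiE[of V "%_. verts G"]]) (auto simp: homc_set_def)

lemma homc_prodg:
 assumes "K \<subseteq> V \<times> V" "C \<subseteq> V \<times> V"
 shows "homc V K C (prodg G H) = homc V K C G * homc V K C H"
proof -
 let ?m = "%(f, g). restrict (%x. prod_encode (f x, g x)) V"
 let ?n = "%f. (restrict (%x. fst (prod_decode (f x))) V, restrict (%x. snd (prod_decode (f x))) V)"
 have "bij_betw ?m (homc_set V K C G \<times> homc_set V K C H) (homc_set V K C (prodg G H))"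
 proof (rule bij_betwI[where g = ?n])
  show "?m \<in> homc_set V K C G \<times> homc_set V K C H \<rightarrow> homc_set V K C (prodg G H)"
  proof
   fix p assume "p \<in> homc_set V K C G \<times> homc_set V K C H"
   then obtain f g where p: "p = (f, g)" "f \<in> homc_set V K C G" "g \<in> homc_set V K C H" by auto
   show "?m p \<in> homc_set V K C (prodg G H)" unfolding homc_set_def
   proof (intro CollectI conjI ballI)
    show "?m p \<in> V \<rightarrow>\<^sub>E verts (prodg G H)" using p by (auto simp: homc_set_def PiE_iff prodg_def)
    fix e assume e: "e \<in> K"
    then obtain u v where uv: "e = (u, v)" "u \<in> V" "v \<in> V" using assms by auto
    then show "case e of (u, v) => adj (prodg G H) (?m p u) (?m p v)" using p e by (auto simp: homc_set_def prodg_def)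
   next
    fix e assume e: "e \<in> C"
    then obtain u v where uv: "e = (u, v)" "u \<in> V" "v \<in> V" using assms by auto
    then show "case e of (u, v) => ?m p u = ?m p v" using p e by (auto simp: homc_set_def)
   qed
  qed
  show "?n \<in> homc_set V K C (prodg G H) \<rightarrow> homc_set V K C G \<times> homc_set V K C H"
  proof
   fix f assume f: "f \<in> homc_set V K C (prodg G H)"
   have fv: "fst (prod_decode (f x)) \<in> verts G" "snd (prod_decode (f x)) \<in> verts H" if "x \<in> V" for x
    using f that by (auto simp: homc_set_def PiE_iff prodg_def)
   have fk: "adj G (fst (prod_decode (f u))) (fst (prod_decode (f v)))" "adj H (snd (prod_decode (f u))) (snd (prod_decode (f v)))" if "(u, v) \<in> K" for u v
    using f that by (auto simp: homc_set_def prodg_def)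
   have fc: "f u = f v" if "(u, v) \<in> C" for u v using f that by (auto simp: homc_set_def)
   show "?n f \<in> homc_set V K C G \<times> homc_set V K C H"
    using assms fv fk fc unfolding homc_set_def by (fastforce simp: subset_iff)
  qed
  show "?n (?m p) = p" if "p \<in> homc_set V K C G \<times> homc_set V K C H" for p
   using that by (auto simp: homc_set_def PiE_iff extensional_def fun_eq_iff restrict_def)
  show "?m (?n f) = f" if "f \<in> homc_set V K C (prodg G H)" for f
   using that by (auto simp: homc_set_def PiE_iff extensional_def fun_eq_iff restrict_def)
 qed
 from bij_betw_same_card[OF this] show ?thesis by (simp add: homc_def card_cartesian_product)
qed

lemma homc_looped: "K \<subseteq> V \<times> V ==> homc V K C (looped n) = homc V {} C (looped n)"
proof -
 assume "K \<subseteq> V \<times> V"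
 then have "homc_set V K C (looped n) = homc_set V {} C (looped n)"
  unfolding homc_set_def by (intro Collect_cong) (auto simp: looped_def PiE_iff)
 then show ?thesis by (simp add: homc_def)
qed

text \<open>One orientation per edge, so that inclusion-exclusion meets each edge once.\<close>

definition up_edges :: "graph => (nat \<times> nat) set" where
 "up_edges F = {(u, v). adj F u v & u < v}"

lemma up_edges_sub: "wf_graph F ==> up_edges F \<subseteq> verts F \<times> verts F"
 by (auto simp: up_edges_def wf_graph_def)

lemma finite_up_edges: "wf_graph F ==> finite (up_edges F)"
 using up_edges_sub[of F] finite_subset by (auto simp: wf_graph_def)

lemma hom_homc:
 assumes "simple_graph F" "wf_graph G"
 shows "hom F G = homc (verts F) (up_edges F) {} G"
proof -
 have sy: "adj G x y ==> adj G y x" for x y using assms(2) by (auto simp: wf_graph_def)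
 have F: "adj F u v ==> adj F v u" "~ adj F u u" for u v using assms(1) by (auto simp: simple_graph_def wf_graph_def)
 have "(\<forall>u v. adj F u v --> adj G (f u) (f v)) \<longleftrightarrow> (\<forall>(u, v)\<in>up_edges F. adj G (f u) (f v))" for f
 proof
  assume a: "\<forall>(u, v)\<in>up_edges F. adj G (f u) (f v)"
  show "\<forall>u v. adj F u v --> adj G (f u) (f v)"
  proof (intro allI impI)
   fix u v assume uv: "adj F u v"
   then have "u < v \<or> v < u" using F(2) by (metis nat_neq_iff)
   then show "adj G (f u) (f v)"
   proof
    assume "u < v" then show ?thesis using a uv by (auto simp: up_edges_def)
   next
    assume "v < u" then have "adj G (f v) (f u)" using a F(1)[OF uv] by (auto simp: up_edges_def)
    then show ?thesis by (rule sy)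
   qed
  qed
 qed (auto simp: up_edges_def)
 then show ?thesis by (simp add: hom_def homc_def homc_set_def)
qed

lemma prod_one_minus:
 fixes x :: "'a => int"
 assumes "finite A"
 shows "(\<Prod>e\<in>A. 1 - x e) = (\<Sum>S\<in>Pow A. (-1) ^ card S * (\<Prod>e\<in>S. x e))"
 using assms
proof (induction A rule: finite_induct)
 case (insert a A)
 let ?g = "%S. (-1) ^ card S * (\<Prod>e\<in>S. x e)"
 have inj: "inj_on (insert a) (Pow A)" using insert(2) by (auto simp: inj_on_def)
 have "(\<Sum>S\<in>Pow (insert a A). ?g S) = (\<Sum>S\<in>Pow A. ?g S) + (\<Sum>S\<in>insert a ` Pow A. ?g S)"
  unfolding Pow_insert using insert(1,2) by (subst sum.union_disjoint) auto
 also have "(\<Sum>S\<in>insert a ` Pow A. ?g S) = (\<Sum>S\<in>Pow A. ?g (insert a S))" using inj by (simp add: sum.reindex)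
 also have "... = (\<Sum>S\<in>Pow A. - x a * ?g S)"
 proof (rule sum.cong)
  fix S assume S: "S \<in> Pow A"
  then have "finite S" "a ~: S" using insert(1,2) finite_subset by auto
  then show "?g (insert a S) = - x a * ?g S" by simp
 qed simp
 also have "... = - x a * (\<Sum>S\<in>Pow A. ?g S)" by (simp add: sum_distrib_left)
 finally show ?case using insert by (simp add: algebra_simps)
qed simp

lemma prod_of_bool: "finite A ==> (\<Prod>e\<in>A. of_bool (P e) :: int) = of_bool (\<forall>e\<in>A. P e)"
 by (induction A rule: finite_induct) auto

lemma card_eq_sum_prod:
 assumes "finite X" "finite A"
 shows "(\<Sum>f\<in>X. \<Prod>e\<in>A. of_bool (P f e) :: int) = int (card {f \<in> X. \<forall>e\<in>A. P f e})"
proof -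
 have "(\<Prod>e\<in>A. of_bool (P f e) :: int) = of_bool (\<forall>e\<in>A. P f e)" for f
  using assms(2) by (rule prod_of_bool)
 then have "(\<Sum>f\<in>X. \<Prod>e\<in>A. of_bool (P f e) :: int) = (\<Sum>f\<in>X. of_bool (\<forall>e\<in>A. P f e))" by simp
 also have "... = int (card (X Int {f. \<forall>e\<in>A. P f e}))" using assms(1) by (simp add: sum_of_bool_eq)
 also have "X Int {f. \<forall>e\<in>A. P f e} = {f \<in> X. \<forall>e\<in>A. P f e}" by auto
 finally show ?thesis .
qed

text \<open>Images are adjacent in the complement iff they are neither equal nor adjacent. The
  indicator is \<open>(1 - equal) * (1 - adjacent)\<close>, and both products over the edges of
  \<open>F\<close> are expanded, equality giving \<open>C\<close> and adjacency giving
  \<open>K\<close>.\<close>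

lemma hom_compl_expand:
 assumes F: "simple_graph F" and G: "simple_graph G"
 shows "int (hom F (compl_graph G)) =
  (\<Sum>C\<in>Pow (up_edges F). \<Sum>K\<in>Pow (up_edges F). (-1) ^ (card C + card K) * int (homc (verts F) K C G))"
proof -
 let ?V = "verts F" and ?A = "up_edges F"
 have wF: "wf_graph F" and wG: "wf_graph G" "finite (verts G)" and fV: "finite ?V"
  using F G by (auto simp: simple_graph_def wf_graph_def)
 have fA: "finite ?A" by (rule finite_up_edges[OF wF])
 let ?X = "?V \<rightarrow>\<^sub>E verts G"
 have fX: "finite ?X" using fV wG by (auto intro: finite_PiE)
 let ?a = "%f e. of_bool (adj G (f (fst e)) (f (snd e))) :: int" and ?d = "%f e. of_bool (f (fst e) = f (snd e)) :: int"
 have wC: "wf_graph (compl_graph G)" using simple_compl[OF G] by (simp add: simple_graph_def)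
 have "homc_set ?V ?A {} (compl_graph G) = {f \<in> ?X. \<forall>e\<in>?A. f (fst e) ~= f (snd e) & ~ adj G (f (fst e)) (f (snd e))}"
 proof -
  have "(\<forall>(u, v)\<in>?A. adj (compl_graph G) (f u) (f v)) \<longleftrightarrow> (\<forall>e\<in>?A. f (fst e) ~= f (snd e) & ~ adj G (f (fst e)) (f (snd e)))"
   if "f \<in> ?X" for f using that up_edges_sub[OF wF] by (fastforce simp: compl_graph_def PiE_iff)
  then show ?thesis unfolding homc_set_def by (auto simp: compl_graph_def)
 qed
 then have "int (hom F (compl_graph G)) = (\<Sum>f\<in>?X. \<Prod>e\<in>?A. of_bool (f (fst e) ~= f (snd e) & ~ adj G (f (fst e)) (f (snd e))))"
  unfolding hom_homc[OF F wC] homc_def card_eq_sum_prod[OF fX fA] by simp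
 also have "... = (\<Sum>f\<in>?X. (\<Prod>e\<in>?A. 1 - ?d f e) * (\<Prod>e\<in>?A. 1 - ?a f e))"
  by (intro sum.cong refl) (auto simp: prod.distrib[symmetric] of_bool_def intro!: prod.cong)
 also have "... = (\<Sum>f\<in>?X. \<Sum>C\<in>Pow ?A. \<Sum>K\<in>Pow ?A. (-1) ^ (card C + card K) * ((\<Prod>e\<in>K. ?a f e) * (\<Prod>e\<in>C. ?d f e)))"
  by (simp add: prod_one_minus[OF fA] sum_product power_add algebra_simps)
 also have "... = (\<Sum>C\<in>Pow ?A. \<Sum>K\<in>Pow ?A. (-1) ^ (card C + card K) * (\<Sum>f\<in>?X. (\<Prod>e\<in>K. ?a f e) * (\<Prod>e\<in>C. ?d f e)))"
  by (subst sum.swap, intro sum.cong refl, subst sum.swap) (simp add: sum_distrib_left)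
 also have "... = (\<Sum>C\<in>Pow ?A. \<Sum>K\<in>Pow ?A. (-1) ^ (card C + card K) * int (homc ?V K C G))"
 proof (intro sum.cong refl arg_cong2[of _ _ _ _ "(*)"])
  fix C K assume CK: "C \<in> Pow ?A" "K \<in> Pow ?A"
  then have fin: "finite C" "finite K" using fA finite_subset by auto
  have "(\<Prod>e\<in>K. ?a f e) = of_bool (\<forall>e\<in>K. adj G (f (fst e)) (f (snd e)))" for f by (rule prod_of_bool[OF fin(2)])
  moreover have "(\<Prod>e\<in>C. ?d f e) = of_bool (\<forall>e\<in>C. f (fst e) = f (snd e))" for f :: "nat => nat" by (rule prod_of_bool[OF fin(1)])
  ultimately have "(\<Sum>f\<in>?X. (\<Prod>e\<in>K. ?a f e) * (\<Prod>e\<in>C. ?d f e)) = (\<Sum>f\<in>?X. of_bool ((\<forall>e\<in>K. adj G (f (fst e)) (f (snd e))) & (\<forall>e\<in>C. f (fst e) = f (snd e))))"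
   by (intro sum.cong refl) (simp only: of_bool_conj)
  also have "... = int (card (?X Int {f. (\<forall>e\<in>K. adj G (f (fst e)) (f (snd e))) & (\<forall>e\<in>C. f (fst e) = f (snd e))}))" using fX by (simp add: sum_of_bool_eq)
  also have "?X Int {f. (\<forall>e\<in>K. adj G (f (fst e)) (f (snd e))) & (\<forall>e\<in>C. f (fst e) = f (snd e))} = homc_set ?V K C G"
   by (auto simp: homc_set_def split_beta)
  finally show "(\<Sum>f\<in>?X. (\<Prod>e\<in>K. ?a f e) * (\<Prod>e\<in>C. ?d f e)) = int (homc ?V K C G)" by (simp add: homc_def)
 qed
 finally show ?thesis .
qed

text \<open>Applied after division by a power of \<open>n\<close> that bounds all terms except the
  two leading ones.\<close>

lemma bounded_quadratic_zero:
 fixes A B c :: real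
 assumes "!!n :: nat. n >= 1 ==> \<bar>A * real n ^ 2 + B * real n\<bar> <= c"
 shows "A = 0 & B = 0"
proof -
 have lim: "(%n. x + y / real n) \<longlonglongrightarrow> x" for x y :: real
  using tendsto_add[OF tendsto_const[of x] lim_const_over_n[of y]] by simp
 have B0: "b = 0" if b: "!!n :: nat. n >= 1 ==> \<bar>b\<bar> <= c' / real n" for b c' :: real
 proof -
  have "(%n. \<bar>b\<bar>) \<longlonglongrightarrow> \<bar>b\<bar>" by simp
  moreover have "(%n. 0 + c' / real n) \<longlonglongrightarrow> 0" by (rule lim)
  ultimately have "\<bar>b\<bar> <= 0" by (rule LIMSEQ_le) (use b in \<open>auto intro!: exI[of _ 1]\<close>)
  then show ?thesis by simp
 qed
 have A: "A = 0"
 proof (rule B0[of A "c + \<bar>B\<bar>"])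
  fix n :: nat assume n: "n >= 1"
  have "\<bar>A\<bar> * real n ^ 2 <= \<bar>A * real n ^ 2 + B * real n\<bar> + \<bar>B * real n\<bar>" using abs_triangle_ineq4[of "A * real n ^ 2 + B * real n" "B * real n"] by (simp add: abs_mult)
  also have "... <= c + \<bar>B\<bar> * real n" using assms[OF n] by (simp add: abs_mult)
  also have "c * 1 <= c * real n" using n assms[OF n] by (intro mult_left_mono) auto
  then have "c + \<bar>B\<bar> * real n <= (c + \<bar>B\<bar>) * real n" by (simp add: distrib_right)
  finally have "(\<bar>A\<bar> * real n) * real n <= (c + \<bar>B\<bar>) * real n" by (simp add: power2_eq_square)
  then have "\<bar>A\<bar> * real n <= c + \<bar>B\<bar>" using n by (simp add: mult_le_cancel_right)
  then show "\<bar>A\<bar> <= (c + \<bar>B\<bar>) / real n" using n by (simp add: field_simps)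
 qed
 have "B = 0"
 proof (rule B0[of B c])
  fix n :: nat assume n: "n >= 1"
  have "\<bar>B\<bar> * real n <= c" using assms[OF n] A by (simp add: abs_mult)
  then show "\<bar>B\<bar> <= c / real n" using n by (simp add: field_simps)
 qed
 then show ?thesis using A by simp
qed

text \<open>In the looped graph the count is \<open>n\<close> to the number of classes generated by
  \<open>C\<close>. Extracting two coefficients takes only the exact exponents for no edge and one
  edge, and a loss of at least two for two distinct edges.\<close>

lemma homc_loop_count:
 assumes "finite V"
 shows "homc V {} {} (looped n) = n ^ card V"
  "(a, b) \<in> V \<times> V ==> a ~= b ==> homc V {} {(a, b)} (looped n) = n ^ (card V - 1)"
  "{(a, b), (c, d)} \<subseteq> C ==> {a, b, c, d} \<subseteq> V ==> a < b ==> c < d ==> (a, b) ~= (c, d) ==> homc V {} C (looped n) <= n ^ (card V - 2)"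
proof -
 have "homc_set V {} {} (looped n) = V \<rightarrow>\<^sub>E {..<n}" by (auto simp: homc_set_def looped_def)
 then show "homc V {} {} (looped n) = n ^ card V" using assms by (simp add: homc_def card_PiE)
 have inj: "card X <= n ^ (card V - card W)" if X: "X \<subseteq> V \<rightarrow>\<^sub>E {..<n}" "W \<subseteq> V"
  and d: "!!f g. f \<in> X ==> g \<in> X ==> (!!x. x \<in> V - W ==> f x = g x) ==> (!!x. x \<in> W ==> f x = g x)" for X W
 proof -
  have "inj_on (%f. restrict f (V - W)) X"
  proof (rule inj_onI)
   fix f g assume fg: "f \<in> X" "g \<in> X" "restrict f (V - W) = restrict g (V - W)"
   then have e: "f x = g x" if "x \<in> V - W" for x using that by (metis restrict_apply')
   have "f x = g x" if "x \<in> V" for x using d[OF fg(1,2) e, of x] e[of x] that by blast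
   then show "f = g" using fg X(1) by (intro PiE_ext[of f V "%_. {..<n}" g]) auto
  qed
  moreover have "(%f. restrict f (V - W)) ` X \<subseteq> V - W \<rightarrow>\<^sub>E {..<n}"
  proof (rule image_subsetI)
   fix f assume "f \<in> X"
   then have "f \<in> V \<rightarrow>\<^sub>E {..<n}" using X(1) by blast
   then have "f x \<in> {..<n}" if "x \<in> V - W" for x using PiE_mem[of f V "%_. {..<n}" x] that by simp
   then show "restrict f (V - W) \<in> V - W \<rightarrow>\<^sub>E {..<n}" by (rule restrict_PiE_iff[THEN iffD2, OF ballI])
  qed
  moreover have "finite (V - W \<rightarrow>\<^sub>E {..<n})" using assms by (auto intro: finite_PiE)
  ultimately have "card X <= card (V - W \<rightarrow>\<^sub>E {..<n})" by (metis card_image card_mono)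
  also have "... = n ^ (card V - card W)" using assms X(2) by (simp add: card_PiE card_Diff_subset finite_subset)
  finally show ?thesis .
 qed
 show "homc V {} {(a, b)} (looped n) = n ^ (card V - 1)" if ab: "(a, b) \<in> V \<times> V" "a ~= b"
 proof -
  have "bij_betw (%f. restrict f (V - {b})) (homc_set V {} {(a, b)} (looped n)) (V - {b} \<rightarrow>\<^sub>E {..<n})"
  proof (rule bij_betwI[where g = "%f. f(b := f a)"])
   show "(%f. restrict f (V - {b})) (f(b := f a)) = f" if "f \<in> V - {b} \<rightarrow>\<^sub>E {..<n}" for f
    using that by (auto simp: PiE_iff extensional_def fun_eq_iff restrict_def)
  qed (use ab in \<open>auto simp: homc_set_def looped_def PiE_iff extensional_def fun_eq_iff restrict_def\<close>)
  from bij_betw_same_card[OF this] show ?thesis using assms ab by (simp add: homc_def card_PiE)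
 qed
 show "homc V {} C (looped n) <= n ^ (card V - 2)" if C: "{(a, b), (c, d)} \<subseteq> C" "{a, b, c, d} \<subseteq> V" "a < b" "c < d" "(a, b) ~= (c, d)"
 proof -
  let ?X = "homc_set V {} C (looped n)"
  have X: "?X \<subseteq> V \<rightarrow>\<^sub>E {..<n}" by (auto simp: homc_set_def looped_def)
  have f: "f a = f b" "f c = f d" if "f \<in> ?X" for f using that C(1) by (auto simp: homc_set_def)
  show ?thesis
  \<comment> \<open>Two coordinates are recovered from the others: the larger ends of the two edges
    if these differ, and otherwise \<open>b\<close> and \<open>c\<close>, which both follow from
    \<open>a\<close>.\<close>
  proof (cases "b = d")
   case False
   have "card ?X <= n ^ (card V - card {b, d})"
   proof (rule inj[OF X])
    show "{b, d} \<subseteq> V" using C by auto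
    fix h g x assume hg: "h \<in> ?X" "g \<in> ?X" "!!x. x \<in> V - {b, d} ==> h x = g x" "x \<in> {b, d}"
    have "h b = g b & h d = g d"
    proof (cases "a = d")
     case True
     then have "h c = g c" using hg(3)[of c] C by auto
     then show ?thesis using f[OF hg(1)] f[OF hg(2)] True by simp
    next
     case ad: False
     then have ha: "h a = g a" using hg(3)[of a] C by auto
     then have hb: "h b = g b" using f[OF hg(1)] f[OF hg(2)] by simp
     have "h c = g c"
     proof (cases "c = b")
      case cb: False
      then show ?thesis using hg(3)[of c] C by auto
     qed (use hb in simp)
     then show ?thesis using f[OF hg(1)] f[OF hg(2)] hb by simp
    qed
    then show "h x = g x" using hg(4) by auto
   qed
   then show ?thesis using False by (simp add: homc_def numeral_2_eq_2)
  next
   case True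
   have "card ?X <= n ^ (card V - card {b, c})"
   proof (rule inj[OF X])
    show "{b, c} \<subseteq> V" using C by auto
    fix h g x assume hg: "h \<in> ?X" "g \<in> ?X" "!!x. x \<in> V - {b, c} ==> h x = g x" "x \<in> {b, c}"
    have "a ~= c" using True C by auto
    then have "h a = g a" using hg(3)[of a] C by auto
    then have "h b = g b & h c = g c" using f[OF hg(1)] f[OF hg(2)] True by simp
    then show "h x = g x" using hg(4) by auto
   qed
   moreover have "b ~= c" using True C by auto
   ultimately show ?thesis by (simp add: homc_def numeral_2_eq_2)
  qed
 qed
qed

section \<open>Isolating coefficients\<close>

lemma sum_alternating:
 assumes "finite A" shows "(\<Sum>S\<in>Pow A. (-1) ^ card S :: int) = of_bool (A = {})"
proof -
 have "(\<Sum>S\<in>Pow A. (-1) ^ card S :: int) = (\<Prod>e\<in>A. 1 - 1)" using prod_one_minus[OF assms, of "%_. 1"] by simp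
 also have "... = of_bool (A = {})" using assms by (cases "A = {}") (auto simp: zero_power)
 finally show ?thesis .
qed

lemma sum_alternating_above:
 assumes "finite A"
 shows "(\<Sum>S\<in>Pow A. (-1) ^ card S * of_bool (X \<subseteq> S) :: int) = (-1) ^ card A * of_bool (X = A)"
proof (cases "X \<subseteq> A")
 case True
 have fin: "finite X" "finite (A - X)" using True assms finite_subset by auto
 have "{S \<in> Pow A. X \<subseteq> S} = (%K. X Un K) ` Pow (A - X)"
 proof (intro equalityI subsetI)
  fix S assume "S \<in> {S \<in> Pow A. X \<subseteq> S}"
  then show "S \<in> (%K. X Un K) ` Pow (A - X)" by (intro image_eqI[of _ _ "S - X"]) auto
 qed (use True in auto)
 moreover have "inj_on (%K. X Un K) (Pow (A - X))" by (auto simp: inj_on_def)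
 moreover have "(\<Sum>S\<in>Pow A. (-1) ^ card S * of_bool (X \<subseteq> S) :: int) = (\<Sum>S\<in>{S \<in> Pow A. X \<subseteq> S}. (-1) ^ card S)"
 proof -
  have "(\<Sum>S\<in>Pow A. (-1) ^ card S * of_bool (X \<subseteq> S) :: int) = (\<Sum>S\<in>Pow A. if X \<subseteq> S then (-1) ^ card S else 0)"
   by (intro sum.cong) auto
  also have "... = (\<Sum>S\<in>{S \<in> Pow A. X \<subseteq> S}. (-1) ^ card S)" by (rule sum.inter_filter[symmetric]) (use assms in simp)
  finally show ?thesis .
 qed
 ultimately have "(\<Sum>S\<in>Pow A. (-1) ^ card S * of_bool (X \<subseteq> S) :: int) = (\<Sum>K\<in>Pow (A - X). (-1) ^ card (X Un K))"
  by (simp add: sum.reindex)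
 also have "... = (\<Sum>K\<in>Pow (A - X). (-1) ^ card X * (-1) ^ card K)"
 proof (rule sum.cong)
  fix K assume "K \<in> Pow (A - X)"
  then have "card (X Un K) = card X + card K" using fin finite_subset by (intro card_Un_disjoint) auto
  then show "(-1 :: int) ^ card (X Un K) = (-1) ^ card X * (-1) ^ card K" by (simp add: power_add)
 qed simp
 also have "... = (-1) ^ card X * of_bool (A - X = {})" by (simp add: sum_distrib_left[symmetric] sum_alternating[OF fin(2)])
 also have "... = (-1) ^ card A * of_bool (X = A)" using True by auto
 finally show ?thesis .
next
 case False
 have "(\<Sum>S\<in>Pow A. (-1) ^ card S * of_bool (X \<subseteq> S) :: int) = 0" by (rule sum.neutral) (use False in auto)
 then show ?thesis using False by auto
qed

text \<open>The sign sum factors over the fibres of \<open>h\<close> above \<open>B\<close>; a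
  nonempty fibre contributes the signed count of its nonempty subsets, which is \<open>-1\<close>.
  So there is no cancellation once \<open>B\<close> is covered.\<close>

lemma sum_alternating_surj:
 assumes "finite A" "finite B"
 shows "(\<Sum>K\<in>Pow A. (-1) ^ card K * of_bool (h ` K = B) :: int) = (-1) ^ card B * of_bool (B \<subseteq> h ` A)"
 using assms
proof (induction A arbitrary: B rule: finite_induct)
 case empty then show ?case by (cases "B = {}") auto
next
 case (insert a A)
 let ?g = "%B K. (-1) ^ card K * of_bool (h ` K = B) :: int"
 have inj: "inj_on (insert a) (Pow A)" using insert(2) by (auto simp: inj_on_def)
 have "(\<Sum>S\<in>Pow (insert a A). ?g B S) = (\<Sum>S\<in>Pow A. ?g B S) + (\<Sum>S\<in>insert a ` Pow A. ?g B S)"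
  unfolding Pow_insert using insert(1,2) by (subst sum.union_disjoint) auto
 also have "(\<Sum>S\<in>insert a ` Pow A. ?g B S) = (\<Sum>S\<in>Pow A. ?g B (insert a S))" using inj by (simp add: sum.reindex)
 also have "... = (\<Sum>S\<in>Pow A. - of_bool (h a \<in> B) * (?g B S + ?g (B - {h a}) S))"
 proof (rule sum.cong)
  fix S assume S: "S \<in> Pow A"
  then have c: "card (insert a S) = Suc (card S)" using insert(1,2) finite_subset by (subst card_insert_disjoint) auto
  have "of_bool (insert (h a) (h ` S) = B) = (of_bool (h a \<in> B) * (of_bool (h ` S = B) + of_bool (h ` S = B - {h a})) :: int)"
  proof -
   have "of_bool (insert b X = B) = (of_bool (b \<in> B) * (of_bool (X = B) + of_bool (X = B - {b})) :: int)" for b X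
   proof (cases "b \<in> B")
    case True
    then have "insert b X = B \<longleftrightarrow> X = B \<or> X = B - {b}" "~ (X = B & X = B - {b})" by blast+
    then show ?thesis using True by (auto simp: of_bool_def)
   qed auto
   then show ?thesis .
  qed
  then show "?g B (insert a S) = - of_bool (h a \<in> B) * (?g B S + ?g (B - {h a}) S)" using c by (simp add: algebra_simps)
 qed simp
 also have "... = - of_bool (h a \<in> B) * ((\<Sum>S\<in>Pow A. ?g B S) + (\<Sum>S\<in>Pow A. ?g (B - {h a}) S))"
  by (simp only: sum_distrib_left[symmetric] sum.distrib)
 finally have e: "(\<Sum>S\<in>Pow (insert a A). ?g B S) =
  (\<Sum>S\<in>Pow A. ?g B S) + - of_bool (h a \<in> B) * ((\<Sum>S\<in>Pow A. ?g B S) + (\<Sum>S\<in>Pow A. ?g (B - {h a}) S))" .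
 show ?case
 proof (cases "h a \<in> B")
  case True
  have "(\<Sum>S\<in>Pow (insert a A). ?g B S) = - (\<Sum>S\<in>Pow A. ?g (B - {h a}) S)" using e True by simp
  also have "... = - ((-1) ^ card (B - {h a}) * of_bool (B - {h a} \<subseteq> h ` A))" using insert.IH[of "B - {h a}"] insert.prems by simp
  also have "card B = Suc (card (B - {h a}))" using True insert.prems by (metis card_Suc_Diff1)
  then have "- ((-1) ^ card (B - {h a}) * of_bool (B - {h a} \<subseteq> h ` A)) = ((-1) ^ card B * of_bool (B \<subseteq> h ` insert a A) :: int)"
   by (auto simp: of_bool_def)
  finally show ?thesis .
 next
  case False
  then have "B \<subseteq> h ` insert a A \<longleftrightarrow> B \<subseteq> h ` A" by auto
  then show ?thesis using e False insert.IH[OF insert.prems] by simp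
 qed
qed

definition nrm :: "(nat => nat) => nat \<times> nat => nat \<times> nat" where
 "nrm k = (%(u, v). (min (k u) (k v), max (k u) (k v)))"

definition subg :: "nat set => (nat \<times> nat) set => graph" where
 "subg S M = \<lparr> verts = S, adj = (%x y. x \<in> S & y \<in> S & (min x y, max x y) \<in> M) \<rparr>"

lemma wf_subg: "finite S ==> wf_graph (subg S M)"
 unfolding wf_graph_def subg_def by (simp add: min.commute max.commute)

lemma homc_subg:
 assumes "finite V" "finite W" "S \<subseteq> W" "K \<subseteq> V \<times> V"
 shows "int (homc V K C (subg S M)) =
  (\<Sum>k\<in>V \<rightarrow>\<^sub>E W. of_bool (\<forall>(u, v)\<in>C. k u = k v) * of_bool (k ` V \<subseteq> S) * of_bool (nrm k ` K \<subseteq> M))"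
proof -
 have fin: "finite (V \<rightarrow>\<^sub>E W)" using assms by (auto intro: finite_PiE)
 have e: "homc_set V K C (subg S M) = {k \<in> V \<rightarrow>\<^sub>E W. (\<forall>(u, v)\<in>C. k u = k v) & k ` V \<subseteq> S & nrm k ` K \<subseteq> M}" (is "?L = ?R")
 proof (intro equalityI subsetI)
  fix k assume k: "k \<in> ?L"
  then have "k \<in> V \<rightarrow>\<^sub>E S" "\<forall>(u, v)\<in>C. k u = k v" "\<forall>(u, v)\<in>K. (min (k u) (k v), max (k u) (k v)) \<in> M"
   by (auto simp: homc_set_def subg_def)
  then show "k \<in> ?R" using assms(3) by (auto simp: PiE_iff nrm_def)
 next
  fix k assume k: "k \<in> ?R"
  then have kS: "k \<in> V \<rightarrow>\<^sub>E S" by (auto simp: PiE_iff)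
  have "adj (subg S M) (k u) (k v)" if "(u, v) \<in> K" for u v
  proof -
   have "u \<in> V" "v \<in> V" using that assms(4) by auto
   then show ?thesis using k kS that by (auto simp: subg_def PiE_iff nrm_def image_subset_iff)
  qed
  then show "k \<in> ?L" using k kS unfolding homc_set_def by (auto simp: subg_def)
 qed
 have "(\<Sum>k\<in>V \<rightarrow>\<^sub>E W. of_bool (\<forall>(u, v)\<in>C. k u = k v) * of_bool (k ` V \<subseteq> S) * of_bool (nrm k ` K \<subseteq> M) :: int) =
  (\<Sum>k\<in>V \<rightarrow>\<^sub>E W. of_bool ((\<forall>(u, v)\<in>C. k u = k v) & k ` V \<subseteq> S & nrm k ` K \<subseteq> M))"
  by (intro sum.cong refl) (simp only: of_bool_conj mult.assoc)
 also have "... = int (card ((V \<rightarrow>\<^sub>E W) Int {k. (\<forall>(u, v)\<in>C. k u = k v) & k ` V \<subseteq> S & nrm k ` K \<subseteq> M}))" using fin by (simp add: sum_of_bool_eq)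
 also have "(V \<rightarrow>\<^sub>E W) Int {k. (\<forall>(u, v)\<in>C. k u = k v) & k ` V \<subseteq> S & nrm k ` K \<subseteq> M} = ?R" by auto
 finally show ?thesis by (simp add: homc_def e)
qed

lemma sum_pairs: "(\<Sum>a\<in>A. \<Sum>b\<in>B. f a b) = (\<Sum>x\<in>A \<times> B. f (fst x) (snd x))"
 by (simp add: sum.cartesian_product split_beta)

lemma sum_swap4:
 fixes p :: "'a => 'b => int"
 shows "(\<Sum>S\<in>A. \<Sum>M\<in>B. p S M * (\<Sum>C\<in>D. \<Sum>K\<in>E. w C K * h C K S M)) = (\<Sum>C\<in>D. \<Sum>K\<in>E. w C K * (\<Sum>S\<in>A. \<Sum>M\<in>B. p S M * h C K S M))"
proof -
 have "(\<Sum>S\<in>A. \<Sum>M\<in>B. p S M * (\<Sum>C\<in>D. \<Sum>K\<in>E. w C K * h C K S M)) = (\<Sum>x\<in>A \<times> B. \<Sum>y\<in>D \<times> E. p (fst x) (snd x) * (w (fst y) (snd y) * h (fst y) (snd y) (fst x) (snd x)))"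
  by (simp only: sum_pairs[of _ E D] sum_pairs[of _ B A] sum_distrib_left)
 also have "... = (\<Sum>y\<in>D \<times> E. \<Sum>x\<in>A \<times> B. p (fst x) (snd x) * (w (fst y) (snd y) * h (fst y) (snd y) (fst x) (snd x)))" by (rule sum.swap)
 also have "... = (\<Sum>y\<in>D \<times> E. \<Sum>x\<in>A \<times> B. w (fst y) (snd y) * (p (fst x) (snd x) * h (fst y) (snd y) (fst x) (snd x)))" by (simp add: mult.left_commute)
 also have "... = (\<Sum>C\<in>D. \<Sum>K\<in>E. w C K * (\<Sum>S\<in>A. \<Sum>M\<in>B. p S M * h C K S M))"
  by (simp only: sum_pairs[of _ E D] sum_pairs[of _ B A] sum_distrib_left)
 finally show ?thesis .
qed

lemma sum_factor:
 fixes a :: "'k => int"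
 shows "(\<Sum>S\<in>A. \<Sum>M\<in>B. (p S * r M) * (\<Sum>k\<in>X. a k * s S k * m M k)) = (\<Sum>k\<in>X. a k * (\<Sum>S\<in>A. p S * s S k) * (\<Sum>M\<in>B. r M * m M k))"
proof -
 have "(\<Sum>S\<in>A. \<Sum>M\<in>B. (p S * r M) * (\<Sum>k\<in>X. a k * s S k * m M k)) = (\<Sum>S\<in>A. \<Sum>M\<in>B. \<Sum>k\<in>X. a k * ((p S * s S k) * (r M * m M k)))"
  unfolding sum_distrib_left by (simp add: mult_ac)
 also have "... = (\<Sum>S\<in>A. \<Sum>k\<in>X. \<Sum>M\<in>B. a k * ((p S * s S k) * (r M * m M k)))" by (intro sum.cong refl sum.swap)
 also have "... = (\<Sum>k\<in>X. \<Sum>S\<in>A. \<Sum>M\<in>B. a k * ((p S * s S k) * (r M * m M k)))" by (rule sum.swap)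
 also have "... = (\<Sum>k\<in>X. a k * (\<Sum>S\<in>A. p S * s S k) * (\<Sum>M\<in>B. r M * m M k))"
 proof (rule sum.cong[OF refl])
  fix k
  show "(\<Sum>S\<in>A. \<Sum>M\<in>B. a k * ((p S * s S k) * (r M * m M k))) = a k * (\<Sum>S\<in>A. p S * s S k) * (\<Sum>M\<in>B. r M * m M k)"
   unfolding mult.assoc[of "a k" "\<Sum>S\<in>A. p S * s S k"] sum_product by (simp only: sum_distrib_left)
 qed
 finally show ?thesis .
qed

text \<open>The free graph runs with signs through all \<open>subg S M\<close> inside the target
  \<open>T\<close>. This keeps exactly the maps \<open>k\<close> onto the vertices of
  \<open>T\<close> for which \<open>K\<close> covers exactly the edges of \<open>T\<close>, and
  there the coefficient is \<open>Ds\<close>. Summing over \<open>K\<close> gives the same sign for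
  every contributing \<open>k\<close>, so nothing cancels, and \<open>k0\<close> shows that a term
  is present.\<close>

lemma isolate_coefficient:
 fixes D :: "(nat \<times> nat) set => (nat \<times> nat) set => int"
 assumes F: "wf_graph F" and T: "wf_graph T" and CC: "CC \<subseteq> Pow (up_edges F)"
  and eq: "!!K0. wf_graph K0 ==> (\<Sum>C\<in>CC. \<Sum>K\<in>Pow (up_edges F). ((-1) ^ card K * D K C) * int (homc (verts F) K C K0)) = 0"
  and tight: "!!C K k. C \<in> CC ==> K \<subseteq> up_edges F ==> k \<in> verts F \<rightarrow>\<^sub>E verts T ==> (\<forall>(u, v)\<in>C. k u = k v) ==>
   k ` verts F = verts T ==> nrm k ` K = up_edges T ==> D K C = Ds"
  and ex: "C0 \<in> CC" "k0 \<in> verts F \<rightarrow>\<^sub>E verts T" "\<forall>(u, v)\<in>C0. k0 u = k0 v" "k0 ` verts F = verts T" "up_edges T \<subseteq> nrm k0 ` up_edges F"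
 shows "Ds = 0"
proof -
 let ?V = "verts F" and ?W = "verts T" and ?A = "up_edges F" and ?B = "up_edges T"
 have fin: "finite ?V" "finite ?W" "finite ?A" "finite ?B" using F T finite_up_edges by (auto simp: wf_graph_def)
 have fCC: "finite CC" using CC fin(3) finite_subset by auto
 let ?X = "?V \<rightarrow>\<^sub>E ?W"
 have fX: "finite ?X" using fin by (auto intro: finite_PiE)
 let ?a = "%C k. of_bool (\<forall>(u, v)\<in>C. k u = k v) :: int"
 let ?w = "%C K. (-1) ^ card K * D K C"
 let ?p = "%S M. (-1) ^ card S * (-1) ^ card M :: int"
 let ?h = "%C K S M. \<Sum>k\<in>?X. ?a C k * of_bool (k ` ?V \<subseteq> S) * of_bool (nrm k ` K \<subseteq> M)"
 have z: "(\<Sum>C\<in>CC. \<Sum>K\<in>Pow ?A. ?w C K * ?h C K S M) = 0" if "S \<in> Pow ?W" for S M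
 proof -
  have S: "S \<subseteq> ?W" "finite S" using that fin(2) finite_subset by auto
  have "(\<Sum>C\<in>CC. \<Sum>K\<in>Pow ?A. ?w C K * ?h C K S M) = (\<Sum>C\<in>CC. \<Sum>K\<in>Pow ?A. ?w C K * int (homc ?V K C (subg S M)))"
  proof (intro sum.cong refl arg_cong2[of _ _ _ _ "(*)"])
   fix C K assume "K \<in> Pow ?A"
   then have "K \<subseteq> ?V \<times> ?V" using up_edges_sub[OF F] by auto
   then show "?h C K S M = int (homc ?V K C (subg S M))" using homc_subg[OF fin(1,2) S(1)] by simp
  qed
  then show ?thesis using eq[OF wf_subg[OF S(2)]] by simp
 qed
 have "(\<Sum>S\<in>Pow ?W. \<Sum>M\<in>Pow ?B. ?p S M * (\<Sum>C\<in>CC. \<Sum>K\<in>Pow ?A. ?w C K * ?h C K S M)) = 0" using z by simp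
 then have 1: "(\<Sum>C\<in>CC. \<Sum>K\<in>Pow ?A. ?w C K * (\<Sum>S\<in>Pow ?W. \<Sum>M\<in>Pow ?B. ?p S M * ?h C K S M)) = 0" by (rule trans[OF sum_swap4[where p = ?p and w = ?w and h = ?h, symmetric]])
 let ?s = "(-1) ^ card ?W * (-1) ^ card ?B :: int"
 have inner: "(\<Sum>S\<in>Pow ?W. \<Sum>M\<in>Pow ?B. ?p S M * ?h C K S M) = ?s * (\<Sum>k\<in>?X. ?a C k * of_bool (k ` ?V = ?W) * of_bool (nrm k ` K = ?B))" for C K
 proof -
  have "(\<Sum>S\<in>Pow ?W. \<Sum>M\<in>Pow ?B. ?p S M * ?h C K S M) = (\<Sum>k\<in>?X. ?a C k * (\<Sum>S\<in>Pow ?W. (-1) ^ card S * of_bool (k ` ?V \<subseteq> S)) * (\<Sum>M\<in>Pow ?B. (-1) ^ card M * of_bool (nrm k ` K \<subseteq> M)))"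
   by (rule sum_factor[where A = "Pow ?W" and B = "Pow ?B" and X = ?X and a = "?a C" and p = "%S. (-1) ^ card S" and
    r = "%M. (-1) ^ card M" and s = "%S k. of_bool (k ` ?V \<subseteq> S)" and m = "%M k. of_bool (nrm k ` K \<subseteq> M)"])
  also have "... = (\<Sum>k\<in>?X. ?s * (?a C k * of_bool (k ` ?V = ?W) * of_bool (nrm k ` K = ?B)))"
   unfolding sum_alternating_above[OF fin(2)] sum_alternating_above[OF fin(4)] by (intro sum.cong refl) (simp only: mult_ac)
  finally show ?thesis by (simp only: sum_distrib_left)
 qed
 have "?s * (\<Sum>C\<in>CC. \<Sum>K\<in>Pow ?A. ?w C K * Z C K) = (\<Sum>C\<in>CC. \<Sum>K\<in>Pow ?A. ?w C K * (?s * Z C K))" for Z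
  unfolding sum_distrib_left by (intro sum.cong refl) (rule mult.left_commute)
 then have "?s * (\<Sum>C\<in>CC. \<Sum>K\<in>Pow ?A. ?w C K * (\<Sum>k\<in>?X. ?a C k * of_bool (k ` ?V = ?W) * of_bool (nrm k ` K = ?B))) = 0"
  using 1 unfolding inner by (simp only:)
 then have "(\<Sum>C\<in>CC. \<Sum>K\<in>Pow ?A. ?w C K * (\<Sum>k\<in>?X. ?a C k * of_bool (k ` ?V = ?W) * of_bool (nrm k ` K = ?B))) = 0" by simp
 moreover have "(\<Sum>C\<in>CC. \<Sum>K\<in>Pow ?A. ?w C K * (\<Sum>k\<in>?X. ?a C k * of_bool (k ` ?V = ?W) * of_bool (nrm k ` K = ?B))) =
  (\<Sum>C\<in>CC. \<Sum>K\<in>Pow ?A. \<Sum>k\<in>?X. Ds * (?a C k * of_bool (k ` ?V = ?W)) * ((-1) ^ card K * of_bool (nrm k ` K = ?B)))"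
  unfolding sum_distrib_left
 proof (intro sum.cong refl)
  fix C K k assume A: "C \<in> CC" "K \<in> Pow ?A" "k \<in> ?X"
  show "?w C K * (?a C k * of_bool (k ` ?V = ?W) * of_bool (nrm k ` K = ?B)) =
   Ds * (?a C k * of_bool (k ` ?V = ?W)) * ((-1) ^ card K * of_bool (nrm k ` K = ?B))"
  proof (cases "(\<forall>(u, v)\<in>C. k u = k v) & k ` ?V = ?W & nrm k ` K = ?B")
   case True
   then show ?thesis using tight[OF A(1) _ A(3)] A(2) by simp
  qed auto
 qed
 moreover have "... = (\<Sum>C\<in>CC. \<Sum>k\<in>?X. \<Sum>K\<in>Pow ?A. Ds * (?a C k * of_bool (k ` ?V = ?W)) * ((-1) ^ card K * of_bool (nrm k ` K = ?B)))"
  by (intro sum.cong refl sum.swap)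
 moreover have "... = (\<Sum>C\<in>CC. \<Sum>k\<in>?X. Ds * (?a C k * of_bool (k ` ?V = ?W)) * ((-1) ^ card ?B * of_bool (?B \<subseteq> nrm k ` ?A)))"
  by (simp only: sum_distrib_left[symmetric] sum_alternating_surj[OF fin(3,4)])
 moreover have "... = (Ds * (-1) ^ card ?B) * (\<Sum>C\<in>CC. \<Sum>k\<in>?X. of_bool ((\<forall>(u, v)\<in>C. k u = k v) & k ` ?V = ?W & ?B \<subseteq> nrm k ` ?A))"
  unfolding sum_distrib_left by (intro sum.cong refl) (simp only: of_bool_conj mult_ac)
 ultimately have 2: "(Ds * (-1) ^ card ?B) * (\<Sum>C\<in>CC. \<Sum>k\<in>?X. of_bool ((\<forall>(u, v)\<in>C. k u = k v) & k ` ?V = ?W & ?B \<subseteq> nrm k ` ?A)) = 0" by simp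
 have "(0 :: int) < (\<Sum>C\<in>CC. \<Sum>k\<in>?X. of_bool ((\<forall>(u, v)\<in>C. k u = k v) & k ` ?V = ?W & ?B \<subseteq> nrm k ` ?A))"
  (is "_ < (\<Sum>C\<in>CC. ?S C)")
 proof (rule sum_pos2[OF fCC ex(1)])
  show "0 < ?S C0" by (rule sum_pos2[OF fX ex(2)]) (use ex in auto)
  show "0 <= ?S C" for C by (rule sum_nonneg) simp
 qed
 then show ?thesis using 2 by simp
qed

section \<open>Relations closed under complements and under products\<close>

locale indist =
 fixes R :: "graph => graph => bool"
 assumes R_simple: "R G H ==> simple_graph G & simple_graph H"
  and R_compl: "R G H ==> R (compl_graph G) (compl_graph H)"
  and R_prod: "R G H ==> wf_graph K ==> R (prodg G K) (prodg H K)"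
begin

definition cl :: "graph => bool" where
 "cl F \<longleftrightarrow> simple_graph F & (\<forall>G H. R G H --> hom F G = hom F H)"

text \<open>The difference of the complement expansions for the products with \<open>K0\<close> and
  \<open>looped n\<close> vanishes for all \<open>n\<close>. The power \<open>n ^ card V\<close>
  belongs to \<open>C = {}\<close> and the next one to single edges. The single edges all carry the
  same power, so only their sum is obtained.\<close>

lemma key_equations:
 assumes F: "cl F" and GH: "R G H" and K0: "wf_graph K0" and ne: "up_edges F ~= {}"
 defines "T \<equiv> %C. \<Sum>K\<in>Pow (up_edges F). ((-1) ^ card K * (int (homc (verts F) K C G) - int (homc (verts F) K C H))) * int (homc (verts F) K C K0)"
 shows "T {} = 0" "(\<Sum>e\<in>up_edges F. T {e}) = 0"
proof -
 let ?V = "verts F" and ?A = "up_edges F"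
 have sF: "simple_graph F" "wf_graph F" using F by (auto simp: cl_def simple_graph_def)
 have fin: "finite ?V" "finite ?A" using sF finite_up_edges by (auto simp: wf_graph_def)
 have sub: "K \<subseteq> ?V \<times> ?V" if "K \<in> Pow ?A" for K using up_edges_sub[OF sF(2)] that by auto
 let ?a = "%C n. homc ?V {} C (looped n)"
 have eq0: "(\<Sum>C\<in>Pow ?A. (-1) ^ card C * T C * int (?a C n)) = 0" for n
 proof -
  let ?G = "%G. prodg (prodg G K0) (looped n)"
  have R: "R (?G G) (?G H)" using R_prod[OF R_prod[OF GH K0] wf_looped] .
  have s: "simple_graph (?G G)" "simple_graph (?G H)" using R_simple[OF R] by auto
  have "hom F (compl_graph (?G G)) = hom F (compl_graph (?G H))" using F R_compl[OF R] by (simp add: cl_def)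
  then have "(\<Sum>C\<in>Pow ?A. \<Sum>K\<in>Pow ?A. (-1) ^ (card C + card K) * int (homc ?V K C (?G G))) =
    (\<Sum>C\<in>Pow ?A. \<Sum>K\<in>Pow ?A. (-1) ^ (card C + card K) * int (homc ?V K C (?G H)))"
   using hom_compl_expand[OF sF(1) s(1)] hom_compl_expand[OF sF(1) s(2)] by simp
  then have "0 = (\<Sum>C\<in>Pow ?A. \<Sum>K\<in>Pow ?A. (-1) ^ (card C + card K) * (int (homc ?V K C (?G G)) - int (homc ?V K C (?G H))))"
   by (simp add: sum_subtractf right_diff_distrib)
  also have "... = (\<Sum>C\<in>Pow ?A. (-1) ^ card C * T C * int (?a C n))"
   unfolding T_def sum_distrib_left sum_distrib_right
  proof (intro sum.cong refl)
   fix C K assume CK: "C \<in> Pow ?A" "K \<in> Pow ?A"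
   have "homc ?V K C (?G G') = homc ?V K C G' * homc ?V K C K0 * ?a C n" for G'
    unfolding homc_prodg[OF sub[OF CK(2)] sub[OF CK(1)]] homc_looped[OF sub[OF CK(2)], of C n] ..
   then show "(-1) ^ (card C + card K) * (int (homc ?V K C (?G G)) - int (homc ?V K C (?G H))) =
    (-1) ^ card C * ((-1) ^ card K * (int (homc ?V K C G) - int (homc ?V K C H)) * int (homc ?V K C K0)) * int (?a C n)"
    by (simp add: power_add algebra_simps)
  qed
  finally show ?thesis by simp
 qed
 \<comment> \<open>An edge provides two vertices, so the exponent \<open>card ?V - 2\<close> used
   below is not truncated.\<close>
 obtain a0 b0 where ab0: "(a0, b0) \<in> ?A" using ne by auto
 then have "{a0, b0} \<subseteq> ?V" "a0 ~= b0" using sub[of ?A] by (auto simp: up_edges_def)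
 then have v2: "2 <= card ?V" using card_mono[OF fin(1), of "{a0, b0}"] by simp
 let ?R = "{C \<in> Pow ?A. 2 <= card C}"
 have split: "(\<Sum>C\<in>Pow ?A. f C) = f {} + (\<Sum>e\<in>?A. f {e}) + (\<Sum>C\<in>?R. f C)" for f :: "(nat \<times> nat) set => real"
 proof -
  have P: "Pow ?A = {{}} Un ((%e. {e}) ` ?A) Un ?R"
  proof (intro equalityI subsetI)
   fix C assume C: "C \<in> Pow ?A"
   then have fC: "finite C" using fin(2) finite_subset by auto
   consider "card C = 0" | "card C = 1" | "2 <= card C" by linarith
   then show "C \<in> {{}} Un ((%e. {e}) ` ?A) Un ?R"
   proof cases
    case 1 then show ?thesis using fC by simp
   next
    case 2 then show ?thesis using C by (auto simp: card_1_singleton_iff)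
   next
    case 3 then show ?thesis using C by simp
   qed
  qed auto
  have "sum f (Pow ?A) = sum f ({{}} Un ((%e. {e}) ` ?A) Un ?R)" by (rule arg_cong[OF P])
  also have "... = sum f ({{}} Un ((%e. {e}) ` ?A)) + sum f ?R"
   using fin(2) by (intro sum.union_disjoint) auto
  also have "sum f ({{}} Un ((%e. {e}) ` ?A)) = f {} + (\<Sum>e\<in>?A. f {e})"
   using fin(2) by (subst sum.union_disjoint) (auto simp: sum.reindex inj_on_def)
  finally show ?thesis .
 qed
 let ?t = "%C. real_of_int ((-1) ^ card C * T C)"
 let ?c = "\<Sum>C\<in>?R. \<bar>?t C\<bar>"
 have main: "real_of_int (T {}) = 0 & - real_of_int (\<Sum>e\<in>?A. T {e}) = 0"
 proof (rule bounded_quadratic_zero[of _ _ ?c])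
  fix n :: nat assume n: "n >= 1"
  have npos: "0 < real n ^ (card ?V - 2)" using n by simp
  obtain w where w: "card ?V = 2 + w" using v2 le_Suc_ex by blast
  have p1: "real n ^ card ?V = real n ^ 2 * real n ^ (card ?V - 2)" by (simp add: w power_add power2_eq_square)
  have p2: "real n ^ (card ?V - 1) = real n * real n ^ (card ?V - 2)"
   by (simp add: w)
  have "real_of_int (\<Sum>C\<in>Pow ?A. (-1) ^ card C * T C * int (?a C n)) = 0" using eq0[of n] by simp
  then have "(\<Sum>C\<in>Pow ?A. ?t C * real (?a C n)) = 0" by simp
  then have "?t {} * real (?a {} n) + (\<Sum>e\<in>?A. ?t {e} * real (?a {e} n)) + (\<Sum>C\<in>?R. ?t C * real (?a C n)) = 0"
   unfolding split .
  moreover have "real (?a {} n) = real n ^ card ?V" using homc_loop_count(1)[OF fin(1)] by simp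
  moreover have "real (?a {e} n) = real n ^ (card ?V - 1)" if "e \<in> ?A" for e
  proof -
   obtain a b where e: "e = (a, b)" by force
   have "(a, b) \<in> ?V \<times> ?V" "a ~= b" using that e up_edges_sub[OF sF(2)] by (auto simp: up_edges_def)
   then show ?thesis using homc_loop_count(2)[OF fin(1)] e by simp
  qed
  ultimately have "real_of_int (T {}) * real n ^ card ?V + (\<Sum>e\<in>?A. - real_of_int (T {e}) * real n ^ (card ?V - 1)) = - (\<Sum>C\<in>?R. ?t C * real (?a C n))"
   by simp
  then have "(real_of_int (T {}) * real n ^ 2 + - real_of_int (\<Sum>e\<in>?A. T {e}) * real n) * real n ^ (card ?V - 2) = - (\<Sum>C\<in>?R. ?t C * real (?a C n))"
  proof -
   have S: "(\<Sum>e\<in>?A. - real_of_int (T {e}) * x) = - real_of_int (\<Sum>e\<in>?A. T {e}) * x" for x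
    by (simp add: sum_distrib_right sum_negf)
   assume "real_of_int (T {}) * real n ^ card ?V + (\<Sum>e\<in>?A. - real_of_int (T {e}) * real n ^ (card ?V - 1)) = - (\<Sum>C\<in>?R. ?t C * real (?a C n))"
   then show ?thesis unfolding p1 p2 S by (simp only: distrib_right mult.assoc)
  qed
  from arg_cong[OF this, of abs]
  have "\<bar>real_of_int (T {}) * real n ^ 2 + - real_of_int (\<Sum>e\<in>?A. T {e}) * real n\<bar> * real n ^ (card ?V - 2) = \<bar>\<Sum>C\<in>?R. ?t C * real (?a C n)\<bar>"
   using npos by (simp only: abs_minus_cancel abs_mult abs_of_pos)
  also have "... <= (\<Sum>C\<in>?R. \<bar>?t C * real (?a C n)\<bar>)" by (rule sum_abs)
  also have "... <= (\<Sum>C\<in>?R. \<bar>?t C\<bar> * real n ^ (card ?V - 2))"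
  proof (rule sum_mono)
   fix C assume C: "C \<in> ?R"
   then have "finite C" "2 <= card C" using fin(2) finite_subset by auto
   then obtain x y where xy: "x \<in> C" "y \<in> C" "x ~= y" by (metis card_2_iff' obtain_subset_with_card_n subsetD)
   obtain a b c d where e: "x = (a, b)" "y = (c, d)" by force
   have "(a, b) \<in> ?A" "(c, d) \<in> ?A" using C xy e by auto
   then have "{a, b, c, d} \<subseteq> ?V" "a < b" "c < d" using up_edges_sub[OF sF(2)] by (auto simp: up_edges_def)
   then have "?a C n <= n ^ (card ?V - 2)" using homc_loop_count(3)[OF fin(1), of a b c d C n] xy e by auto
   then have "real (?a C n) <= real n ^ (card ?V - 2)" by (metis of_nat_le_iff of_nat_power)
   then show "\<bar>?t C * real (?a C n)\<bar> <= \<bar>?t C\<bar> * real n ^ (card ?V - 2)" by (simp only: abs_mult abs_of_nat) (rule mult_left_mono, auto)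
  qed
  also have "... = ?c * real n ^ (card ?V - 2)" by (simp add: sum_distrib_right)
  finally show "\<bar>real_of_int (T {}) * real n ^ 2 + - real_of_int (\<Sum>e\<in>?A. T {e}) * real n\<bar> <= ?c" by (rule mult_right_le_imp_le[OF _ npos])
 qed
 show "T {} = 0" "(\<Sum>e\<in>?A. T {e}) = 0" using main by (simp_all only: neg_equal_0_iff_equal of_int_eq_0_iff)
qed

end

section \<open>Minor closure\<close>

text \<open>\<open>k\<close> is a quotient map for \<open>C\<close>: it is constant on the classes,
  and \<open>tight\<close> says that its fibres are no larger than the classes. Constrained maps on
  \<open>V\<close> therefore are maps on \<open>verts T\<close>, and \<open>K\<close> imposes
  exactly the edges of \<open>T\<close>.\<close>

lemma homc_factor:
 assumes k: "k \<in> V \<rightarrow>\<^sub>E verts T" "k ` V = verts T" and K: "K \<subseteq> V \<times> V" "nrm k ` K = up_edges T" and T: "simple_graph T" and G: "wf_graph G"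
  and C: "C \<subseteq> V \<times> V" "\<forall>(u, v)\<in>C. k u = k v"
  and tight: "!!f :: nat => nat. \<forall>(u, v)\<in>C. f u = f v ==> \<forall>x\<in>V. \<forall>y\<in>V. k x = k y --> f x = f y"
 shows "homc V K C G = hom T G"
proof -
 let ?W = "verts T"
 have sy: "adj G x y ==> adj G y x" for x y using G by (auto simp: wf_graph_def)
 have kW: "k x \<in> ?W" if "x \<in> V" for x using k(2) that by auto
 define i where "i w = (SOME x. x \<in> V & k x = w)" for w
 have i: "i w \<in> V" "k (i w) = w" if "w \<in> ?W" for w
 proof -
  have "w \<in> k ` V" using that k(2) by simp
  then have "\<exists>x. x \<in> V & k x = w" by auto
  from someI_ex[OF this] show "i w \<in> V" "k (i w) = w" by (auto simp: i_def)
 qed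
 have "bij_betw (%g. restrict (g \<circ> k) V) (homc_set ?W (up_edges T) {} G) (homc_set V K C G)"
 proof (rule bij_betwI[where g = "%f. restrict (f \<circ> i) ?W"])
  show "(%g. restrict (g \<circ> k) V) \<in> homc_set ?W (up_edges T) {} G \<rightarrow> homc_set V K C G"
  proof
   fix g assume g: "g \<in> homc_set ?W (up_edges T) {} G"
   then have gW: "g w \<in> verts G" if "w \<in> ?W" for w using that by (auto simp: homc_set_def PiE_iff)
   have ge: "adj G (g x) (g y)" if "(x, y) \<in> up_edges T" for x y using g that by (auto simp: homc_set_def)
   have "adj G (g (k u)) (g (k v))" if "(u, v) \<in> K" for u v
   proof -
    have "nrm k (u, v) \<in> up_edges T" using K(2) that by blast
    then have "adj G (g (min (k u) (k v))) (g (max (k u) (k v)))" using ge by (simp add: nrm_def)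
    then show ?thesis using sy by (cases "k u <= k v") (auto simp: min_def max_def split: if_splits)
   qed
   moreover have "u \<in> V & v \<in> V" if "(u, v) \<in> K Un C" for u v using that K(1) C(1) by auto
   moreover have "k u = k v" if "(u, v) \<in> C" for u v using that C(2) by auto
   ultimately show "restrict (g \<circ> k) V \<in> homc_set V K C G" unfolding homc_set_def using gW kW by fastforce
  qed
  show "(%f. restrict (f \<circ> i) ?W) \<in> homc_set V K C G \<rightarrow> homc_set ?W (up_edges T) {} G"
  proof
   fix f assume f: "f \<in> homc_set V K C G"
   then have fV: "f x \<in> verts G" if "x \<in> V" for x using that by (auto simp: homc_set_def PiE_iff)
   have fk: "adj G (f u) (f v)" if "(u, v) \<in> K" for u v using f that by (auto simp: homc_set_def)
   have fC: "\<forall>(u, v)\<in>C. f u = f v" using f unfolding homc_set_def by blast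
   have ft: "f x = f y" if "x \<in> V" "y \<in> V" "k x = k y" for x y using tight[OF fC] that by blast
   have "adj G (f (i x)) (f (i y))" "x \<in> ?W" "y \<in> ?W" if xy: "(x, y) \<in> up_edges T" for x y
   proof -
    show W: "x \<in> ?W" "y \<in> ?W" using xy T by (auto simp: up_edges_def simple_graph_def wf_graph_def)
    obtain u v where uv: "(u, v) \<in> K" "nrm k (u, v) = (x, y)" using xy K(2) by (metis imageE prod.collapse)
    have V: "u \<in> V" "v \<in> V" using uv K(1) by auto
    have "k u = x & k v = y \<or> k u = y & k v = x" using uv(2) by (auto simp: nrm_def min_def max_def split: if_splits)
    then show "adj G (f (i x)) (f (i y))"
    proof
     assume "k u = x & k v = y"
     then have "f (i x) = f u" "f (i y) = f v" using ft[of "i x" u] ft[of "i y" v] V i[OF W(1)] i[OF W(2)] by auto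
     then show ?thesis using fk[OF uv(1)] by simp
    next
     assume "k u = y & k v = x"
     then have "f (i x) = f v" "f (i y) = f u" using ft[of "i x" v] ft[of "i y" u] V i[OF W(1)] i[OF W(2)] by auto
     then show ?thesis using fk[OF uv(1)] sy by simp
    qed
   qed
   then show "restrict (f \<circ> i) ?W \<in> homc_set ?W (up_edges T) {} G" unfolding homc_set_def using fV i by fastforce
  qed
  show "restrict (restrict (g \<circ> k) V \<circ> i) ?W = g" if "g \<in> homc_set ?W (up_edges T) {} G" for g
   using that i by (auto simp: homc_set_def PiE_iff extensional_def fun_eq_iff restrict_def)
  show "restrict (restrict (f \<circ> i) ?W \<circ> k) V = f" if f: "f \<in> homc_set V K C G" for f
  proof
   fix x
   have fC: "\<forall>(u, v)\<in>C. f u = f v" using f unfolding homc_set_def by blast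
   have "f (i (k x)) = f x" if "x \<in> V" using tight[OF fC] that i[OF kW[OF that]] by blast
   then show "restrict (restrict (f \<circ> i) ?W \<circ> k) V x = f x" using f kW by (auto simp: homc_set_def PiE_iff extensional_def restrict_def)
  qed
 qed
 from bij_betw_same_card[OF this] show ?thesis by (simp add: hom_homc[OF T G] homc_def)
qed

definition contract :: "graph => nat => nat => graph" where
 "contract F a b = \<lparr> verts = verts F - {b},
  adj = (%x y. x ~= y & (\<exists>u v. adj F u v & (if u = b then a else u) = x & (if v = b then a else v) = y)) \<rparr>"

context indist
begin

lemma R_wf: "R G H ==> wf_graph G & wf_graph H"
 using R_simple by (auto simp: simple_graph_def)

text \<open>The equation for \<open>C = {}\<close> is isolated at \<open>T\<close>: a map onto
  equally many vertices is a bijection, so every surviving \<open>K\<close> is a copy of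
  \<open>T\<close>.\<close>

lemma cl_delete:
 assumes F: "cl F" and T: "simple_graph T" "verts T = verts F" "!!u v. adj T u v ==> adj F u v"
 shows "cl T"
proof (cases "up_edges F = {}")
 case True
 have sF: "simple_graph F" using F by (simp add: cl_def)
 have "~ adj F u v" for u v
 proof
  assume uv: "adj F u v"
  then have "u ~= v" "adj F v u" using sF by (auto simp: simple_graph_def wf_graph_def)
  then have "u < v \<or> v < u" by (simp add: neq_iff)
  then show False using uv True \<open>adj F v u\<close> by (auto simp: up_edges_def)
 qed
 then have "adj T u v = adj F u v" for u v using T(3) by blast
 then have "hom T G = hom F G" for G by (simp add: hom_def T(2))
 then show ?thesis using F T by (simp add: cl_def)
next
 case False
 have sF: "simple_graph F" "wf_graph F" "finite (verts F)" using F by (auto simp: cl_def simple_graph_def wf_graph_def)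
 have wT: "wf_graph T" using T by (simp add: simple_graph_def)
 let ?V = "verts F"
 have "hom T G = hom T H" if GH: "R G H" for G H
 proof -
  have "int (hom T G) - int (hom T H) = 0"
  proof (rule isolate_coefficient[OF sF(2) wT, of "{{}}" "%K C. int (homc ?V K C G) - int (homc ?V K C H)"])
   show "(\<Sum>C\<in>{{}}. \<Sum>K\<in>Pow (up_edges F). ((-1) ^ card K * (int (homc ?V K C G) - int (homc ?V K C H))) * int (homc ?V K C K0)) = 0"
    if "wf_graph K0" for K0 using key_equations(1)[OF F GH that False] by simp
   fix C K k assume a: "C \<in> {{} :: (nat \<times> nat) set}" "K \<subseteq> up_edges F" "k \<in> ?V \<rightarrow>\<^sub>E verts T" "k ` ?V = verts T" "nrm k ` K = up_edges T"
   have "inj_on k ?V" using a(4) T(2) sF(3) by (metis eq_card_imp_inj_on)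
   then have "homc ?V K {} G' = hom T G'" if "wf_graph G'" for G'
    using a up_edges_sub[OF sF(2)] by (intro homc_factor[OF a(3,4) _ a(5) T(1) that]) (auto simp: inj_on_def)
   then show "int (homc ?V K C G) - int (homc ?V K C H) = int (hom T G) - int (hom T H)" using a(1) R_wf[OF GH] by simp
  next
   show "up_edges T \<subseteq> nrm (restrict id ?V) ` up_edges F"
   proof
    fix e assume e: "e \<in> up_edges T"
    then have "e \<in> up_edges F" using T(3) by (auto simp: up_edges_def)
    moreover have "nrm (restrict id ?V) e = e" using calculation up_edges_sub[OF sF(2)] by (auto simp: nrm_def up_edges_def)
    ultimately show "e \<in> nrm (restrict id ?V) ` up_edges F" by (metis image_eqI)
   qed
  qed (use T(2) in auto)
  then show ?thesis by simp
 qed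
 then show ?thesis using T(1) by (simp add: cl_def)
qed

lemma simple_contract:
 assumes "simple_graph F" "adj F a b"
 shows "simple_graph (contract F a b)"
proof -
 have wf: "adj F u v ==> u \<in> verts F & v \<in> verts F" "adj F u v ==> adj F v u" "~ adj F u u" "finite (verts F)" for u v
  using assms(1) by (auto simp: simple_graph_def wf_graph_def)
 then have "a ~= b" "a \<in> verts F" using assms(2) by auto
 then show ?thesis using wf unfolding simple_graph_def wf_graph_def contract_def by (auto; blast)
qed

text \<open>Only the sum over all single contractions is known, but that is enough: whichever edge
  \<open>(c, d)\<close> is contracted, a map onto one vertex fewer that identifies its ends is
  otherwise injective, so every surviving term has the count of the same graph.\<close>

lemma cl_contract:
 assumes F: "cl F" and ab: "adj F a b"
 shows "cl (contract F a b)"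
proof -
 let ?T = "contract F a b" and ?V = "verts F"
 have sF: "simple_graph F" "wf_graph F" "finite ?V" using F by (auto simp: cl_def simple_graph_def wf_graph_def)
 have ab': "a \<in> ?V" "b \<in> ?V" "a ~= b" "adj F b a" using ab sF by (auto simp: simple_graph_def wf_graph_def)
 have sT: "simple_graph ?T" using simple_contract[OF sF(1) ab] .
 then have wT: "wf_graph ?T" by (simp add: simple_graph_def)
 have vT: "verts ?T = ?V - {b}" by (simp add: contract_def)
 let ?e0 = "(min a b, max a b)"
 have e0: "?e0 \<in> up_edges F" using ab ab' by (auto simp: up_edges_def min_def max_def)
 let ?p = "%x. if x = b then a else x"
 have "hom ?T G = hom ?T H" if GH: "R G H" for G H
 proof -
  have "int (hom ?T G) - int (hom ?T H) = 0"
  proof (rule isolate_coefficient[OF sF(2) wT, of "(%e. {e}) ` up_edges F" "%K C. int (homc ?V K C G) - int (homc ?V K C H)"])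
   show "(\<Sum>C\<in>(%e. {e}) ` up_edges F. \<Sum>K\<in>Pow (up_edges F). ((-1) ^ card K * (int (homc ?V K C G) - int (homc ?V K C H))) * int (homc ?V K C K0)) = 0"
    if "wf_graph K0" for K0
    using key_equations(2)[OF F GH that] e0 by (subst sum.reindex) (auto simp: inj_on_def)
   fix C K k assume a: "C \<in> (%e. {e}) ` up_edges F" "K \<subseteq> up_edges F" "k \<in> ?V \<rightarrow>\<^sub>E verts ?T" "\<forall>(u, v)\<in>C. k u = k v" "k ` ?V = verts ?T" "nrm k ` K = up_edges ?T"
   obtain c d where cd: "C = {(c, d)}" "adj F c d" "c < d" using a(1) by (auto simp: up_edges_def)
   have cdV: "c \<in> ?V" "d \<in> ?V" using cd sF by (auto simp: wf_graph_def)
   have kcd: "k c = k d" using a(4) cd by auto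
   have "k ` (?V - {d}) = verts ?T"
   proof -
    have "k d \<in> k ` (?V - {d})" using kcd cdV cd(3) by (intro image_eqI[of _ _ c]) auto
    then have "k ` ?V \<subseteq> k ` (?V - {d})" by blast
    then show ?thesis using a(5) by blast
   qed
   moreover have "card (?V - {d}) = card (verts ?T)" using vT ab' cdV sF(3) by simp
   ultimately have inj: "inj_on k (?V - {d})" using sF(3) by (intro eq_card_imp_inj_on) auto
   have "homc ?V K C G' = hom ?T G'" if "wf_graph G'" for G'
   proof (rule homc_factor[OF a(3,5) _ a(6) sT that _ a(4)])
    show "K \<subseteq> ?V \<times> ?V" using a(2) up_edges_sub[OF sF(2)] by auto
    show "C \<subseteq> ?V \<times> ?V" using cd cdV by auto
    fix f :: "nat => nat" assume "\<forall>(u, v)\<in>C. f u = f v"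
    then have fcd: "f c = f d" using cd by auto
    have "f x = f y" if "x \<in> ?V" "y \<in> ?V" "k x = k y" for x y
    proof -
     define x' y' where "x' = (if x = d then c else x)" and "y' = (if y = d then c else y)"
     have "x' \<in> ?V - {d}" "y' \<in> ?V - {d}" "k x' = k y'" using that cdV cd kcd by (auto simp: x'_def y'_def)
     then have "x' = y'" using inj by (auto simp: inj_on_def)
     then show ?thesis using fcd by (auto simp: x'_def y'_def split: if_splits)
    qed
    then show "\<forall>x\<in>?V. \<forall>y\<in>?V. k x = k y --> f x = f y" by blast
   qed
   then show "int (homc ?V K C G) - int (homc ?V K C H) = int (hom ?T G) - int (hom ?T H)" using R_wf[OF GH] by simp
  next
   show "{?e0} \<in> (%e. {e}) ` up_edges F" using e0 by blast
   show "\<forall>(u, v)\<in>{?e0}. restrict ?p ?V u = restrict ?p ?V v" using ab' by (auto simp: min_def max_def)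
   show "restrict ?p ?V ` ?V = verts ?T" using ab' unfolding vT by (auto simp: image_iff)
   show "restrict ?p ?V \<in> ?V \<rightarrow>\<^sub>E verts ?T" using ab' unfolding vT by auto
   show "up_edges ?T \<subseteq> nrm (restrict ?p ?V) ` up_edges F"
   proof
    fix e assume "e \<in> up_edges ?T"
    then obtain x y u v where e: "e = (x, y)" "x < y" "adj F u v" "?p u = x" "?p v = y" by (auto simp: up_edges_def contract_def)
    have uv: "u \<in> ?V" "v \<in> ?V" "u ~= v" "adj F v u" using e sF by (auto simp: simple_graph_def wf_graph_def)
    have "nrm (restrict ?p ?V) (u, v) = e" "nrm (restrict ?p ?V) (v, u) = e" using e uv by (auto simp: nrm_def min_def max_def)
    moreover have "(u, v) \<in> up_edges F \<or> (v, u) \<in> up_edges F" using e uv by (auto simp: up_edges_def)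
    ultimately show "e \<in> nrm (restrict ?p ?V) ` up_edges F" by (elim disjE) (erule image_eqI[rotated], simp)+
   qed
  qed (use e0 in auto)
  then show ?thesis by simp
 qed
 then show ?thesis using sT by (simp add: cl_def)
qed

text \<open>One edge of \<open>C\<close> is contracted at a time and the other constraints are
  pushed to the contraction, dropping pairs of \<open>C\<close> whose ends have merged. If that edge
  also lies in \<open>K\<close>, both counts vanish because simple graphs have no loops. With
  \<open>C\<close> empty the count is that of a spanning subgraph.\<close>

theorem homc_closed:
 assumes "cl F" "R G H" "K \<subseteq> gedges F" "C \<subseteq> gedges F"
 shows "homc (verts F) K C G = homc (verts F) K C H"
 using assms(1,3,4)
proof (induction "card (verts F)" arbitrary: F K C rule: less_induct)
 case less
 let ?V = "verts F"
 have sF: "simple_graph F" "finite ?V" using less.prems by (auto simp: cl_def simple_graph_def wf_graph_def)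
 have w: "wf_graph G" "wf_graph H" and sGH: "simple_graph G" "simple_graph H" using R_wf[OF assms(2)] R_simple[OF assms(2)] by auto
 have Fa: "adj F u v ==> u \<in> ?V & v \<in> ?V" "adj F u v ==> adj F v u" "~ adj F u u" for u v using sF by (auto simp: simple_graph_def wf_graph_def)
 show ?case
 proof (cases "C = {}")
  case True
  define T where "T = \<lparr> verts = ?V, adj = (%x y. (x, y) \<in> K \<or> (y, x) \<in> K) \<rparr>"
  have sT: "simple_graph T" using sF(2) less.prems(2) Fa by (auto simp: simple_graph_def wf_graph_def T_def)
  have "cl T" by (rule cl_delete[OF less.prems(1) sT]) (use less.prems(2) Fa in \<open>auto simp: T_def\<close>)
  then have "hom T G = hom T H" using assms(2) by (simp add: cl_def)
  moreover have "homc ?V K C G' = hom T G'" if "wf_graph G'" for G'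
  proof -
   have "homc_set ?V K C G' = {f. f \<in> verts T \<rightarrow>\<^sub>E verts G' & (\<forall>u v. adj T u v --> adj G' (f u) (f v))}"
    unfolding homc_set_def True T_def using that by (intro Collect_cong) (auto simp: wf_graph_def)
   then show ?thesis by (simp add: homc_def hom_def)
  qed
  ultimately show ?thesis using w by simp
 next
  case False
  then obtain a b where ab: "(a, b) \<in> C" by auto
  then have adjab: "adj F a b" using less.prems(3) by auto
  have ab': "a \<in> ?V" "b \<in> ?V" "a ~= b" using Fa adjab by auto
  let ?T = "contract F a b"
  define pi where "pi x = (if x = b then a else x)" for x
  have vT: "verts ?T = ?V - {b}" by (simp add: contract_def)
  have aT: "adj ?T x y \<longleftrightarrow> x ~= y & (\<exists>u v. adj F u v & pi u = x & pi v = y)" for x y by (simp add: contract_def pi_def)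
  have pib: "pi u = pi v ==> u = v \<or> (u, v) = (a, b) \<or> (u, v) = (b, a)" for u v by (auto simp: pi_def split: if_splits)
  have piV: "pi x \<in> ?V - {b}" if "x \<in> ?V" for x using that ab' by (auto simp: pi_def)
  have clT: "cl ?T" by (rule cl_contract[OF less.prems(1) adjab])
  show ?thesis
  proof (cases "(a, b) \<in> K \<or> (b, a) \<in> K")
   case True
   have "homc_set ?V K C G' = {}" if s: "simple_graph G'" for G'
   proof (rule ccontr)
    assume "homc_set ?V K C G' ~= {}"
    then obtain f where f: "f \<in> homc_set ?V K C G'" by auto
    then have "f a = f b" using ab by (auto simp: homc_set_def)
    moreover have "adj G' (f a) (f b) \<or> adj G' (f b) (f a)" using f True by (auto simp: homc_set_def)
    ultimately show False using s by (auto simp: simple_graph_def)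
   qed
   then show ?thesis using sGH by (simp add: homc_def)
  next
   case nK: False
   let ?K = "(%(u, v). (pi u, pi v)) ` K" and ?C = "(%(u, v). (pi u, pi v)) ` {(u, v) \<in> C. pi u ~= pi v}"
   have "homc (verts ?T) ?K ?C G = homc (verts ?T) ?K ?C H"
   proof (rule less.hyps[OF _ clT])
    show "card (verts ?T) < card ?V" unfolding vT by (rule card_Diff1_less[OF sF(2) ab'(2)])
    show "?K \<subseteq> gedges ?T"
    proof
     fix e assume "e \<in> ?K"
     then obtain u v where uv: "(u, v) \<in> K" "e = (pi u, pi v)" by auto
     have "adj F u v" using uv less.prems(2) by auto
     moreover have "pi u ~= pi v" using uv(1) nK calculation Fa(3) pib[of u v] by auto
     ultimately show "e \<in> gedges ?T" unfolding uv(2) using aT by blast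
    qed
    show "?C \<subseteq> gedges ?T"
    proof
     fix e assume "e \<in> ?C"
     then obtain u v where uv: "(u, v) \<in> C" "pi u ~= pi v" "e = (pi u, pi v)" by auto
     have "adj F u v" using uv less.prems(3) by auto
     then show "e \<in> gedges ?T" using uv(2) unfolding uv(3) using aT by blast
    qed
   qed
   moreover have "homc ?V K C G' = homc (verts ?T) ?K ?C G'" if "wf_graph G'" for G'
   proof -
    have KV: "u \<in> ?V & v \<in> ?V" if "(u, v) \<in> K Un C" for u v using that less.prems(2,3) Fa(1) by auto
    have "bij_betw (%f. restrict f (?V - {b})) (homc_set ?V K C G') (homc_set (verts ?T) ?K ?C G')"
    proof (rule bij_betwI[where g = "%g. restrict (g \<circ> pi) ?V"])
     show "(%f. restrict f (?V - {b})) \<in> homc_set ?V K C G' \<rightarrow> homc_set (verts ?T) ?K ?C G'"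
     proof
      fix f assume f: "f \<in> homc_set ?V K C G'"
      have fab: "f a = f b" using f ab by (auto simp: homc_set_def)
      have fp: "f (pi x) = f x" for x using fab by (simp add: pi_def)
      have r: "restrict f (?V - {b}) (pi x) = f x" if "x \<in> ?V" for x using piV[OF that] fp by simp
      have fV: "f x \<in> verts G'" if "x \<in> ?V" for x using f that by (auto simp: homc_set_def PiE_iff)
      have k: "adj G' (f u) (f v)" if "(u, v) \<in> K" for u v using f that by (auto simp: homc_set_def)
      have c: "f u = f v" if "(u, v) \<in> C" for u v using f that by (auto simp: homc_set_def)
      show "restrict f (?V - {b}) \<in> homc_set (verts ?T) ?K ?C G'" unfolding homc_set_def vT
      proof (intro CollectI conjI ballI)
       show "restrict f (?V - {b}) \<in> ?V - {b} \<rightarrow>\<^sub>E verts G'" using fV by auto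
       show "case e of (u, v) => adj G' (restrict f (?V - {b}) u) (restrict f (?V - {b}) v)" if e: "e \<in> ?K" for e
       proof -
        obtain u v where uv: "(u, v) \<in> K" "e = (pi u, pi v)" using e by auto
        then show ?thesis using r KV[of u v] k[OF uv(1)] by (simp only: prod.case uv(2)) simp
       qed
       show "case e of (u, v) => restrict f (?V - {b}) u = restrict f (?V - {b}) v" if e: "e \<in> ?C" for e
       proof -
        obtain u v where uv: "(u, v) \<in> C" "e = (pi u, pi v)" using e by auto
        then show ?thesis using r KV[of u v] c[OF uv(1)] by (simp only: prod.case uv(2)) simp
       qed
      qed
     qed
     show "(%g. restrict (g \<circ> pi) ?V) \<in> homc_set (verts ?T) ?K ?C G' \<rightarrow> homc_set ?V K C G'"
     proof
      fix g assume g: "g \<in> homc_set (verts ?T) ?K ?C G'"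
      have gV: "g x \<in> verts G'" if "x \<in> ?V - {b}" for x using g that by (auto simp: homc_set_def PiE_iff vT)
      have k: "adj G' (g (pi u)) (g (pi v))" if "(u, v) \<in> K" for u v
      proof -
       have "(pi u, pi v) \<in> ?K" by (rule image_eqI[OF _ that]) simp
       then show ?thesis using g unfolding homc_set_def by blast
      qed
      have c: "g (pi u) = g (pi v)" if "(u, v) \<in> C" for u v
      proof (cases "pi u = pi v")
       case False
       have "(pi u, pi v) \<in> ?C" by (rule image_eqI[of _ _ "(u, v)"]) (use that False in auto)
       then show ?thesis using g unfolding homc_set_def by blast
      qed simp
      show "restrict (g \<circ> pi) ?V \<in> homc_set ?V K C G'" unfolding homc_set_def
      proof (intro CollectI conjI ballI)
       show "restrict (g \<circ> pi) ?V \<in> ?V \<rightarrow>\<^sub>E verts G'" using gV piV by auto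
       show "case e of (u, v) => adj G' (restrict (g \<circ> pi) ?V u) (restrict (g \<circ> pi) ?V v)" if "e \<in> K" for e
        using that k KV by (cases e) auto
       show "case e of (u, v) => restrict (g \<circ> pi) ?V u = restrict (g \<circ> pi) ?V v" if "e \<in> C" for e
        using that c KV by (cases e) auto
      qed
     qed
     show "restrict (restrict f (?V - {b}) \<circ> pi) ?V = f" if f: "f \<in> homc_set ?V K C G'" for f
     proof
      fix x
      have "f a = f b" using f ab by (auto simp: homc_set_def)
      then show "restrict (restrict f (?V - {b}) \<circ> pi) ?V x = f x"
       using f ab' by (auto simp: homc_set_def PiE_iff extensional_def restrict_def pi_def)
     qed
     show "restrict (restrict (g \<circ> pi) ?V) (?V - {b}) = g" if "g \<in> homc_set (verts ?T) ?K ?C G'" for g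
      using that by (auto simp: homc_set_def PiE_iff extensional_def restrict_def fun_eq_iff vT pi_def)
    qed
    from bij_betw_same_card[OF this] show ?thesis by (simp add: homc_def)
   qed
   ultimately show ?thesis using w by simp
  qed
 qed
qed

text \<open>The edges inside branch sets are contracted, those between branch sets adjacent in
  \<open>T\<close> are kept, and vertices outside the branch sets stay free. The latter contribute a
  power of the number of vertices, which the count without constraints determines, so it can be
  cancelled.\<close>

theorem cl_minor:
 assumes F: "cl F" and T: "simple_graph T" "verts T ~= {}" and m: "minor (gedges F) (verts F) (gedges T) (verts T)"
 shows "cl T"
proof -
 let ?V = "verts F" and ?W = "verts T"
 obtain B where B: "\<forall>x\<in>?W. B x ~= {} & B x \<subseteq> ?V & conn (gedges F) (B x)" "\<forall>x\<in>?W. \<forall>y\<in>?W. x ~= y --> B x Int B y = {}"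
  "\<forall>(x, y)\<in>gedges T. \<exists>u\<in>B x. \<exists>v\<in>B y. (u, v) \<in> gedges F" using m unfolding minor_def by (elim exE conjE)
 have sF: "simple_graph F" "finite ?V" using F by (auto simp: cl_def simple_graph_def wf_graph_def)
 have Ta: "adj T x y ==> x \<in> ?W & y \<in> ?W" for x y using T by (auto simp: simple_graph_def wf_graph_def)
 define K where "K = {(u, v). adj F u v & (\<exists>x y. adj T x y & u \<in> B x & v \<in> B y)}"
 define C where "C = {(u, v). adj F u v & (\<exists>x\<in>?W. u \<in> B x & v \<in> B x)}"
 define U where "U = (\<Union>x\<in>?W. B x)"
 define ix where "ix u = (THE x. x \<in> ?W & u \<in> B x)" for u
 have ix: "ix u = x" if "x \<in> ?W" "u \<in> B x" for u x unfolding ix_def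
  by (rule the_equality) (use that B(2) in blast)+
 define rp where "rp x = (SOME u. u \<in> B x)" for x
 have rp: "rp x \<in> B x" if "x \<in> ?W" for x using B(1) that unfolding rp_def by (metis ex_in_conv someI_ex)
 have count: "homc ?V K C G = hom T G * card (verts G) ^ card (?V - U)" if G: "wf_graph G" for G
 proof -
  let ?H = "{f. f \<in> ?W \<rightarrow>\<^sub>E verts G & (\<forall>u v. adj T u v --> adj G (f u) (f v))}"
  let ?m = "%(g, h). restrict (%x. if x \<in> U then g (ix x) else h x) ?V"
  have "bij_betw ?m (?H \<times> (?V - U \<rightarrow>\<^sub>E verts G)) (homc_set ?V K C G)"
  proof (rule bij_betwI[where g = "%f. (restrict (f \<circ> rp) ?W, restrict f (?V - U))"])
   show "?m \<in> ?H \<times> (?V - U \<rightarrow>\<^sub>E verts G) \<rightarrow> homc_set ?V K C G"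
   proof
    fix q assume "q \<in> ?H \<times> (?V - U \<rightarrow>\<^sub>E verts G)"
    then obtain g h where q: "q = (g, h)" "g \<in> ?W \<rightarrow>\<^sub>E verts G" "!!u v. adj T u v ==> adj G (g u) (g v)" "h \<in> ?V - U \<rightarrow>\<^sub>E verts G" by auto
    have mU: "?m q u = g x" if "x \<in> ?W" "u \<in> B x" for u x using that q ix[OF that] B(1) by (auto simp: U_def)
    show "?m q \<in> homc_set ?V K C G" unfolding homc_set_def
    proof (intro CollectI conjI ballI)
     show "?m q \<in> ?V \<rightarrow>\<^sub>E verts G"
     proof -
      have "?m q u \<in> verts G" if u: "u \<in> ?V" for u
      proof (cases "u \<in> U")
       case True
       then obtain x where "x \<in> ?W" "u \<in> B x" by (auto simp: U_def)
       then show ?thesis using mU q(2) by auto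
      qed (use q u in auto)
      moreover have "?m q \<in> extensional ?V" by (simp add: q)
      ultimately show ?thesis by (simp add: PiE_iff)
     qed
     show "case e of (u, v) => adj G (?m q u) (?m q v)" if e: "e \<in> K" for e
     proof -
      obtain u v x y where "e = (u, v)" "adj T x y" "u \<in> B x" "v \<in> B y" using e by (auto simp: K_def)
      then show ?thesis using mU[of x u] mU[of y v] Ta q(3) by simp
     qed
     show "case e of (u, v) => ?m q u = ?m q v" if e: "e \<in> C" for e
     proof -
      obtain u v x where "e = (u, v)" "x \<in> ?W" "u \<in> B x" "v \<in> B x" using e by (auto simp: C_def)
      then show ?thesis using mU[of x u] mU[of x v] by simp
     qed
    qed
   qed
   have const: "f u = f v" if f: "f \<in> homc_set ?V K C G" and x: "x \<in> ?W" "u \<in> B x" "v \<in> B x" for f x u v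
   proof -
    have "(u, v) \<in> (gedges F Int B x \<times> B x)\<^sup>*" using B(1) x by (auto simp: conn_def)
    then show ?thesis
    proof (induction rule: rtrancl_induct)
     case (step y z)
     then have "(y, z) \<in> C" using x(1) by (auto simp: C_def)
     then have "f y = f z" using f by (auto simp: homc_set_def)
     then show ?case using step by simp
    qed simp
   qed
   show "(%f. (restrict (f \<circ> rp) ?W, restrict f (?V - U))) \<in> homc_set ?V K C G \<rightarrow> ?H \<times> (?V - U \<rightarrow>\<^sub>E verts G)"
   proof
    fix f assume f: "f \<in> homc_set ?V K C G"
    have fV: "f x \<in> verts G" if "x \<in> ?V" for x using f that by (auto simp: homc_set_def PiE_iff)
    have "adj G (f (rp x)) (f (rp y))" if xy: "adj T x y" for x y
    proof -
     obtain u v where uv: "u \<in> B x" "v \<in> B y" "adj F u v" using B(3) xy by blast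
     then have "(u, v) \<in> K" using xy by (auto simp: K_def)
     then have "adj G (f u) (f v)" using f by (auto simp: homc_set_def)
     moreover have "f (rp x) = f u" "f (rp y) = f v" using const[OF f] rp Ta[OF xy] uv by blast+
     ultimately show ?thesis by simp
    qed
    moreover have "f (rp x) \<in> verts G" if "x \<in> ?W" for x using fV rp[OF that] B(1) that by blast
    ultimately show "(restrict (f \<circ> rp) ?W, restrict f (?V - U)) \<in> ?H \<times> (?V - U \<rightarrow>\<^sub>E verts G)" using fV Ta by auto
   qed
   show "(%f. (restrict (f \<circ> rp) ?W, restrict f (?V - U))) (?m q) = q" if qq: "q \<in> ?H \<times> (?V - U \<rightarrow>\<^sub>E verts G)" for q
   proof -
    obtain g h where q: "q = (g, h)" "g \<in> ?W \<rightarrow>\<^sub>E verts G" "h \<in> ?V - U \<rightarrow>\<^sub>E verts G" using qq by auto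
    have "?m q (rp x) = g x" if "x \<in> ?W" for x using rp[OF that] ix[OF that rp[OF that]] B(1) that q by (auto simp: U_def)
    then have "restrict (?m q \<circ> rp) ?W = g" using q(2) by (auto simp: fun_eq_iff PiE_iff extensional_def restrict_def)
    moreover have "restrict (?m q) (?V - U) = h" using q by (auto simp: fun_eq_iff PiE_iff extensional_def restrict_def)
    ultimately show ?thesis using q(1) by simp
   qed
   show "?m ((%f. (restrict (f \<circ> rp) ?W, restrict f (?V - U))) f) = f" if f: "f \<in> homc_set ?V K C G" for f
   proof
    fix u
    show "?m ((%f. (restrict (f \<circ> rp) ?W, restrict f (?V - U))) f) u = f u"
    proof (cases "u \<in> U")
     case True
     then obtain x where x: "x \<in> ?W" "u \<in> B x" by (auto simp: U_def)
     then have "u \<in> ?V" using B(1) by blast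
     moreover have "f (rp x) = f u" using const[OF f x(1) rp[OF x(1)] x(2)] .
     ultimately show ?thesis using True x ix[OF x] by simp
    next
     case False
     then show ?thesis using f by (auto simp: homc_set_def PiE_iff extensional_def restrict_def)
    qed
   qed
  qed
  from bij_betw_same_card[OF this] show ?thesis using sF(2) by (simp add: homc_def hom_def card_cartesian_product card_PiE)
 qed
 have Vne: "?V ~= {}" using T(2) B(1) by blast
 have "hom T G = hom T H" if GH: "R G H" for G H
 proof -
  have w: "wf_graph G" "wf_graph H" "finite (verts G)" "finite (verts H)" using R_wf[OF GH] by (auto simp: wf_graph_def)
  have "homc ?V {} {} G' = card (verts G') ^ card ?V" for G' using sF(2) by (simp add: homc_def homc_set_def card_PiE)
  then have "card (verts G) ^ card ?V = card (verts H) ^ card ?V" using homc_closed[OF F GH, of "{}" "{}"] by simp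
  moreover have "0 < card ?V" using Vne sF(2) by (simp add: card_gt_0_iff)
  ultimately have n: "card (verts G) = card (verts H)" by (metis power_eq_imp_eq_base zero_le)
  show ?thesis
  proof (cases "card (verts G) = 0")
   case True
   then have "verts G = {}" "verts H = {}" using n w by auto
   moreover have "?W \<rightarrow>\<^sub>E ({} :: nat set) = {}" using T(2) by (auto simp: PiE_eq_empty_iff)
   ultimately show ?thesis by (simp add: hom_def)
  next
   case False
   have "hom T G * card (verts G) ^ card (?V - U) = hom T H * card (verts H) ^ card (?V - U)"
    using homc_closed[OF F GH, of K C] count[OF w(1)] count[OF w(2)] by (auto simp: K_def C_def)
   then show ?thesis using False n by simp
  qed
 qed
 then show ?thesis using T(1) by (simp add: cl_def)
qed

end

section \<open>Tensors generated by planar operations\<close>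

datatype site_op = OpJ nat | OpD nat | OpA nat

text \<open>The word applied to the constant tensor 1, its head last. After \<open>OpJ i\<close> the
  tensor does not depend on site \<open>i\<close>, which is thereby available again.\<close>

fun vec :: "graph => site_op list => nat list => real" where
 "vec G [] x = 1"
| "vec G (OpJ i # W) x = (\<Sum>a\<in>verts G. vec G W (x[i := a]))"
| "vec G (OpD i # W) x = of_bool (x ! i = x ! Suc i) * vec G W x"
| "vec G (OpA i # W) x = of_bool (adj G (x ! i) (x ! Suc i)) * vec G W x"

fun op_ok :: "nat => site_op => bool" where
 "op_ok N (OpJ i) \<longleftrightarrow> i < N"
| "op_ok N (OpD i) \<longleftrightarrow> Suc i < N"
| "op_ok N (OpA i) \<longleftrightarrow> Suc i < N"

lemma op_ok_Suc: "op_ok N p ==> op_ok (Suc N) p" by (cases p) auto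

definition tuples :: "graph => nat => nat list set" where
 "tuples G n = {x. set x \<subseteq> verts G & length x = n}"

definition Zw :: "graph => nat => site_op list => real" where
 "Zw G N W = (\<Sum>x\<in>tuples G N. vec G W x)"

definition del :: "nat => nat list => nat list" where "del i x = take i x @ drop (Suc i) x"
definition ins :: "nat => nat => nat list => nat list" where "ins i a x = take i x @ a # drop i x"

lemma finite_tuples: "finite (verts G) ==> finite (tuples G n)"
 unfolding tuples_def by (rule finite_lists_length_eq)

lemma tuples_0 [simp]: "tuples G 0 = {[]}" by (auto simp: tuples_def)

lemma tuples_length: "x \<in> tuples G n ==> length x = n" by (simp add: tuples_def)

lemma del_tuples: "x \<in> tuples G (Suc n) ==> i <= n ==> del i x \<in> tuples G n"
 unfolding tuples_def del_def using set_take_subset[of i x] set_drop_subset[of "Suc i" x] by auto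

lemma ins_tuples: "x \<in> tuples G n ==> a \<in> verts G ==> i <= n ==> ins i a x \<in> tuples G (Suc n)"
 unfolding tuples_def ins_def using set_take_subset[of i x] set_drop_subset[of i x] by auto

lemma upd_tuples: "x \<in> tuples G n ==> a \<in> verts G ==> x[i := a] \<in> tuples G n"
 unfolding tuples_def using set_update_subset_insert[of x i a] by auto

lemma sum_tuples_Suc:
 assumes "finite (verts G)"
 shows "(\<Sum>x\<in>tuples G (Suc n). f x) = (\<Sum>y\<in>tuples G n. \<Sum>a\<in>verts G. f (y @ [a]))"
proof -
 have "bij_betw (%(y, a). y @ [a]) (tuples G n \<times> verts G) (tuples G (Suc n))"
 proof (rule bij_betwI[where g = "%x. (butlast x, last x)"])
  show "(%x. (butlast x, last x)) \<in> tuples G (Suc n) \<rightarrow> tuples G n \<times> verts G"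
  proof
   fix x assume x: "x \<in> tuples G (Suc n)"
   then have "x ~= []" by (auto simp: tuples_def)
   then have "last x \<in> set x" by simp
   then show "(butlast x, last x) \<in> tuples G n \<times> verts G" using x in_set_butlastD by (fastforce simp: tuples_def)
  qed
  show "(%(y, a). y @ [a]) ((%x. (butlast x, last x)) x) = x" if "x \<in> tuples G (Suc n)" for x
  proof -
   have "x ~= []" using that by (auto simp: tuples_def)
   then show ?thesis by simp
  qed
 qed (auto simp: tuples_def)
 from sum.reindex_bij_betw[OF this, of f] show ?thesis by (simp add: sum.cartesian_product split_beta)
qed

lemma sum_tuples_append:
 assumes "finite (verts G)"
 shows "(\<Sum>x\<in>tuples G (m + n). f x) = (\<Sum>y\<in>tuples G m. \<Sum>z\<in>tuples G n. f (y @ z))"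
proof (induction n arbitrary: f)
 case (Suc n)
 have "(\<Sum>x\<in>tuples G (m + Suc n). f x) = (\<Sum>x\<in>tuples G (m + n). \<Sum>a\<in>verts G. f (x @ [a]))"
  using sum_tuples_Suc[OF assms, of f "m + n"] by simp
 also have "... = (\<Sum>y\<in>tuples G m. \<Sum>z\<in>tuples G n. \<Sum>a\<in>verts G. f ((y @ z) @ [a]))" by (rule Suc)
 also have "... = (\<Sum>y\<in>tuples G m. \<Sum>z\<in>tuples G (Suc n). f (y @ z))"
  using sum_tuples_Suc[OF assms, of "%z. f (_ @ z)" n] by simp
 finally show ?case .
qed simp

section \<open>Tensors built in parallel on two graphs with equal word sums\<close>

locale graph_pair =
 fixes G H :: graph
 assumes finG: "finite (verts G)" and finH: "finite (verts H)"
  and symG: "adj G u v ==> adj G v u" and symH: "adj H u v ==> adj H v u"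
  and Zeq: "(!!p. p \<in> set W ==> op_ok N p) ==> Zw G N W = Zw H N W"
begin

text \<open>Both components follow the same planar recipe: sites are inserted, summed out or
  compared with a neighbour, never permuted. Restricted to tuples, the relation turns out to be the
  graph of a linear isometry (\<open>KK_ip\<close>).\<close>

inductive KK :: "nat => (nat list => real) => (nat list => real) => bool" where
 K_one: "KK 0 (%_. 1) (%_. 1)"
| K_cong: "KK n f g ==> (!!x. x \<in> tuples G n ==> f x = f' x) ==> (!!x. x \<in> tuples H n ==> g x = g' x) ==> KK n f' g'"
| K_ins: "KK n f g ==> i <= n ==> KK (Suc n) (%x. f (del i x)) (%x. g (del i x))"
| K_sum: "KK (Suc n) f g ==> i <= n ==> KK n (%x. \<Sum>a\<in>verts G. f (ins i a x)) (%x. \<Sum>a\<in>verts H. g (ins i a x))"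
| K_D: "KK n f g ==> Suc i < n ==> KK n (%x. of_bool (x ! i = x ! Suc i) * f x) (%x. of_bool (x ! i = x ! Suc i) * g x)"
| K_A: "KK n f g ==> Suc i < n ==> KK n (%x. of_bool (adj G (x ! i) (x ! Suc i)) * f x) (%x. of_bool (adj H (x ! i) (x ! Suc i)) * g x)"
| K_lin: "KK n f g ==> KK n f' g' ==> KK n (%x. c * f x + d * f' x) (%x. c * g x + d * g' x)"

text \<open>Recipes in \<open>KK\<close> change the number of sites while a word works on a fixed
  number \<open>N\<close>; the surplus sites are scratch space, summed out at the end.\<close>

definition base :: "graph => nat => nat => site_op list => nat list => real" where
 "base F n N W x = (\<Sum>y\<in>tuples F (N - n). vec F W (x @ y))"

inductive BB :: "nat => (nat list => real) => (nat list => real) => bool" where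
 B_base: "n <= N ==> (!!p. p \<in> set W ==> op_ok N p) ==> BB n (base G n N W) (base H n N W)"
| B_cong: "BB n f g ==> (!!x. x \<in> tuples G n ==> f x = f' x) ==> (!!x. x \<in> tuples H n ==> g x = g' x) ==> BB n f' g'"
| B_lin: "BB n f g ==> BB n f' g' ==> BB n (%x. c * f x + d * f' x) (%x. c * g x + d * g' x)"

lemma BB_zero: "BB 0 f g ==> f [] = g []"
proof (induction "0 :: nat" f g rule: BB.induct)
 case (B_base N W)
 have "base F 0 N W [] = Zw F N W" for F by (simp add: base_def Zw_def)
 then show ?case using Zeq[OF B_base(2)] by simp
qed auto

text \<open>The site operators J_j D_j move a free site from position j + 1 to position j, and J_(j+1) D_j moves it back.\<close>
lemma gap_left:
 assumes "!!x. x \<in> tuples F N ==> vec F W x = f (del (Suc j) x)" "Suc j < N" "x \<in> tuples F N" "finite (verts F)"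
 shows "vec F (OpJ j # OpD j # W) x = f (del j x)"
proof -
 have l: "length x = N" and xj: "x ! Suc j \<in> verts F" using assms(2,3) by (auto simp: tuples_def subset_iff)
 have "vec F (OpJ j # OpD j # W) x = (\<Sum>a\<in>verts F. if a = x ! Suc j then vec F W (x[j := x ! Suc j]) else 0)"
  using l assms(2) by (auto intro!: sum.cong)
 also have "... = vec F W (x[j := x ! Suc j])" using assms(4) xj by simp
 also have "... = f (del (Suc j) (x[j := x ! Suc j]))" by (rule assms(1)[OF upd_tuples[OF assms(3) xj]])
 also have "del (Suc j) (x[j := x ! Suc j]) = del j x"
  using l assms(2) by (simp add: del_def take_Suc_conv_app_nth Cons_nth_drop_Suc[symmetric] take_update_swap list_update_append)
 finally show ?thesis .
qed

lemma gap_right: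
 assumes "!!x. x \<in> tuples F N ==> vec F W x = f (del j x)" "Suc j < N" "x \<in> tuples F N" "finite (verts F)"
 shows "vec F (OpJ (Suc j) # OpD j # W) x = f (del (Suc j) x)"
proof -
 have l: "length x = N" and xj: "x ! j \<in> verts F" using assms(2,3) by (auto simp: tuples_def subset_iff)
 have "vec F (OpJ (Suc j) # OpD j # W) x = (\<Sum>a\<in>verts F. if a = x ! j then vec F W (x[Suc j := x ! j]) else 0)"
  using l assms(2) by (auto intro!: sum.cong)
 also have "... = vec F W (x[Suc j := x ! j])" using assms(4) xj by simp
 also have "... = f (del j (x[Suc j := x ! j]))" by (rule assms(1)[OF upd_tuples[OF assms(3) xj]])
 also have "del j (x[Suc j := x ! j]) = del (Suc j) x"
 proof (rule nth_equalityI)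
  show "length (del j (x[Suc j := x ! j])) = length (del (Suc j) x)" using l assms(2) by (simp add: del_def)
  show "del j (x[Suc j := x ! j]) ! i = del (Suc j) x ! i" if "i < length (del j (x[Suc j := x ! j]))" for i
   using that l assms(2) by (auto simp: del_def nth_append nth_list_update min_def less_Suc_eq)
 qed
 finally show ?thesis .
qed

text \<open>The new word is chosen before the graph and the tensor, so that one word serves both
  graphs.\<close>

lemma shift_left:
 assumes "i <= m" "m < N" "!!p. p \<in> set W ==> op_ok N p"
 shows "\<exists>W'. (\<forall>p\<in>set W'. op_ok N p) & (\<forall>F f. finite (verts F) --> (\<forall>x\<in>tuples F N. vec F W x = f (del m x)) --> (\<forall>x\<in>tuples F N. vec F W' x = f (del i x)))"
 using assms
proof (induction m arbitrary: W)
 case 0 then show ?case by (intro exI[of _ W]) auto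
next
 case (Suc m)
 show ?case
 proof (cases "i = Suc m")
  case True then show ?thesis using Suc by (intro exI[of _ W]) auto
 next
  case False
  have "\<exists>W'. (\<forall>p\<in>set W'. op_ok N p) & (\<forall>F f. finite (verts F) --> (\<forall>x\<in>tuples F N. vec F (OpJ m # OpD m # W) x = f (del m x)) --> (\<forall>x\<in>tuples F N. vec F W' x = f (del i x)))"
   by (rule Suc.IH) (use Suc.prems False in auto)
  then show ?thesis using gap_left[of _ N W _ m] Suc.prems(2) by meson
 qed
qed

lemma shift_right:
 assumes "i <= m" "m < N" "!!p. p \<in> set W ==> op_ok N p"
 shows "\<exists>W'. (\<forall>p\<in>set W'. op_ok N p) & (\<forall>F f. finite (verts F) --> (\<forall>x\<in>tuples F N. vec F W x = f (del i x)) --> (\<forall>x\<in>tuples F N. vec F W' x = f (del m x)))"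
 using assms
proof (induction "m - i" arbitrary: i W)
 case 0 then show ?case by (intro exI[of _ W]) auto
next
 case (Suc k)
 have "\<exists>W'. (\<forall>p\<in>set W'. op_ok N p) & (\<forall>F f. finite (verts F) --> (\<forall>x\<in>tuples F N. vec F (OpJ (Suc i) # OpD i # W) x = f (del (Suc i) x)) --> (\<forall>x\<in>tuples F N. vec F W' x = f (del m x)))"
  by (rule Suc.hyps) (use Suc.prems Suc.hyps(2) in auto)
 moreover have "Suc i < N" using Suc.hyps(2) Suc.prems by linarith
 ultimately show ?case using gap_right[of _ N W _ i] by meson
qed

lemma vec_pad: "(!!p. p \<in> set W ==> op_ok N p) ==> length x = N ==> vec F W (x @ y) = vec F W x"
proof (induction W arbitrary: x)
 case (Cons p W)
 have IH: "vec F W (x' @ y) = vec F W x'" if "length x' = N" for x' using Cons.IH[of x'] Cons.prems that by auto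
 have "op_ok N p" using Cons.prems by simp
 then show ?case using IH Cons.prems(2) by (cases p) (auto simp: nth_append list_update_append)
qed simp

text \<open>A further scratch site, on which the word does not depend, is appended and then moved to
  position \<open>i\<close>.\<close>

lemma BB_ins:
 assumes "BB n f g" "i <= n"
 shows "BB (Suc n) (%x. f (del i x)) (%x. g (del i x))"
 using assms
proof (induction rule: BB.induct)
 case (B_base n N W)
 have "\<exists>W'. (\<forall>p\<in>set W'. op_ok (Suc N) p) & (\<forall>F f. finite (verts F) --> (\<forall>x\<in>tuples F (Suc N). vec F W x = f (del N x)) --> (\<forall>x\<in>tuples F (Suc N). vec F W' x = f (del i x)))"
  by (rule shift_left) (use B_base op_ok_Suc in auto)
 then obtain W' where W': "\<forall>p\<in>set W'. op_ok (Suc N) p"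
  "!!F f. finite (verts F) ==> (\<forall>x\<in>tuples F (Suc N). vec F W x = f (del N x)) ==> (\<forall>x\<in>tuples F (Suc N). vec F W' x = f (del i x))" by blast
 have v: "vec F W' x = vec F W (del i x)" if F: "finite (verts F)" "x \<in> tuples F (Suc N)" for F x
 proof -
  have "vec F W x = vec F W (del N x)" if "x \<in> tuples F (Suc N)" for x
  proof -
   have "x = del N x @ drop N x" using that by (simp add: del_def tuples_def)
   moreover have "length (del N x) = N" using that by (simp add: del_def tuples_def)
   ultimately show ?thesis using vec_pad[of W N "del N x" F "drop N x"] B_base.hyps(2) by metis
  qed
  then show ?thesis using W'(2)[OF F(1), of "vec F W"] F(2) by blast
 qed
 have e: "base F (Suc n) (Suc N) W' x = base F n N W (del i x)" if F: "finite (verts F)" "x \<in> tuples F (Suc n)" for F x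
 proof -
  have "vec F W' (x @ y) = vec F W (del i x @ y)" if y: "y \<in> tuples F (N - n)" for y
  proof -
   have "x @ y \<in> tuples F (Suc N)" using F y B_base.hyps(1) by (auto simp: tuples_def)
   moreover have "del i (x @ y) = del i x @ y" using F B_base.prems by (auto simp: del_def tuples_def)
   ultimately show ?thesis using v[OF F(1)] by metis
  qed
  then show ?thesis by (simp add: base_def)
 qed
 have "BB (Suc n) (base G (Suc n) (Suc N) W') (base H (Suc n) (Suc N) W')"
  by (rule BB.B_base) (use W' B_base in auto)
 then show ?case by (rule BB.B_cong) (use e finG finH in auto)
next
 case (B_cong n f g f' g')
 then have "BB (Suc n) (%x. f (del i x)) (%x. g (del i x))" by simp
 then show ?case by (rule BB.B_cong) (use B_cong del_tuples in auto)
next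
 case (B_lin n f g f' g' c d)
 then show ?case by (auto intro: BB.B_lin)
qed

lemma BB_D: assumes "BB n f g" "Suc i < n"
 shows "BB n (%x. of_bool (x ! i = x ! Suc i) * f x) (%x. of_bool (x ! i = x ! Suc i) * g x)"
 using assms
proof (induction rule: BB.induct)
 case (B_base n N W)
 have e: "base F n N (OpD i # W) x = of_bool (x ! i = x ! Suc i) * base F n N W x" if "x \<in> tuples F n" for F x
  using tuples_length[OF that] B_base.prems by (simp add: base_def sum_distrib_left nth_append)
 have "BB n (base G n N (OpD i # W)) (base H n N (OpD i # W))" by (rule BB.B_base) (use B_base in auto)
 then show ?case by (rule BB.B_cong) (use e in auto)
next
 case (B_cong n f g f' g')
 then have "BB n (%x. of_bool (x ! i = x ! Suc i) * f x) (%x. of_bool (x ! i = x ! Suc i) * g x)" by simp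
 then show ?case by (rule BB.B_cong) (use B_cong in auto)
next
 case (B_lin n f g f' g' c d)
 then have "BB n (%x. c * (of_bool (x ! i = x ! Suc i) * f x) + d * (of_bool (x ! i = x ! Suc i) * f' x))
  (%x. c * (of_bool (x ! i = x ! Suc i) * g x) + d * (of_bool (x ! i = x ! Suc i) * g' x))" by (intro BB.B_lin) auto
 then show ?case by (rule BB.B_cong) (auto simp: algebra_simps)
qed

lemma BB_A: assumes "BB n f g" "Suc i < n"
 shows "BB n (%x. of_bool (adj G (x ! i) (x ! Suc i)) * f x) (%x. of_bool (adj H (x ! i) (x ! Suc i)) * g x)"
 using assms
proof (induction rule: BB.induct)
 case (B_base n N W)
 have e: "base F n N (OpA i # W) x = of_bool (adj F (x ! i) (x ! Suc i)) * base F n N W x" if "x \<in> tuples F n" for F x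
  using tuples_length[OF that] B_base.prems by (simp add: base_def sum_distrib_left nth_append)
 have "BB n (base G n N (OpA i # W)) (base H n N (OpA i # W))" by (rule BB.B_base) (use B_base in auto)
 then show ?case by (rule BB.B_cong) (use e in auto)
next
 case (B_cong n f g f' g')
 then have "BB n (%x. of_bool (adj G (x ! i) (x ! Suc i)) * f x) (%x. of_bool (adj H (x ! i) (x ! Suc i)) * g x)" by simp
 then show ?case by (rule BB.B_cong) (use B_cong in auto)
next
 case (B_lin n f g f' g' c d)
 then have "BB n (%x. c * (of_bool (adj G (x ! i) (x ! Suc i)) * f x) + d * (of_bool (adj G (x ! i) (x ! Suc i)) * f' x))
  (%x. c * (of_bool (adj H (x ! i) (x ! Suc i)) * g x) + d * (of_bool (adj H (x ! i) (x ! Suc i)) * g' x))" by (intro BB.B_lin) auto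
 then show ?case by (rule BB.B_cong) (auto simp: algebra_simps)
qed

text \<open>\<open>OpJ i\<close> sums out site \<open>i\<close> and leaves it free. The free site is
  moved to position \<open>n\<close>, where \<open>base\<close> sums over it once more. This yields
  a factor \<open>card (verts F)\<close>, equal for both graphs by the empty word, which is divided
  out; without vertices all sums are empty.\<close>

lemma BB_sum:
 assumes "BB (Suc n) f g" "i <= n"
 shows "BB n (%x. \<Sum>a\<in>verts G. f (ins i a x)) (%x. \<Sum>a\<in>verts H. g (ins i a x))"
 using assms
proof (induction "Suc n" f g rule: BB.induct)
 case (B_base N W)
 have nN: "n < N" using B_base by simp
 have "\<exists>W'. (\<forall>p\<in>set W'. op_ok N p) & (\<forall>F f. finite (verts F) --> (\<forall>x\<in>tuples F N. vec F (OpJ i # W) x = f (del i x)) --> (\<forall>x\<in>tuples F N. vec F W' x = f (del n x)))"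
  by (rule shift_right) (use B_base nN in auto)
 then obtain W' where W': "\<forall>p\<in>set W'. op_ok N p"
  "!!F f. finite (verts F) ==> (\<forall>x\<in>tuples F N. vec F (OpJ i # W) x = f (del i x)) ==> (\<forall>x\<in>tuples F N. vec F W' x = f (del n x))" by blast
 have v: "vec F W' x = (\<Sum>a\<in>verts F. vec F W (ins i a (del n x)))" if F: "finite (verts F)" "x \<in> tuples F N" for F x
 proof -
  have "vec F (OpJ i # W) x = (\<Sum>a\<in>verts F. vec F W (ins i a (del i x)))" if "x \<in> tuples F N" for x
  proof -
   have "x[i := a] = ins i a (del i x)" for a using tuples_length[OF that] B_base.prems nN
    by (simp add: ins_def del_def upd_conv_take_nth_drop)
   then show ?thesis by simp
  qed
  then show ?thesis using W'(2)[OF F(1), of "%z. \<Sum>a\<in>verts F. vec F W (ins i a z)"] F(2) by blast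
 qed
 have e: "base F n N W' x = real (card (verts F)) * (\<Sum>a\<in>verts F. base F (Suc n) N W (ins i a x))" if F: "finite (verts F)" "x \<in> tuples F n" for F x
 proof -
  have l: "length x = n" using F tuples_length by auto
  have N: "N - n = 1 + (N - Suc n)" using nN by simp
  have "base F n N W' x = (\<Sum>y\<in>tuples F 1. \<Sum>z\<in>tuples F (N - Suc n). vec F W' (x @ y @ z))"
   unfolding base_def N by (rule sum_tuples_append[OF F(1)])
  also have "... = (\<Sum>y\<in>tuples F 1. \<Sum>z\<in>tuples F (N - Suc n). \<Sum>a\<in>verts F. vec F W (ins i a x @ z))"
  proof (intro sum.cong refl)
   fix y z assume yz: "y \<in> tuples F 1" "z \<in> tuples F (N - Suc n)"
   have "x @ y @ z \<in> tuples F N" using F yz nN by (auto simp: tuples_def)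
   moreover have "ins i a (del n (x @ y @ z)) = ins i a x @ z" for a
    using l yz B_base.prems by (auto simp: ins_def del_def tuples_def)
   ultimately show "vec F W' (x @ y @ z) = (\<Sum>a\<in>verts F. vec F W (ins i a x @ z))" using v[OF F(1)] by simp
  qed
  also have "... = real (card (tuples F 1)) * (\<Sum>z\<in>tuples F (N - Suc n). \<Sum>a\<in>verts F. vec F W (ins i a x @ z))" by simp
  also have "card (tuples F 1) = card (verts F)" using sum_tuples_Suc[OF F(1), of "%_. 1 :: nat" 0] by simp
  also have "(\<Sum>z\<in>tuples F (N - Suc n). \<Sum>a\<in>verts F. vec F W (ins i a x @ z)) = (\<Sum>a\<in>verts F. base F (Suc n) N W (ins i a x))"
   unfolding base_def by (rule sum.swap)
  finally show ?thesis .
 qed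
 have cGH: "card (verts G) = card (verts H)"
 proof -
  have "Zw F 1 [] = real (card (verts F))" if "finite (verts F)" for F
   using sum_tuples_Suc[OF that, of "%_. 1 :: real" 0] by (simp add: Zw_def)
  then show ?thesis using Zeq[of "[]" 1] finG finH by simp
 qed
 have B: "BB n (base G n N W') (base H n N W')" by (rule BB.B_base) (use W' nN in auto)
 show ?case
 proof (cases "card (verts G) = 0")
  case True
  then have "verts G = {}" "verts H = {}" using cGH finG finH by auto
  then have "BB n (%x. 0 * base G n N W' x + 0 * base G n N W' x) (%x. 0 * base H n N W' x + 0 * base H n N W' x)" by (intro BB.B_lin B)
  then show ?thesis by (rule BB.B_cong) (simp_all add: \<open>verts G = {}\<close> \<open>verts H = {}\<close>)
 next
  case False
  let ?c = "1 / real (card (verts G))"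
  have "BB n (%x. ?c * base G n N W' x + 0 * base G n N W' x) (%x. ?c * base H n N W' x + 0 * base H n N W' x)" by (intro BB.B_lin B)
  then show ?thesis by (rule BB.B_cong) (use e[OF finG] e[OF finH] False cGH in auto)
 qed
next
 case (B_cong f g f' g')
 then have "BB n (%x. \<Sum>a\<in>verts G. f (ins i a x)) (%x. \<Sum>a\<in>verts H. g (ins i a x))" by simp
 then show ?case by (rule BB.B_cong) (use B_cong ins_tuples in \<open>auto intro!: sum.cong\<close>)
next
 case (B_lin f g f' g' c d)
 then have "BB n (%x. c * (\<Sum>a\<in>verts G. f (ins i a x)) + d * (\<Sum>a\<in>verts G. f' (ins i a x))) (%x. c * (\<Sum>a\<in>verts H. g (ins i a x)) + d * (\<Sum>a\<in>verts H. g' (ins i a x)))"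
  by (intro BB.B_lin) auto
 then show ?case by (rule BB.B_cong) (auto simp: sum_distrib_left sum.distrib)
qed

lemma KK_BB: "KK n f g ==> BB n f g"
proof (induction rule: KK.induct)
 case K_one
 have "BB 0 (base G 0 0 []) (base H 0 0 [])" by (rule BB.B_base) auto
 then show ?case by (rule BB.B_cong) (auto simp: base_def)
qed (auto intro: BB.B_cong BB_ins BB_sum BB_D BB_A BB.B_lin)

lemma KK_zero: "KK 0 f g ==> f [] = g []" by (rule BB_zero[OF KK_BB])

end

section \<open>Operator words as grid counts\<close>

abbreviation pe :: "nat => nat => nat" where "pe i c \<equiv> prod_encode (i, c)"

text \<open>\<open>pe i c\<close> stands for site \<open>i\<close> at time \<open>c\<close>:
  \<open>N\<close> rows and \<open>L + 1\<close> columns.\<close>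

definition Vr :: "nat => nat => nat set" where
 "Vr N L = {v. fst (prod_decode v) < N & snd (prod_decode v) <= L}"

lemma pe_Vr [simp]: "pe i c \<in> Vr N L \<longleftrightarrow> i < N & c <= L" by (simp add: Vr_def)

lemma Vr_E: assumes "v \<in> Vr N L" obtains i c where "v = pe i c" "i < N" "c <= L"
 using assms that[of "fst (prod_decode v)" "snd (prod_decode v)"] by (auto simp: Vr_def)

lemma finite_Vr: "finite (Vr N L)"
proof -
 have "Vr N L = prod_encode ` ({..<N} \<times> {..L})" by (auto elim!: Vr_E)
 then show ?thesis by simp
qed

definition links :: "nat set => nat => (nat \<times> nat) set" where
 "links J L = (%j. (pe j L, pe j (Suc L))) ` J"

definition colp :: "nat => (nat \<times> nat) set => (nat \<times> nat) set" where
 "colp c Q = (%(i, j). (pe i c, pe j c)) ` Q"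

text \<open>Column \<open>c\<close> holds the site values after the last \<open>c\<close> letters of
  the word have been applied. \<open>Cc\<close> ties consecutive columns by equalities, except at a
  summed site; \<open>OpA\<close> and \<open>OpD\<close> constrain the new column. The empty
  \<open>colp\<close> terms give all clauses the shape of \<open>card_fib_Suc\<close>.\<close>

fun Kc :: "site_op list => (nat \<times> nat) set" where
 "Kc [] = {}"
| "Kc (OpA i # W) = colp (Suc (length W)) {(i, Suc i)} Un Kc W"
| "Kc (OpJ i # W) = colp (Suc (length W)) {} Un Kc W"
| "Kc (OpD i # W) = colp (Suc (length W)) {} Un Kc W"

fun Cc :: "nat => site_op list => (nat \<times> nat) set" where
 "Cc N [] = {}"
| "Cc N (OpA i # W) = colp (Suc (length W)) {} Un links {..<N} (length W) Un Cc N W"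
| "Cc N (OpJ i # W) = colp (Suc (length W)) {} Un links ({..<N} - {i}) (length W) Un Cc N W"
| "Cc N (OpD i # W) = colp (Suc (length W)) {(i, Suc i)} Un links {..<N} (length W) Un Cc N W"

text \<open>The ambient grid size merely exceeds both side lengths.\<close>

definition rect :: "nat => nat => graph" where
 "rect N L = \<lparr> verts = Vr N L, adj = (%u v. u \<in> Vr N L & v \<in> Vr N L & (prod_decode u, prod_decode v) \<in> grid_edges (N + Suc L)) \<rparr>"

lemma simple_rect: "simple_graph (rect N L)"
 unfolding simple_graph_def wf_graph_def rect_def using finite_Vr by (auto simp: grid_edges_def)

lemma adj_rect: "adj (rect N L) (pe i c) (pe j d) \<longleftrightarrow> i < N & j < N & c <= L & d <= L &
 (i = j & (d = Suc c \<or> c = Suc d) \<or> c = d & (j = Suc i \<or> i = Suc j))"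
 by (auto simp: rect_def grid_edges_def)

lemma constraints_rect:
 assumes "!!p. p \<in> set W ==> op_ok N p" "length W <= L"
 shows "Kc W \<subseteq> gedges (rect N L) & Cc N W \<subseteq> gedges (rect N L)"
 using assms
proof (induction W)
 case (Cons p W)
 have IH: "Kc W \<subseteq> gedges (rect N L) & Cc N W \<subseteq> gedges (rect N L)" using Cons by simp
 have p: "op_ok N p" "Suc (length W) <= L" using Cons.prems by auto
 have l: "links J (length W) \<subseteq> gedges (rect N L)" if "J \<subseteq> {..<N}" for J
  using that p(2) by (auto simp: links_def adj_rect)
 show ?case using IH p l[of "{..<N}"] l[of "{..<N} - {_}"] by (cases p) (auto simp: colp_def adj_rect)
qed simp

lemma constraints_Vr:
 assumes "!!p. p \<in> set W ==> op_ok N p"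
 shows "Kc W \<subseteq> Vr N (length W) \<times> Vr N (length W)" "Cc N W \<subseteq> Vr N (length W) \<times> Vr N (length W)"
 using constraints_rect[of W N "length W"] assms by (auto simp: rect_def)

definition fib :: "nat set => (nat \<times> nat) set => (nat \<times> nat) set => graph => nat set => nat => nat list => (nat => nat) set" where
 "fib V K C G J c x = {f \<in> homc_set V K C G. \<forall>j\<in>J. f (pe j c) = x ! j}"

text \<open>The new column is determined by its prescribed values, and the links hand them to the
  previous column at the sites \<open>J\<close>.\<close>

lemma card_fib_Suc:
 assumes KC: "K \<subseteq> Vr N L \<times> Vr N L" "C \<subseteq> Vr N L \<times> Vr N L" and J: "J \<subseteq> {..<N}" and x: "x \<in> tuples G N"
  and Q: "A \<subseteq> {..<N} \<times> {..<N}" "B \<subseteq> {..<N} \<times> {..<N}"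
 shows "card (fib (Vr N (Suc L)) (colp (Suc L) A Un K) (colp (Suc L) B Un links J L Un C) G {..<N} (Suc L) x) =
  (if (\<forall>(i, j)\<in>A. adj G (x ! i) (x ! j)) & (\<forall>(i, j)\<in>B. x ! i = x ! j) then card (fib (Vr N L) K C G J L x) else 0)"
proof (cases "(\<forall>(i, j)\<in>A. adj G (x ! i) (x ! j)) & (\<forall>(i, j)\<in>B. x ! i = x ! j)")
 case False
 have "fib (Vr N (Suc L)) (colp (Suc L) A Un K) (colp (Suc L) B Un links J L Un C) G {..<N} (Suc L) x = {}" (is "?F = {}")
 proof (rule ccontr)
  assume "?F ~= {}"
  then obtain f where f: "f \<in> ?F" by blast
  have fx: "f (pe i (Suc L)) = x ! i" if "i < N" for i using f that by (auto simp: fib_def)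
  moreover have "adj G (f (pe i (Suc L))) (f (pe j (Suc L)))" if "(i, j) \<in> A" for i j
   using f that unfolding fib_def homc_set_def colp_def by fastforce
  moreover have fB: "f (pe i (Suc L)) = f (pe j (Suc L))" if "(i, j) \<in> B" for i j
   using f that unfolding fib_def homc_set_def colp_def by fastforce
  ultimately have "adj G (x ! i) (x ! j)" if "(i, j) \<in> A" for i j using that Q(1) by (metis SigmaE2 lessThan_iff subsetD)
  moreover have "x ! i = x ! j" if ij: "(i, j) \<in> B" for i j
  proof -
   have "(i, j) \<in> {..<N} \<times> {..<N}" using Q(2) ij by (rule subsetD)
   then show ?thesis using fx[of i] fx[of j] fB[OF ij] by simp
  qed
  ultimately show False using False by blast
 qed
 then show ?thesis unfolding if_not_P[OF False] by simp
next
 case True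
 have xv: "x ! i \<in> verts G" if "i < N" for i using x that by (auto simp: tuples_def subset_iff)
 have sub: "Vr N L \<subseteq> Vr N (Suc L)" by (auto simp: Vr_def)
 let ?ext = "%f v. if v \<in> Vr N L then f v else if v \<in> Vr N (Suc L) then x ! fst (prod_decode v) else undefined"
 have "bij_betw (%f. restrict f (Vr N L)) (fib (Vr N (Suc L)) (colp (Suc L) A Un K) (colp (Suc L) B Un links J L Un C) G {..<N} (Suc L) x) (fib (Vr N L) K C G J L x)" (is "bij_betw _ ?F ?F'")
 proof (rule bij_betwI[where g = ?ext])
  show "(%f. restrict f (Vr N L)) \<in> ?F \<rightarrow> ?F'"
  proof
   fix f assume f: "f \<in> ?F"
   have fv: "f v \<in> verts G" if "v \<in> Vr N (Suc L)" for v using f that unfolding fib_def homc_set_def by (auto simp: PiE_iff)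
   have fK: "adj G (f u) (f v)" if "(u, v) \<in> K" for u v using f that unfolding fib_def homc_set_def by auto
   have fC: "f u = f v" if "(u, v) \<in> C" for u v using f that unfolding fib_def homc_set_def by auto
   have fl: "f (pe j L) = f (pe j (Suc L))" if "j \<in> J" for j using f that unfolding fib_def homc_set_def links_def by auto
   have fx: "f (pe j (Suc L)) = x ! j" if "j < N" for j using f that unfolding fib_def by auto
   show "restrict f (Vr N L) \<in> ?F'" unfolding fib_def homc_set_def
   proof (intro CollectI conjI)
    show "restrict f (Vr N L) \<in> Vr N L \<rightarrow>\<^sub>E verts G" using fv sub by auto
    show "\<forall>(u, v)\<in>K. adj G (restrict f (Vr N L) u) (restrict f (Vr N L) v)" using fK KC by auto
    show "\<forall>(u, v)\<in>C. restrict f (Vr N L) u = restrict f (Vr N L) v" using fC KC by auto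
    show "\<forall>j\<in>J. restrict f (Vr N L) (pe j L) = x ! j" using fl fx J by auto
   qed
  qed
  show "?ext \<in> ?F' \<rightarrow> ?F"
  proof
   fix f assume f: "f \<in> ?F'"
   have fv: "f v \<in> verts G" if "v \<in> Vr N L" for v using f that unfolding fib_def homc_set_def by (auto simp: PiE_iff)
   have fK: "adj G (f u) (f v)" if "(u, v) \<in> K" for u v using f that unfolding fib_def homc_set_def by auto
   have fC: "f u = f v" if "(u, v) \<in> C" for u v using f that unfolding fib_def homc_set_def by auto
   have fl: "f (pe j L) = x ! j" if "j \<in> J" for j using f that unfolding fib_def by auto
   have xS: "x ! fst (prod_decode v) \<in> verts G" if "v \<in> Vr N (Suc L)" for v using that xv by (auto simp: Vr_def)
   show "?ext f \<in> ?F" unfolding fib_def homc_set_def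
   proof (intro CollectI conjI)
    show "?ext f \<in> Vr N (Suc L) \<rightarrow>\<^sub>E verts G" using fv xS sub by (auto simp: PiE_iff extensional_def)
    show "\<forall>(u, v)\<in>colp (Suc L) A Un K. adj G (?ext f u) (?ext f v)" using fK KC Q True by (auto simp: colp_def)
    show "\<forall>(u, v)\<in>colp (Suc L) B Un links J L Un C. ?ext f u = ?ext f v" using fC fl J KC Q True by (auto simp: colp_def links_def)
    show "\<forall>j\<in>{..<N}. ?ext f (pe j (Suc L)) = x ! j" by auto
   qed
  qed
  show "?ext (restrict f (Vr N L)) = f" if f: "f \<in> ?F" for f
  proof
   fix v
   have u: "f v = undefined" if "v ~: Vr N (Suc L)" using f that unfolding fib_def homc_set_def by (auto simp: PiE_iff extensional_def)
   have fx: "f (pe j (Suc L)) = x ! j" if "j < N" for j using f that unfolding fib_def by auto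
   have "f v = x ! fst (prod_decode v)" if v: "v \<in> Vr N (Suc L)" "v ~: Vr N L"
   proof -
    obtain i c where ic: "v = pe i c" "i < N" "c <= Suc L" using v(1) by (rule Vr_E)
    then have "c = Suc L" using v(2) by auto
    then show ?thesis using ic fx by simp
   qed
   then show "?ext (restrict f (Vr N L)) v = f v" using u by auto
  qed
  show "restrict (?ext f) (Vr N L) = f" if "f \<in> ?F'" for f
   using that unfolding fib_def homc_set_def by (auto simp: PiE_iff extensional_def restrict_def fun_eq_iff)
 qed
 then show ?thesis using True bij_betw_same_card by fastforce
qed

lemma vec_card_fib:
 assumes "!!p. p \<in> set W ==> op_ok N p" "x \<in> tuples G N" "finite (verts G)"
 shows "vec G W x = real (card (fib (Vr N (length W)) (Kc W) (Cc N W) G {..<N} (length W) x))"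
 using assms(1,2)
proof (induction W arbitrary: x)
 case Nil
 have xv: "x ! i \<in> verts G" if "i < N" for i using Nil(2) that by (auto simp: tuples_def subset_iff)
 have "fib (Vr N 0) {} {} G {..<N} 0 x = {%v. if v \<in> Vr N 0 then x ! fst (prod_decode v) else undefined}"
 proof (intro equalityI subsetI)
  fix f assume f: "f \<in> fib (Vr N 0) {} {} G {..<N} 0 x"
  have "f v = (if v \<in> Vr N 0 then x ! fst (prod_decode v) else undefined)" for v
   using f by (auto simp: fib_def homc_set_def PiE_iff extensional_def elim!: Vr_E)
  then show "f \<in> {%v. if v \<in> Vr N 0 then x ! fst (prod_decode v) else undefined}" by blast
 next
  fix f assume "f \<in> {%v. if v \<in> Vr N 0 then x ! fst (prod_decode v) else undefined}"
  then show "f \<in> fib (Vr N 0) {} {} G {..<N} 0 x"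
   using xv by (auto simp: fib_def homc_set_def PiE_iff extensional_def elim!: Vr_E)
 qed
 then show ?case by simp
next
 case (Cons p W)
 have W: "!!p. p \<in> set W ==> op_ok N p" and p: "op_ok N p" using Cons.prems by auto
 have KC: "Kc W \<subseteq> Vr N (length W) \<times> Vr N (length W)" "Cc N W \<subseteq> Vr N (length W) \<times> Vr N (length W)"
  using constraints_Vr[of W N] W by auto
 have IH: "vec G W z = real (card (fib (Vr N (length W)) (Kc W) (Cc N W) G {..<N} (length W) z))" if "z \<in> tuples G N" for z
  using Cons.IH W that by blast
 show ?case
 proof (cases p)
  case (OpJ i)
  let ?f = "fib (Vr N (length W)) (Kc W) (Cc N W) G"
  have i: "i < N" and lx: "length x = N" using p OpJ Cons.prems by (auto simp: tuples_def)
  \<comment> \<open>Leaving site \<open>i\<close> of the previous column open amounts to summing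
    over its value.\<close>
  have U: "?f ({..<N} - {i}) (length W) x = (\<Union>a\<in>verts G. ?f {..<N} (length W) (x[i := a]))"
  proof (intro equalityI subsetI)
   fix f assume f: "f \<in> ?f ({..<N} - {i}) (length W) x"
   then have "f (pe i (length W)) \<in> verts G" using i by (auto simp: fib_def homc_set_def PiE_iff)
   moreover have "f \<in> ?f {..<N} (length W) (x[i := f (pe i (length W))])" using f lx i by (auto simp: fib_def nth_list_update)
   ultimately show "f \<in> (\<Union>a\<in>verts G. ?f {..<N} (length W) (x[i := a]))" by blast
  next
   fix f assume "f \<in> (\<Union>a\<in>verts G. ?f {..<N} (length W) (x[i := a]))"
   then obtain a where a: "f \<in> ?f {..<N} (length W) (x[i := a])" by blast
   have "x[i := a] ! j = x ! j" if "j ~= i" for j using that by simp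
   then show "f \<in> ?f ({..<N} - {i}) (length W) x" using a by (simp add: fib_def)
  qed
  have "card (?f ({..<N} - {i}) (length W) x) = (\<Sum>a\<in>verts G. card (?f {..<N} (length W) (x[i := a])))"
   unfolding U
  proof (rule card_UN_disjoint[OF assms(3)])
   show "\<forall>a\<in>verts G. finite (?f {..<N} (length W) (x[i := a]))"
    using finite_homc_set[OF finite_Vr assms(3)] by (auto simp: fib_def)
   show "\<forall>a\<in>verts G. \<forall>b\<in>verts G. a ~= b --> ?f {..<N} (length W) (x[i := a]) Int ?f {..<N} (length W) (x[i := b]) = {}"
   proof (intro ballI impI)
    fix a b :: nat assume ab: "a ~= b"
    have "f (pe i (length W)) = c" if "f \<in> ?f {..<N} (length W) (x[i := c])" for f c
     using that i lx by (auto simp: fib_def)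
    then show "?f {..<N} (length W) (x[i := a]) Int ?f {..<N} (length W) (x[i := b]) = {}" using ab by blast
   qed
  qed
  then show ?thesis using OpJ card_fib_Suc[OF KC _ Cons.prems(2), of "{..<N} - {i}" "{}" "{}"] IH[OF upd_tuples[OF Cons.prems(2)]] by simp
 next
  case (OpD i)
  then show ?thesis using p card_fib_Suc[OF KC _ Cons.prems(2), of "{..<N}" "{}" "{(i, Suc i)}"] IH[OF Cons.prems(2)] by simp
 next
  case (OpA i)
  then show ?thesis using p card_fib_Suc[OF KC _ Cons.prems(2), of "{..<N}" "{(i, Suc i)}" "{}"] IH[OF Cons.prems(2)] by simp
 qed
qed

lemma Zw_homc:
 assumes "!!p. p \<in> set W ==> op_ok N p" "finite (verts G)"
 shows "Zw G N W = real (homc (Vr N (length W)) (Kc W) (Cc N W) G)"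
proof -
 let ?h = "homc_set (Vr N (length W)) (Kc W) (Cc N W) G"
 let ?f = "fib (Vr N (length W)) (Kc W) (Cc N W) G {..<N} (length W)"
 have U: "?h = (\<Union>x\<in>tuples G N. ?f x)"
 proof (intro equalityI subsetI)
  fix f assume f: "f \<in> ?h"
  let ?x = "map (%j. f (pe j (length W))) [0..<N]"
  have "?x \<in> tuples G N" using f by (auto simp: tuples_def homc_set_def PiE_iff)
  moreover have "f \<in> ?f ?x" using f by (auto simp: fib_def)
  ultimately show "f \<in> (\<Union>x\<in>tuples G N. ?f x)" by blast
 qed (auto simp: fib_def)
 have "card ?h = (\<Sum>x\<in>tuples G N. card (?f x))" unfolding U
 proof (rule card_UN_disjoint[OF finite_tuples[OF assms(2)]])
  show "\<forall>x\<in>tuples G N. finite (?f x)" using finite_homc_set[OF finite_Vr assms(2)] by (auto simp: fib_def)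
  show "\<forall>x\<in>tuples G N. \<forall>y\<in>tuples G N. x ~= y --> ?f x Int ?f y = {}"
  proof (intro ballI impI)
   fix x y assume xy: "x \<in> tuples G N" "y \<in> tuples G N" "x ~= y"
   then obtain i where "i < N" "x ! i ~= y ! i" by (metis nth_equalityI tuples_length)
   then show "?f x Int ?f y = {}" by (auto simp: fib_def)
  qed
 qed
 then show ?thesis using vec_card_fib[OF assms(1) _ assms(2)] by (simp add: Zw_def homc_def)
qed

context indist
begin

text \<open>The rectangle of the word is a minor of a large grid and hence in \<open>cl\<close>; the
  word sum is one of its constrained counts, to which \<open>homc_closed\<close> applies. Without
  sites the word is empty, and this case is apart because \<open>cl_minor\<close> asks for a
  vertex.\<close>

lemma Zw_eq:
 assumes grids: "!!r. \<exists>F. cl F & minor (gedges F) (verts F) (grid_edges r) ({..<r} \<times> {..<r})"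
  and GH: "R G H" and W: "!!p. p \<in> set W ==> op_ok N p"
 shows "Zw G N W = Zw H N W"
proof (cases "N = 0")
 case True
 have "~ op_ok 0 p" for p by (cases p) auto
 then have "W = []" using W True by (cases W) auto
 then show ?thesis using True by (simp add: Zw_def)
next
 case False
 let ?L = "length W"
 obtain F B where F: "cl F" and B1: "\<forall>x\<in>{..<N + Suc ?L} \<times> {..<N + Suc ?L}. B x ~= {} & B x \<subseteq> verts F & conn (gedges F) (B x)"
  and B2: "\<forall>x\<in>{..<N + Suc ?L} \<times> {..<N + Suc ?L}. \<forall>y\<in>{..<N + Suc ?L} \<times> {..<N + Suc ?L}. x ~= y --> B x Int B y = {}"
  and B3: "\<forall>(x, y)\<in>grid_edges (N + Suc ?L). \<exists>u\<in>B x. \<exists>v\<in>B y. (u, v) \<in> gedges F"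
  using grids[of "N + Suc ?L"] unfolding minor_def by (elim exE conjE)
 have d: "prod_decode v \<in> {..<N + Suc ?L} \<times> {..<N + Suc ?L}" if "v \<in> Vr N ?L" for v
  using that by (auto simp: Vr_def mem_Times_iff)
 have "minor (gedges F) (verts F) (gedges (rect N ?L)) (verts (rect N ?L))" unfolding minor_def
 proof (intro exI[of _ "%v. B (prod_decode v)"] conjI ballI impI)
  fix v assume v: "v \<in> verts (rect N ?L)"
  then have dv: "prod_decode v \<in> {..<N + Suc ?L} \<times> {..<N + Suc ?L}" using d by (simp add: rect_def)
  show "B (prod_decode v) ~= {}" "B (prod_decode v) \<subseteq> verts F" "conn (gedges F) (B (prod_decode v))" using bspec[OF B1 dv] by simp_all
  fix w assume w: "w \<in> verts (rect N ?L)" "v ~= w"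
  have n: "prod_decode v ~= prod_decode w" using w(2) by (metis prod_decode_inverse)
  have dw: "prod_decode w \<in> {..<N + Suc ?L} \<times> {..<N + Suc ?L}" using d w by (simp add: rect_def)
  show "B (prod_decode v) Int B (prod_decode w) = {}" using bspec[OF bspec[OF B2 dv] dw] n by simp
 next
  fix z assume z: "z \<in> gedges (rect N ?L)"
  obtain v w where vw: "z = (v, w)" by (cases z)
  then have "(prod_decode v, prod_decode w) \<in> grid_edges (N + Suc ?L)" using z by (simp add: rect_def)
  then show "case z of (x, y) => \<exists>u\<in>B (prod_decode x). \<exists>v\<in>B (prod_decode y). (u, v) \<in> gedges F" using bspec[OF B3, of "(prod_decode v, prod_decode w)"] vw by simp
 qed
 moreover have "pe 0 0 \<in> verts (rect N ?L)" using False by (simp add: rect_def)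
 ultimately have "cl (rect N ?L)" using cl_minor[OF F simple_rect] by blast
 then have "homc (Vr N ?L) (Kc W) (Cc N W) G = homc (Vr N ?L) (Kc W) (Cc N W) H"
  using homc_closed[of "rect N ?L" G H "Kc W" "Cc N W"] GH constraints_rect[of W N ?L] W by (simp add: rect_def)
 moreover have "finite (verts G)" "finite (verts H)" using R_wf[OF GH] by (auto simp: wf_graph_def)
 ultimately show ?thesis using Zw_homc[OF W] by simp
qed

end

section \<open>Closure properties of the tensor pairs\<close>

lemma CS_sum:
 fixes a b :: "'i => real"
 assumes "finite I"
 shows "(\<Sum>i\<in>I. a i * b i)\<^sup>2 <= (\<Sum>i\<in>I. (a i)\<^sup>2) * (\<Sum>i\<in>I. (b i)\<^sup>2)"
proof -
 have "0 <= (\<Sum>i\<in>I. \<Sum>j\<in>I. (a i * b j - a j * b i)\<^sup>2)" by (intro sum_nonneg) auto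
 also have "... = (\<Sum>i\<in>I. \<Sum>j\<in>I. (a i)\<^sup>2 * (b j)\<^sup>2 + (b i)\<^sup>2 * (a j)\<^sup>2 - 2 * ((a i * b i) * (a j * b j)))"
  by (intro sum.cong refl) (simp add: power2_eq_square algebra_simps)
 also have "... = 2 * ((\<Sum>i\<in>I. (a i)\<^sup>2) * (\<Sum>i\<in>I. (b i)\<^sup>2)) - 2 * (\<Sum>i\<in>I. a i * b i)\<^sup>2"
  by (simp add: sum.distrib sum_subtractf sum_distrib_left[symmetric] sum_distrib_right[symmetric] power2_eq_square[of "sum _ _"])
 finally show ?thesis by simp
qed

text \<open>The hypotheses make \<open>C\<close> the product of \<open>T\<close> with a projection
  commuting with it. In place of a spectral theorem, \<open>v\<close> is contracted by
  \<open>X = 1 - e T\<close>: the form of \<open>C\<close> does not increase from \<open>v\<close>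
  to \<open>X v\<close>, while the norm shrinks geometrically. So the form at \<open>v\<close> is
  bounded below by quantities tending to 0.\<close>

lemma psd_of_square:
 fixes C T :: "'i => 'i => real"
 assumes fin: "finite I" and Cs: "!!i j. i \<in> I ==> j \<in> I ==> C i j = C j i" and Ts: "!!i j. i \<in> I ==> j \<in> I ==> T i j = T j i"
  and CC: "!!i k. i \<in> I ==> k \<in> I ==> (\<Sum>j\<in>I. C i j * C j k) = (\<Sum>j\<in>I. T i j * C j k)"
  and d: "0 < d" and pos: "!!v. d * (\<Sum>i\<in>I. (v i)\<^sup>2) <= (\<Sum>i\<in>I. v i * (\<Sum>j\<in>I. T i j * v j))"
 shows "0 <= (\<Sum>i\<in>I. v i * (\<Sum>j\<in>I. C i j * v j))"
proof -
 define ip where "ip u v = (\<Sum>i\<in>I. u i * v i)" for u v :: "'i => real"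
 define ap where "ap M v = (%i. \<Sum>j\<in>I. M i j * v j)" for M :: "'i => 'i => real" and v
 define sz where "sz M = 1 + (\<Sum>i\<in>I. \<Sum>j\<in>I. (M i j)\<^sup>2)" for M :: "'i => 'i => real"
 have ipc: "ip u v = ip v u" for u v by (simp add: ip_def mult.commute)
 have cg: "ip u v = ip u w" if "!!i. i \<in> I ==> v i = w i" for u v w using that by (simp add: ip_def)
 have ipn: "0 <= ip u u" for u by (simp add: ip_def sum_nonneg)
 have adj: "ip (ap M u) v = ip u (ap M v)" if "!!i j. i \<in> I ==> j \<in> I ==> M i j = M j i" for M u v
 proof -
  have "ip (ap M u) v = (\<Sum>i\<in>I. \<Sum>j\<in>I. M i j * u j * v i)" by (simp add: ip_def ap_def sum_distrib_right)
  also have "... = (\<Sum>j\<in>I. \<Sum>i\<in>I. M i j * u j * v i)" by (rule sum.swap)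
  also have "... = (\<Sum>j\<in>I. \<Sum>i\<in>I. u j * (M j i * v i))" using that by (intro sum.cong refl) simp
  finally show ?thesis by (simp add: ip_def ap_def sum_distrib_left)
 qed
 note aC = adj[of C, OF Cs] and aT = adj[of T, OF Ts]
 have sq: "ap C (ap C u) i = ap T (ap C u) i" if "i \<in> I" for u i
 proof -
  have "ap C (ap C u) i = (\<Sum>j\<in>I. \<Sum>k\<in>I. C i j * C j k * u k)" by (simp add: ap_def sum_distrib_left mult.assoc)
  also have "... = (\<Sum>k\<in>I. (\<Sum>j\<in>I. C i j * C j k) * u k)" by (subst sum.swap) (simp add: sum_distrib_right)
  also have "... = (\<Sum>k\<in>I. (\<Sum>j\<in>I. T i j * C j k) * u k)" using CC that by simp
  also have "... = (\<Sum>j\<in>I. \<Sum>k\<in>I. T i j * C j k * u k)" by (subst sum.swap) (simp add: sum_distrib_right)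
  finally show ?thesis by (simp add: ap_def sum_distrib_left mult.assoc)
 qed
 have sq': "ip u (ap C (ap C w)) = ip u (ap T (ap C w))" for u w by (rule cg) (rule sq)
 have apb: "ip (ap M u) (ap M u) <= sz M * ip u u" for M u
 proof -
  have "ip (ap M u) (ap M u) = (\<Sum>i\<in>I. (\<Sum>j\<in>I. M i j * u j)\<^sup>2)" by (simp add: ip_def ap_def power2_eq_square)
  also have "... <= (\<Sum>i\<in>I. (\<Sum>j\<in>I. (M i j)\<^sup>2) * (\<Sum>j\<in>I. (u j)\<^sup>2))" by (intro sum_mono CS_sum fin)
  also have "... = (sz M - 1) * ip u u" by (simp add: sz_def ip_def sum_distrib_right power2_eq_square)
  also have "... <= sz M * ip u u" using ipn[of u] by (simp add: algebra_simps)
  finally show ?thesis .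
 qed
 have amgm: "2 * \<bar>ip u w\<bar> <= ip u u + ip w w" for u w
 proof -
  have "0 <= ip (%i. u i + w i) (%i. u i + w i)" "0 <= ip (%i. u i - w i) (%i. u i - w i)" by (rule ipn)+
  moreover have "ip (%i. u i + w i) (%i. u i + w i) = ip u u + 2 * ip u w + ip w w"
   "ip (%i. u i - w i) (%i. u i - w i) = ip u u - 2 * ip u w + ip w w"
   by (simp_all add: ip_def sum.distrib sum_subtractf sum_distrib_left algebra_simps)
  ultimately show ?thesis by linarith
 qed
 have sz1: "1 <= sz M" for M by (simp add: sz_def sum_nonneg)
 have form: "\<bar>ip u (ap M u)\<bar> <= sz M * ip u u" for M u
 proof -
  have "2 * \<bar>ip u (ap M u)\<bar> <= ip u u + sz M * ip u u" using amgm[of u "ap M u"] apb[of M u] by linarith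
  moreover have "ip u u <= sz M * ip u u" using mult_right_mono[OF sz1 ipn[of u], of M] by simp
  ultimately show ?thesis by linarith
 qed
 \<comment> \<open>\<open>sz T\<close> exceeds the squared Frobenius norm and bounds both the form
   of \<open>T\<close> and the squared norm of \<open>T u\<close>. The part
   \<open>e * sz T <= 1\<close> serves the descent \<open>dec\<close>, the part
   \<open>e * sz T <= d\<close> the contraction \<open>contr\<close>.\<close>
 define e where "e = min 1 d / sz T"
 define q where "q = max 0 (1 - e * d)"
 have e: "0 < e" "e * sz T <= 1" "e * sz T <= d" using sz1[of T] d by (auto simp: e_def)
 have q: "0 <= q" "q < 1" using e d by (auto simp: q_def)
 define X where "X v = (%i. v i - e * ap T v i)" for v
 have lin: "ip u (%i. v i - c * w i) = ip u v - c * ip u w" for u v w c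
  by (simp add: ip_def sum_subtractf sum_distrib_left algebra_simps)
 have lin': "ip (%i. v i - c * w i) u = ip v u - c * ip w u" for u v w c using lin ipc by metis
 have apl: "ap M (%i. v i - c * w i) = (%i. ap M v i - c * ap M w i)" for M v w c
  by (simp add: ap_def fun_eq_iff sum_subtractf sum_distrib_left algebra_simps)
 \<comment> \<open>By symmetry and \<open>C^2 = T C\<close> all mixed terms reduce to
   \<open>w = C v\<close>: \<open><v, C T v> = |w|^2\<close> and
   \<open><T v, C T v> = <w, T w>\<close>. The choice of \<open>e\<close> makes the quadratic term
   at most half of the linear one.\<close>
 have dec: "ip (X v) (ap C (X v)) <= ip v (ap C v)" for v
 proof -
  let ?w = "ap C v"
  have 1: "ip v (ap C (ap T v)) = ip ?w ?w"
  proof -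
   have "ip v (ap C (ap T v)) = ip (ap T ?w) v" using aC[of v "ap T v"] aT[of "?w" v] by (simp add: ipc)
   also have "... = ip v (ap C ?w)" using sq'[of v v] by (simp add: ipc)
   finally show ?thesis using aC[of v ?w] by simp
  qed
  have 2: "ip (ap T v) ?w = ip ?w ?w" using 1 aC[of v "ap T v"] by (simp add: ipc)
  have 3: "ip (ap T v) (ap C (ap T v)) = ip ?w (ap T ?w)"
  proof -
   have "ip (ap T v) (ap C (ap T v)) = ip v (ap C (ap C (ap T v)))" using aT[of v] sq'[of v "ap T v"] by simp
   also have "... = ip (ap C ?w) (ap T v)" using aC by simp
   also have "... = ip v (ap T (ap C ?w))" using aT[of v "ap C ?w"] by (simp add: ipc)
   also have "... = ip v (ap C (ap C ?w))" using sq' by simp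
   also have "... = ip ?w (ap C ?w)" using aC by simp
   also have "... = ip ?w (ap T ?w)" using sq' by simp
   finally show ?thesis .
  qed
  have "ip (X v) (ap C (X v)) = ip v ?w - 2 * e * ip ?w ?w + e * (e * ip ?w (ap T ?w))"
   unfolding X_def apl lin lin' 1 2 3 by (simp add: algebra_simps)
  moreover have "e * ip ?w (ap T ?w) <= e * (sz T * ip ?w ?w)" using form[of ?w T] e(1) by (intro mult_left_mono) auto
  moreover have "e * (sz T * ip ?w ?w) <= 1 * ip ?w ?w" using mult_right_mono[OF e(2) ipn[of ?w]] by (simp add: mult.assoc)
  ultimately have le: "ip (X v) (ap C (X v)) = ip v ?w - 2 * e * ip ?w ?w + e * (e * ip ?w (ap T ?w))" "e * ip ?w (ap T ?w) <= ip ?w ?w" by linarith+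
  then have "ip (X v) (ap C (X v)) <= ip v ?w - 2 * e * ip ?w ?w + e * ip ?w ?w"
   using e(1) mult_left_mono[OF le(2), of e] by simp
  then show ?thesis using e(1) mult_nonneg_nonneg[of e "ip ?w ?w"] ipn[of ?w] by linarith
 qed
 have contr: "ip (X v) (X v) <= q * ip v v" for v
 proof -
  have p: "d * ip v v <= ip v (ap T v)" using pos[of v] by (simp add: ip_def ap_def power2_eq_square)
  have "ip (X v) (X v) = ip v v - 2 * e * ip v (ap T v) + e * (e * ip (ap T v) (ap T v))"
   unfolding X_def lin lin' by (simp add: algebra_simps ipc)
  also have "... <= ip v v - 2 * e * (d * ip v v) + e * (d * ip v v)"
  proof -
   have "e * ip (ap T v) (ap T v) <= e * (sz T * ip v v)" using apb e(1) by (intro mult_left_mono) auto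
   also have "... <= d * ip v v" using mult_right_mono[OF e(3) ipn[of v]] by (simp add: mult.assoc)
   finally have "e * (e * ip (ap T v) (ap T v)) <= e * (d * ip v v)" using e(1) by (intro mult_left_mono) auto
   moreover have "2 * e * (d * ip v v) <= 2 * e * ip v (ap T v)" using p e(1) by (intro mult_left_mono) auto
   ultimately show ?thesis by linarith
  qed
  also have "... = (1 - e * d) * ip v v" by (simp add: algebra_simps)
  also have "... <= q * ip v v" using ipn[of v] by (intro mult_right_mono) (auto simp: q_def)
  finally show ?thesis .
 qed
 have it: "- (sz C * q ^ k) * ip v v <= ip v (ap C v)" for k v
 proof (induction k arbitrary: v)
  case 0 then show ?case using form[of v C] by simp
 next
  case (Suc k)
  have "sz C * q ^ k * ip (X v) (X v) <= sz C * q ^ k * (q * ip v v)" using contr sz1[of C] q by (intro mult_left_mono) auto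
  then show ?case using Suc[of "X v"] dec[of v] by (simp add: algebra_simps)
 qed
 have "(%k. - (sz C * q ^ k) * ip v v) \<longlonglongrightarrow> - (sz C * 0) * ip v v"
  using q by (intro tendsto_intros LIMSEQ_realpow_zero) auto
 then have "0 <= ip v (ap C v)" using it LIMSEQ_le_const2[of "%k. - (sz C * q ^ k) * ip v v" 0 "ip v (ap C v)"] by simp
 then show ?thesis by (simp add: ip_def ap_def)
qed

lemma rev_tuples: "x \<in> tuples F n ==> rev x \<in> tuples F n" by (simp add: tuples_def)

lemma rev_del: "length x = Suc n ==> i <= n ==> rev (del (n - i) x) = del i (rev x)"
 by (simp add: del_def take_rev drop_rev Suc_diff_le)

lemma rev_ins: "length x = n ==> i <= n ==> rev (ins (n - i) a x) = ins i a (rev x)"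
 by (simp add: ins_def take_rev drop_rev)

lemma ins_append: "length u = k ==> ins k a (u @ v) = u @ a # v" by (simp add: ins_def)
lemma del_append: "length u = k ==> del k (u @ a # v) = u @ v" by (simp add: del_def)

lemma del_ins: "i <= length x ==> del i (ins i a x) = x" by (simp add: del_def ins_def)

lemma sum_tuples_ins:
 assumes "finite (verts F)" "i <= n"
 shows "(\<Sum>x\<in>tuples F (Suc n). f x) = (\<Sum>y\<in>tuples F n. \<Sum>a\<in>verts F. f (ins i a y))"
proof -
 have "bij_betw (%(y, a). ins i a y) (tuples F n \<times> verts F) (tuples F (Suc n))"
 proof (rule bij_betwI[where g = "%x. (del i x, x ! i)"])
  show "(%(y, a). ins i a y) \<in> tuples F n \<times> verts F \<rightarrow> tuples F (Suc n)" using ins_tuples assms(2) by auto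
  show "(%x. (del i x, x ! i)) \<in> tuples F (Suc n) \<rightarrow> tuples F n \<times> verts F"
  proof
   fix x assume x: "x \<in> tuples F (Suc n)"
   then have "x ! i \<in> set x" using assms(2) by (simp add: tuples_def)
   then show "(del i x, x ! i) \<in> tuples F n \<times> verts F" using x del_tuples[OF x assms(2)] by (auto simp: tuples_def)
  qed
  show "(%x. (del i x, x ! i)) ((%(y, a). ins i a y) z) = z" if "z \<in> tuples F n \<times> verts F" for z
   using that assms(2) by (auto simp: del_ins tuples_length ins_def nth_append del_def)
  show "(%(y, a). ins i a y) ((%x. (del i x, x ! i)) x) = x" if "x \<in> tuples F (Suc n)" for x
   using tuples_length[OF that] assms(2) by (simp add: ins_def del_def id_take_nth_drop[symmetric])
 qed
 from sum.reindex_bij_betw[OF this, of f] show ?thesis by (simp add: sum.cartesian_product split_beta)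
qed

lemma sum_tuples_rev: "(\<Sum>x\<in>tuples F n. f (rev x)) = (\<Sum>x\<in>tuples F n. f x)"
 by (rule sum.reindex_bij_witness[of _ rev rev]) (auto simp: rev_tuples)

context graph_pair
begin

text \<open>Reversing the sites keeps neighbours neighbours; in the case \<open>K_A\<close> the
  symmetry of adjacency enters.\<close>

lemma KK_rev: "KK n f g ==> KK n (%x. f (rev x)) (%x. g (rev x))"
proof (induction rule: KK.induct)
 case K_one show ?case by (rule KK.K_one)
next
 case (K_cong n f g f' g')
 from K_cong.IH show ?case by (rule KK.K_cong) (use K_cong rev_tuples in auto)
next
 case (K_ins n f g i)
 have "KK (Suc n) (%x. f (rev (del (n - i) x))) (%x. g (rev (del (n - i) x)))" by (rule KK.K_ins[OF K_ins.IH]) simp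
 then show ?case by (rule KK.K_cong) (use rev_del K_ins tuples_length in auto)
next
 case (K_sum n f g i)
 have "KK n (%x. \<Sum>a\<in>verts G. f (rev (ins (n - i) a x))) (%x. \<Sum>a\<in>verts H. g (rev (ins (n - i) a x)))" by (rule KK.K_sum[OF K_sum.IH]) simp
 then show ?case by (rule KK.K_cong) (use rev_ins K_sum tuples_length in auto)
next
 case (K_D n f g i)
 let ?j = "n - Suc (Suc i)"
 have r: "rev x ! i = x ! Suc ?j" "rev x ! Suc i = x ! ?j" if "length x = n" for x :: "nat list"
  using that K_D.hyps by (simp_all add: rev_nth Suc_diff_Suc)
 have "KK n (%x. of_bool (x ! ?j = x ! Suc ?j) * f (rev x)) (%x. of_bool (x ! ?j = x ! Suc ?j) * g (rev x))"
  by (rule KK.K_D[OF K_D.IH]) (use K_D.hyps in simp)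
 then show ?case by (rule KK.K_cong) (use r tuples_length in \<open>auto simp: eq_commute\<close>)
next
 case (K_A n f g i)
 let ?j = "n - Suc (Suc i)"
 have r: "rev x ! i = x ! Suc ?j" "rev x ! Suc i = x ! ?j" if "length x = n" for x :: "nat list"
  using that K_A.hyps by (simp_all add: rev_nth Suc_diff_Suc)
 have s: "adj G u v = adj G v u" "adj H u v = adj H v u" for u v using symG symH by blast+
 have a: "adj G (rev x ! i) (rev x ! Suc i) = adj G (x ! ?j) (x ! Suc ?j)" "adj H (rev x ! i) (rev x ! Suc i) = adj H (x ! ?j) (x ! Suc ?j)"
  if "length x = n" for x unfolding r[OF that] by (rule s)+
 have "KK n (%x. of_bool (adj G (x ! ?j) (x ! Suc ?j)) * f (rev x)) (%x. of_bool (adj H (x ! ?j) (x ! Suc ?j)) * g (rev x))"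
  by (rule KK.K_A[OF K_A.IH]) (use K_A.hyps in simp)
 then show ?case
  by (rule KK.K_cong) (simp_all only: a tuples_length)
next
 case (K_lin n f g f' g' c d)
 then show ?case by (intro KK.K_lin)
qed

lemma KK_tensor:
 assumes "KK m f g" and f': "KK n f' g'"
 shows "KK (m + n) (%x. f (take m x) * f' (drop m x)) (%x. g (take m x) * g' (drop m x))"
 using assms(1)
proof (induction rule: KK.induct)
 case K_one show ?case using f' by simp
next
 case (K_cong m f g f1 g1)
 have t: "take m x \<in> tuples F m" if "x \<in> tuples F (m + n)" for x F
  using that set_take_subset[of m x] by (auto simp: tuples_def)
 from K_cong.IH show ?case by (rule KK.K_cong) (use K_cong t in auto)
next
 case (K_ins m f g i)
 have r: "take m (del i x) = del i (take (Suc m) x)" "drop m (del i x) = drop (Suc m) x" if "length x = Suc m + n" for x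
  using that K_ins.hyps by (simp_all add: del_def min_def drop_take)
 have "KK (Suc (m + n)) (%x. f (take m (del i x)) * f' (drop m (del i x))) (%x. g (take m (del i x)) * g' (drop m (del i x)))"
  by (rule KK.K_ins[OF K_ins.IH]) (use K_ins.hyps in simp)
 then show ?case unfolding add_Suc by (rule KK.K_cong) (use r tuples_length in auto)
next
 case (K_sum m f g i)
 have r: "take (Suc m) (ins i a x) = ins i a (take m x)" "drop (Suc m) (ins i a x) = drop m x" if "length x = m + n" for x a
  using that K_sum.hyps by (simp_all add: ins_def min_def drop_take take_Cons' drop_Cons')
 have "KK (m + n) (%x. \<Sum>a\<in>verts G. f (take (Suc m) (ins i a x)) * f' (drop (Suc m) (ins i a x)))
  (%x. \<Sum>a\<in>verts H. g (take (Suc m) (ins i a x)) * g' (drop (Suc m) (ins i a x)))"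
  by (rule KK.K_sum[OF K_sum.IH[unfolded add_Suc]]) (use K_sum.hyps in simp)
 then show ?case by (rule KK.K_cong) (use r tuples_length in \<open>auto simp: sum_distrib_right\<close>)
next
 case (K_D m f g i)
 have "KK (m + n) (%x. of_bool (x ! i = x ! Suc i) * (f (take m x) * f' (drop m x))) (%x. of_bool (x ! i = x ! Suc i) * (g (take m x) * g' (drop m x)))"
  by (rule KK.K_D[OF K_D.IH]) (use K_D.hyps in simp)
 then show ?case by (rule KK.K_cong) (use K_D.hyps in auto)
next
 case (K_A m f g i)
 have "KK (m + n) (%x. of_bool (adj G (x ! i) (x ! Suc i)) * (f (take m x) * f' (drop m x))) (%x. of_bool (adj H (x ! i) (x ! Suc i)) * (g (take m x) * g' (drop m x)))"
  by (rule KK.K_A[OF K_A.IH]) (use K_A.hyps in simp)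
 then show ?case by (rule KK.K_cong) (use K_A.hyps in auto)
next
 case (K_lin m f g f1 g1 c d)
 from KK.K_lin[OF K_lin.IH, of c d] show ?case by (rule KK.K_cong) (auto simp: algebra_simps)
qed

lemma KK_contr1:
 assumes "KK (Suc (Suc n)) f g" "i <= n"
 shows "KK n (%x. \<Sum>a\<in>verts G. f (ins i a (ins i a x))) (%x. \<Sum>a\<in>verts H. g (ins i a (ins i a x)))"
proof -
 have e: "(\<Sum>a\<in>verts F. \<Sum>b\<in>verts F. of_bool (ins i b (ins i a x) ! i = ins i b (ins i a x) ! Suc i) * f (ins i b (ins i a x)))
   = (\<Sum>a\<in>verts F. f (ins i a (ins i a x)))" if "finite (verts F)" "length x = n" for F x and f :: "nat list => real"
 proof (rule sum.cong[OF refl])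
  fix a assume a: "a \<in> verts F"
  have "ins i b (ins i a x) ! i = b" "ins i b (ins i a x) ! Suc i = a" for b
   using that(2) assms(2) by (auto simp: ins_def nth_append)
  then have "(\<Sum>b\<in>verts F. of_bool (ins i b (ins i a x) ! i = ins i b (ins i a x) ! Suc i) * f (ins i b (ins i a x)))
   = (\<Sum>b\<in>verts F. if b = a then f (ins i a (ins i a x)) else 0)" by (intro sum.cong) auto
  then show "(\<Sum>b\<in>verts F. of_bool (ins i b (ins i a x) ! i = ins i b (ins i a x) ! Suc i) * f (ins i b (ins i a x))) = f (ins i a (ins i a x))"
   using a that(1) by simp
 qed
 have "KK n (%x. \<Sum>a\<in>verts G. \<Sum>b\<in>verts G. of_bool (ins i b (ins i a x) ! i = ins i b (ins i a x) ! Suc i) * f (ins i b (ins i a x)))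
  (%x. \<Sum>a\<in>verts H. \<Sum>b\<in>verts H. of_bool (ins i b (ins i a x) ! i = ins i b (ins i a x) ! Suc i) * g (ins i b (ins i a x)))"
  by (rule K_sum[OF K_sum[OF K_D[OF assms(1)]]]) (use assms(2) in auto)
 then show ?thesis by (rule K_cong) (rule e[OF finG tuples_length], assumption, rule e[OF finH tuples_length], assumption)
qed

text \<open>A block is contracted with its mirror image beside it, the innermost pair first, so that
  each single contraction joins neighbours.\<close>

lemma KK_contr:
 assumes "KK (p + (q + q) + r) f g"
 shows "KK (p + r) (%x. \<Sum>y\<in>tuples G q. f (take p x @ y @ rev y @ drop p x)) (%x. \<Sum>y\<in>tuples H q. g (take p x @ y @ rev y @ drop p x))"
 using assms
proof (induction q arbitrary: f g)
 case 0 then show ?case by simp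
next
 case (Suc q)
 have "KK (Suc (Suc (p + (q + q) + r))) f g" using Suc.prems by (simp add: add.commute add.left_commute)
 from KK_contr1[OF this, of "p + q"]
 have "KK (p + (q + q) + r) (%x. \<Sum>a\<in>verts G. f (ins (p + q) a (ins (p + q) a x))) (%x. \<Sum>a\<in>verts H. g (ins (p + q) a (ins (p + q) a x)))" by simp
 note IH = Suc.IH[OF this]
 have e: "(\<Sum>y\<in>tuples F q. \<Sum>a\<in>verts F. h (ins (p + q) a (ins (p + q) a (take p x @ y @ rev y @ drop p x)))) =
  (\<Sum>y\<in>tuples F (Suc q). h (take p x @ y @ rev y @ drop p x))" if F: "finite (verts F)" "length x = p + r" for F x and h :: "nat list => real"
 proof -
  have "ins (p + q) a (ins (p + q) a (take p x @ y @ rev y @ drop p x)) = take p x @ (y @ [a]) @ rev (y @ [a]) @ drop p x"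
   if "y \<in> tuples F q" for y a
   using tuples_length[OF that] F(2) ins_append[of "take p x @ y" "p + q" a] by simp
  then show ?thesis by (simp add: sum_tuples_Suc[OF F(1)])
 qed
 show ?case using IH by (rule K_cong) (use e finG finH tuples_length in auto)
qed

text \<open>One tensor times the mirror image of the other, contracted completely, is a scalar pair,
  to which \<open>KK_zero\<close> applies. In particular a tensor vanishing on one side has a
  partner vanishing on the other.\<close>

lemma KK_ip:
 assumes "KK n f g" "KK n f' g'"
 shows "(\<Sum>x\<in>tuples G n. f x * f' x) = (\<Sum>x\<in>tuples H n. g x * g' x)"
proof -
 have "KK (0 + (n + n) + 0) (%x. f (take n x) * f' (rev (drop n x))) (%x. g (take n x) * g' (rev (drop n x)))"
  using KK_tensor[OF assms(1) KK_rev[OF assms(2)]] by simp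
 from KK_zero[OF KK_contr[OF this, simplified]]
 show ?thesis by (simp add: tuples_length cong: sum.cong)
qed

text \<open>Each step inserts a pair of equal neighbours in the middle; the result is the identity
  kernel with one argument reversed.\<close>

lemma KK_id: "KK (n + n) (%x. of_bool (take n x = rev (drop n x))) (%x. of_bool (take n x = rev (drop n x)))"
proof (induction n)
 case 0 then show ?case by (auto intro: K_cong[OF K_one])
next
 case (Suc n)
 let ?f = "%x. of_bool (take n x = rev (drop n x)) :: real"
 have "KK (Suc (Suc (n + n))) (%x. of_bool (x ! n = x ! Suc n) * ?f (del n (del n x))) (%x. of_bool (x ! n = x ! Suc n) * ?f (del n (del n x)))"
  by (rule K_D[OF K_ins[OF K_ins[OF Suc]]]) auto
 moreover have "of_bool (x ! n = x ! Suc n) * ?f (del n (del n x)) = of_bool (take (Suc n) x = rev (drop (Suc n) x))"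
  if "length x = Suc (Suc (n + n))" for x :: "nat list"
 proof -
  define u a b v where "u = take n x" and "a = x ! n" and "b = x ! Suc n" and "v = drop (Suc (Suc n)) x"
  have x: "x = u @ a # b # v" using that by (simp add: u_def a_def b_def v_def Cons_nth_drop_Suc)
  have l: "length u = n" "length v = n" using that by (auto simp: u_def v_def)
  have "del n (del n x) = u @ v" unfolding x using l del_append[of u n] by simp
  moreover have "take (Suc n) x = u @ [a]" "drop (Suc n) x = b # v" unfolding x using l by auto
  moreover have "x ! n = a" "x ! Suc n = b" by (simp_all add: a_def b_def)
  ultimately show ?thesis using l by (auto simp: of_bool_def)
 qed
 ultimately have "KK (Suc (Suc (n + n))) (%x. of_bool (take (Suc n) x = rev (drop (Suc n) x))) (%x. of_bool (take (Suc n) x = rev (drop (Suc n) x)))"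
  using tuples_length by (elim K_cong) blast+
 then show ?case by simp
qed

text \<open>Tensors with \<open>n + n\<close> sites multiply like kernels once the summed index is
  reversed in the second factor, as planar contraction demands.\<close>

lemma KK_mult:
 assumes "KK (n + n) f g" "KK (n + n) f' g'"
 shows "KK (n + n) (%w. \<Sum>z\<in>tuples G n. f (take n w @ z) * f' (rev z @ drop n w)) (%w. \<Sum>z\<in>tuples H n. g (take n w @ z) * g' (rev z @ drop n w))"
proof -
 have "KK (n + (n + n) + n) (%x. f (take (n + n) x) * f' (drop (n + n) x)) (%x. g (take (n + n) x) * g' (drop (n + n) x))"
  using KK_tensor[OF assms] by (simp add: add.assoc)
 from KK_contr[OF this] show ?thesis
 proof (rule K_cong)
  have e: "take (n + n) (take n x @ y @ rev y @ drop n x) = take n x @ y" "drop (n + n) (take n x @ y @ rev y @ drop n x) = rev y @ drop n x"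
   if "length x = n + n" "length y = n" for x y :: "nat list" using that by simp_all
  show "(\<Sum>y\<in>tuples G n. f (take (n + n) (take n x @ y @ rev y @ drop n x)) * f' (drop (n + n) (take n x @ y @ rev y @ drop n x))) =
   (\<Sum>z\<in>tuples G n. f (take n x @ z) * f' (rev z @ drop n x))" if "x \<in> tuples G (n + n)" for x
   using that by (intro sum.cong refl) (simp only: e tuples_length)
  show "(\<Sum>y\<in>tuples H n. g (take (n + n) (take n x @ y @ rev y @ drop n x)) * g' (drop (n + n) (take n x @ y @ rev y @ drop n x))) =
   (\<Sum>z\<in>tuples H n. g (take n x @ z) * g' (rev z @ drop n x))" if "x \<in> tuples H (n + n)" for x
   using that by (intro sum.cong refl) (simp only: e tuples_length)
 qed
qed

end

section \<open>Simultaneous bases and positivity\<close>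

text \<open>Bessel's inequality for the point mass at \<open>x\<close> bounds the sum of
  \<open>(b i x)^2\<close> over \<open>i\<close> by 1; summing over \<open>x\<close> bounds the
  number of orthonormal functions.\<close>

lemma bessel_card:
 fixes b :: "nat => 'x => real"
 assumes fin: "finite X" and on: "!!i j. i < k ==> j < k ==> (\<Sum>x\<in>X. b i x * b j x) = of_bool (i = j)"
 shows "k <= card X"
proof -
 have le: "(\<Sum>i<k. (b i x)\<^sup>2) <= 1" if x: "x \<in> X" for x
 proof -
  have m: "(\<Sum>z\<in>X. of_bool (z = x) * (\<Sum>i<k. b i x * b i z)) = (\<Sum>i<k. (b i x)\<^sup>2)"
  proof -
   have "(\<Sum>z\<in>X. of_bool (z = x) * (\<Sum>i<k. b i x * b i z)) = (\<Sum>z\<in>X. if z = x then (\<Sum>i<k. b i x * b i x) else 0)"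
    by (intro sum.cong) auto
   then show ?thesis using fin x by (simp add: power2_eq_square)
  qed
  have o1: "(\<Sum>z\<in>X. of_bool (z = x) * of_bool (z = x)) = (1 :: real)"
  proof -
   have "(\<Sum>z\<in>X. of_bool (z = x) * of_bool (z = x)) = (\<Sum>z\<in>X. if z = x then 1 else 0 :: real)" by (intro sum.cong) auto
   then show ?thesis using fin x by simp
  qed
  have s: "(\<Sum>z\<in>X. (\<Sum>i<k. b i x * b i z) * (\<Sum>j<k. b j x * b j z)) = (\<Sum>i<k. (b i x)\<^sup>2)"
  proof -
   have "(\<Sum>z\<in>X. (\<Sum>i<k. b i x * b i z) * (\<Sum>j<k. b j x * b j z)) = (\<Sum>z\<in>X. \<Sum>i<k. \<Sum>j<k. b i x * b j x * (b i z * b j z))"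
    unfolding sum_product by (intro sum.cong refl) simp
   also have "... = (\<Sum>i<k. \<Sum>z\<in>X. \<Sum>j<k. b i x * b j x * (b i z * b j z))" by (rule sum.swap)
   also have "... = (\<Sum>i<k. \<Sum>j<k. \<Sum>z\<in>X. b i x * b j x * (b i z * b j z))" by (intro sum.cong refl sum.swap)
   also have "... = (\<Sum>i<k. \<Sum>j<k. b i x * b j x * of_bool (i = j))" using on by (intro sum.cong refl) (simp add: sum_distrib_left[symmetric])
   also have "... = (\<Sum>i<k. \<Sum>j<k. if j = i then (b i x)\<^sup>2 else 0)" by (intro sum.cong refl) (simp add: power2_eq_square)
   finally show ?thesis by simp
  qed
  have "0 <= (\<Sum>z\<in>X. (of_bool (z = x) - (\<Sum>i<k. b i x * b i z))\<^sup>2)" by (intro sum_nonneg) auto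
  also have "... = (\<Sum>z\<in>X. of_bool (z = x) * of_bool (z = x)) - 2 * (\<Sum>z\<in>X. of_bool (z = x) * (\<Sum>i<k. b i x * b i z))
    + (\<Sum>z\<in>X. (\<Sum>i<k. b i x * b i z) * (\<Sum>j<k. b j x * b j z))"
   unfolding sum_distrib_left[of 2] sum_subtractf[symmetric] sum.distrib[symmetric]
   by (intro sum.cong refl) (simp only: power2_eq_square algebra_simps)
  finally show ?thesis unfolding m o1 s by simp
 qed
 have "real k = (\<Sum>i<k. \<Sum>x\<in>X. (b i x)\<^sup>2)" using on by (simp add: power2_eq_square)
 also have "... = (\<Sum>x\<in>X. \<Sum>i<k. (b i x)\<^sup>2)" by (rule sum.swap)
 also have "... <= (\<Sum>x\<in>X. 1)" by (intro sum_mono le)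
 finally show ?thesis by simp
qed

context graph_pair
begin

text \<open>Taken on the side of \<open>G\<close>; for pairs in \<open>KK\<close> it agrees with the
  one on the side of \<open>H\<close> by \<open>KK_ip\<close>.\<close>

definition ip :: "nat => (nat list => real) => (nat list => real) => real" where
 "ip n f f' = (\<Sum>x\<in>tuples G n. f x * f' x)"

lemma KK_null: "KK n (%_. 0) (%_. 0)"
proof -
 have "KK n (%_. 1) (%_. 1)"
 proof (induction n)
  case (Suc n) from K_ins[OF this, of 0] show ?case by simp
 qed (rule K_one)
 from K_lin[OF this this, of 0 0] show ?thesis by simp
qed

lemma KK_sum_list:
 assumes "!!i. i < k ==> KK n (b i) (b' i)"
 shows "KK n (%x. \<Sum>i<k. c i * b i x) (%x. \<Sum>i<(k::nat). c i * b' i x)"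
 using assms
proof (induction k)
 case 0 then show ?case by (simp add: KK_null)
next
 case (Suc k)
 then have "KK n (%x. 1 * (\<Sum>i<k. c i * b i x) + c k * b k x) (%x. 1 * (\<Sum>i<k. c i * b' i x) + c k * b' k x)" by (intro K_lin) auto
 then show ?case by simp
qed

definition basis :: "nat => nat => (nat => nat list => real) => (nat => nat list => real) => bool" where
 "basis n k b b' \<longleftrightarrow> (\<forall>i<k. KK n (b i) (b' i)) & (\<forall>i<k. \<forall>j<k. ip n (b i) (b j) = of_bool (i = j))"

definition full :: "nat => nat => (nat => nat list => real) => (nat => nat list => real) => bool" where
 "full n k b b' \<longleftrightarrow> (\<forall>i<k. KK n (b i) (b' i)) & (\<forall>f g. KK n f g -->
  (\<forall>x\<in>tuples G n. f x = (\<Sum>i<k. ip n f (b i) * b i x)) & (\<forall>y\<in>tuples H n. g y = (\<Sum>i<k. ip n f (b i) * b' i y)))"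

text \<open>A longest orthonormal family of pairs spans. The residue of a pair is again a pair, and
  a residue of positive norm could be normalised and added. A residue of norm 0 vanishes on
  \<open>G\<close> and, by \<open>KK_ip\<close>, on \<open>H\<close>.\<close>

lemma full_ex: "\<exists>k b b'. full n k b b'"
proof -
 let ?Q = "%k. \<exists>b b'. basis n k b b'"
 have Q0: "?Q 0" by (simp add: basis_def)
 have Qb: "k <= card (tuples G n)" if "?Q k" for k
  using bessel_card[OF finite_tuples[OF finG]] that by (fastforce simp: basis_def ip_def)
 obtain k where k: "?Q k" "\<forall>m. ?Q m --> m <= k"
  using GreatestI_nat[of ?Q, OF Q0 Qb] Greatest_le_nat[of ?Q, OF _ Qb] by blast
 then obtain b b' where b: "basis n k b b'" by blast
 have bK: "KK n (b i) (b' i)" if "i < k" for i using b that by (simp add: basis_def)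
 have bo: "ip n (b i) (b j) = of_bool (i = j)" if "i < k" "j < k" for i j using b that by (simp add: basis_def)
 have "(\<forall>x\<in>tuples G n. f x = (\<Sum>i<k. ip n f (b i) * b i x)) & (\<forall>y\<in>tuples H n. g y = (\<Sum>i<k. ip n f (b i) * b' i y))" if fg: "KK n f g" for f g
 proof -
  define r where "r = (%x. f x - (\<Sum>i<k. ip n f (b i) * b i x))"
  define r' where "r' = (%x. g x - (\<Sum>i<k. ip n f (b i) * b' i x))"
  have rK: "KK n r r'" using K_lin[where c = 1 and d = "-1", OF fg KK_sum_list[where c = "%i. ip n f (b i)" and k = k, OF bK]] by (simp add: r_def r'_def)
  have rb: "ip n r (b j) = 0" if j: "j < k" for j
  proof -
   have "ip n r (b j) = ip n f (b j) - (\<Sum>x\<in>tuples G n. \<Sum>i<k. ip n f (b i) * (b i x * b j x))"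
    by (simp add: ip_def r_def left_diff_distrib sum_subtractf sum_distrib_right mult.assoc)
   also have "(\<Sum>x\<in>tuples G n. \<Sum>i<k. ip n f (b i) * (b i x * b j x)) = (\<Sum>i<k. ip n f (b i) * ip n (b i) (b j))"
    by (subst sum.swap) (simp add: ip_def sum_distrib_left)
   also have "... = (\<Sum>i<k. if i = j then ip n f (b j) else 0)" using bo j by (intro sum.cong) auto
   finally show ?thesis using j by simp
  qed
  have r0: "ip n r r = 0"
  proof (rule ccontr)
   assume "ip n r r ~= 0"
   moreover have "0 <= ip n r r" by (simp add: ip_def sum_nonneg)
   ultimately have p: "0 < ip n r r" by simp
   let ?s = "1 / sqrt (ip n r r)"
   let ?b = "b(k := (%x. ?s * r x))" and ?b' = "b'(k := (%x. ?s * r' x))"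
   have "KK n (%x. ?s * r x) (%x. ?s * r' x)" using K_lin[OF rK rK, of ?s 0] by simp
   moreover have "ip n (%x. ?s * r x) (%x. ?s * r x) = 1"
   proof -
    have "ip n (%x. ?s * r x) (%x. ?s * r x) = (?s * ?s) * ip n r r" unfolding ip_def sum_distrib_left by (intro sum.cong refl) (simp only: mult_ac)
    also have "?s * ?s = 1 / ip n r r" using p by (simp add: real_sqrt_mult_self)
    finally show ?thesis using p by simp
   qed
   moreover have "ip n (%x. ?s * r x) (b j) = 0" "ip n (b j) (%x. ?s * r x) = 0" if "j < k" for j
   proof -
    have "ip n (%x. ?s * r x) (b j) = ?s * ip n r (b j)" unfolding ip_def sum_distrib_left by (intro sum.cong refl) (simp only: mult_ac)
    then show "ip n (%x. ?s * r x) (b j) = 0" using rb[OF that] by simp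
    then show "ip n (b j) (%x. ?s * r x) = 0" by (simp only: ip_def mult.commute)
   qed
   ultimately have "basis n (Suc k) ?b ?b'" unfolding basis_def using bK bo by (auto simp: less_Suc_eq)
   then show False using k(2) by fastforce
  qed
  have "(\<Sum>x\<in>tuples G n. r x * r x) = 0" using r0 by (simp add: ip_def)
  then have "r x = 0" if "x \<in> tuples G n" for x using that finite_tuples[OF finG] by (simp add: sum_nonneg_eq_0_iff)
  moreover have "(\<Sum>x\<in>tuples H n. r' x * r' x) = 0" using r0 KK_ip[OF rK rK] by (simp add: ip_def)
  then have "r' x = 0" if "x \<in> tuples H n" for x using that finite_tuples[OF finH] by (simp add: sum_nonneg_eq_0_iff)
  ultimately show ?thesis by (auto simp: r_def r'_def)
 qed
 then have "full n k b b'" using bK unfolding full_def by blast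
 then show ?thesis by blast
qed

definition bsel :: "nat => nat \<times> (nat => nat list => real) \<times> (nat => nat list => real)" where
 "bsel n = (SOME q. full n (fst q) (fst (snd q)) (snd (snd q)))"

definition "kk n = fst (bsel n)"
definition "bb n = fst (snd (bsel n))"
definition "bb' n = snd (snd (bsel n))"

lemma full_sel: "full n (kk n) (bb n) (bb' n)"
proof -
 obtain k b b' where "full n k b b'" using full_ex by blast
 then have "full n (fst (k, b, b')) (fst (snd (k, b, b'))) (snd (snd (k, b, b')))" by simp
 then show ?thesis unfolding kk_def bb_def bb'_def bsel_def by (rule someI)
qed

lemma bb_KK: "i < kk n ==> KK n (bb n i) (bb' n i)" using full_sel by (simp add: full_def)

lemma expandG: "KK n f g ==> x \<in> tuples G n ==> f x = (\<Sum>i<kk n. ip n f (bb n i) * bb n i x)"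
 using full_sel[of n] unfolding full_def by blast

lemma expandH: "KK n f g ==> y \<in> tuples H n ==> g y = (\<Sum>i<kk n. ip n f (bb n i) * bb' n i y)"
 using full_sel[of n] unfolding full_def by blast

text \<open>The kernel of the isometry behind \<open>KK\<close>; it becomes the expectation of a
  word of generators.\<close>

definition P :: "nat => nat list => nat list => real" where
 "P n x y = (\<Sum>i<kk n. bb n i x * bb' n i y)"

text \<open>An isometry that commutes with operations carried out in parallel on both sides lets an
  operation on its left argument reappear as the adjoint on its right argument. Expanding in the
  bases makes this an exchange of sums.\<close>

lemma intertwine:
 assumes T: "!!f g. KK n f g ==> KK m (T f) (T' g)" and S: "!!f g. KK m f g ==> KK n (S f) (S' g)"
  and adj: "!!f f'. ip m (T f) f' = ip n f (S f')" and x: "x \<in> tuples G m" and y: "y \<in> tuples H n"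
 shows "(\<Sum>i<kk n. T (bb n i) x * bb' n i y) = (\<Sum>j<kk m. bb m j x * S' (bb' m j) y)"
proof -
 have c: "ip n f f' = ip n f' f" for n f f' by (simp add: ip_def mult.commute)
 have "(\<Sum>i<kk n. T (bb n i) x * bb' n i y) = (\<Sum>i<kk n. (\<Sum>j<kk m. ip m (T (bb n i)) (bb m j) * bb m j x) * bb' n i y)"
  by (intro sum.cong refl arg_cong2[where f = "(*)"] expandG[OF T[OF bb_KK] x]) simp
 also have "... = (\<Sum>i<kk n. \<Sum>j<kk m. bb m j x * (ip n (S (bb m j)) (bb n i) * bb' n i y))"
  unfolding sum_distrib_right adj by (intro sum.cong refl) (simp only: c[of n "bb n _" "S _"] mult_ac)
 also have "... = (\<Sum>j<kk m. \<Sum>i<kk n. bb m j x * (ip n (S (bb m j)) (bb n i) * bb' n i y))" by (rule sum.swap)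
 also have "... = (\<Sum>j<kk m. bb m j x * S' (bb' m j) y)"
  unfolding sum_distrib_left[symmetric]
  by (intro sum.cong refl arg_cong2[where f = "(*)"] expandH[OF S[OF bb_KK] y, symmetric]) simp
 finally show ?thesis .
qed

lemma adj_ins_sum: "i <= n ==> ip (Suc n) (%x. f (del i x)) f' = ip n f (%x. \<Sum>a\<in>verts G. f' (ins i a x))"
 unfolding ip_def sum_tuples_ins[OF finG, of i n] sum_distrib_left
 by (intro sum.cong refl) (simp add: del_ins tuples_length)

lemma ip_commute: "ip n f f' = ip n f' f" by (simp only: ip_def mult.commute)

lemma P_ins: assumes "i <= n" "x \<in> tuples G (Suc n)" "y \<in> tuples H n"
 shows "P n (del i x) y = (\<Sum>a\<in>verts H. P (Suc n) x (ins i a y))"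
proof -
 have "(\<Sum>j<kk n. bb n j (del i x) * bb' n j y) = (\<Sum>j<kk (Suc n). bb (Suc n) j x * (\<Sum>a\<in>verts H. bb' (Suc n) j (ins i a y)))"
 proof (rule intertwine[where T = "%f x. f (del i x)" and T' = "%f x. f (del i x)" and S = "%f x. \<Sum>a\<in>verts G. f (ins i a x)" and S' = "%f x. \<Sum>a\<in>verts H. f (ins i a x)", OF _ _ _ assms(2,3)])
  show "KK (Suc n) (%x. f (del i x)) (%x. g (del i x))" if "KK n f g" for f g using that assms(1) by (rule K_ins)
  show "KK n (%x. \<Sum>a\<in>verts G. f (ins i a x)) (%x. \<Sum>a\<in>verts H. g (ins i a x))" if "KK (Suc n) f g" for f g using that assms(1) by (rule K_sum)
 qed (rule adj_ins_sum[OF assms(1)])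
 also have "... = (\<Sum>j<kk (Suc n). \<Sum>a\<in>verts H. bb (Suc n) j x * bb' (Suc n) j (ins i a y))" by (simp only: sum_distrib_left)
 also have "... = (\<Sum>a\<in>verts H. \<Sum>j<kk (Suc n). bb (Suc n) j x * bb' (Suc n) j (ins i a y))" by (rule sum.swap)
 finally show ?thesis by (simp only: P_def)
qed

lemma P_sum: assumes "i <= n" "x \<in> tuples G n" "y \<in> tuples H (Suc n)"
 shows "(\<Sum>a\<in>verts G. P (Suc n) (ins i a x) y) = P n x (del i y)"
proof -
 have "(\<Sum>a\<in>verts G. P (Suc n) (ins i a x) y) = (\<Sum>j<kk (Suc n). \<Sum>a\<in>verts G. bb (Suc n) j (ins i a x) * bb' (Suc n) j y)"
  unfolding P_def by (rule sum.swap)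
 also have "... = (\<Sum>j<kk (Suc n). (\<Sum>a\<in>verts G. bb (Suc n) j (ins i a x)) * bb' (Suc n) j y)" by (simp only: sum_distrib_right)
 also have "... = (\<Sum>j<kk n. bb n j x * bb' n j (del i y))"
 proof (rule intertwine[where T = "%f x. \<Sum>a\<in>verts G. f (ins i a x)" and T' = "%f x. \<Sum>a\<in>verts H. f (ins i a x)" and S = "%f x. f (del i x)" and S' = "%f x. f (del i x)", OF _ _ _ assms(2,3)])
  show "KK (Suc n) (%x. f (del i x)) (%x. g (del i x))" if "KK n f g" for f g using that assms(1) by (rule K_ins)
  show "KK n (%x. \<Sum>a\<in>verts G. f (ins i a x)) (%x. \<Sum>a\<in>verts H. g (ins i a x))" if "KK (Suc n) f g" for f g using that assms(1) by (rule K_sum)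
  show "ip n (%x. \<Sum>a\<in>verts G. f (ins i a x)) f' = ip (Suc n) f (%x. f' (del i x))" for f f'
   using adj_ins_sum[OF assms(1), of f' f] ip_commute[of n f'] ip_commute[of "Suc n" f] by metis
 qed
 finally show ?thesis by (simp only: P_def)
qed

text \<open>Multiplication operators are their own adjoints, so \<open>intertwine\<close> moves them
  across unchanged.\<close>

lemma P_diag:
 assumes "x \<in> tuples G n" "y \<in> tuples H n" and K: "!!f g. KK n f g ==> KK n (%x. c x * f x) (%y. d y * g y)"
 shows "c x * P n x y = d y * P n x y"
proof -
 have "(\<Sum>j<kk n. (c x * bb n j x) * bb' n j y) = (\<Sum>j<kk n. bb n j x * (d y * bb' n j y))"
  by (rule intertwine[where T = "%f x. c x * f x" and T' = "%g y. d y * g y" and S = "%f x. c x * f x" and S' = "%g y. d y * g y", OF K K _ assms(1,2)])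
   (simp_all only: ip_def mult_ac)
 then show ?thesis unfolding P_def by (simp only: sum_distrib_left mult_ac)
qed

lemma P_D: assumes "Suc i < n" "x \<in> tuples G n" "y \<in> tuples H n"
 shows "of_bool (x ! i = x ! Suc i) * P n x y = of_bool (y ! i = y ! Suc i) * P n x y"
 by (rule P_diag[where c = "%x. of_bool (x ! i = x ! Suc i)" and d = "%x. of_bool (x ! i = x ! Suc i)", OF assms(2,3)])
  (rule K_D[OF _ assms(1)])

lemma P_A: assumes "Suc i < n" "x \<in> tuples G n" "y \<in> tuples H n"
 shows "of_bool (adj G (x ! i) (x ! Suc i)) * P n x y = of_bool (adj H (y ! i) (y ! Suc i)) * P n x y"
 by (rule P_diag[where c = "%x. of_bool (adj G (x ! i) (x ! Suc i))" and d = "%x. of_bool (adj H (x ! i) (x ! Suc i))", OF assms(2,3)])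
  (rule K_A[OF _ assms(1)])

lemma P_rev: assumes "x \<in> tuples G n" "y \<in> tuples H n"
 shows "P n (rev x) (rev y) = P n x y"
proof -
 have "(\<Sum>j<kk n. bb n j (rev x) * bb' n j (rev y)) = (\<Sum>j<kk n. bb n j x * bb' n j (rev (rev y)))"
 proof (rule intertwine[where T = "%f x. f (rev x)" and T' = "%f x. f (rev x)" and S = "%f x. f (rev x)" and S' = "%f x. f (rev x)", OF KK_rev KK_rev _ assms(1) rev_tuples[OF assms(2)]])
  show "ip n (%x. f (rev x)) f' = ip n f (%x. f' (rev x))" for f f'
   using sum_tuples_rev[of "%x. f x * f' (rev x)" G n] by (simp add: ip_def)
 qed
 then show ?thesis by (simp add: P_def)
qed

lemma P_0: "P 0 [] [] = 1"
 using expandH[OF K_one, of "[]"] by (simp add: P_def ip_def)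

text \<open>\<open>intertwine\<close> for multiplication by a kernel: \<open>?T\<close> uses the
  reversed kernel and \<open>?S\<close>, its adjoint, the kernel itself. This is the source of the
  square relation in \<open>P_psd\<close>.\<close>

lemma P_mult:
 assumes a: "KK (n + n) a a'" and x: "x' \<in> tuples G n" "x'' \<in> tuples G n" and y: "y \<in> tuples H n" "y'' \<in> tuples H n"
 shows "(\<Sum>y'\<in>tuples H n. a' (rev y @ y') * P (n + n) (rev x' @ x'') (rev y' @ y'')) = (\<Sum>z\<in>tuples G n. a (rev z @ x') * P (n + n) (rev z @ x'') (rev y @ y''))"
proof -
 let ?T = "%a F f w. \<Sum>z\<in>tuples F n. a (rev (take n w @ z)) * f (rev z @ drop n w) :: real"
 let ?S = "%a F f w. \<Sum>z\<in>tuples F n. a (take n w @ z) * f (rev z @ drop n w) :: real"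
 have l: "length x' = n" "length y = n" using x(1) y(1) by (simp_all add: tuples_def)
 have ad: "ip (n + n) (?T a G f) f' = ip (n + n) f (?S a G f')" for f f'
 proof -
  have "ip (n + n) (?T a G f) f' = (\<Sum>u\<in>tuples G n. \<Sum>v\<in>tuples G n. \<Sum>z\<in>tuples G n. a (rev z @ rev u) * f (rev z @ v) * f' (u @ v))"
   unfolding ip_def sum_tuples_append[OF finG] by (intro sum.cong refl) (simp add: tuples_length sum_distrib_right)
  also have "... = (\<Sum>u\<in>tuples G n. \<Sum>z\<in>tuples G n. \<Sum>v\<in>tuples G n. a (rev z @ rev u) * f (rev z @ v) * f' (u @ v))"
   by (intro sum.cong refl sum.swap)
  also have "... = (\<Sum>z\<in>tuples G n. \<Sum>u\<in>tuples G n. \<Sum>v\<in>tuples G n. a (rev z @ rev u) * f (rev z @ v) * f' (u @ v))" by (rule sum.swap)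
  also have "... = (\<Sum>z\<in>tuples G n. \<Sum>u\<in>tuples G n. \<Sum>v\<in>tuples G n. a (z @ rev u) * f (z @ v) * f' (u @ v))"
   by (rule sum_tuples_rev[of "%z. \<Sum>u\<in>tuples G n. \<Sum>v\<in>tuples G n. a (z @ rev u) * f (z @ v) * f' (u @ v)"])
  also have "... = (\<Sum>z\<in>tuples G n. \<Sum>u\<in>tuples G n. \<Sum>v\<in>tuples G n. a (z @ u) * f (z @ v) * f' (rev u @ v))"
   by (rule sum.cong[OF refl], rule trans[OF sum_tuples_rev[symmetric]]) simp
  also have "... = (\<Sum>z\<in>tuples G n. \<Sum>v\<in>tuples G n. \<Sum>u\<in>tuples G n. a (z @ u) * f (z @ v) * f' (rev u @ v))"
   by (intro sum.cong refl sum.swap)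
  also have "... = ip (n + n) f (?S a G f')"
   unfolding ip_def sum_tuples_append[OF finG] by (intro sum.cong refl) (simp add: tuples_length sum_distrib_left mult_ac)
  finally show ?thesis .
 qed
 have "(\<Sum>j<kk (n + n). ?T a G (bb (n + n) j) (rev x' @ x'') * bb' (n + n) j (rev y @ y'')) = (\<Sum>j<kk (n + n). bb (n + n) j (rev x' @ x'') * ?S a' H (bb' (n + n) j) (rev y @ y''))"
 proof (rule intertwine[where T = "?T a G" and T' = "?T a' H" and S = "?S a G" and S' = "?S a' H"])
  show "KK (n + n) (?T a G f) (?T a' H g)" if "KK (n + n) f g" for f g by (rule KK_mult[OF KK_rev[OF a] that])
  show "KK (n + n) (?S a G f) (?S a' H g)" if "KK (n + n) f g" for f g by (rule KK_mult[OF a that])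
  show "rev x' @ x'' \<in> tuples G (n + n)" "rev y @ y'' \<in> tuples H (n + n)" using x y by (auto simp: tuples_def)
 qed (rule ad)
 also have "(\<Sum>j<kk (n + n). ?T a G (bb (n + n) j) (rev x' @ x'') * bb' (n + n) j (rev y @ y'')) = (\<Sum>j<kk (n + n). \<Sum>z\<in>tuples G n. a (rev z @ x') * (bb (n + n) j (rev z @ x'') * bb' (n + n) j (rev y @ y'')))"
  using l by (simp add: sum_distrib_right mult.assoc)
 also have "... = (\<Sum>z\<in>tuples G n. a (rev z @ x') * P (n + n) (rev z @ x'') (rev y @ y''))"
  unfolding P_def sum_distrib_left by (rule sum.swap)
 also have "(\<Sum>j<kk (n + n). bb (n + n) j (rev x' @ x'') * ?S a' H (bb' (n + n) j) (rev y @ y'')) = (\<Sum>j<kk (n + n). \<Sum>z\<in>tuples H n. a' (rev y @ z) * (bb (n + n) j (rev x' @ x'') * bb' (n + n) j (rev z @ y'')))"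
  using l by (simp add: sum_distrib_left mult_ac)
 also have "... = (\<Sum>z\<in>tuples H n. a' (rev y @ z) * P (n + n) (rev x' @ x'') (rev z @ y''))"
  unfolding P_def sum_distrib_left by (rule sum.swap)
 finally show ?thesis by simp
qed

lemma P_psd:
 "0 <= (\<Sum>p\<in>tuples G n \<times> tuples H n. v p * (\<Sum>q\<in>tuples G n \<times> tuples H n. P (n + n) (rev (fst p) @ fst q) (rev (snd p) @ snd q) * v q))"
proof -
 let ?X = "tuples G n" and ?Y = "tuples H n" and ?k = "kk (n + n)"
 define b where "b i x x' = bb (n + n) i (rev x @ x')" for i x x'
 define b' where "b' i y y' = bb' (n + n) i (rev y @ y')" for i y y'
 define C where "C p q = P (n + n) (rev (fst p) @ fst q) (rev (snd p) @ snd q)" for p q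
 define S where "S x x' = (\<Sum>i<?k. \<Sum>z\<in>?X. b i x z * b i x' z)" for x x'
 define T where "T p q = S (fst p) (fst q) * of_bool (snd p = snd q)" for p q :: "nat list \<times> nat list"
 have finX: "finite ?X" "finite ?Y" by (rule finite_tuples[OF finG], rule finite_tuples[OF finH])
 have Cb: "C p q = (\<Sum>i<?k. b i (fst p) (fst q) * b' i (snd p) (snd q))" for p q by (simp add: C_def P_def b_def b'_def)
 have Ssym: "S x x' = S x' x" for x x' by (simp add: S_def mult.commute)
 have Tap: "(\<Sum>q\<in>?X \<times> ?Y. T (x, y) q * w q) = (\<Sum>z\<in>?X. S x z * w (z, y))" if "y \<in> ?Y" for x y w
 proof -
  have "(\<Sum>q\<in>?X \<times> ?Y. T (x, y) q * w q) = (\<Sum>z\<in>?X. \<Sum>y'\<in>?Y. T (x, y) (z, y') * w (z, y'))" by (simp add: sum.cartesian_product split_beta)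
  also have "... = (\<Sum>z\<in>?X. \<Sum>y'\<in>?Y. if y' = y then S x z * w (z, y) else 0)"
   by (intro sum.cong refl) (auto simp: T_def)
  finally have "(\<Sum>q\<in>?X \<times> ?Y. T (x, y) q * w q) = (\<Sum>z\<in>?X. \<Sum>y'\<in>?Y. if y' = y then S x z * w (z, y) else 0)" .
  then show ?thesis using that finX by simp
 qed
 have CC: "(\<Sum>q\<in>?X \<times> ?Y. C p q * C q r) = (\<Sum>q\<in>?X \<times> ?Y. T p q * C q r)" if pr: "p \<in> ?X \<times> ?Y" "r \<in> ?X \<times> ?Y" for p r
 proof -
  obtain x y where p: "p = (x, y)" "x \<in> ?X" "y \<in> ?Y" using pr by auto
  obtain x2 y2 where r: "r = (x2, y2)" "x2 \<in> ?X" "y2 \<in> ?Y" using pr by auto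
  have K: "(\<Sum>y'\<in>?Y. b' i y y' * C (x', y') r) = (\<Sum>z\<in>?X. b i z x' * C (z, y) r)" if "i < ?k" "x' \<in> ?X" for i x'
   using P_mult[OF bb_KK[OF that(1)] that(2) r(2) p(3) r(3)] by (simp add: b_def b'_def C_def r)
  have "(\<Sum>q\<in>?X \<times> ?Y. C p q * C q r) = (\<Sum>x'\<in>?X. \<Sum>y'\<in>?Y. C p (x', y') * C (x', y') r)" by (simp add: sum.cartesian_product split_beta)
  also have "... = (\<Sum>x'\<in>?X. \<Sum>y'\<in>?Y. \<Sum>i<?k. b i x x' * (b' i y y' * C (x', y') r))"
   by (intro sum.cong refl) (simp add: Cb[of "(x, y)"] p(1) sum_distrib_right mult.assoc)
  also have "... = (\<Sum>x'\<in>?X. \<Sum>i<?k. \<Sum>y'\<in>?Y. b i x x' * (b' i y y' * C (x', y') r))" by (intro sum.cong refl sum.swap)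
  also have "... = (\<Sum>x'\<in>?X. \<Sum>i<?k. b i x x' * (\<Sum>z\<in>?X. b i z x' * C (z, y) r))"
   unfolding sum_distrib_left[symmetric] by (intro sum.cong refl arg_cong2[where f = "(*)"] K) auto
  also have "... = (\<Sum>x'\<in>?X. \<Sum>i<?k. \<Sum>z\<in>?X. b i x x' * b i z x' * C (z, y) r)" by (simp add: sum_distrib_left mult.assoc)
  also have "... = (\<Sum>x'\<in>?X. \<Sum>z\<in>?X. \<Sum>i<?k. b i x x' * b i z x' * C (z, y) r)" by (intro sum.cong refl sum.swap)
  also have "... = (\<Sum>z\<in>?X. \<Sum>x'\<in>?X. \<Sum>i<?k. b i x x' * b i z x' * C (z, y) r)" by (rule sum.swap)
  also have "... = (\<Sum>z\<in>?X. \<Sum>i<?k. \<Sum>x'\<in>?X. b i x x' * b i z x' * C (z, y) r)" by (intro sum.cong refl sum.swap)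
  also have "... = (\<Sum>z\<in>?X. S x z * C (z, y) r)" by (simp add: S_def sum_distrib_right)
  also have "... = (\<Sum>q\<in>?X \<times> ?Y. T p q * C q r)" unfolding p(1) by (rule Tap[OF p(3), symmetric])
  finally show ?thesis .
 qed
 define e where "e i = ip (n + n) (%x. of_bool (take n x = rev (drop n x))) (bb (n + n) i)" for i
 define E where "E = (\<Sum>i<?k. (e i)\<^sup>2)"
 have E: "0 <= E" by (simp add: E_def sum_nonneg)
 have ident: "of_bool (x = z) = (\<Sum>i<?k. e i * b i x z)" if "x \<in> ?X" "z \<in> ?X" for x z
 proof -
  have "rev x @ z \<in> tuples G (n + n)" using that by (auto simp: tuples_def)
  from expandG[OF KK_id this] show ?thesis using that by (auto simp: e_def b_def tuples_length of_bool_def split: if_splits)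
 qed
 \<comment> \<open>The identity kernel is a combination of the \<open>b i\<close> with coefficients
   \<open>e i\<close>, so \<open>w\<close> is recovered from the \<open>t i\<close>, and
   Cauchy-Schwarz bounds its squared norm by \<open>E\<close> times the form of \<open>T\<close>.
   Using \<open>1 + E\<close> avoids a division by 0.\<close>
 have pos: "1 / (1 + E) * (\<Sum>p\<in>?X \<times> ?Y. (w p)\<^sup>2) <= (\<Sum>p\<in>?X \<times> ?Y. w p * (\<Sum>q\<in>?X \<times> ?Y. T p q * w q))" for w
 proof -
  define t where "t i z y = (\<Sum>x\<in>?X. b i x z * w (x, y))" for i z y
  have "(\<Sum>p\<in>?X \<times> ?Y. w p * (\<Sum>q\<in>?X \<times> ?Y. T p q * w q)) = (\<Sum>x\<in>?X. \<Sum>y\<in>?Y. w (x, y) * (\<Sum>q\<in>?X \<times> ?Y. T (x, y) q * w q))"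
   by (simp add: sum.cartesian_product split_beta)
  also have "... = (\<Sum>x\<in>?X. \<Sum>y\<in>?Y. \<Sum>x'\<in>?X. \<Sum>i<?k. \<Sum>z\<in>?X. w (x, y) * (b i x z * b i x' z * w (x', y)))"
   by (intro sum.cong refl) (simp add: Tap S_def sum_distrib_right sum_distrib_left)
  also have "... = (\<Sum>y\<in>?Y. \<Sum>x\<in>?X. \<Sum>x'\<in>?X. \<Sum>i<?k. \<Sum>z\<in>?X. w (x, y) * (b i x z * b i x' z * w (x', y)))" by (rule sum.swap)
  also have "... = (\<Sum>y\<in>?Y. \<Sum>x\<in>?X. \<Sum>i<?k. \<Sum>x'\<in>?X. \<Sum>z\<in>?X. w (x, y) * (b i x z * b i x' z * w (x', y)))" by (intro sum.cong refl sum.swap)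
  also have "... = (\<Sum>y\<in>?Y. \<Sum>i<?k. \<Sum>x\<in>?X. \<Sum>x'\<in>?X. \<Sum>z\<in>?X. w (x, y) * (b i x z * b i x' z * w (x', y)))" by (intro sum.cong refl sum.swap)
  also have "... = (\<Sum>y\<in>?Y. \<Sum>i<?k. \<Sum>x\<in>?X. \<Sum>z\<in>?X. \<Sum>x'\<in>?X. w (x, y) * (b i x z * b i x' z * w (x', y)))" by (intro sum.cong refl sum.swap)
  also have "... = (\<Sum>y\<in>?Y. \<Sum>i<?k. \<Sum>z\<in>?X. \<Sum>x\<in>?X. \<Sum>x'\<in>?X. w (x, y) * (b i x z * b i x' z * w (x', y)))" by (intro sum.cong refl sum.swap)
  also have "... = (\<Sum>y\<in>?Y. \<Sum>i<?k. \<Sum>z\<in>?X. (t i z y)\<^sup>2)"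
   unfolding t_def power2_eq_square sum_product by (intro sum.cong refl) (simp only: mult_ac)
  finally have q: "(\<Sum>p\<in>?X \<times> ?Y. w p * (\<Sum>q\<in>?X \<times> ?Y. T p q * w q)) = (\<Sum>y\<in>?Y. \<Sum>i<?k. \<Sum>z\<in>?X. (t i z y)\<^sup>2)" (is "?L = ?q") .
  have tw: "w (z, y) = (\<Sum>i<?k. e i * t i z y)" if z: "z \<in> ?X" for z y
  proof -
   have "w (z, y) = (\<Sum>x\<in>?X. if x = z then w (x, y) else 0)" using z finX by simp
   also have "... = (\<Sum>x\<in>?X. (\<Sum>i<?k. e i * b i x z) * w (x, y))" using ident z by (intro sum.cong refl) (simp flip: ident)
   also have "... = (\<Sum>x\<in>?X. \<Sum>i<?k. e i * (b i x z * w (x, y)))" by (simp add: sum_distrib_right mult.assoc)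
   also have "... = (\<Sum>i<?k. \<Sum>x\<in>?X. e i * (b i x z * w (x, y)))" by (rule sum.swap)
   finally show ?thesis by (simp add: t_def sum_distrib_left)
  qed
  have "(\<Sum>p\<in>?X \<times> ?Y. (w p)\<^sup>2) = (\<Sum>z\<in>?X. \<Sum>y\<in>?Y. (w (z, y))\<^sup>2)" by (simp add: sum.cartesian_product split_beta)
  also have "... <= (\<Sum>z\<in>?X. \<Sum>y\<in>?Y. E * (\<Sum>i<?k. (t i z y)\<^sup>2))"
   unfolding E_def by (intro sum_mono) (simp add: tw CS_sum)
  also have "... = E * (\<Sum>z\<in>?X. \<Sum>y\<in>?Y. \<Sum>i<?k. (t i z y)\<^sup>2)" by (simp add: sum_distrib_left)
  also have "(\<Sum>z\<in>?X. \<Sum>y\<in>?Y. \<Sum>i<?k. (t i z y)\<^sup>2) = (\<Sum>y\<in>?Y. \<Sum>z\<in>?X. \<Sum>i<?k. (t i z y)\<^sup>2)" by (rule sum.swap)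
  also have "... = ?q" by (intro sum.cong refl sum.swap)
  also have "E * ?q <= (1 + E) * ?q" by (intro mult_right_mono sum_nonneg) auto
  finally show ?thesis unfolding q using E by (simp add: field_simps)
 qed
 have "0 <= (\<Sum>p\<in>?X \<times> ?Y. v p * (\<Sum>q\<in>?X \<times> ?Y. C p q * v q))"
 proof (rule psd_of_square[where T = T, OF _ _ _ CC _ pos])
  show "C p q = C q p" if "p \<in> ?X \<times> ?Y" "q \<in> ?X \<times> ?Y" for p q
  proof -
   have "rev (fst p) @ fst q \<in> tuples G (n + n)" "rev (snd p) @ snd q \<in> tuples H (n + n)" using that by (auto simp: tuples_def)
   from P_rev[OF this] show ?thesis by (simp add: C_def)
  qed
  show "T p q = T q p" for p q using Ssym by (auto simp: T_def)
 qed (use E finX in auto)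
 then show ?thesis by (simp add: C_def)
qed

end

section \<open>The C*-algebra of bounded matrices\<close>

text \<open>Infinite matrices are coded in the type \<open>nat => complex\<close> that
  \<open>quantum_isomorphic\<close> prescribes, with pairs of indices as numbers.\<close>

definition ix :: "(nat => complex) => nat => nat => complex" where "ix a i j = a (prod_encode (i, j))"

definition mk :: "(nat => nat => complex) => nat => complex" where
 "mk f p = f (fst (prod_decode p)) (snd (prod_decode p))"

lemma ix_mk [simp]: "ix (mk f) i j = f i j" by (simp add: ix_def mk_def)

lemma ix_ext: "(!!i j. ix a i j = ix b i j) ==> a = b"
proof
 fix p assume "!!i j. ix a i j = ix b i j"
 from this[of "fst (prod_decode p)" "snd (prod_decode p)"] show "a p = b p" by (simp add: ix_def)
qed

definition sq :: "nat => (nat => complex) => real" where "sq n v = (\<Sum>i<n. (cmod (v i))\<^sup>2)"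

lemma sq_nonneg [simp]: "0 <= sq n v" by (simp add: sq_def sum_nonneg)

lemma sq_mono: "m <= n ==> sq m v <= sq n v" unfolding sq_def by (rule sum_mono2) auto

lemma CS_complex: "(cmod (\<Sum>i<n. u i * w i))\<^sup>2 <= sq n u * sq n w"
proof -
 have "cmod (\<Sum>i<n. u i * w i) <= (\<Sum>i<n. cmod (u i) * cmod (w i))" using norm_sum[of "%i. u i * w i" "{..<n}"] by (simp add: norm_mult)
 then have "(cmod (\<Sum>i<n. u i * w i))\<^sup>2 <= (\<Sum>i<n. cmod (u i) * cmod (w i))\<^sup>2" by (rule power_mono) simp
 also have "... <= sq n u * sq n w" unfolding sq_def by (rule CS_sum) simp
 finally show ?thesis .
qed

lemma sq_add:
 assumes "sq n u <= A\<^sup>2 * S" "sq n w <= B\<^sup>2 * S" "0 <= A" "0 <= B" "0 <= S"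
 shows "sq n (%i. u i + w i) <= (A + B)\<^sup>2 * S"
proof -
 let ?c = "\<Sum>i<n. cmod (u i) * cmod (w i)"
 have "?c\<^sup>2 <= sq n u * sq n w" unfolding sq_def by (rule CS_sum) simp
 also have "... <= (A\<^sup>2 * S) * (B\<^sup>2 * S)" using assms by (intro mult_mono) auto
 also have "... = (A * B * S)\<^sup>2" by (simp add: power2_eq_square)
 finally have c: "?c <= A * B * S" by (rule power2_le_imp_le) (use assms in simp)
 have "sq n (%i. u i + w i) <= (\<Sum>i<n. (cmod (u i) + cmod (w i))\<^sup>2)" unfolding sq_def by (intro sum_mono power_mono norm_triangle_ineq) auto
 also have "... = sq n u + sq n w + 2 * ?c" by (simp add: sq_def power2_sum sum.distrib sum_distrib_left mult.assoc)
 also have "... <= A\<^sup>2 * S + B\<^sup>2 * S + 2 * (A * B * S)" using assms c by linarith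
 also have "... = (A + B)\<^sup>2 * S" by (simp add: power2_sum algebra_simps)
 finally show ?thesis .
qed

text \<open>An operator bound tested on finite square sections; \<open>bd_rect\<close> extends it to
  rectangular ones, and limits of these replace a Hilbert space.\<close>

definition bd :: "real => (nat => complex) => bool" where
 "bd M a \<longleftrightarrow> 0 <= M & (\<forall>n v. sq n (%i. \<Sum>j<n. ix a i j * v j) <= M\<^sup>2 * sq n v)"

lemma bd_rect: assumes "bd M a" shows "sq m (%i. \<Sum>j<n. ix a i j * v j) <= M\<^sup>2 * sq n v"
proof -
 let ?N = "max m n" and ?v = "%j. if j < n then v j else 0"
 have e: "(\<Sum>j<?N. ix a i j * ?v j) = (\<Sum>j<n. ix a i j * v j)" for i
 proof -
  have "(\<Sum>j<?N. ix a i j * ?v j) = (\<Sum>j<?N. if j \<in> {..<n} then ix a i j * v j else 0)" by (intro sum.cong) auto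
  also have "... = (\<Sum>j\<in>{..<?N} Int {..<n}. ix a i j * v j)" by (rule sum.inter_restrict[symmetric]) simp
  also have "{..<?N} Int {..<n} = {..<n}" by auto
  finally show ?thesis .
 qed
 have s: "sq ?N ?v = sq n v"
 proof -
  have "sq ?N ?v = (\<Sum>j<?N. if j \<in> {..<n} then (cmod (v j))\<^sup>2 else 0)" unfolding sq_def by (intro sum.cong) auto
  also have "... = (\<Sum>j\<in>{..<?N} Int {..<n}. (cmod (v j))\<^sup>2)" by (rule sum.inter_restrict[symmetric]) simp
  also have "{..<?N} Int {..<n} = {..<n}" by auto
  finally show ?thesis by (simp add: sq_def)
 qed
 have "sq m (%i. \<Sum>j<n. ix a i j * v j) <= sq ?N (%i. \<Sum>j<n. ix a i j * v j)" by (rule sq_mono) simp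
 also have "... <= M\<^sup>2 * sq n v" using conjunct2[OF assms[unfolded bd_def], rule_format, of ?N ?v] unfolding e s .
 finally show ?thesis .
qed

definition st :: "(nat => complex) => nat => complex" where "st a = mk (%i j. cnj (ix a j i))"

lemma ix_st [simp]: "ix (st a) i j = cnj (ix a j i)" by (simp add: st_def)

lemma sq_complex: "complex_of_real (sq n y) = (\<Sum>i<n. y i * cnj (y i))"
 unfolding sq_def of_real_sum complex_norm_square ..

text \<open>For \<open>y = (st a) v\<close> one has \<open>|y|^2 = <v, a y>\<close>, at most
  \<open>|v| * M * |y|\<close>; cancel \<open>|y|\<close>.\<close>

lemma bd_st: assumes "bd M a" shows "bd M (st a)"
proof -
 have M: "0 <= M" using assms by (simp add: bd_def)
 have "sq n (%i. \<Sum>j<n. ix (st a) i j * v j) <= M\<^sup>2 * sq n v" for n v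
 proof -
  let ?y = "%i. \<Sum>j<n. ix (st a) i j * v j"
  let ?z = "%j. \<Sum>i<n. ix a j i * ?y i"
  have "complex_of_real (sq n ?y) = (\<Sum>i<n. \<Sum>j<n. cnj (?y i) * cnj (ix a j i) * v j)"
   unfolding sq_complex by (intro sum.cong refl) (simp add: sum_distrib_right mult_ac)
  also have "... = (\<Sum>j<n. \<Sum>i<n. cnj (?y i) * cnj (ix a j i) * v j)" by (rule sum.swap)
  also have "... = (\<Sum>j<n. v j * cnj (?z j))" by (intro sum.cong refl) (simp add: sum_distrib_left mult_ac)
  finally have eq: "complex_of_real (sq n ?y) = (\<Sum>j<n. v j * cnj (?z j))" .
  have "(sq n ?y)\<^sup>2 = (cmod (\<Sum>j<n. v j * cnj (?z j)))\<^sup>2" unfolding eq[symmetric] by simp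
  also have "... <= sq n v * sq n (%j. cnj (?z j))" by (rule CS_complex)
  also have "sq n (%j. cnj (?z j)) = sq n ?z" by (simp only: sq_def complex_mod_cnj)
  also have "sq n v * sq n ?z <= sq n v * (M\<^sup>2 * sq n ?y)" by (intro mult_left_mono bd_rect[OF assms]) auto
  finally have le: "sq n ?y * sq n ?y <= (M\<^sup>2 * sq n v) * sq n ?y" by (simp add: power2_eq_square mult_ac)
  show ?thesis
  proof (cases "sq n ?y = 0")
   case True then show ?thesis by simp
  next
   case False
   then have "0 < sq n ?y" using sq_nonneg[of n ?y] by linarith
   then show ?thesis using le by (rule mult_right_le_imp_le[rotated])
  qed
 qed
 then show ?thesis using M by (simp add: bd_def)
qed

lemma bd_col: assumes "bd M a" shows "sq n (%i. ix a i j) <= M\<^sup>2"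
proof -
 have "sq n (%i. \<Sum>l<Suc j. ix a i l * of_bool (l = j)) <= M\<^sup>2 * sq (Suc j) (%l. of_bool (l = j))" by (rule bd_rect[OF assms])
 moreover have "(\<Sum>l<Suc j. ix a i l * of_bool (l = j)) = ix a i j" for i by (simp add: of_bool_def if_distrib cong: if_cong)
 moreover have "sq (Suc j) (%l. of_bool (l = j)) = 1"
 proof -
  have "sq (Suc j) (%l. of_bool (l = j)) = (\<Sum>l<Suc j. if l = j then 1 else 0)" unfolding sq_def by (intro sum.cong) auto
  then show ?thesis by simp
 qed
 ultimately show ?thesis by simp
qed

lemma bd_row: assumes "bd M a" shows "sq n (ix a i) <= M\<^sup>2"
 using bd_col[OF bd_st[OF assms], of n i] by (simp add: sq_def)

lemma bd_entry: assumes "bd M a" shows "cmod (ix a i j) <= M"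
proof -
 have "(cmod (ix a i j))\<^sup>2 <= sq (Suc i) (%i. ix a i j)" by (simp add: sq_def sum_nonneg)
 also have "... <= M\<^sup>2" by (rule bd_col[OF assms])
 finally show ?thesis by (rule power2_le_imp_le) (use assms in \<open>simp add: bd_def\<close>)
qed

lemma sq_tendsto:
 assumes "!!i. i < n ==> (%k. y k i) \<longlonglongrightarrow> z i"
 shows "(%k. sq n (y k)) \<longlonglongrightarrow> sq n z"
 unfolding sq_def using assms by (intro tendsto_sum tendsto_power tendsto_norm) auto

lemma l2_summable:
 assumes "!!n. sq n u <= A" "!!n. sq n w <= B"
 shows "summable (%k. u k * w k)"
proof (rule summable_comparison_test[of _ "%k. (cmod (u k))\<^sup>2 + (cmod (w k))\<^sup>2"])
 have "norm (u k * w k) <= (cmod (u k))\<^sup>2 + (cmod (w k))\<^sup>2" for k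
 proof -
  have "2 * (cmod (u k) * cmod (w k)) <= (cmod (u k))\<^sup>2 + (cmod (w k))\<^sup>2"
   using zero_le_power2[of "cmod (u k) - cmod (w k)"] unfolding power2_diff by linarith
  moreover have "0 <= cmod (u k) * cmod (w k)" by simp
  ultimately show ?thesis unfolding norm_mult by linarith
 qed
 then show "\<exists>N. \<forall>k\<ge>N. norm (u k * w k) <= (cmod (u k))\<^sup>2 + (cmod (w k))\<^sup>2" by blast
 have "summable (%k. (cmod (u k))\<^sup>2)" by (rule summableI_nonneg_bounded[of _ A]) (use assms in \<open>auto simp: sq_def\<close>)
 moreover have "summable (%k. (cmod (w k))\<^sup>2)" by (rule summableI_nonneg_bounded[of _ B]) (use assms in \<open>auto simp: sq_def\<close>)
 ultimately show "summable (%k. (cmod (u k))\<^sup>2 + (cmod (w k))\<^sup>2)" by (rule summable_add)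
qed

lemma l2_CS:
 assumes "!!n. sq n u <= A" "!!n. sq n w <= B"
 shows "(cmod (\<Sum>k. u k * w k))\<^sup>2 <= A * B"
proof -
 have "(%n. \<Sum>k<n. u k * w k) \<longlonglongrightarrow> (\<Sum>k. u k * w k)" using l2_summable[OF assms] by (rule summable_LIMSEQ)
 then have "(%n. (cmod (\<Sum>k<n. u k * w k))\<^sup>2) \<longlonglongrightarrow> (cmod (\<Sum>k. u k * w k))\<^sup>2" by (intro tendsto_intros)
 moreover have "(cmod (\<Sum>k<n. u k * w k))\<^sup>2 <= A * B" for n
 proof -
  have "0 <= A" using assms(1)[of 0] by (simp add: sq_def)
  then show ?thesis using CS_complex[of u w n] mult_mono[OF assms(1)[of n] assms(2)[of n]] by simp
 qed
 ultimately show ?thesis using LIMSEQ_le_const2 by blast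
qed

definition mu :: "(nat => complex) => (nat => complex) => nat => complex" where
 "mu a b = mk (%i j. \<Sum>k. ix a i k * ix b k j)"

lemma ix_mu: "ix (mu a b) i j = (\<Sum>k. ix a i k * ix b k j)" by (simp add: mu_def)

lemma mu_summable: "bd M a ==> bd N b ==> summable (%k. ix a i k * ix b k j)"
 by (rule l2_summable[OF bd_row bd_col])

lemma mu_LIMSEQ: "bd M a ==> bd N b ==> (%K. \<Sum>k<K. ix a i k * ix b k j) \<longlonglongrightarrow> ix (mu a b) i j"
 unfolding ix_mu by (rule summable_LIMSEQ[OF mu_summable])

lemma bd_mu: assumes a: "bd M a" and b: "bd N b" shows "bd (M * N) (mu a b)"
proof -
 have MN: "0 <= M" "0 <= N" using assms by (auto simp: bd_def)
 have "sq n (%i. \<Sum>j<n. ix (mu a b) i j * v j) <= (M * N)\<^sup>2 * sq n v" for n v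
 proof -
  let ?z = "%k. \<Sum>j<n. ix b k j * v j"
  have "(%K. sq n (%i. \<Sum>j<n. (\<Sum>k<K. ix a i k * ix b k j) * v j)) \<longlonglongrightarrow> sq n (%i. \<Sum>j<n. ix (mu a b) i j * v j)"
   by (intro sq_tendsto tendsto_sum tendsto_mult tendsto_const mu_LIMSEQ[OF a b])
  moreover have "sq n (%i. \<Sum>j<n. (\<Sum>k<K. ix a i k * ix b k j) * v j) <= (M * N)\<^sup>2 * sq n v" for K
  proof -
   have "(\<Sum>j<n. (\<Sum>k<K. ix a i k * ix b k j) * v j) = (\<Sum>k<K. ix a i k * ?z k)" for i
    unfolding sum_distrib_right sum_distrib_left by (subst sum.swap) (simp only: mult.assoc)
   then have "sq n (%i. \<Sum>j<n. (\<Sum>k<K. ix a i k * ix b k j) * v j) = sq n (%i. \<Sum>k<K. ix a i k * ?z k)" by simp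
   also have "... <= M\<^sup>2 * sq K ?z" by (rule bd_rect[OF a])
   also have "... <= M\<^sup>2 * (N\<^sup>2 * sq n v)" by (intro mult_left_mono bd_rect[OF b]) auto
   finally show ?thesis by (simp add: power_mult_distrib mult_ac)
  qed
  ultimately show ?thesis using LIMSEQ_le_const2 by blast
 qed
 then show ?thesis using MN by (simp add: bd_def)
qed

text \<open>The double series need not converge absolutely, so the sums are exchanged by truncation:
  the tail of \<open>s\<close> beyond \<open>L\<close> is small in square norm, \<open>b\<close>
  keeps it small, and Cauchy-Schwarz against \<open>r\<close> makes the error vanish.\<close>

lemma mu_assoc_core:
 assumes r: "!!n. sq n r <= A" and s: "!!n. sq n s <= B" and b: "bd N b"
 shows "(%l. (\<Sum>k. r k * ix b k l) * s l) sums (\<Sum>k. r k * (\<Sum>l. ix b k l * s l))"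
proof -
 define t where "t k = (\<Sum>l. ix b k l * s l)" for k
 define tl where "tl L k = (\<Sum>l<L. ix b k l * s l)" for L k
 have tlim: "(%L. tl L k) \<longlonglongrightarrow> t k" for k
  unfolding tl_def t_def by (rule summable_LIMSEQ[OF l2_summable[OF bd_row[OF b] s]])
 have A: "0 <= A" using r[of 0] by (simp add: sq_def)
 have "incseq (%L. sq L s)" by (simp add: incseq_def sq_mono)
 then obtain S where S: "(%L. sq L s) \<longlonglongrightarrow> S" "!!L. sq L s <= S" using incseq_convergent[of "%L. sq L s" B] s by blast
 have tail: "sq m (%k. t k - tl L k) <= N\<^sup>2 * (S - sq L s)" for m L
 proof -
  have "(%L'. sq m (%k. tl L' k - tl L k)) \<longlonglongrightarrow> sq m (%k. t k - tl L k)" by (intro sq_tendsto tendsto_diff tlim tendsto_const)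
  moreover have "sq m (%k. tl L' k - tl L k) <= N\<^sup>2 * (S - sq L s)" if "L' >= L" for L'
  proof -
   let ?v = "%l. if l < L then 0 else s l"
   have sp: "(\<Sum>l<L'. f l) = (\<Sum>l<L. f l) + (\<Sum>l=L..<L'. f l)" for f :: "nat => 'z :: comm_monoid_add"
    using that by (simp add: lessThan_atLeast0 sum.atLeastLessThan_concat)
   have "tl L' k - tl L k = (\<Sum>l<L'. ix b k l * ?v l)" for k
    unfolding tl_def sp by simp
   then have "sq m (%k. tl L' k - tl L k) <= N\<^sup>2 * sq L' ?v" using bd_rect[OF b, of m ?v L'] by simp
   also have "sq L' ?v = sq L' s - sq L s" unfolding sq_def sp by simp
   also have "N\<^sup>2 * (sq L' s - sq L s) <= N\<^sup>2 * (S - sq L s)" using S(2) by (intro mult_left_mono) auto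
   finally show ?thesis .
  qed
  ultimately show ?thesis using LIMSEQ_le_const2 by blast
 qed
 have bs: "summable (%k. r k * ix b k l)" for l by (rule l2_summable[OF r bd_col[OF b]])
 have rt: "summable (%k. r k * (t k - tl L k))" for L by (rule l2_summable[OF r tail])
 have part: "(%k. r k * tl L k) sums (\<Sum>l<L. (\<Sum>k. r k * ix b k l) * s l)" for L
 proof -
  have "(%k. \<Sum>l<L. (r k * ix b k l) * s l) sums (\<Sum>l<L. (\<Sum>k. r k * ix b k l) * s l)"
   by (intro sums_sum sums_mult2 summable_sums bs)
  then show ?thesis by (simp add: tl_def sum_distrib_left mult.assoc)
 qed
 have diff: "(\<Sum>k. r k * t k) - (\<Sum>l<L. (\<Sum>k. r k * ix b k l) * s l) = (\<Sum>k. r k * (t k - tl L k))" for L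
 proof -
  have "(%k. r k * (t k - tl L k) + r k * tl L k) sums ((\<Sum>k. r k * (t k - tl L k)) + (\<Sum>l<L. (\<Sum>k. r k * ix b k l) * s l))"
   by (rule sums_add[OF summable_sums[OF rt] part])
  then have "(%k. r k * t k) sums ((\<Sum>k. r k * (t k - tl L k)) + (\<Sum>l<L. (\<Sum>k. r k * ix b k l) * s l))" by (simp add: algebra_simps)
  from sums_unique[OF this, symmetric] have e: "(\<Sum>k. r k * t k) = (\<Sum>k. r k * (t k - tl L k)) + (\<Sum>l<L. (\<Sum>k. r k * ix b k l) * s l)" .
  show ?thesis unfolding e by (rule add_diff_cancel_right')
 qed
 have "(%L. (cmod ((\<Sum>k. r k * t k) - (\<Sum>l<L. (\<Sum>k. r k * ix b k l) * s l)))\<^sup>2) \<longlonglongrightarrow> 0"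
 proof (rule tendsto_sandwich[of "%_. 0" _ _ "%L. A * (N\<^sup>2 * (S - sq L s))"])
  show "\<forall>\<^sub>F L in sequentially. (cmod ((\<Sum>k. r k * t k) - (\<Sum>l<L. (\<Sum>k. r k * ix b k l) * s l)))\<^sup>2 <= A * (N\<^sup>2 * (S - sq L s))"
   unfolding diff by (intro always_eventually allI l2_CS[OF r tail])
  have "(%L. A * (N\<^sup>2 * (S - sq L s))) \<longlonglongrightarrow> A * (N\<^sup>2 * (S - S))" by (intro tendsto_intros S)
  then show "(%L. A * (N\<^sup>2 * (S - sq L s))) \<longlonglongrightarrow> 0" by simp
 qed auto
 then have "(%L. cmod ((\<Sum>k. r k * t k) - (\<Sum>l<L. (\<Sum>k. r k * ix b k l) * s l))) \<longlonglongrightarrow> 0" by (simp add: tendsto_null_power)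
 then have "(%L. (\<Sum>k. r k * t k) - (\<Sum>l<L. (\<Sum>k. r k * ix b k l) * s l)) \<longlonglongrightarrow> 0" by (rule tendsto_norm_zero_cancel)
 from tendsto_diff[OF tendsto_const[of "\<Sum>k. r k * t k"] this]
 show ?thesis unfolding sums_def t_def by simp
qed

lemma mu_assoc: assumes "bd M a" "bd N b" "bd K c" shows "mu (mu a b) c = mu a (mu b c)"
 by (rule ix_ext) (simp add: ix_mu sums_unique[OF mu_assoc_core[OF bd_row[OF assms(1)] bd_col[OF assms(3)] assms(2)], symmetric])

lemma st_mu: assumes "bd M a" "bd N b" shows "st (mu a b) = mu (st b) (st a)"
proof (rule ix_ext)
 fix i j
 have "(%k. cnj (ix a j k * ix b k i)) sums cnj (\<Sum>k. ix a j k * ix b k i)" unfolding sums_cnj by (rule summable_sums[OF mu_summable[OF assms]])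
 then show "ix (st (mu a b)) i j = ix (mu (st b) (st a)) i j" by (simp add: ix_mu sums_unique[symmetric] mult.commute)
qed

section \<open>The operator norm\<close>

definition nm :: "(nat => complex) => real" where "nm a = Inf {M. bd M a}"

lemma nm_le: "bd M a ==> nm a <= M"
 unfolding nm_def by (rule cInf_lower) (auto simp: bdd_below_def bd_def)

text \<open>The infimum is attained because being a bound is a closed condition.\<close>

lemma nm_bd: assumes "bd M a" shows "bd (nm a) a"
proof -
 have ne: "{M. bd M a} ~= {}" using assms by blast
 have n0: "0 <= nm a" unfolding nm_def using ne by (rule cInf_greatest) (simp add: bd_def)
 have "sq n (%i. \<Sum>j<n. ix a i j * v j) <= (nm a)\<^sup>2 * sq n v" for n v
 proof -
  have "sq n (%i. \<Sum>j<n. ix a i j * v j) <= (nm a + 1 / real (Suc k))\<^sup>2 * sq n v" for k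
  proof -
   have "Inf {M. bd M a} < nm a + 1 / real (Suc k)" by (simp add: nm_def)
   from cInf_lessD[OF ne this] obtain M' where M': "bd M' a" "M' < nm a + 1 / real (Suc k)" by blast
   have "sq n (%i. \<Sum>j<n. ix a i j * v j) <= M'\<^sup>2 * sq n v" by (rule bd_rect[OF M'(1)])
   also have "... <= (nm a + 1 / real (Suc k))\<^sup>2 * sq n v" using M' by (intro mult_right_mono power_mono) (auto simp: bd_def)
   finally show ?thesis .
  qed
  moreover have "(%k. (nm a + 1 / real (Suc k))\<^sup>2 * sq n v) \<longlonglongrightarrow> (nm a + 0)\<^sup>2 * sq n v"
   by (intro tendsto_intros LIMSEQ_Suc[OF lim_1_over_n])
  ultimately show ?thesis using LIMSEQ_le_const[of "%k. (nm a + 1 / real (Suc k))\<^sup>2 * sq n v" "(nm a)\<^sup>2 * sq n v" "sq n (%i. \<Sum>j<n. ix a i j * v j)"] by simp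
 qed
 then show ?thesis using n0 by (simp add: bd_def)
qed

lemma nm_nonneg: "bd M a ==> 0 <= nm a" using nm_bd by (auto simp: bd_def)

lemma bd_add: assumes "bd M a" "bd N b" shows "bd (M + N) (%p. a p + b p)"
proof -
 have MN: "0 <= M" "0 <= N" using assms by (auto simp: bd_def)
 have "sq n (%i. \<Sum>j<n. ix (%p. a p + b p) i j * v j) <= (M + N)\<^sup>2 * sq n v" for n v
 proof -
  have "(\<Sum>j<n. ix (%p. a p + b p) i j * v j) = (\<Sum>j<n. ix a i j * v j) + (\<Sum>j<n. ix b i j * v j)" for i
   by (simp add: ix_def distrib_right sum.distrib)
  then show ?thesis using sq_add[OF bd_rect[OF assms(1), of n v n] bd_rect[OF assms(2), of n v n] MN sq_nonneg] by simp
 qed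
 then show ?thesis using MN by (simp add: bd_def)
qed

lemma bd_smult: assumes "bd M a" shows "bd (cmod c * M) (%p. c * a p)"
proof -
 have "sq n (%i. \<Sum>j<n. ix (%p. c * a p) i j * v j) <= (cmod c * M)\<^sup>2 * sq n v" for n v
 proof -
  have eq: "(\<Sum>j<n. ix (%p. c * a p) i j * v j) = c * (\<Sum>j<n. ix a i j * v j)" for i by (simp add: ix_def sum_distrib_left mult.assoc)
  have "sq n (%i. \<Sum>j<n. ix (%p. c * a p) i j * v j) = (cmod c)\<^sup>2 * sq n (%i. \<Sum>j<n. ix a i j * v j)"
   by (simp only: sq_def eq norm_mult power_mult_distrib sum_distrib_left[of "(cmod c)\<^sup>2"])
  also have "... <= (cmod c)\<^sup>2 * (M\<^sup>2 * sq n v)" by (intro mult_left_mono bd_rect[OF assms]) auto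
  finally show ?thesis by (simp add: power_mult_distrib mult.assoc)
 qed
 then show ?thesis using assms by (simp add: bd_def)
qed

lemma bd_zero: "bd 0 (%_. 0)" by (simp add: bd_def ix_def sq_def)

lemma bd_limit:
 assumes "!!k. K <= k ==> bd M (x k)" "!!i j. (%k. ix (x k) i j) \<longlonglongrightarrow> ix y i j"
 shows "bd M y"
proof -
 have "sq n (%i. \<Sum>j<n. ix y i j * v j) <= M\<^sup>2 * sq n v" for n v
 proof (rule LIMSEQ_le_const2)
  show "(%k. sq n (%i. \<Sum>j<n. ix (x k) i j * v j)) \<longlonglongrightarrow> sq n (%i. \<Sum>j<n. ix y i j * v j)"
   by (intro sq_tendsto tendsto_sum tendsto_mult tendsto_const assms(2))
  show "\<exists>N. \<forall>k\<ge>N. sq n (%i. \<Sum>j<n. ix (x k) i j * v j) <= M\<^sup>2 * sq n v" using bd_rect[OF assms(1)] by blast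
 qed
 moreover have "0 <= M" using assms(1)[of K] by (simp add: bd_def)
 ultimately show ?thesis by (simp add: bd_def)
qed

lemma sq_form:
 "complex_of_real (sq m (%i. \<Sum>j<n. ix a i j * v j)) = (\<Sum>l<n. cnj (v l) * (\<Sum>j<n. (\<Sum>i<m. ix (st a) l i * ix a i j) * v j))"
proof -
 let ?y = "%i. \<Sum>j<n. ix a i j * v j"
 have "complex_of_real (sq m ?y) = (\<Sum>i<m. \<Sum>l<n. \<Sum>j<n. cnj (v l) * (cnj (ix a i l) * ix a i j * v j))"
  unfolding sq_complex
 proof (rule sum.cong[OF refl])
  fix i
  have "?y i * cnj (?y i) = (\<Sum>l<n. cnj (ix a i l * v l)) * ?y i" by (simp add: mult.commute)
  also have "... = (\<Sum>l<n. \<Sum>j<n. cnj (v l) * (cnj (ix a i l) * ix a i j * v j))" unfolding sum_product by (simp add: mult_ac)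
  finally show "?y i * cnj (?y i) = (\<Sum>l<n. \<Sum>j<n. cnj (v l) * (cnj (ix a i l) * ix a i j * v j))" .
 qed
 also have "... = (\<Sum>l<n. \<Sum>i<m. \<Sum>j<n. cnj (v l) * (cnj (ix a i l) * ix a i j * v j))" by (rule sum.swap)
 also have "... = (\<Sum>l<n. \<Sum>j<n. \<Sum>i<m. cnj (v l) * (cnj (ix a i l) * ix a i j * v j))" by (intro sum.cong refl sum.swap)
 finally show ?thesis by (simp add: sum_distrib_left sum_distrib_right)
qed

text \<open>The identity \<open>|a v|^2 = <v, (st a) a v>\<close> holds only in the limit, since
  entries of the product involve full columns of \<open>a\<close>. \<open>sq_form\<close> is its
  version for \<open>m\<close> rows, and \<open>m\<close> tends to infinity.\<close>

lemma cstar_bd: assumes a: "bd M a" and N: "bd N (mu (st a) a)" shows "bd (sqrt N) a"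
proof -
 have N0: "0 <= N" using N by (simp add: bd_def)
 have "sq n (%i. \<Sum>j<n. ix a i j * v j) <= N * sq n v" for n v
 proof -
  let ?y = "%i. \<Sum>j<n. ix a i j * v j"
  let ?g = "\<Sum>l<n. cnj (v l) * (\<Sum>j<n. ix (mu (st a) a) l j * v j)"
  have "(%m. complex_of_real (sq m ?y)) \<longlonglongrightarrow> ?g" unfolding sq_form
   by (intro tendsto_sum tendsto_mult tendsto_const mu_LIMSEQ[OF bd_st[OF a] a])
  then have "(%m. cmod (complex_of_real (sq m ?y))) \<longlonglongrightarrow> cmod ?g" by (rule tendsto_norm)
  then have "(%m. sq m ?y) \<longlonglongrightarrow> cmod ?g" by simp
  then have "sq n ?y <= cmod ?g" by (rule LIMSEQ_le_const) (use sq_mono in blast)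
  also have "cmod ?g <= N * sq n v"
  proof (rule power2_le_imp_le)
   have "(cmod ?g)\<^sup>2 <= sq n (%l. cnj (v l)) * sq n (%l. \<Sum>j<n. ix (mu (st a) a) l j * v j)" by (rule CS_complex)
   also have "... <= sq n v * (N\<^sup>2 * sq n v)" by (intro mult_mono bd_rect[OF N]) (auto simp: sq_def sum_nonneg)
   finally show "(cmod ?g)\<^sup>2 <= (N * sq n v)\<^sup>2" by (simp add: power2_eq_square mult_ac)
  qed (use N0 in simp)
  finally show ?thesis .
 qed
 then show ?thesis using N0 by (simp add: bd_def)
qed

text \<open>Boundedness is derived, not assumed. Columns are finite, so for finitely supported
  \<open>v\<close> and \<open>y = a v\<close> the identity
  \<open>|y|^2 = <v, a a v> = <v, y>\<close> is a finite sum, and Cauchy-Schwarz gives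
  \<open>|y| <= |v|\<close>.\<close>

lemma proj_bd:
 assumes sy: "st a = a" and fin: "!!j. \<exists>K. \<forall>i\<ge>K. ix a i j = 0"
  and idem: "!!l j K. (!!i. K <= i ==> ix a i j = 0) ==> (\<Sum>i<K. ix a l i * ix a i j) = ix a l j"
 shows "bd 1 a"
proof -
 obtain K0 where K0: "!!i j. K0 j <= i ==> ix a i j = 0" using fin by metis
 have "sq n (%i. \<Sum>j<n. ix a i j * v j) <= sq n v" for n v
 proof -
  define K where "K = n + (\<Sum>j<n. K0 j)"
  have Kj: "K0 j <= K" if "j < n" for j using that member_le_sum[of j "{..<n}" K0] by (simp add: K_def)
  let ?y = "%i. \<Sum>j<n. ix a i j * v j"
  have "complex_of_real (sq K ?y) = (\<Sum>l<n. cnj (v l) * (\<Sum>j<n. (\<Sum>i<K. ix a l i * ix a i j) * v j))" unfolding sq_form sy ..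
  also have "... = (\<Sum>l<n. cnj (v l) * ?y l)"
  proof (intro sum.cong refl arg_cong2[where f = "(*)"] idem)
   show "ix a i j = 0" if "j \<in> {..<n}" "K <= i" for i j using K0[of j i] Kj[of j] that by simp
  qed
  finally have eq: "complex_of_real (sq K ?y) = (\<Sum>l<n. cnj (v l) * ?y l)" .
  have "(sq K ?y)\<^sup>2 = (cmod (\<Sum>l<n. cnj (v l) * ?y l))\<^sup>2" unfolding eq[symmetric] by simp
  also have "... <= sq n (%l. cnj (v l)) * sq n ?y" by (rule CS_complex)
  also have "sq n (%l. cnj (v l)) = sq n v" by (simp only: sq_def complex_mod_cnj)
  also have "sq n v * sq n ?y <= sq n v * sq K ?y" by (intro mult_left_mono sq_mono) (auto simp: K_def)
  finally have le: "sq K ?y * sq K ?y <= sq n v * sq K ?y" by (simp add: power2_eq_square)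
  have "sq K ?y <= sq n v"
  proof (cases "sq K ?y = 0")
   case True then show ?thesis by simp
  next
   case False
   then have "0 < sq K ?y" using sq_nonneg[of K ?y] by linarith
   then show ?thesis using le by (rule mult_right_le_imp_le[rotated])
  qed
  moreover have "sq n ?y <= sq K ?y" by (rule sq_mono) (simp add: K_def)
  ultimately show ?thesis by linarith
 qed
 then show ?thesis by (simp add: bd_def)
qed

text \<open>The corner cut out by \<open>I\<close> is an algebra with its own unit
  \<open>ident I\<close>. It accommodates GNS spaces of any dimension, with null directions left
  outside \<open>I\<close>.\<close>

definition Car :: "nat set => (nat => complex) set" where
 "Car I = {a. (\<exists>M. bd M a) & (\<forall>i j. ix a i j ~= 0 --> i \<in> I & j \<in> I)}"

definition ident :: "nat set => nat => complex" where "ident I = mk (%i j. of_bool (i = j & i \<in> I))"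

definition mat_alg :: "nat set => (nat => complex) cstar" where
 "mat_alg I = \<lparr> ca_carrier = Car I, ca_zero = (%_. 0), ca_one = ident I, ca_add = (%a b p. a p + b p), ca_smult = (%c a p. c * a p),
  ca_mult = mu, ca_star = st, ca_norm = nm \<rparr>"

lemma mat_alg_sel [simp]: "ca_carrier (mat_alg I) = Car I" "ca_zero (mat_alg I) = (%_. 0)" "ca_one (mat_alg I) = ident I"
 "ca_add (mat_alg I) = (%a b p. a p + b p)" "ca_smult (mat_alg I) = (%c a p. c * a p)" "ca_mult (mat_alg I) = mu"
 "ca_star (mat_alg I) = st" "ca_norm (mat_alg I) = nm"
 by (simp_all add: mat_alg_def)

lemma ix_lin [simp]: "ix (%p. a p + b p) i j = ix a i j + ix b i j" "ix (%p. c * a p) i j = c * ix a i j"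
 "ix (%_. 0) i j = 0" "ix (%p. - a p) i j = - ix a i j" "ix (%p. a p - b p) i j = ix a i j - ix b i j"
 by (simp_all add: ix_def)

lemma Car_bd: "a \<in> Car I ==> bd (nm a) a" using nm_bd by (auto simp: Car_def)

lemma Car_supp: "a \<in> Car I ==> i ~: I \<or> j ~: I ==> ix a i j = 0" by (auto simp: Car_def)

lemma CarI: "bd M a ==> (!!i j. i ~: I \<or> j ~: I ==> ix a i j = 0) ==> a \<in> Car I" by (auto simp: Car_def)

lemma Car_add: "a \<in> Car I ==> b \<in> Car I ==> (%p. a p + b p) \<in> Car I"
 by (rule CarI[OF bd_add[OF Car_bd Car_bd]]) (auto simp: Car_supp)

lemma Car_smult: "a \<in> Car I ==> (%p. c * a p) \<in> Car I"
 by (rule CarI[OF bd_smult[OF Car_bd]]) (auto simp: Car_supp)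

lemma Car_st: "a \<in> Car I ==> st a \<in> Car I"
 by (rule CarI[OF bd_st[OF Car_bd]]) (auto simp: Car_supp)

lemma Car_mu: "a \<in> Car I ==> b \<in> Car I ==> mu a b \<in> Car I"
 by (rule CarI[OF bd_mu[OF Car_bd Car_bd]]) (auto simp: Car_supp ix_mu)

lemma ident_Car: "ident I \<in> Car I"
proof (rule CarI)
 have "sq n (%i. \<Sum>j<n. ix (ident I) i j * v j) <= sq n v" for n v
 proof -
  have "(\<Sum>j<n. ix (ident I) i j * v j) = (if i \<in> I then v i else 0)" if "i < n" for i
  proof -
   have "(\<Sum>j<n. ix (ident I) i j * v j) = (\<Sum>j<n. if j = i then (if i \<in> I then v i else 0) else 0)" by (intro sum.cong) (auto simp: ident_def)
   then show ?thesis using that by simp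
  qed
  then show ?thesis unfolding sq_def by (intro sum_mono) simp
 qed
 then show "bd 1 (ident I)" by (simp add: bd_def)
qed (auto simp: ident_def)

lemma mu_ident: assumes "a \<in> Car I" shows "mu (ident I) a = a" "mu a (ident I) = a"
proof -
 have "(\<Sum>k. ix (ident I) i k * ix a k j) = ix a i j" for i j
  using suminf_finite[of "{i}" "%k. ix (ident I) i k * ix a k j"] Car_supp[OF assms, of i j] by (cases "i \<in> I") (auto simp: ident_def)
 then show "mu (ident I) a = a" by (intro ix_ext) (simp add: ix_mu)
 have "(\<Sum>k. ix a i k * ix (ident I) k j) = ix a i j" for i j
  using suminf_finite[of "{j}" "%k. ix a i k * ix (ident I) k j"] Car_supp[OF assms, of i j] by (cases "j \<in> I") (auto simp: ident_def)
 then show "mu a (ident I) = a" by (intro ix_ext) (simp add: ix_mu)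
qed

lemma nm_eq_0: assumes "a \<in> Car I" shows "nm a = 0 \<longleftrightarrow> a = (%_. 0)"
proof
 assume "nm a = 0"
 then have "bd 0 a" using Car_bd[OF assms] by simp
 then show "a = (%_. 0)" by (intro ix_ext) (use bd_entry in fastforce)
next
 assume "a = (%_. 0)"
 then show "nm a = 0" using nm_le[OF bd_zero] nm_nonneg[OF bd_zero] by auto
qed

lemma nm_smult: assumes "a \<in> Car I" shows "nm (%p. c * a p) = cmod c * nm a"
proof (cases "c = 0")
 case True
 then show ?thesis using nm_eq_0[of "%_. 0" I] CarI[OF bd_zero, of I] by simp
next
 case False
 have "nm (%p. c * a p) <= cmod c * nm a" by (rule nm_le[OF bd_smult[OF Car_bd[OF assms]]])
 moreover have "nm (%p. (1 / c) * (c * a p)) <= cmod (1 / c) * nm (%p. c * a p)" by (rule nm_le[OF bd_smult[OF Car_bd[OF Car_smult[OF assms]]]])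
 then have "nm a <= nm (%p. c * a p) / cmod c" using False by (simp add: norm_divide)
 then have "cmod c * nm a <= nm (%p. c * a p)" using False by (simp add: field_simps)
 ultimately show ?thesis by simp
qed

lemma st_st: "st (st a) = a" by (rule ix_ext) simp

lemma nm_st: assumes "a \<in> Car I" shows "nm (st a) = nm a"
 using nm_le[OF bd_st[OF Car_bd[OF assms]]] nm_le[OF bd_st[OF Car_bd[OF Car_st[OF assms]]]] by (simp add: st_st)

lemma nm_cstar: assumes "a \<in> Car I" shows "nm (mu (st a) a) = (nm a)\<^sup>2"
proof -
 have "nm (mu (st a) a) <= nm (st a) * nm a" by (rule nm_le[OF bd_mu[OF Car_bd Car_bd]]) (use assms Car_st in auto)
 moreover have "nm a <= sqrt (nm (mu (st a) a))" by (rule nm_le[OF cstar_bd[OF Car_bd[OF assms] Car_bd[OF Car_mu[OF Car_st[OF assms] assms]]]])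
 then have "(nm a)\<^sup>2 <= (sqrt (nm (mu (st a) a)))\<^sup>2" by (rule power_mono) (rule nm_nonneg[OF Car_bd[OF assms]])
 moreover have "0 <= nm (mu (st a) a)" by (rule nm_nonneg[OF Car_bd[OF Car_mu[OF Car_st[OF assms] assms]]])
 ultimately show ?thesis using nm_st[OF assms] by (simp add: power2_eq_square)
qed

text \<open>The norm dominates the entries, so an entrywise limit exists. Bounds pass to it by
  \<open>bd_limit\<close>, once to see that it is bounded and once for convergence in norm.\<close>

lemma nm_complete:
 fixes s :: "nat => nat => complex"
 assumes s: "!!n. s n \<in> Car I" and C: "!!e. 0 < e ==> \<exists>N. \<forall>m\<ge>N. \<forall>n\<ge>N. nm (%p. s m p + - 1 * s n p) < e"
 shows "\<exists>l\<in>Car I. \<forall>e>0. \<exists>N. \<forall>n\<ge>N. nm (%p. s n p + - 1 * l p) < e"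
proof -
 have D: "(%p. s m p + - 1 * s n p) \<in> Car I" for m n by (rule Car_add[OF s Car_smult[OF s]])
 have "\<exists>z. (%n. ix (s n) i j) \<longlonglongrightarrow> z" for i j
 proof -
  have "Cauchy (%n. ix (s n) i j)"
  proof (rule metric_CauchyI)
   fix e :: real assume "0 < e"
   then obtain N where N: "\<forall>m\<ge>N. \<forall>n\<ge>N. nm (%p. s m p + - 1 * s n p) < e" using C by blast
   have "dist (ix (s m) i j) (ix (s n) i j) < e" if "N <= m" "N <= n" for m n
   proof -
    have "cmod (ix (%p. s m p + - 1 * s n p) i j) <= nm (%p. s m p + - 1 * s n p)" by (rule bd_entry[OF Car_bd[OF D]])
    then show ?thesis using N that by (fastforce simp: dist_norm)
   qed
   then show "\<exists>N. \<forall>m\<ge>N. \<forall>n\<ge>N. dist (ix (s m) i j) (ix (s n) i j) < e" by blast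
  qed
  then show ?thesis using Cauchy_convergent by (auto simp: convergent_def)
 qed
 then obtain z where z: "!!i j. (%n. ix (s n) i j) \<longlonglongrightarrow> z i j" by metis
 define l where "l = mk z"
 have lim: "bd e (%p. s m p + - 1 * l p)" if "\<forall>n\<ge>N. nm (%p. s m p + - 1 * s n p) <= e" for e N m
 proof (rule bd_limit[of N _ "%n p. s m p + - 1 * s n p"])
  show "bd e (%p. s m p + - 1 * s n p)" if n: "N <= n" for n
  proof -
   have "bd (nm (%p. s m p + - 1 * s n p)) (%p. s m p + - 1 * s n p)" by (rule Car_bd[OF D])
   moreover have "M\<^sup>2 * sq k v <= e\<^sup>2 * sq k v" if "0 <= M" "M <= e" for M k v using that by (intro mult_right_mono power_mono) auto
   ultimately show ?thesis using \<open>\<forall>n\<ge>N. nm (%p. s m p + - 1 * s n p) <= e\<close> n unfolding bd_def by (meson order_trans)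
  qed
  show "(%n. ix (%p. s m p + - 1 * s n p) i j) \<longlonglongrightarrow> ix (%p. s m p + - 1 * l p) i j" for i j
   unfolding ix_lin l_def ix_mk by (intro tendsto_intros z)
 qed
 obtain N0 where N0: "\<forall>m\<ge>N0. \<forall>n\<ge>N0. nm (%p. s m p + - 1 * s n p) < 1" using C[of 1] by auto
 have "bd 1 (%p. s N0 p + - 1 * l p)" by (rule lim[of N0]) (use N0 in \<open>auto simp: less_imp_le\<close>)
 from bd_add[OF Car_bd[OF s] bd_smult[OF this, of "- 1"]] have "\<exists>M. bd M (%p. s N0 p + - 1 * (s N0 p + - 1 * l p))" by blast
 then have "\<exists>M. bd M l" by (simp add: algebra_simps)
 moreover have "ix l i j = 0" if "i ~: I \<or> j ~: I" for i j
  using z[of i j] that Car_supp[OF s, of i j] LIMSEQ_unique[OF _ tendsto_const] by (fastforce simp: l_def)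
 ultimately have "l \<in> Car I" by (auto intro: CarI)
 moreover have "\<exists>N. \<forall>n\<ge>N. nm (%p. s n p + - 1 * l p) < e" if e: "0 < e" for e
 proof -
  obtain N where N: "\<forall>m\<ge>N. \<forall>n\<ge>N. nm (%p. s m p + - 1 * s n p) < e / 2" using C[of "e / 2"] e by auto
  have "nm (%p. s m p + - 1 * l p) < e" if "N <= m" for m
  proof -
   have "bd (e / 2) (%p. s m p + - 1 * l p)" by (rule lim[of N]) (use N that in \<open>auto simp: less_imp_le\<close>)
   from nm_le[OF this] e show ?thesis by simp
  qed
  then show ?thesis by blast
 qed
 ultimately show ?thesis by blast
qed

lemma unital_mat_alg: assumes "I ~= {}" shows "unital_cstar (mat_alg I)"
 unfolding unital_cstar_def Let_def ca_diff_def mat_alg_sel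
proof (intro conjI ballI allI impI)
 show "(%_. 0) \<in> Car I" by (rule CarI[OF bd_zero]) simp
 show "ident I \<in> Car I" by (rule ident_Car)
 show "ident I ~= (%_. 0)"
 proof
  assume "ident I = (%_. 0)"
  then have "ix (ident I) i i = 0" for i by simp
  then show False using assms by (auto simp: ident_def)
 qed
 fix a assume a: "a \<in> Car I"
 show "st a \<in> Car I" by (rule Car_st[OF a])
 show "\<exists>b\<in>Car I. (%p. a p + b p) = (%_. 0)" by (rule bexI[OF _ Car_smult[OF a, of "- 1"]]) simp
 show "mu (ident I) a = a" "mu a (ident I) = a" using mu_ident[OF a] by auto
 show "nm a = 0 \<longleftrightarrow> a = (%_. 0)" by (rule nm_eq_0[OF a])
 show "nm (mu (st a) a) = (nm a)\<^sup>2" by (rule nm_cstar[OF a])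
 show "st (st a) = a" by (rule st_st)
 show "(%p. 0 + a p) = a" "(%p. 1 * a p) = a" by simp_all
 note aM = Car_bd[OF a]
 { fix c
  show "(%p. c * a p) \<in> Car I" by (rule Car_smult[OF a])
  show "st (%p. c * a p) = (%p. cnj c * st a p)" by (rule ix_ext) simp
  show "nm (%p. c * a p) = cmod c * nm a" by (rule nm_smult[OF a])
  fix d
  show "(%p. (c + d) * a p) = (%p. c * a p + d * a p)" "(%p. c * (d * a p)) = (%p. c * d * a p)" by (simp_all add: algebra_simps) }
 fix b assume b: "b \<in> Car I"
 note bM = Car_bd[OF b]
 show "(%p. a p + b p) \<in> Car I" "mu a b \<in> Car I" by (rule Car_add[OF a b], rule Car_mu[OF a b])
 show "(%p. a p + b p) = (%p. b p + a p)" by (simp add: add.commute)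
 show "st (%p. a p + b p) = (%p. st a p + st b p)" by (rule ix_ext) simp
 show "st (mu a b) = mu (st b) (st a)" by (rule st_mu[OF aM bM])
 show "nm (%p. a p + b p) <= nm a + nm b" by (rule nm_le[OF bd_add[OF aM bM]])
 show "nm (mu a b) <= nm a * nm b" by (rule nm_le[OF bd_mu[OF aM bM]])
 { fix c
  show "(%p. c * (a p + b p)) = (%p. c * a p + c * b p)" by (simp add: algebra_simps)
  show "mu (%p. c * a p) b = (%p. c * mu a b p)" "mu a (%p. c * b p) = (%p. c * mu a b p)"
   by (rule ix_ext, simp add: ix_mu suminf_mult[OF mu_summable[OF aM bM], symmetric] mult_ac)+ }
 fix c assume c: "c \<in> Car I"
 note cM = Car_bd[OF c]
 show "(%p. a p + b p + c p) = (%p. a p + (b p + c p))" by (simp add: add.assoc)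
 show "mu (mu a b) c = mu a (mu b c)" by (rule mu_assoc[OF aM bM cM])
 show "mu a (%p. b p + c p) = (%p. mu a b p + mu a c p)"
  by (rule ix_ext) (simp add: ix_mu suminf_add[OF mu_summable[OF aM bM] mu_summable[OF aM cM]] distrib_left)
 show "mu (%p. a p + b p) c = (%p. mu a c p + mu b c p)"
  by (rule ix_ext) (simp add: ix_mu suminf_add[OF mu_summable[OF aM cM] mu_summable[OF bM cM]] distrib_right)
next
 fix s :: "nat => nat => complex"
 assume "\<forall>n. s n \<in> Car I" "\<forall>\<epsilon>>0. \<exists>N. \<forall>m\<ge>N. \<forall>n\<ge>N. nm (%p. s m p + - 1 * s n p) < \<epsilon>"
 then show "\<exists>l\<in>Car I. \<forall>\<epsilon>>0. \<exists>N. \<forall>n\<ge>N. nm (%p. s n p + - 1 * l p) < \<epsilon>" by (intro nm_complete) auto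
qed

lemma ix_ca_sum: assumes "finite S" shows "ix (ca_sum (mat_alg I) f S) i j = (\<Sum>x\<in>S. ix (f x) i j)"
proof -
 have "ix (foldr (%x acc p. f x p + acc p) xs (%_. 0)) i j = (\<Sum>x\<leftarrow>xs. ix (f x) i j)" for xs by (induction xs) auto
 then show ?thesis using assms by (simp add: ca_sum_def sum_list_distinct_conv_sum_set)
qed

section \<open>A GNS construction\<close>

definition psd :: "(nat => nat => real) => bool" where
 "psd k \<longleftrightarrow> (\<forall>i j. k i j = k j i) & (\<forall>S v. finite S --> 0 <= (\<Sum>i\<in>S. \<Sum>j\<in>S. v i * v j * k i j))"

text \<open>The form at \<open>v + t * e_l\<close>, written as a quadratic polynomial in
  \<open>t\<close>.\<close>

lemma psd_add:
 assumes k: "psd k" and S: "finite S" and l: "l \<in> S"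
 shows "0 <= (\<Sum>i\<in>S. \<Sum>j\<in>S. v i * v j * k i j) + 2 * t * (\<Sum>i\<in>S. v i * k i l) + t\<^sup>2 * k l l"
proof -
 define d where "d = (%i. if i = l then t else 0)"
 have sy: "k i j = k j i" for i j using k by (simp add: psd_def)
 have d: "(\<Sum>i\<in>S. d i * f i) = t * f l" for f
 proof -
  have "(\<Sum>i\<in>S. d i * f i) = (\<Sum>i\<in>S. if i = l then t * f l else 0)" by (intro sum.cong) (auto simp: d_def)
  then show ?thesis using S l by simp
 qed
 have "0 <= (\<Sum>i\<in>S. \<Sum>j\<in>S. (v i + d i) * (v j + d j) * k i j)" using k S by (simp add: psd_def)
 also have "... = (\<Sum>i\<in>S. \<Sum>j\<in>S. v i * v j * k i j) + (\<Sum>i\<in>S. \<Sum>j\<in>S. d j * (v i * k i j)) + (\<Sum>i\<in>S. d i * (\<Sum>j\<in>S. v j * k i j)) + (\<Sum>i\<in>S. d i * (\<Sum>j\<in>S. d j * k i j))"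
  unfolding sum_distrib_left sum.distrib[symmetric] by (intro sum.cong refl) (simp add: algebra_simps)
 also have "... = (\<Sum>i\<in>S. \<Sum>j\<in>S. v i * v j * k i j) + (\<Sum>i\<in>S. t * (v i * k i l)) + t * (\<Sum>j\<in>S. v j * k l j) + t * (t * k l l)"
  unfolding d ..
 also have "(\<Sum>j\<in>S. v j * k l j) = (\<Sum>i\<in>S. v i * k i l)" by (simp add: sy[of l])
 finally show ?thesis by (simp add: sum_distrib_left[symmetric] power2_eq_square algebra_simps)
qed

lemma psd_diag: "psd k ==> 0 <= k l l"
 using psd_add[of k "{l}" l "%_. 0" 1] by simp

text \<open>With \<open>k l l = 0\<close> the form at \<open>e_j + t * e_l\<close> is affine in
  \<open>t\<close> and nonnegative, so its slope vanishes.\<close>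

lemma psd_zero: assumes k: "psd k" and z: "k l l = 0" shows "k l j = 0"
proof (rule ccontr)
 assume n: "k l j ~= 0"
 have s: "k j l = k l j" using k by (simp add: psd_def)
 have "l ~= j" using n z by auto
 have "0 <= k j j + 2 * t * k l j" for t
 proof -
  have "0 <= (\<Sum>i\<in>{l, j}. \<Sum>i'\<in>{l, j}. of_bool (i = j) * of_bool (i' = j) * k i i') + 2 * t * (\<Sum>i\<in>{l, j}. of_bool (i = j) * k i l) + t\<^sup>2 * k l l"
   by (rule psd_add[OF k]) auto
  then show ?thesis using z \<open>l ~= j\<close> s by simp
 qed
 from this[of "- (k j j + 1) / (2 * k l j)"] show False using n by (simp add: field_simps)
qed

text \<open>Elimination of index \<open>l\<close>. For \<open>k l l = 0\<close> the quotient is 0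
  and the kernel is left unchanged, which is right since row \<open>l\<close> vanishes by
  \<open>psd_zero\<close>.\<close>

definition schur :: "nat => (nat => nat => real) => nat => nat => real" where
 "schur l k i j = k i j - k i l * k l j / k l l"

lemma psd_schur: assumes k: "psd k" shows "psd (schur l k)"
proof (cases "k l l = 0")
 case True then show ?thesis using k by (simp add: psd_def schur_def)
next
 case False
 have sy: "k i j = k j i" for i j using k by (simp add: psd_def)
 have p: "0 < k l l" using False psd_diag[OF k, of l] by simp
 have "0 <= (\<Sum>i\<in>S. \<Sum>j\<in>S. v i * v j * (k i j - k i l * k l j / k l l))" if S: "finite S" for S v
 proof -
  define w where "w i = (if i \<in> S then v i else 0)" for i
  have w: "(\<Sum>i\<in>insert l S. w i * f i) = (\<Sum>i\<in>S. v i * f i)" for f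
  proof -
   have "(\<Sum>i\<in>insert l S. w i * f i) = (\<Sum>i\<in>S. w i * f i)" using S by (intro sum.mono_neutral_right) (auto simp: w_def)
   then show ?thesis by (simp add: w_def)
  qed
  have ww: "(\<Sum>i\<in>insert l S. \<Sum>j\<in>insert l S. w i * w j * k i j) = (\<Sum>i\<in>S. \<Sum>j\<in>S. v i * v j * k i j)"
   by (simp only: mult.assoc sum_distrib_left[symmetric] w)
  let ?s = "\<Sum>i\<in>S. v i * k i l"
  have "0 <= (\<Sum>i\<in>S. \<Sum>j\<in>S. v i * v j * k i j) + 2 * (- ?s / k l l) * ?s + (- ?s / k l l)\<^sup>2 * k l l"
   using psd_add[OF k, of "insert l S" l w "- ?s / k l l"] S unfolding ww w by simp
  also have "... = (\<Sum>i\<in>S. \<Sum>j\<in>S. v i * v j * k i j) - ?s * ?s / k l l" using p by (simp add: power2_eq_square field_simps)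
  also have "?s * ?s = (\<Sum>i\<in>S. \<Sum>j\<in>S. (v i * k i l) * (v j * k l j))" unfolding sum_product by (simp add: sy[of l])
  also have "(\<Sum>i\<in>S. \<Sum>j\<in>S. v i * v j * k i j) - (\<Sum>i\<in>S. \<Sum>j\<in>S. (v i * k i l) * (v j * k l j)) / k l l = (\<Sum>i\<in>S. \<Sum>j\<in>S. v i * v j * (k i j - k i l * k l j / k l l))"
   unfolding sum_divide_distrib sum_subtractf[symmetric] by (intro sum.cong refl) (simp add: algebra_simps)
  finally show ?thesis .
 qed
 moreover have "k i j - k i l * k l j / k l l = k j i - k j l * k l i / k l l" for i j by (simp add: sy[of i] sy[of l j])
 ultimately show ?thesis by (simp add: psd_def schur_def)
qed

primrec ker :: "(nat => nat => real) => nat => nat => nat => real" where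
 "ker k 0 = k"
| "ker k (Suc l) = schur l (ker k l)"

lemma psd_ker: "psd k ==> psd (ker k l)" by (induction l) (auto intro: psd_schur)

lemma ker_vanish: assumes k: "psd k" shows "i < l ==> ker k l i j = 0"
proof (induction l arbitrary: i j)
 case (Suc l)
 show ?case
 proof (cases "i = l")
  case True
  then show ?thesis using psd_zero[OF psd_ker[OF k], of l l j] by (cases "ker k l l l = 0") (auto simp: schur_def)
 next
  case False then show ?thesis using Suc by (simp add: schur_def)
 qed
qed simp

text \<open>Gram-Schmidt for the vectors behind the kernel: \<open>r l i\<close> is the coordinate
  \<open>l\<close> of vector \<open>i\<close>, \<open>J\<close> collects the nonzero pivots, and
  \<open>c m\<close> writes the orthonormal vector \<open>m\<close> in terms of the vectors up to
  \<open>m\<close>.\<close>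

lemma cholesky:
 assumes k: "psd k"
 obtains r c :: "nat => nat => real" and J where "!!i j n. i < n ==> k i j = (\<Sum>l<n. r l i * r l j)"
  "!!m l. m \<in> J ==> (\<Sum>i\<le>m. c m i * r l i) = of_bool (l = m)" "!!l i. l ~: J ==> r l i = 0" "!!l i. i < l ==> r l i = 0" "k 0 0 ~= 0 ==> 0 \<in> J"
proof -
 define r where "r l i = ker k l l i / sqrt (ker k l l l)" for l i
 define J where "J = {l. ker k l l l ~= 0}"
 have sy: "ker k l i j = ker k l j i" for l i j using psd_ker[OF k] by (simp add: psd_def)
 have step: "ker k l i j = ker k (Suc l) i j + r l i * r l j" for l i j
 proof -
  have "r l i * r l j = (ker k l l i * ker k l l j) / (sqrt (ker k l l l) * sqrt (ker k l l l))" by (simp add: r_def)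
  also have "sqrt (ker k l l l) * sqrt (ker k l l l) = ker k l l l" using psd_diag[OF psd_ker[OF k]] by simp
  finally show ?thesis by (simp add: sy[of l i l] schur_def)
 qed
 have 1: "k i j = (\<Sum>l<n. r l i * r l j)" if "i < n" for i j n
 proof -
  have "k i j = (\<Sum>l<n. r l i * r l j) + ker k n i j" for n
  proof (induction n)
   case (Suc n) show ?case unfolding sum.lessThan_Suc using Suc step[of n i j] by linarith
  qed simp
  from this[of n] show ?thesis using ker_vanish[OF k that] by simp
 qed
 have 3: "r l i = 0" if "l ~: J" for l i using that by (simp add: r_def J_def)
 have 4: "r l i = 0" if "i < l" for l i using ker_vanish[OF k that, of l] sy[of l i l] by (simp add: r_def)
 have "\<exists>c. \<forall>l. (\<Sum>i\<le>m. c i * r l i) = of_bool (l = m)" if "m \<in> J" for m using that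
 proof (induction m rule: less_induct)
  case (less m)
  then have "\<forall>l. \<exists>c. l < m & l \<in> J --> (\<forall>t. (\<Sum>i\<le>l. c i * r t i) = of_bool (t = l))" by metis
  then obtain cc where cc: "!!l t. l < m ==> l \<in> J ==> (\<Sum>i\<le>l. cc l i * r t i) = of_bool (t = l)" by metis
  have rm: "r m m ~= 0" using less.prems by (simp add: r_def J_def)
  let ?L = "J Int {..<m}"
  \<comment> \<open>From vector \<open>m\<close> its components along the earlier orthonormal
    vectors are subtracted, and the rest is divided by the pivot.\<close>
  define c where "c i = (of_bool (i = m) - (\<Sum>l\<in>?L. r l m * (if i <= l then cc l i else 0))) / r m m" for i
  have "(\<Sum>i\<le>m. c i * r t i) = of_bool (t = m)" for t
  proof -
   have a: "(\<Sum>i\<le>m. of_bool (i = m) * r t i) = r t m"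
   proof -
    have "(\<Sum>i\<le>m. of_bool (i = m) * r t i) = (\<Sum>i\<le>m. if i = m then r t m else 0)" by (intro sum.cong) auto
    then show ?thesis by simp
   qed
   have "(\<Sum>i\<le>m. (\<Sum>l\<in>?L. r l m * (if i <= l then cc l i else 0)) * r t i) = (\<Sum>l\<in>?L. r l m * (\<Sum>i\<le>m. (if i <= l then cc l i else 0) * r t i))"
    unfolding sum_distrib_right sum_distrib_left by (subst sum.swap) (simp only: mult.assoc)
   also have "... = (\<Sum>l\<in>?L. if l = t then r t m else 0)"
   proof (rule sum.cong[OF refl])
    fix l assume l: "l \<in> ?L"
    have "(\<Sum>i\<le>m. (if i <= l then cc l i else 0) * r t i) = (\<Sum>i\<le>m. if i \<in> {..l} then cc l i * r t i else 0)" by (intro sum.cong) auto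
    also have "... = (\<Sum>i\<in>{..m} Int {..l}. cc l i * r t i)" by (rule sum.inter_restrict[symmetric]) simp
    also have "{..m} Int {..l} = {..l}" using l by auto
    finally show "r l m * (\<Sum>i\<le>m. (if i <= l then cc l i else 0) * r t i) = (if l = t then r t m else 0)" using cc[of l t] l by auto
   qed
   also have "... = (if t \<in> ?L then r t m else 0)" by simp
   finally have b: "(\<Sum>i\<le>m. (\<Sum>l\<in>?L. r l m * (if i <= l then cc l i else 0)) * r t i) = (if t \<in> ?L then r t m else 0)" .
   have "(\<Sum>i\<le>m. c i * r t i) = ((\<Sum>i\<le>m. of_bool (i = m) * r t i) - (\<Sum>i\<le>m. (\<Sum>l\<in>?L. r l m * (if i <= l then cc l i else 0)) * r t i)) / r m m"
    unfolding c_def sum_subtractf[symmetric] sum_divide_distrib by (intro sum.cong refl) (simp only: left_diff_distrib times_divide_eq_left diff_divide_distrib)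
   also have "... = (r t m - (if t \<in> ?L then r t m else 0)) / r m m" unfolding a b ..
   also have "... = of_bool (t = m)" using rm 3[of t m] 4[of m t] by (cases "t = m"; cases "t < m") auto
   finally show ?thesis .
  qed
  then show ?case by blast
 qed
 then obtain c where "!!m l. m \<in> J ==> (\<Sum>i\<le>m. c m i * r l i) = of_bool (l = m)" by metis
 moreover have "0 \<in> J" if "k 0 0 ~= 0" using that by (simp add: J_def)
 ultimately show thesis using that[of r J c] 1 3 4 by blast
qed

text \<open>\<open>k\<close> is the inner product of numbered words and \<open>\<tau> g h\<close>
  puts a letter in front. In the basis from \<open>cholesky\<close> this becomes a matrix. The
  hypotheses say nothing about boundedness; it follows from \<open>proj_bd\<close>, since the
  matrices are symmetric, idempotent and have finite columns.\<close>

theorem gns: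
 fixes k :: "nat => nat => real" and \<tau> :: "nat => nat => nat => nat"
 assumes k: "psd k" and k0: "k 0 0 ~= 0" and finG: "finite (verts G)" and finH: "finite (verts H)"
  and sa: "!!g h i j. g \<in> verts G ==> h \<in> verts H ==> k (\<tau> g h i) j = k i (\<tau> g h j)"
  and idem: "!!g h i j. g \<in> verts G ==> h \<in> verts H ==> k i (\<tau> g h (\<tau> g h j)) = k i (\<tau> g h j)"
  and sumH: "!!g i j. g \<in> verts G ==> (\<Sum>h\<in>verts H. k i (\<tau> g h j)) = k i j"
  and sumG: "!!h i j. h \<in> verts H ==> (\<Sum>g\<in>verts G. k i (\<tau> g h j)) = k i j"
  and orth: "!!g h g' h' i j. g \<in> verts G ==> g' \<in> verts G ==> h \<in> verts H ==> h' \<in> verts H ==> rel G g g' ~= rel H h h' ==> k i (\<tau> g h (\<tau> g' h' j)) = 0"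
 shows "quantum_isomorphic G H"
proof -
 obtain r c J where kr: "!!i j n. i < n ==> k i j = (\<Sum>l<n. r l i * r l j)"
  and cr: "!!m l. m \<in> J ==> (\<Sum>i\<le>m. c m i * r l i) = of_bool (l = m)"
  and rJ: "!!l i. l ~: J ==> r l i = 0" and r0: "!!l i. i < l ==> r l i = 0" and J0: "k 0 0 ~= 0 ==> 0 \<in> J"
  by (rule cholesky[OF k]) blast
 have sy: "k i j = k j i" for i j using k by (simp add: psd_def)
 have ck: "(\<Sum>i\<le>l. c l i * k i x) = r l x" if l: "l \<in> J" for l x
 proof -
  have "(\<Sum>i\<le>l. c l i * k i x) = (\<Sum>i\<le>l. \<Sum>t<Suc l. c l i * r t i * r t x)"
   using kr[of _ "Suc l" x] by (intro sum.cong refl) (simp add: sum_distrib_left mult.assoc del: sum.lessThan_Suc)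
  also have "... = (\<Sum>t<Suc l. (\<Sum>i\<le>l. c l i * r t i) * r t x)" unfolding sum_distrib_right by (rule sum.swap)
  also have "... = (\<Sum>t<Suc l. if t = l then r l x else 0)" using cr[OF l] by (intro sum.cong) auto
  finally show ?thesis by simp
 qed
 \<comment> \<open>Coordinate \<open>l\<close> of the image of the orthonormal vector
   \<open>m\<close> under the letter \<open>(g, h)\<close>.\<close>
 define U where "U g h l m = (if m \<in> J then \<Sum>j\<le>m. c m j * r l (\<tau> g h j) else 0)" for g h l m
 have UJ: "U g h l m = 0" if "l ~: J \<or> m ~: J" for g h l m using that rJ by (auto simp: U_def)
 have Uk: "U g h l m = (\<Sum>i\<le>l. \<Sum>j\<le>m. c l i * c m j * k i (\<tau> g h j))" if "l \<in> J" "m \<in> J" for g h l m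
 proof -
  have "U g h l m = (\<Sum>j\<le>m. c m j * (\<Sum>i\<le>l. c l i * k i (\<tau> g h j)))" using that ck by (simp add: U_def)
  also have "... = (\<Sum>j\<le>m. \<Sum>i\<le>l. c l i * c m j * k i (\<tau> g h j))" by (simp add: sum_distrib_left mult_ac)
  finally show ?thesis by (subst sum.swap)
 qed
 have Us: "U g h l m = U g h m l" if gh: "g \<in> verts G" "h \<in> verts H" for g h l m
 proof (cases "l \<in> J & m \<in> J")
  case True
  have "k i (\<tau> g h j) = k j (\<tau> g h i)" for i j using sa[OF gh, of i j] sy[of j "\<tau> g h i"] by simp
  then have "(\<Sum>i\<le>l. \<Sum>j\<le>m. c l i * c m j * k i (\<tau> g h j)) = (\<Sum>i\<le>l. \<Sum>j\<le>m. c m j * c l i * k j (\<tau> g h i))" by (intro sum.cong refl) simp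
  also have "... = (\<Sum>j\<le>m. \<Sum>i\<le>l. c m j * c l i * k j (\<tau> g h i))" by (rule sum.swap)
  finally show ?thesis using Uk True by simp
 next
  case False then show ?thesis using UJ by auto
 qed
 \<comment> \<open>Vector \<open>j\<close> has no coordinates beyond \<open>j\<close>, so every
   column is finite.\<close>
 have Uf: "\<exists>K. \<forall>t\<ge>K. U g h t m = 0" for g h m
 proof (intro exI[of _ "Suc (\<Sum>j\<le>m. \<tau> g h j)"] allI impI)
  fix t assume t: "Suc (\<Sum>j\<le>m. \<tau> g h j) <= t"
  have "r t (\<tau> g h j) = 0" if "j <= m" for j
   using t member_le_sum[of j "{..m}" "\<tau> g h"] that by (intro r0) simp
  then show "U g h t m = 0" by (simp add: U_def)
 qed
 \<comment> \<open>Summing over the coordinates \<open>t\<close> gives the kernel of the two images,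
   and \<open>sa\<close> moves the first letter across. The bound \<open>K'\<close> is large enough
   for \<open>kr\<close> to be exact.\<close>
 have UU: "(\<Sum>t<K. U g h l t * U g' h' t m) = (if l \<in> J & m \<in> J then \<Sum>i\<le>l. \<Sum>j\<le>m. c l i * c m j * k i (\<tau> g h (\<tau> g' h' j)) else 0)"
  if gh: "g \<in> verts G" "h \<in> verts H" and K: "!!t. K <= t ==> U g' h' t m = 0" for g h g' h' l m K
 proof (cases "l \<in> J & m \<in> J")
  case True
  define K' where "K' = K + Suc (\<Sum>i\<le>l. \<tau> g h i)"
  have K': "\<tau> g h i < K'" if "i <= l" for i using that member_le_sum[of i "{..l}" "\<tau> g h"] by (simp add: K'_def)
  have "(\<Sum>t<K. U g h l t * U g' h' t m) = (\<Sum>t<K'. U g h l t * U g' h' t m)"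
   using K by (intro sum.mono_neutral_left) (auto simp: K'_def)
  also have "... = (\<Sum>t<K'. (\<Sum>i\<le>l. c l i * r t (\<tau> g h i)) * (\<Sum>j\<le>m. c m j * r t (\<tau> g' h' j)))"
   using True by (intro sum.cong refl) (simp add: Us[OF gh, of l], simp add: U_def)
  also have "... = (\<Sum>t<K'. \<Sum>i\<le>l. \<Sum>j\<le>m. c l i * c m j * (r t (\<tau> g h i) * r t (\<tau> g' h' j)))"
   unfolding sum_product by (intro sum.cong refl) (simp only: mult_ac)
  also have "... = (\<Sum>i\<le>l. \<Sum>t<K'. \<Sum>j\<le>m. c l i * c m j * (r t (\<tau> g h i) * r t (\<tau> g' h' j)))" by (rule sum.swap)
  also have "... = (\<Sum>i\<le>l. \<Sum>j\<le>m. \<Sum>t<K'. c l i * c m j * (r t (\<tau> g h i) * r t (\<tau> g' h' j)))" by (intro sum.cong refl sum.swap)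
  also have "... = (\<Sum>i\<le>l. \<Sum>j\<le>m. c l i * c m j * k (\<tau> g h i) (\<tau> g' h' j))"
   using kr[OF K'] by (intro sum.cong refl) (simp add: sum_distrib_left[symmetric])
  finally show ?thesis using True sa[OF gh] by simp
 next
  case False then show ?thesis using UJ by (auto intro!: sum.neutral)
 qed
 define u where "u g h = mk (%l m. complex_of_real (U g h l m))" for g h
 have mu_u: "ix (mu (u g h) (u g' h')) l m = complex_of_real (if l \<in> J & m \<in> J then \<Sum>i\<le>l. \<Sum>j\<le>m. c l i * c m j * k i (\<tau> g h (\<tau> g' h' j)) else 0)"
  if gh: "g \<in> verts G" "h \<in> verts H" for g h g' h' l m
 proof -
  obtain K where K: "!!t. K <= t ==> U g' h' t m = 0" using Uf by blast
  have "ix (mu (u g h) (u g' h')) l m = (\<Sum>t<K. complex_of_real (U g h l t) * complex_of_real (U g' h' t m))"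
   unfolding ix_mu u_def ix_mk by (rule suminf_finite) (use K in auto)
  also have "... = complex_of_real (\<Sum>t<K. U g h l t * U g' h' t m)" by simp
  also have "(\<Sum>t<K. U g h l t * U g' h' t m) = (if l \<in> J & m \<in> J then \<Sum>i\<le>l. \<Sum>j\<le>m. c l i * c m j * k i (\<tau> g h (\<tau> g' h' j)) else 0)"
   by (rule UU[OF gh K])
  finally show ?thesis .
 qed
 have st_u: "st (u g h) = u g h" if "g \<in> verts G" "h \<in> verts H" for g h
  by (rule ix_ext) (simp add: u_def Us[OF that])
 have Ui: "U g h l m = (if l \<in> J & m \<in> J then \<Sum>i\<le>l. \<Sum>j\<le>m. c l i * c m j * k i (\<tau> g h (\<tau> g h j)) else 0)" if "g \<in> verts G" "h \<in> verts H" for g h l m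
  using Uk[of l m g h] UJ[of l m g h] idem[OF that] by auto
 have pu: "ca_proj (mat_alg J) (u g h)" if gh: "g \<in> verts G" "h \<in> verts H" for g h
 proof -
  have "bd 1 (u g h)"
  proof (rule proj_bd[OF st_u[OF gh]])
   show "\<exists>K. \<forall>i\<ge>K. ix (u g h) i j = 0" for j using Uf[of g h j] by (simp add: u_def)
   show "(\<Sum>i<K. ix (u g h) l i * ix (u g h) i j) = ix (u g h) l j" if K: "!!i. K <= i ==> ix (u g h) i j = 0" for l j K
   proof -
    have z: "U g h t j = 0" if "K <= t" for t using K[OF that] by (simp add: u_def)
    have "(\<Sum>t<K. U g h l t * U g h t j) = U g h l j" unfolding Ui[OF gh, of l j] by (rule UU[OF gh z])
    from arg_cong[OF this, of complex_of_real] show ?thesis by (simp add: u_def)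
   qed
  qed
  then have "u g h \<in> Car J" by (rule CarI) (simp add: u_def UJ)
  moreover have "mu (u g h) (u g h) = u g h" by (rule ix_ext) (simp only: mu_u[OF gh], simp add: u_def Ui[OF gh])
  ultimately show ?thesis using st_u[OF gh] by (simp add: ca_proj_def)
 qed
 have rsum: "(\<Sum>x\<in>X. U (f x) (f' x) l m) = of_bool (l = m & l \<in> J)"
  if X: "!!i j. (\<Sum>x\<in>X. k i (\<tau> (f x) (f' x) j)) = k i j" for X :: "nat set" and f f' l m
 proof (cases "l \<in> J & m \<in> J")
  case True
  have rr: "(\<Sum>x\<in>X. r l (\<tau> (f x) (f' x) j)) = r l j" for j
  proof -
   have "(\<Sum>x\<in>X. r l (\<tau> (f x) (f' x) j)) = (\<Sum>x\<in>X. \<Sum>i\<le>l. c l i * k i (\<tau> (f x) (f' x) j))" using ck True by simp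
   also have "... = (\<Sum>i\<le>l. \<Sum>x\<in>X. c l i * k i (\<tau> (f x) (f' x) j))" by (rule sum.swap)
   also have "... = r l j" using ck True X by (simp add: sum_distrib_left[symmetric])
   finally show ?thesis .
  qed
  have "(\<Sum>x\<in>X. U (f x) (f' x) l m) = (\<Sum>x\<in>X. \<Sum>j\<le>m. c m j * r l (\<tau> (f x) (f' x) j))" using True by (simp add: U_def)
  also have "... = (\<Sum>j\<le>m. \<Sum>x\<in>X. c m j * r l (\<tau> (f x) (f' x) j))" by (rule sum.swap)
  also have "... = (\<Sum>j\<le>m. c m j * r l j)" using rr by (simp add: sum_distrib_left[symmetric])
  finally show ?thesis using cr[of m l] True by simp
 next
  case False then show ?thesis using UJ by (auto intro!: sum.neutral)
 qed
 have sH: "(\<Sum>h\<in>verts H. U g h l m) = of_bool (l = m & l \<in> J)" if "g \<in> verts G" for g l m by (rule rsum[OF sumH[OF that]])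
 have sG: "(\<Sum>g\<in>verts G. U g h l m) = of_bool (l = m & l \<in> J)" if "h \<in> verts H" for h l m by (rule rsum[OF sumG[OF that]])
 have "qiso_in (mat_alg J) G H" unfolding qiso_in_def
 proof (intro conjI exI[of _ u] ballI impI)
  show "unital_cstar (mat_alg J)" using unital_mat_alg J0[OF k0] by blast
  show "ca_proj (mat_alg J) (u g h)" if "g \<in> verts G" "h \<in> verts H" for g h by (rule pu[OF that])
  show "ca_sum (mat_alg J) (%h. u g h) (verts H) = ca_one (mat_alg J)" if "g \<in> verts G" for g
   using sH[OF that] by (intro ix_ext) (auto simp: ix_ca_sum[OF finH] u_def ident_def of_real_sum[symmetric] simp del: of_real_sum)
  show "ca_sum (mat_alg J) (%g. u g h) (verts G) = ca_one (mat_alg J)" if "h \<in> verts H" for h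
   using sG[OF that] by (intro ix_ext) (auto simp: ix_ca_sum[OF finG] u_def ident_def of_real_sum[symmetric] simp del: of_real_sum)
  show "ca_mult (mat_alg J) (u g h) (u g' h') = ca_zero (mat_alg J)"
   if "g \<in> verts G" "g' \<in> verts G" "h \<in> verts H" "h' \<in> verts H" "rel G g g' ~= rel H h h'" for g g' h h'
   using orth[OF that] by (intro ix_ext) (simp add: mu_u[OF that(1,3)])
 qed
 then show ?thesis unfolding quantum_isomorphic_def by blast
qed

section \<open>Quantum isomorphism\<close>

context graph_pair
begin

text \<open>The value of the state at a product of generators. Words with letters outside the vertex
  sets get 0; they occur because words are enumerated by all numbers.\<close>

definition phi :: "(nat \<times> nat) list => real" where
 "phi w = (if set w \<subseteq> verts G \<times> verts H then P (length w) (map fst w) (map snd w) else 0)"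

lemma word_tuples: "set w \<subseteq> verts G \<times> verts H ==> map fst w \<in> tuples G (length w) & map snd w \<in> tuples H (length w)"
 by (auto simp: tuples_def)

lemma phi_rev: "phi (rev w) = phi w"
 using P_rev[of "map fst w" "length w" "map snd w"] word_tuples[of w] by (simp add: phi_def rev_map)

lemma phi_Nil: "phi [] = 1" by (simp add: phi_def P_0)

lemma phi_sumH: assumes g: "g \<in> verts G" shows "(\<Sum>h\<in>verts H. phi (u @ (g, h) # v)) = phi (u @ v)"
proof (cases "set (u @ v) \<subseteq> verts G \<times> verts H")
 case True
 let ?x = "map fst u @ g # map fst v" and ?y = "map snd u @ map snd v"
 have "(\<Sum>h\<in>verts H. phi (u @ (g, h) # v)) = (\<Sum>h\<in>verts H. P (Suc (length u + length v)) ?x (ins (length u) h ?y))"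
  using True g by (intro sum.cong refl) (simp add: phi_def ins_append)
 also have "... = P (length u + length v) (del (length u) ?x) ?y"
  by (rule P_ins[symmetric]) (use True g in \<open>auto simp: tuples_def\<close>)
 also have "... = phi (u @ v)" using True by (simp add: phi_def del_append)
 finally show ?thesis .
next
 case False
 then have "phi (u @ (g, h) # v) = 0" for h by (auto simp: phi_def)
 moreover have "phi (u @ v) = 0" using False by (simp only: phi_def if_False)
 ultimately show ?thesis by simp
qed

lemma phi_sumG: assumes h: "h \<in> verts H" shows "(\<Sum>g\<in>verts G. phi (u @ (g, h) # v)) = phi (u @ v)"
proof (cases "set (u @ v) \<subseteq> verts G \<times> verts H")
 case True
 let ?x = "map fst u @ map fst v" and ?y = "map snd u @ h # map snd v"
 have "(\<Sum>g\<in>verts G. phi (u @ (g, h) # v)) = (\<Sum>g\<in>verts G. P (Suc (length u + length v)) (ins (length u) g ?x) ?y)"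
  using True h by (intro sum.cong refl) (simp add: phi_def ins_append)
 also have "... = P (length u + length v) ?x (del (length u) ?y)"
  by (rule P_sum) (use True h in \<open>auto simp: tuples_def\<close>)
 also have "... = phi (u @ v)" using True by (simp add: phi_def del_append)
 finally show ?thesis .
next
 case False
 then have "phi (u @ (g, h) # v) = 0" for g by (auto simp: phi_def)
 moreover have "phi (u @ v) = 0" using False by (simp only: phi_def if_False)
 ultimately show ?thesis by simp
qed

text \<open>\<open>P_D\<close> and \<open>P_A\<close> carry the indicators of equality and adjacency
  from \<open>G\<close> to \<open>H\<close>. Where \<open>phi\<close> is nonzero they must agree,
  and together they determine \<open>rel\<close>.\<close>

lemma phi_rel: assumes r: "rel G g g' ~= rel H h h'" shows "phi (u @ (g, h) # (g', h') # v) = 0"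
proof (cases "set (u @ (g, h) # (g', h') # v) \<subseteq> verts G \<times> verts H")
 case True
 let ?w = "u @ (g, h) # (g', h') # v"
 note t = word_tuples[OF True]
 have n: "map fst ?w ! length u = g" "map fst ?w ! Suc (length u) = g'" "map snd ?w ! length u = h" "map snd ?w ! Suc (length u) = h'"
  by (auto simp: nth_append)
 have w: "phi ?w = P (length ?w) (map fst ?w) (map snd ?w)" using True by (simp only: phi_def if_True)
 have l: "Suc (length u) < length ?w" by simp
 have D: "of_bool (g = g') * phi ?w = of_bool (h = h') * phi ?w"
  using P_D[OF l conjunct1[OF t] conjunct2[OF t]] unfolding n w .
 have A: "of_bool (adj G g g') * phi ?w = of_bool (adj H h h') * phi ?w"
  using P_A[OF l conjunct1[OF t] conjunct2[OF t]] unfolding n w .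
 show ?thesis
 proof (rule ccontr)
  assume "phi ?w ~= 0"
  then have c: "X = Y" if "of_bool X * phi ?w = of_bool Y * phi ?w" for X Y using that by (cases X; cases Y) simp_all
  have "rel G g g' = rel H h h'" unfolding rel_def c[OF D] c[OF A] ..
  then show False using r by simp
 qed
next
 case False then show ?thesis by (simp only: phi_def if_False)
qed

text \<open>Insert the unit as the sum of all letters \<open>(g, a)\<close> in front of
  \<open>(g, h)\<close>; by \<open>phi_rel\<close> only \<open>a = h\<close> survives.\<close>

lemma phi_idem: assumes "g \<in> verts G" "h \<in> verts H" shows "phi (u @ (g, h) # (g, h) # v) = phi (u @ (g, h) # v)"
proof -
 have "phi (u @ (g, h) # v) = (\<Sum>a\<in>verts H. phi (u @ (g, a) # (g, h) # v))" by (rule phi_sumH[OF assms(1), symmetric])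
 also have "... = (\<Sum>a\<in>verts H. if a = h then phi (u @ (g, h) # (g, h) # v) else 0)"
  using phi_rel[of g g _ h u v] by (intro sum.cong refl) (auto simp: rel_def)
 finally show ?thesis using assms(2) finH by simp
qed

definition words :: "nat => (nat \<times> nat) list set" where
 "words n = {w. set w \<subseteq> verts G \<times> verts H & length w = n}"

lemma finite_words: "finite (words n)"
 unfolding words_def by (rule finite_lists_length_eq) (simp add: finG finH)

lemma phi_psd_words: "0 <= (\<Sum>w\<in>words n. v w * (\<Sum>w'\<in>words n. v w' * phi (rev w @ w')))"
proof -
 let ?X = "tuples G n \<times> tuples H n" and ?z = "%p. zip (fst p) (snd p)"
 have b: "bij_betw ?z ?X (words n)"
 proof (rule bij_betwI[where g = "%w. (map fst w, map snd w)"])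
  show "?z \<in> ?X \<rightarrow> words n" by (auto simp: words_def tuples_def subset_iff dest: set_zip_leftD set_zip_rightD)
  show "(%w. (map fst w, map snd w)) \<in> words n \<rightarrow> ?X" using word_tuples by (auto simp: words_def)
  show "(%w. (map fst w, map snd w)) (?z p) = p" if "p \<in> ?X" for p using that by (auto simp: tuples_def)
 qed (simp add: zip_map_fst_snd)
 have p: "phi (rev (?z p) @ ?z q) = P (n + n) (rev (fst p) @ fst q) (rev (snd p) @ snd q)" if "p \<in> ?X" "q \<in> ?X" for p q
 proof -
  have "?z p \<in> words n" "?z q \<in> words n" using b that by (auto simp: bij_betw_def)
  moreover have "map fst (?z p) = fst p" "map snd (?z p) = snd p" "map fst (?z q) = fst q" "map snd (?z q) = snd q"
   using that by (auto simp: tuples_def)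
  ultimately show ?thesis by (simp add: phi_def words_def rev_map[symmetric])
 qed
 have i: "(\<Sum>w'\<in>words n. v w' * phi (rev w @ w')) = (\<Sum>q\<in>?X. v (?z q) * phi (rev w @ ?z q))" for w
  by (rule sum.reindex_bij_betw[OF b, symmetric])
 have "(\<Sum>w\<in>words n. v w * (\<Sum>w'\<in>words n. v w' * phi (rev w @ w'))) = (\<Sum>p\<in>?X. v (?z p) * (\<Sum>q\<in>?X. v (?z q) * phi (rev (?z p) @ ?z q)))"
  unfolding i by (rule sum.reindex_bij_betw[OF b, symmetric])
 also have "... = (\<Sum>p\<in>?X. v (?z p) * (\<Sum>q\<in>?X. P (n + n) (rev (fst p) @ fst q) (rev (snd p) @ snd q) * v (?z q)))"
  by (rule sum.cong[OF refl], rule arg_cong2[where f = "(*)", OF refl], rule sum.cong[OF refl]) (simp only: p mult.commute)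
 also have "0 <= ..." by (rule P_psd)
 finally show ?thesis .
qed

text \<open>Factors that sum to the unit lengthen a word without changing its value; this reduces
  positivity to words of one length.\<close>

lemma phi_pad: assumes g: "g \<in> verts G" shows "phi u = (\<Sum>x\<in>tuples H d. phi (u @ zip (replicate d g) x))"
proof (induction d)
 case (Suc d)
 have "(\<Sum>x\<in>tuples H (Suc d). phi (u @ zip (replicate (Suc d) g) x)) = (\<Sum>x\<in>tuples H d. \<Sum>a\<in>verts H. phi (u @ zip (replicate (Suc d) g) (x @ [a])))"
  by (rule sum_tuples_Suc[OF finH])
 also have "... = (\<Sum>x\<in>tuples H d. \<Sum>a\<in>verts H. phi ((u @ zip (replicate d g) x) @ (g, a) # []))"
 proof (intro sum.cong refl)
  fix x a assume x: "x \<in> tuples H d"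
  have "zip (replicate (Suc d) g) (x @ [a]) = zip (replicate d g) x @ [(g, a)]"
   using tuples_length[OF x] by (simp add: replicate_append_same[symmetric] del: replicate_append_same replicate_Suc add: replicate_Suc)
  then show "phi (u @ zip (replicate (Suc d) g) (x @ [a])) = phi ((u @ zip (replicate d g) x) @ (g, a) # [])" by simp
 qed
 also have "... = (\<Sum>x\<in>tuples H d. phi ((u @ zip (replicate d g) x) @ []))" by (intro sum.cong refl phi_sumH[OF g])
 finally show ?case using Suc by simp
qed simp

lemma phi_pad2: assumes g: "g \<in> verts G"
 shows "phi (rev w @ w') = (\<Sum>x\<in>tuples H d. \<Sum>x'\<in>tuples H d'. phi (rev (w @ zip (replicate d g) x) @ (w' @ zip (replicate d' g) x')))"
proof -
 have "phi (rev w @ w') = (\<Sum>x'\<in>tuples H d'. phi (rev w @ w' @ zip (replicate d' g) x'))" using phi_pad[OF g, of "rev w @ w'" d'] by simp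
 also have "... = (\<Sum>x'\<in>tuples H d'. \<Sum>x\<in>tuples H d. phi (rev (w @ zip (replicate d g) x) @ (w' @ zip (replicate d' g) x')))"
 proof (rule sum.cong[OF refl])
  fix x'
  have "phi (rev w @ w' @ zip (replicate d' g) x') = phi (rev (w' @ zip (replicate d' g) x') @ w)" by (subst phi_rev[symmetric]) simp
  also have "... = (\<Sum>x\<in>tuples H d. phi (rev (w' @ zip (replicate d' g) x') @ w @ zip (replicate d g) x))"
   using phi_pad[OF g, of "rev (w' @ zip (replicate d' g) x') @ w" d] by simp
  also have "... = (\<Sum>x\<in>tuples H d. phi (rev (w @ zip (replicate d g) x) @ (w' @ zip (replicate d' g) x')))"
   by (rule sum.cong[OF refl], subst phi_rev[symmetric]) simp
  finally show "phi (rev w @ w' @ zip (replicate d' g) x') = (\<Sum>x\<in>tuples H d. phi (rev (w @ zip (replicate d g) x) @ (w' @ zip (replicate d' g) x')))" .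
 qed
 finally show ?thesis by (subst sum.swap)
qed

text \<open>All words are padded to a common length \<open>n\<close>, the coefficients being
  collected in \<open>V\<close>, so that \<open>phi_psd_words\<close> applies; words with foreign
  letters get weight 0. If \<open>G\<close> has no vertices there is no letter to pad with, but then
  only the empty word has a nonzero value.\<close>

lemma phi_psd:
 fixes wd :: "nat => (nat \<times> nat) list"
 assumes "finite S"
 shows "0 <= (\<Sum>i\<in>S. \<Sum>j\<in>S. v i * v j * phi (rev (wd i) @ wd j))"
proof (cases "verts G = {}")
 case True
 have "phi (rev w @ w') = of_bool (w = []) * of_bool (w' = [])" for w w' using True phi_Nil by (auto simp: phi_def)
 then have "(\<Sum>i\<in>S. \<Sum>j\<in>S. v i * v j * phi (rev (wd i) @ wd j)) = (\<Sum>i\<in>S. v i * of_bool (wd i = [])) * (\<Sum>j\<in>S. v j * of_bool (wd j = []))"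
  unfolding sum_product by (intro sum.cong refl) (simp only: mult_ac)
 then show ?thesis by simp
next
 case False
 then obtain g where g: "g \<in> verts G" by blast
 define n where "n = (\<Sum>i\<in>S. length (wd i))"
 define pad where "pad i x = wd i @ zip (replicate (n - length (wd i)) g) x" for i x
 define T where "T i = tuples H (n - length (wd i))" for i
 define v' where "v' i = (if set (wd i) \<subseteq> verts G \<times> verts H then v i else 0)" for i
 define V where "V z = (\<Sum>i\<in>S. \<Sum>x\<in>T i. v' i * of_bool (z = pad i x))" for z
 have ln: "length (wd i) <= n" if "i \<in> S" for i unfolding n_def using that assms by (intro member_le_sum) auto
 have V: "(\<Sum>z\<in>words n. V z * F z) = (\<Sum>i\<in>S. \<Sum>x\<in>T i. v' i * F (pad i x))" for F
 proof -
  have "(\<Sum>z\<in>words n. V z * F z) = (\<Sum>z\<in>words n. \<Sum>i\<in>S. \<Sum>x\<in>T i. v' i * of_bool (z = pad i x) * F z)" by (simp add: V_def sum_distrib_right)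
  also have "... = (\<Sum>i\<in>S. \<Sum>z\<in>words n. \<Sum>x\<in>T i. v' i * of_bool (z = pad i x) * F z)" by (rule sum.swap)
  also have "... = (\<Sum>i\<in>S. \<Sum>x\<in>T i. \<Sum>z\<in>words n. v' i * of_bool (z = pad i x) * F z)" by (intro sum.cong refl sum.swap)
  also have "... = (\<Sum>i\<in>S. \<Sum>x\<in>T i. v' i * F (pad i x))"
  proof (intro sum.cong refl)
   fix i x assume i: "i \<in> S" and x: "x \<in> T i"
   show "(\<Sum>z\<in>words n. v' i * of_bool (z = pad i x) * F z) = v' i * F (pad i x)"
   proof (cases "set (wd i) \<subseteq> verts G \<times> verts H")
    case True
    have "pad i x \<in> words n" using True x g ln[OF i] unfolding words_def pad_def T_def tuples_def
     by (auto dest: set_zip_leftD set_zip_rightD)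
    moreover have "(\<Sum>z\<in>words n. v' i * of_bool (z = pad i x) * F z) = (\<Sum>z\<in>words n. if z = pad i x then v' i * F (pad i x) else 0)"
     by (intro sum.cong refl) auto
    ultimately show ?thesis using finite_words by simp
   qed (simp add: v'_def)
  qed
  finally show ?thesis .
 qed
 have "v i * v j * phi (rev (wd i) @ wd j) = (\<Sum>x\<in>T i. v' i * (\<Sum>x'\<in>T j. v' j * phi (rev (pad i x) @ pad j x')))" for i j
 proof -
  have "v i * v j * phi (rev (wd i) @ wd j) = v' i * (v' j * phi (rev (wd i) @ wd j))" by (auto simp: v'_def phi_def)
  also have "... = (\<Sum>x\<in>T i. v' i * (\<Sum>x'\<in>T j. v' j * phi (rev (pad i x) @ pad j x')))"
   unfolding T_def pad_def by (subst phi_pad2[OF g]) (simp only: sum_distrib_left)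
  finally show ?thesis .
 qed
 then have "(\<Sum>i\<in>S. \<Sum>j\<in>S. v i * v j * phi (rev (wd i) @ wd j)) = (\<Sum>i\<in>S. \<Sum>j\<in>S. \<Sum>x\<in>T i. v' i * (\<Sum>x'\<in>T j. v' j * phi (rev (pad i x) @ pad j x')))" by simp
 also have "... = (\<Sum>i\<in>S. \<Sum>x\<in>T i. \<Sum>j\<in>S. v' i * (\<Sum>x'\<in>T j. v' j * phi (rev (pad i x) @ pad j x')))" by (intro sum.cong refl sum.swap)
 also have "... = (\<Sum>i\<in>S. \<Sum>x\<in>T i. v' i * (\<Sum>z'\<in>words n. V z' * phi (rev (pad i x) @ z')))"
  unfolding V by (simp only: sum_distrib_left)
 also have "... = (\<Sum>z\<in>words n. V z * (\<Sum>z'\<in>words n. V z' * phi (rev z @ z')))" unfolding V[of "%z. \<Sum>z'\<in>words n. V z' * phi (rev z @ z')"] ..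
 also have "0 <= ..." by (rule phi_psd_words)
 finally show ?thesis .
qed

theorem qiso: "quantum_isomorphic G H"
proof -
 \<comment> \<open>Every word has a number, the empty one being 0, and \<open>\<tau> g h\<close>
   computes the number of the word with \<open>(g, h)\<close> in front.\<close>
 define wd where "wd i = map prod_decode (list_decode i)" for i
 define k where "k i j = phi (rev (wd i) @ wd j)" for i j
 define \<tau> where "\<tau> g h i = list_encode (prod_encode (g, h) # list_decode i)" for g h i
 have w: "wd (\<tau> g h i) = (g, h) # wd i" for g h i by (simp add: wd_def \<tau>_def del: list_encode.simps)
 have 0: "wd 0 = []" by (simp add: wd_def)
 have "k i j = k j i" for i j unfolding k_def by (subst phi_rev[symmetric]) simp
 then have "psd k" using phi_psd[of _ _ wd] by (simp add: psd_def k_def)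
 then show ?thesis
 proof (rule gns[where \<tau> = \<tau>])
  show "k 0 0 ~= 0" by (simp add: k_def 0 phi_Nil)
  show "k (\<tau> g h i) j = k i (\<tau> g h j)" for g h i j by (simp add: k_def w)
  show "k i (\<tau> g h (\<tau> g h j)) = k i (\<tau> g h j)" if "g \<in> verts G" "h \<in> verts H" for g h i j by (simp add: k_def w phi_idem[OF that])
  show "(\<Sum>h\<in>verts H. k i (\<tau> g h j)) = k i j" if "g \<in> verts G" for g i j by (simp add: k_def w phi_sumH[OF that])
  show "(\<Sum>g\<in>verts G. k i (\<tau> g h j)) = k i j" if "h \<in> verts H" for h i j by (simp add: k_def w phi_sumG[OF that])
  show "k i (\<tau> g h (\<tau> g' h' j)) = 0" if "rel G g g' ~= rel H h h'" for g h g' h' i j by (simp add: k_def w phi_rel[OF that])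
 qed (rule finG, rule finH)
qed

end

lemma compl_compl: assumes "simple_graph G" shows "compl_graph (compl_graph G) = G"
proof -
 have "adj (compl_graph (compl_graph G)) u v = adj G u v" for u v
  using assms by (auto simp: compl_graph_def simple_graph_def wf_graph_def)
 then have "adj (compl_graph (compl_graph G)) = adj G" by blast
 then show ?thesis by (intro graph.equality) (simp_all add: compl_graph_def)
qed

lemma hom_prodg: assumes "simple_graph F" "wf_graph G" "wf_graph K" shows "hom F (prodg G K) = hom F G * hom F K"
proof -
 have "wf_graph F" using assms(1) by (simp add: simple_graph_def)
 then show ?thesis using homc_prodg[OF up_edges_sub[of F], of "{}" G K] by (simp add: hom_homc assms wf_prodg)
qed

theorem theorem25:
  fixes models :: "graph \<Rightarrow> 's \<Rightarrow> bool" and \<F> :: "graph set"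
  assumes "logic_on_graphs models"
    and "self_complementary models"
    and "\<forall>F\<in>\<F>. simple_graph F"
    and "\<forall>G H. simple_graph G \<longrightarrow> simple_graph H \<longrightarrow>
            (hom_indist \<F> G H \<longleftrightarrow> L_equiv models G H)"
    and "\<forall>k. \<exists>G H. simple_graph G \<and> simple_graph H \<and> C_equiv k G H \<and> \<not> L_equiv models G H"
  shows "\<forall>G H. simple_graph G \<longrightarrow> simple_graph H \<longrightarrow> L_equiv models G H \<longrightarrow>
            quantum_isomorphic G H"
proof (intro allI impI)
 fix G H assume G: "simple_graph G" and H: "simple_graph H" and L: "L_equiv models G H"
 \<comment> \<open>Stated by counts rather than by the logic: closure under products is then
   multiplicativity of \<open>hom\<close>, while closure under complements is imported from the
   logic.\<close>
 define R where "R A B \<longleftrightarrow> simple_graph A & simple_graph B & hom_indist \<F> A B" for A B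
 have wf: "wf_graph A" if "simple_graph A" for A using that by (simp add: simple_graph_def)
 interpret indist R
 proof
  show "simple_graph A & simple_graph B" if "R A B" for A B using that by (simp add: R_def)
  show "R (compl_graph A) (compl_graph B)" if AB: "R A B" for A B
  proof -
   have s: "simple_graph A" "simple_graph B" using AB by (auto simp: R_def)
   then have e: "L_equiv models A B" using assms(4) AB by (auto simp: R_def)
   have "models (compl_graph A) \<phi> \<longleftrightarrow> models (compl_graph B) \<phi>" for \<phi>
   proof -
    \<comment> \<open>The complement sentence is evaluated on the complements of
      \<open>compl_graph A\<close> and \<open>compl_graph B\<close>, which are \<open>A\<close> and
      \<open>B\<close> again.\<close>
    obtain \<psi> where \<psi>: "!!C. simple_graph C ==> models C \<phi> \<longleftrightarrow> models (compl_graph C) \<psi>"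
     using assms(2) unfolding self_complementary_def by blast
    show ?thesis using \<psi>[OF simple_compl[OF s(1)]] \<psi>[OF simple_compl[OF s(2)]] e by (simp add: compl_compl s L_equiv_def)
   qed
   then show ?thesis using assms(4) simple_compl[OF s(1)] simple_compl[OF s(2)] by (simp add: R_def L_equiv_def)
  qed
  show "R (prodg A K) (prodg B K)" if AB: "R A B" and K: "wf_graph K" for A B K
   using AB assms(3) simple_prodg[OF _ K] by (auto simp: R_def hom_indist_def hom_prodg[OF _ wf K])
 qed
 have clF: "cl F" if "F \<in> \<F>" for F using that assms(3) by (auto simp: cl_def R_def hom_indist_def)
 \<comment> \<open>A member of the class that distinguishes two \<open>C^k\<close>-equivalent graphs
   cannot have an \<open>ok\<close> derivation with parameter \<open>k\<close>, so it contains the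
   grid.\<close>
 have grids: "\<exists>F. cl F & minor (gedges F) (verts F) (grid_edges r) ({..<r} \<times> {..<r})" for r
 proof -
  obtain k where k: "\<forall>E (V :: nat set). sym E & E \<subseteq> V \<times> V & finite V & ~ ok E k {} V --> minor E V (grid_edges r) ({..<r} \<times> {..<r})"
   using excluded_grid[of r] by blast
  obtain A B where AB: "simple_graph A" "simple_graph B" "C_equiv k A B" "~ L_equiv models A B" using assms(5) by blast
  then obtain F where F: "F \<in> \<F>" "hom F A ~= hom F B" using assms(4) unfolding hom_indist_def by blast
  have sF: "simple_graph F" using assms(3) F by blast
  have "~ ok (gedges F) k {} (verts F)" using ok_hom_eq[OF _ sF wf[OF AB(1)] wf[OF AB(2)] AB(3)] F(2) by blast
  moreover have "sym (gedges F)" "gedges F \<subseteq> verts F \<times> verts F" "finite (verts F)"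
   using wf[OF sF] by (auto simp: wf_graph_def sym_def)
  ultimately have "minor (gedges F) (verts F) (grid_edges r) ({..<r} \<times> {..<r})" using k by blast
  then show ?thesis using clF[OF F(1)] by blast
 qed
 have "R G H" using G H L assms(4) by (simp add: R_def)
 interpret graph_pair G H
 proof
  show "Zw G N W = Zw H N W" if "!!p. p \<in> set W ==> op_ok N p" for W N
   using Zw_eq[OF grids \<open>R G H\<close>] that by blast
 qed (use wf[OF G] wf[OF H] in \<open>auto simp: wf_graph_def\<close>)
 show "quantum_isomorphic G H" by (rule qiso)
qed

end
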